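(* Let $(f_k:I\to I)_k$ be a sequence of $\mathcal{C}^\infty$ maps that converges to $f$ in the $\mathcal{C}^\infty$ topology. Assume that each $f_k$ admits an ergodic SRB measure $\mu_k$ and that there is $h>0$ with $h_{f_k}(\mu_k)\ge h$ for all $k$. Then any weak-$*$ accumulation point of $(\mu_k)$ has an SRB component (for $f$).
   Context: $I$ denotes the interval $[0,1]$ or the circle $\mathbb{S}^1$. For a smooth map $g:I\to I$, $\lambda_g(x):=\limsup_{n\to\infty}\frac1n\sum_{i=0}^{n-1}\log|g'(g^ix)|$; a $g$-invariant Borel probability measure $\nu$ is hyperbolic if $\lambda_g(x)>0$ for $\nu$-a.e. $x$. An SRB measure of $g$ is a hyperbolic $g$-invariant Borel probability measure which is absolutely continuous with respect to Lebesgue measure on $I$. An $f$-invariant probability $\mu$ has an SRB component if $\mu=\beta\mu_1+(1-\beta)\mu_0$ with $\beta\in(0,1]$, $\mu_1,\mu_0$ $f$-invariant probability measures and $\mu_1$ an SRB measure of $f$. $h_g(\nu)$ denotes metric entropy. *)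

theory Defs
  imports "HOL-Probability.Probability"
begin

text \<open>
  The interval \<open>[0,1]\<close> and the circle are treated uniformly as curves in a Euclidean space,
  parametrised by arc length (which makes the factor \<open>norm (p')\<close> in derivatives along the
  curve equal to 1). The circle is the unit circle of the complex plane. It is parametrised by
  all of the real line, so that periodic functions have honest two-sided derivatives, and
  \<open>fund_dom\<close> is a set of parameters that meets every point exactly once.
\<close>

record 'a curve =
  par :: "real \<Rightarrow> 'a"
  par_dom :: "real set"
  fund_dom :: "real set"

definition unit_interval :: "real curve" where
  "unit_interval = \<lparr>par = (\<lambda>t. t), par_dom = {0..1}, fund_dom = {0..1}\<rparr>"

definition circle :: "complex curve" where
  "circle = \<lparr>par = cis, par_dom = UNIV, fund_dom = {0..<2 * pi}\<rparr>"

definition points :: "'a curve \<Rightarrow> 'a set" where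
  "points I = par I ` par_dom I"

lemma points_unit_interval: "points unit_interval = {0..1}"
  by (simp add: points_def unit_interval_def)

lemma points_circle: "points circle = sphere 0 1"
proof -
  have "z \<in> range cis" if "norm z = 1" for z
    using that cis_Arg[of z] by (metis norm_zero rangeI sgn_div_norm div_by_1 inverse_1
        scaleR_one zero_neq_one)
  then show ?thesis
    by (auto simp: points_def circle_def)
qed


subsection \<open>Smooth maps and the smooth topology\<close>

text \<open>
  Derivatives are taken within the parameter domain, hence are one-sided at the end points of
  the interval.
\<close>

primrec nth_deriv :: "real set \<Rightarrow> nat \<Rightarrow> (real \<Rightarrow> 'a::real_normed_vector) \<Rightarrow> real \<Rightarrow> 'a" where
  "nth_deriv J 0 u = u"
| "nth_deriv J (Suc n) u = (\<lambda>t. vector_derivative (nth_deriv J n u) (at t within J))"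

text \<open>
  A self-map of the circle is smooth iff it is smooth as a map into the plane, the circle being
  an embedded submanifold; for the same reason the smooth topology is that of uniform convergence
  of all derivatives of the map regarded as a map into the plane.
\<close>

definition smooth_map :: "'a::euclidean_space curve \<Rightarrow> ('a \<Rightarrow> 'a) \<Rightarrow> bool" where
  "smooth_map I g \<longleftrightarrow> g \<in> points I \<rightarrow> points I \<and>
     (\<forall>n. nth_deriv (par_dom I) n (g \<circ> par I) differentiable_on par_dom I)"

definition smooth_convergence ::
    "'a::euclidean_space curve \<Rightarrow> (nat \<Rightarrow> 'a \<Rightarrow> 'a) \<Rightarrow> ('a \<Rightarrow> 'a) \<Rightarrow> bool" where
  "smooth_convergence I f g \<longleftrightarrow>
     (\<forall>n. uniform_limit (par_dom I) (\<lambda>k. nth_deriv (par_dom I) n (f k \<circ> par I))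
            (nth_deriv (par_dom I) n (g \<circ> par I)) sequentially)"

definition abs_deriv :: "'a::euclidean_space curve \<Rightarrow> ('a \<Rightarrow> 'a) \<Rightarrow> 'a \<Rightarrow> real" where
  "abs_deriv I g x = norm (vector_derivative (g \<circ> par I)
     (at (inv_into (fund_dom I) (par I) x) within par_dom I))"

text \<open>Critical points have \<open>log 0 = -\<infinity>\<close>, whereas \<open>ln 0 = 0\<close> in HOL.\<close>

definition ext_ln :: "real \<Rightarrow> ereal" where
  "ext_ln r = (if r = 0 then - \<infinity> else ereal (ln r))"

definition lyapunov :: "'a::euclidean_space curve \<Rightarrow> ('a \<Rightarrow> 'a) \<Rightarrow> 'a \<Rightarrow> ereal" where
  "lyapunov I g x =
     limsup (\<lambda>n. (\<Sum>i<n. ext_ln (abs_deriv I g ((g ^^ i) x))) / ereal (real n))"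


subsection \<open>Invariant measures\<close>

definition borel_on :: "'a::euclidean_space curve \<Rightarrow> 'a measure" where
  "borel_on I = restrict_space borel (points I)"

definition borel_probs :: "'a::euclidean_space curve \<Rightarrow> 'a measure set" where
  "borel_probs I = {\<nu>. prob_space \<nu> \<and> sets \<nu> = sets (borel_on I)}"

text \<open>Arc length; on the circle it has total mass \<open>2 * pi\<close>.\<close>

definition lebesgue_on_curve :: "'a::euclidean_space curve \<Rightarrow> 'a measure" where
  "lebesgue_on_curve I = distr (restrict_space lborel (fund_dom I)) (borel_on I) (par I)"

definition invariant_prob :: "'a::euclidean_space curve \<Rightarrow> ('a \<Rightarrow> 'a) \<Rightarrow> 'a measure \<Rightarrow> bool" where
  "invariant_prob I g \<nu> \<longleftrightarrow> \<nu> \<in> borel_probs I \<and> g \<in> measurable \<nu> \<nu> \<and> distr \<nu> \<nu> g = \<nu>"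

definition ergodic :: "('a \<Rightarrow> 'a) \<Rightarrow> 'a measure \<Rightarrow> bool" where
  "ergodic g \<nu> \<longleftrightarrow>
     (\<forall>A\<in>sets \<nu>. g -` A \<inter> space \<nu> = A \<longrightarrow> measure \<nu> A = 0 \<or> measure \<nu> A = 1)"

definition hyperbolic :: "'a::euclidean_space curve \<Rightarrow> ('a \<Rightarrow> 'a) \<Rightarrow> 'a measure \<Rightarrow> bool" where
  "hyperbolic I g \<nu> \<longleftrightarrow> (AE x in \<nu>. lyapunov I g x > 0)"

definition SRB :: "'a::euclidean_space curve \<Rightarrow> ('a \<Rightarrow> 'a) \<Rightarrow> 'a measure \<Rightarrow> bool" where
  "SRB I g \<nu> \<longleftrightarrow> invariant_prob I g \<nu> \<and> hyperbolic I g \<nu> \<and>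
     absolutely_continuous (lebesgue_on_curve I) \<nu>"

definition has_SRB_component ::
    "'a::euclidean_space curve \<Rightarrow> ('a \<Rightarrow> 'a) \<Rightarrow> 'a measure \<Rightarrow> bool" where
  "has_SRB_component I g \<mu> \<longleftrightarrow> invariant_prob I g \<mu> \<and>
     (\<exists>\<beta> \<mu>\<^sub>1 \<mu>\<^sub>0. 0 < \<beta> \<and> \<beta> \<le> 1 \<and>
        SRB I g \<mu>\<^sub>1 \<and> invariant_prob I g \<mu>\<^sub>0 \<and>
        (\<forall>A\<in>sets \<mu>. measure \<mu> A = \<beta> * measure \<mu>\<^sub>1 A + (1 - \<beta>) * measure \<mu>\<^sub>0 A))"


subsection \<open>Metric entropy\<close>

definition finite_partition :: "'a measure \<Rightarrow> 'a set set \<Rightarrow> bool" where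
  "finite_partition \<nu> P \<longleftrightarrow> finite P \<and> P \<subseteq> sets \<nu> \<and> disjoint P \<and> \<Union>P = space \<nu>"

text \<open>The convention \<open>0 * log 0 = 0\<close> holds automatically.\<close>

definition partition_entropy :: "'a measure \<Rightarrow> 'a set set \<Rightarrow> real" where
  "partition_entropy \<nu> P = - (\<Sum>A\<in>P. measure \<nu> A * ln (measure \<nu> A))"

text \<open>\<open>iterated_join g \<nu> P n\<close> is the join of the partitions \<open>g\<^sup>-\<^sup>i P\<close> for \<open>i < n\<close>.\<close>

primrec iterated_join :: "('a \<Rightarrow> 'a) \<Rightarrow> 'a measure \<Rightarrow> 'a set set \<Rightarrow> nat \<Rightarrow> 'a set set" where
  "iterated_join g \<nu> P 0 = {space \<nu>}"
| "iterated_join g \<nu> P (Suc n) =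
     {A \<inter> ((g ^^ n) -` B \<inter> space \<nu>) | A B. A \<in> iterated_join g \<nu> P n \<and> B \<in> P}"

text \<open>For an invariant measure the upper limit below is a limit, by subadditivity.\<close>

definition entropy_wrt :: "('a \<Rightarrow> 'a) \<Rightarrow> 'a measure \<Rightarrow> 'a set set \<Rightarrow> ereal" where
  "entropy_wrt g \<nu> P =
     limsup (\<lambda>n. ereal (partition_entropy \<nu> (iterated_join g \<nu> P n) / real n))"

definition metric_entropy :: "('a \<Rightarrow> 'a) \<Rightarrow> 'a measure \<Rightarrow> ereal" where
  "metric_entropy g \<nu> = (SUP P\<in>{P. finite_partition \<nu> P}. entropy_wrt g \<nu> P)"


subsection \<open>Weak-* topology\<close>

definition weak_star :: "'a::euclidean_space curve \<Rightarrow> 'a measure topology" where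
  "weak_star I = topology_generated_by
     {{\<nu> \<in> borel_probs I. (\<integral>x. \<phi> x \<partial>\<nu>) \<in> U} | (\<phi> :: 'a \<Rightarrow> real) U.
        continuous_on (points I) \<phi> \<and> open U}"

definition accumulation_point :: "'b topology \<Rightarrow> (nat \<Rightarrow> 'b) \<Rightarrow> 'b \<Rightarrow> bool" where
  "accumulation_point T s x \<longleftrightarrow> x \<in> topspace T \<and>
     (\<forall>U. openin T U \<and> x \<in> U \<longrightarrow> (\<exists>\<^sub>F k in sequentially. s k \<in> U))"

end

theory Submission
  imports Defs
begin

text \<open>
  Fix \<open>0 < h\<^sub>1 < h\<close>. Ruelle's inequality for an absolutely continuous measure, applied to all iterates of
  \<open>f\<^sub>k\<close>, gives a set of \<open>\<mu>\<^sub>k\<close>-measure bounded below on which \<open>\<bar>(f\<^sub>k\<^sup>q)'\<bar>\<close> is at least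
  \<open>exp (q * h\<^sub>1 / 2)\<close>. Let \<open>F\<close> be a lift of a large iterate \<open>f\<^sub>k\<^sup>p\<close> to the parameter line. A
  reparametrisation argument in the spirit of Yomdin shows that, up to exponentially small Lebesgue measure,
  a point whose orbit expands this fast has a positive frequency of times \<open>m\<close> at which \<open>F\<^sup>m\<close> maps a
  neighbourhood of the point diffeomorphically to definite scale while \<open>F\<close> itself expands.
  At such times the push-forward of Lebesgue measure has bounded density, so
  for every union \<open>U\<close> of intervals of total length \<open>s\<close> one obtains
  \<open>\<beta> \<le> K * s + \<mu>\<^sub>k {x. exp (p * h\<^sub>1 / 16) \<le> \<bar>(f\<^sub>k\<^sup>p)' x\<bar> \<and> f\<^sub>k\<^sup>p x \<notin> U}\<close>,
  where \<open>\<beta> > 0\<close> depends neither on \<open>k\<close> nor on \<open>p\<close>, and \<open>K\<close> not on \<open>k\<close>.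

  This inequality survives the weak limit \<open>k \<rightarrow> \<infinity>\<close>. It prevents \<open>\<mu>\<close> from being carried by the union of a
  Lebesgue null set and the set where the Lyapunov exponent of \<open>f\<close> is nonpositive. Consequently the absolutely
  continuous part of \<open>\<mu>\<close> on the set of positive exponent is nontrivial; it is invariant because \<open>f' \<noteq> 0\<close> there,
  and its normalisation is the SRB component.
\<close>

section \<open>Functions with bounded derivatives\<close>

text \<open>Two obstacles shape the proof. Nothing is known about the densities of the given
  measures, and critical points destroy distortion control for iterates. Every estimate is therefore
  made for Lebesgue measure on short curves, with constants that depend on finitely many
  derivatives; a density enters only through an L1 approximation that decides how many iterates are
  used, never the constants of the result. Passing near a critical point is paid for by a factor
  \<open>(|F'| / A) powr (2 / n)\<close>, which costs at most \<open>2 / n * ln A\<close> per step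
  and becomes cheap when the order n of smoothness is high. The rest of the loss per step is E times
  a constant that depends on n alone. It is beaten by a high iterate F: the expansion grows
  exponentially with the order of the iterate while \<open>cover_const n\<close> stays fixed.
  Demanding expansion at the step just before a good time lets the limit inequality see the Lyapunov
  exponent and not only null sets.\<close>

text \<open>Derivatives are existentially quantified rather than iterated \<open>deriv\<close>s so that one-sided
  derivatives at boundary points of \<open>S\<close> are covered.\<close>

primrec bnd :: "nat \<Rightarrow> real \<Rightarrow> real set \<Rightarrow> (real \<Rightarrow> real) \<Rightarrow> bool" where
  "bnd 0 B S w \<longleftrightarrow> (\<forall>x\<in>S. \<bar>w x\<bar> \<le> B)"
| "bnd (Suc n) B S w \<longleftrightarrow> (\<forall>x\<in>S. \<bar>w x\<bar> \<le> B) \<and>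
     (\<exists>w'. (\<forall>x\<in>S. (w has_real_derivative w' x) (at x within S)) \<and> bnd n B S w')"

lemma bnd_bound: "bnd n B S w \<Longrightarrow> x \<in> S \<Longrightarrow> \<bar>w x\<bar> \<le> B"
  by (cases n) auto

lemma bnd_mono: "bnd n B S w \<Longrightarrow> B \<le> C \<Longrightarrow> bnd n C S w"
  by (induction n arbitrary: w) (auto intro: order_trans)

lemma bnd_Suc_D: "bnd (Suc n) B S w \<Longrightarrow> bnd n B S w"
proof (induction n arbitrary: w)
  case (Suc n)
  from Suc.prems obtain w' where "\<forall>x\<in>S. (w has_real_derivative w' x) (at x within S)" "bnd (Suc n) B S w'"
    "\<forall>x\<in>S. \<bar>w x\<bar> \<le> B" by (subst (asm) bnd.simps(2)) blast
  moreover from this have "bnd n B S w'" using Suc.IH by blast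
  ultimately show ?case by (subst bnd.simps(2)) blast
qed auto

lemma bnd_continuous_on: "bnd (Suc n) B S w \<Longrightarrow> continuous_on S w"
  by (auto intro: DERIV_continuous_on)

lemma bnd_add: "bnd n B S v \<Longrightarrow> bnd n C S w \<Longrightarrow> bnd n (B + C) S (\<lambda>x. v x + w x)"
proof (induction n arbitrary: v w)
  case 0
  then show ?case by (auto intro: order_trans[OF abs_triangle_ineq] add_mono)
next
  case (Suc n)
  then obtain v' w' where "\<forall>x\<in>S. (v has_real_derivative v' x) (at x within S)" "bnd n B S v'"
    "\<forall>x\<in>S. (w has_real_derivative w' x) (at x within S)" "bnd n C S w'" by auto
  moreover from this have "bnd n (B + C) S (\<lambda>x. v' x + w' x)" using Suc.IH by auto
  moreover have "\<bar>v x + w x\<bar> \<le> B + C" if "x \<in> S" for x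
    using abs_triangle_ineq[of "v x" "w x"] Suc.prems that by fastforce
  ultimately show ?case
    by (auto intro!: exI[of _ "\<lambda>x. v' x + w' x"] derivative_eq_intros)
qed

text \<open>Leibniz' rule without binomial coefficients: each differentiation doubles the number of
  products, hence the factor 2 ^ n.\<close>

lemma bnd_mult:
  "bnd n B S v \<Longrightarrow> bnd n C S w \<Longrightarrow> 0 \<le> B \<Longrightarrow> 0 \<le> C \<Longrightarrow> bnd n (2 ^ n * (B * C)) S (\<lambda>x. v x * w x)"
proof (induction n arbitrary: v w)
  case 0
  then show ?case by (auto simp: abs_mult intro!: mult_mono)
next
  case (Suc n)
  then obtain v' w' where *: "\<forall>x\<in>S. (v has_real_derivative v' x) (at x within S)" "bnd n B S v'"
    "\<forall>x\<in>S. (w has_real_derivative w' x) (at x within S)" "bnd n C S w'" by auto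
  have "bnd n (2 ^ n * (B * C)) S (\<lambda>x. v' x * w x)" "bnd n (2 ^ n * (B * C)) S (\<lambda>x. v x * w' x)"
    using Suc.IH * bnd_Suc_D[OF Suc.prems(1)] bnd_Suc_D[OF Suc.prems(2)] Suc.prems by auto
  from bnd_add[OF this] have "bnd n (2 ^ Suc n * (B * C)) S (\<lambda>x. v' x * w x + v x * w' x)"
    by (simp add: field_simps)
  moreover have "\<bar>v x * w x\<bar> \<le> 2 ^ Suc n * (B * C)" if "x \<in> S" for x
  proof -
    have "\<bar>v x\<bar> * \<bar>w x\<bar> \<le> B * C"
      using that Suc.prems by (auto intro!: mult_mono)
    moreover have "B * C \<le> 2 ^ Suc n * (B * C)"
      using mult_right_mono[OF one_le_power[of "2::real" "Suc n"], of "B * C"] Suc.prems by simp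
    ultimately show ?thesis by (simp add: abs_mult)
  qed
  ultimately show ?case using *
    by (auto intro!: exI[of _ "\<lambda>x. v' x * w x + v x * w' x"] derivative_eq_intros)
qed

lemma bnd_cmult: "bnd n B S w \<Longrightarrow> bnd n (\<bar>c\<bar> * B) S (\<lambda>x. c * w x)"
proof (induction n arbitrary: w)
  case 0
  then show ?case by (auto simp: abs_mult intro!: mult_left_mono)
next
  case (Suc n)
  then obtain w' where *: "\<forall>x\<in>S. (w has_real_derivative w' x) (at x within S)" "bnd n B S w'" by auto
  then show ?case using Suc
    by (auto simp: abs_mult intro!: exI[of _ "\<lambda>x. c * w' x"] derivative_eq_intros mult_left_mono)
qed

lemma bnd_const: "0 \<le> B \<Longrightarrow> \<bar>k\<bar> \<le> B \<Longrightarrow> bnd i B S (\<lambda>_. k)"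
proof (induction i arbitrary: k)
  case (Suc i)
  have "\<forall>x\<in>S. ((\<lambda>_. k) has_real_derivative 0) (at x within S)" by simp
  moreover have "bnd i B S (\<lambda>_. 0)" using Suc by simp
  ultimately show ?case using Suc by (auto intro!: exI[of _ "\<lambda>_. 0"])
qed auto

text \<open>Comes from iterating the chain rule instead of writing out Faa di Bruno's formula: the
  derivative of v \<circ> u is the product of v' \<circ> u, one order lower, with u', and the
  product costs 2 ^ n * a. The summand 1 keeps the constant large enough for the sup bound of v
  itself.\<close>

primrec comp_const :: "nat \<Rightarrow> real \<Rightarrow> real" where
  "comp_const 0 a = 1"
| "comp_const (Suc n) a = comp_const n a * (1 + 2 ^ n * a)"

lemma comp_const_ge_1: "0 \<le> a \<Longrightarrow> 1 \<le> comp_const n a"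
proof (induction n)
  case (Suc n)
  then have "1 * 1 \<le> comp_const n a * (1 + 2 ^ n * a)"
    by (intro mult_mono) auto
  then show ?case by simp
qed auto

lemma has_real_derivative_comp_within:
  assumes "(v has_real_derivative D) (at (u x) within T)" "u ` S \<subseteq> T"
    "(u has_real_derivative E) (at x within S)"
  shows "((\<lambda>x. v (u x)) has_real_derivative D * E) (at x within S)"
  using DERIV_image_chain[OF has_field_derivative_subset[OF assms(1,2)] assms(3)] by (simp add: o_def)

text \<open>Only the derivative of u is bounded, and to one order less than v. This matters because
  u will be a lift to the line, which may itself be unbounded.\<close>

lemma bnd_comp:
  assumes "bnd n M T v" "u ` S \<subseteq> T" "\<And>x. x \<in> S \<Longrightarrow> (u has_real_derivative u' x) (at x within S)"
    "bnd (n - 1) a S u'" "0 \<le> M" "0 \<le> a"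
  shows "bnd n (comp_const n a * M) S (\<lambda>x. v (u x))"
  using assms(1,4)
proof (induction n arbitrary: v)
  case 0
  then show ?case using assms by auto
next
  case (Suc n)
  then obtain v' where v': "\<forall>x\<in>T. (v has_real_derivative v' x) (at x within T)" "bnd n M T v'" by auto
  have u': "bnd n a S u'" using Suc.prems by simp
  have "bnd (n - 1) a S u'"
    using u' bnd_Suc_D[of "n - 1" a S u'] by (cases n) (auto simp del: bnd.simps(2))
  then have "bnd n (comp_const n a * M) S (\<lambda>x. v' (u x))" using Suc.IH v' by auto
  from bnd_mult[OF this u'] have 1: "bnd n (2 ^ n * ((comp_const n a * M) * a)) S (\<lambda>x. v' (u x) * u' x)"
    using comp_const_ge_1[OF assms(6), of n] assms by auto
  have le: "2 ^ n * ((comp_const n a * M) * a) \<le> comp_const (Suc n) a * M"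
    using comp_const_ge_1[OF assms(6), of n] assms by (simp add: algebra_simps)
  have le2: "M \<le> comp_const (Suc n) a * M"
    using mult_right_mono[OF comp_const_ge_1[OF assms(6), of "Suc n"], of M] assms by simp
  have "((\<lambda>x. v (u x)) has_real_derivative v' (u x) * u' x) (at x within S)" if "x \<in> S" for x
    using has_real_derivative_comp_within[OF _ assms(2)] v' that assms by blast
  moreover have "\<bar>v (u x)\<bar> \<le> comp_const (Suc n) a * M" if "x \<in> S" for x
    using bnd_bound[OF Suc.prems(1), of "u x"] assms(2) that le2 by force
  ultimately show ?case using bnd_mono[OF 1 le]
    by (auto intro!: exI[of _ "\<lambda>x. v' (u x) * u' x"])
qed

text \<open>Unfolds the nested existentials of \<open>bnd\<close> into one sequence of successive
  derivatives, the form in which interpolation and polynomial approximation are carried out;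
  \<open>chain_bnd\<close> folds it back.\<close>

lemma bnd_chain:
  "bnd n B S w \<Longrightarrow> \<exists>d. d 0 = w \<and> (\<forall>i<n. \<forall>x\<in>S. (d i has_real_derivative d (Suc i) x) (at x within S)) \<and>
     (\<forall>i\<le>n. \<forall>x\<in>S. \<bar>d i x\<bar> \<le> B)"
proof (induction n arbitrary: w)
  case 0
  then show ?case by (auto intro: exI[of _ "\<lambda>_. w"])
next
  case (Suc n)
  then obtain w' where w': "\<forall>x\<in>S. (w has_real_derivative w' x) (at x within S)" "bnd n B S w'" by auto
  then obtain d where d: "d 0 = w'" "\<forall>i<n. \<forall>x\<in>S. (d i has_real_derivative d (Suc i) x) (at x within S)"
     "\<forall>i\<le>n. \<forall>x\<in>S. \<bar>d i x\<bar> \<le> B" using Suc.IH by blast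
  let ?e = "case_nat w d"
  have "?e 0 = w" "\<forall>i<Suc n. \<forall>x\<in>S. (?e i has_real_derivative ?e (Suc i) x) (at x within S)"
    "\<forall>i\<le>Suc n. \<forall>x\<in>S. \<bar>?e i x\<bar> \<le> B"
    using w' d Suc.prems by (auto split: nat.split)
  then show ?case by blast
qed

lemma chain_bnd:
  "(\<forall>i<n. \<forall>x\<in>S. (d i has_real_derivative d (Suc i) x) (at x within S)) \<Longrightarrow>
   (\<forall>i\<le>n. \<forall>x\<in>S. \<bar>d i x\<bar> \<le> B) \<Longrightarrow> bnd n B S (d 0)"
proof (induction n arbitrary: d)
  case (Suc n)
  have "bnd n B S (d (Suc 0))"
    using Suc.IH[of "\<lambda>i. d (Suc i)"] Suc.prems by auto
  then show ?case using Suc.prems by auto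
qed auto

lemma has_real_derivative_affine:
  assumes "(w has_real_derivative D) (at (\<alpha> + \<tau> * s) within S)" "\<And>s. s \<in> T \<Longrightarrow> \<alpha> + \<tau> * s \<in> S"
  shows "((\<lambda>s. w (\<alpha> + \<tau> * s)) has_real_derivative \<tau> * D) (at s within T)"
proof -
  have "((\<lambda>s. \<alpha> + \<tau> * s) has_real_derivative \<tau>) (at s within T)"
    by (auto intro!: derivative_eq_intros)
  from has_real_derivative_comp_within[OF assms(1) _ this] assms(2) show ?thesis
    by (auto simp: mult.commute image_subset_iff)
qed

lemma chain_affine:
  assumes "\<And>i x. i < n \<Longrightarrow> x \<in> S \<Longrightarrow> (d i has_real_derivative d (Suc i) x) (at x within S)"
    "\<And>s. s \<in> T \<Longrightarrow> \<alpha> + \<tau> * s \<in> S" "i < n" "s \<in> T"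
  shows "((\<lambda>s. \<tau> ^ i * d i (\<alpha> + \<tau> * s)) has_real_derivative \<tau> ^ Suc i * d (Suc i) (\<alpha> + \<tau> * s)) (at s within T)"
  using DERIV_cmult[OF has_real_derivative_affine[OF assms(1) assms(2)], of i s T "\<tau> ^ i"] assms
  by (simp add: mult_ac)

lemma bnd_affine:
  assumes "bnd n B S w" "\<And>s. s \<in> T \<Longrightarrow> \<alpha> + \<tau> * s \<in> S" "0 \<le> \<tau>" "\<tau> \<le> 1"
  shows "bnd n B T (\<lambda>s. w (\<alpha> + \<tau> * s))"
proof -
  obtain d where d: "d 0 = w" "\<forall>i<n. \<forall>x\<in>S. (d i has_real_derivative d (Suc i) x) (at x within S)"
     "\<forall>i\<le>n. \<forall>x\<in>S. \<bar>d i x\<bar> \<le> B" using bnd_chain[OF assms(1)] by blast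
  let ?e = "\<lambda>i s. \<tau> ^ i * d i (\<alpha> + \<tau> * s)"
  have "bnd n B T (?e 0)"
  proof (rule chain_bnd[where d = ?e]; safe)
    fix i s assume "i < n" "s \<in> T"
    then show "(?e i has_real_derivative ?e (Suc i) s) (at s within T)"
      using chain_affine[of n S d T \<alpha> \<tau>] d assms by auto
  next
    fix i s assume *: "i \<le> n" "s \<in> T"
    then have "\<bar>d i (\<alpha> + \<tau> * s)\<bar> \<le> B" using d assms by auto
    moreover have "\<tau> ^ i \<le> 1" using assms by (simp add: power_le_one)
    ultimately show "\<bar>?e i s\<bar> \<le> B"
      using assms(3) mult_mono[of "\<tau> ^ i" 1 "\<bar>d i (\<alpha> + \<tau> * s)\<bar>" B] by (simp add: abs_mult)
  qed
  then show ?thesis by (simp add: d)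
qed

section \<open>Interpolation between derivatives and polynomial approximation\<close>

lemma MVT_within:
  fixes w :: "real \<Rightarrow> real"
  assumes "x < y" "{x..y} \<subseteq> S" "\<And>z. z \<in> S \<Longrightarrow> (w has_real_derivative w' z) (at z within S)"
  shows "\<exists>z\<in>{x<..<y}. w y - w x = w' z * (y - x)"
proof (rule mvt_simple[OF assms(1), where f' = "\<lambda>z h. w' z * h"])
  fix z assume "x \<le> z" "z \<le> y"
  then have "z \<in> S" using assms(2) by auto
  from has_field_derivative_subset[OF assms(3)[OF this] assms(2)]
  show "(w has_derivative (*) (w' z)) (at z within {x..y})" by (simp add: has_field_derivative_def)
qed

lemma bound_within:
  fixes w :: "real \<Rightarrow> real"
  assumes "convex S" "\<And>z. z \<in> S \<Longrightarrow> (w has_real_derivative w' z) (at z within S)"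
    "\<And>z. z \<in> S \<Longrightarrow> \<bar>w' z\<bar> \<le> B" "x \<in> S" "y \<in> S"
  shows "\<bar>w x - w y\<bar> \<le> B * \<bar>x - y\<bar>"
  using field_differentiable_bound[OF assms(1,2), of B x y] assms by auto

text \<open>Induction on i: the two outer thirds of the interval contain points with small i-th
  derivative, and the mean value theorem between them yields a point for i + 1. The middle third
  keeps the two points apart.\<close>

lemma small_derivative_point:
  "\<exists>K\<ge>0. \<forall>d a b B. a < b \<longrightarrow> 0 \<le> B \<longrightarrow>
     (\<forall>j<i. \<forall>x\<in>{a..b}. (d j has_real_derivative d (Suc j) x) (at x within {a..b})) \<longrightarrow>
     (\<forall>x\<in>{a..b}. \<bar>d 0 x\<bar> \<le> B) \<longrightarrow> (\<exists>\<xi>\<in>{a..b}. (b - a) ^ i * \<bar>d i \<xi>\<bar> \<le> K * B)"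
proof (induction i)
  case 0
  show ?case by (rule exI[of _ 1]) auto
next
  case (Suc i)
  then obtain K where K: "K \<ge> 0" and IH: "\<And>d a b B. a < b \<Longrightarrow> 0 \<le> B \<Longrightarrow>
     (\<forall>j<i. \<forall>x\<in>{a..b}. (d j has_real_derivative d (Suc j) x) (at x within {a..b})) \<Longrightarrow>
     (\<forall>x\<in>{a..b}. \<bar>d 0 x\<bar> \<le> B) \<Longrightarrow> (\<exists>\<xi>\<in>{a..b}. (b - a) ^ i * \<bar>d i \<xi>\<bar> \<le> K * B)" by blast
  show ?case
  proof (intro exI[of _ "6 * 3 ^ i * K"] conjI allI impI)
    show "0 \<le> 6 * 3 ^ i * K" using K by simp
    fix d :: "nat \<Rightarrow> real \<Rightarrow> real" and a b B :: real
    assume ab: "a < b" and B: "0 \<le> B"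
      and d: "\<forall>j<Suc i. \<forall>x\<in>{a..b}. (d j has_real_derivative d (Suc j) x) (at x within {a..b})"
      and d0: "\<forall>x\<in>{a..b}. \<bar>d 0 x\<bar> \<le> B"
    define l where "l = (b - a) / 3"
    have l: "l > 0" "a + l < b - l" "a + l \<le> b" "a \<le> b - l" "b - a = 3 * l" using ab
      by (auto simp: l_def field_simps)
    have *: "\<exists>\<xi>\<in>{a'..b'}. (b' - a') ^ i * \<bar>d i \<xi>\<bar> \<le> K * B" if "a' < b'" "{a'..b'} \<subseteq> {a..b}" for a' b'
      by (rule IH) (use that d d0 B in \<open>auto intro: has_field_derivative_subset[OF _ that(2)]\<close>)
    obtain \<xi>1 where \<xi>1: "\<xi>1 \<in> {a..a+l}" "l ^ i * \<bar>d i \<xi>1\<bar> \<le> K * B" using *[of a "a + l"] l by auto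
    obtain \<xi>2 where \<xi>2: "\<xi>2 \<in> {b-l..b}" "l ^ i * \<bar>d i \<xi>2\<bar> \<le> K * B" using *[of "b - l" b] l by auto
    have lt: "\<xi>1 < \<xi>2" "{\<xi>1..\<xi>2} \<subseteq> {a..b}" "\<xi>2 - \<xi>1 \<ge> l" using \<xi>1 \<xi>2 l by auto
    obtain z where z: "z \<in> {\<xi>1<..<\<xi>2}" "d i \<xi>2 - d i \<xi>1 = d (Suc i) z * (\<xi>2 - \<xi>1)"
      using MVT_within[OF lt(1,2), of "d i" "d (Suc i)"] d by auto
    have "l * \<bar>d (Suc i) z\<bar> \<le> (\<xi>2 - \<xi>1) * \<bar>d (Suc i) z\<bar>"
      using lt by (intro mult_right_mono) auto
    also have "\<dots> = \<bar>d i \<xi>2 - d i \<xi>1\<bar>" using z(2) lt by (simp add: abs_mult)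
    also have "\<dots> \<le> \<bar>d i \<xi>2\<bar> + \<bar>d i \<xi>1\<bar>" by simp
    finally have "l ^ i * (l * \<bar>d (Suc i) z\<bar>) \<le> l ^ i * (\<bar>d i \<xi>2\<bar> + \<bar>d i \<xi>1\<bar>)"
      using l by (intro mult_left_mono) auto
    also have "\<dots> \<le> 2 * K * B" using \<xi>1 \<xi>2 by (simp add: algebra_simps)
    finally have "(b - a) ^ Suc i * \<bar>d (Suc i) z\<bar> \<le> 6 * 3 ^ i * K * B"
      using l by (simp add: power_mult_distrib algebra_simps)
    then show "\<exists>\<xi>\<in>{a..b}. (b - a) ^ Suc i * \<bar>d (Suc i) \<xi>\<bar> \<le> 6 * 3 ^ i * K * B"
      using z lt by force
  qed
qed

text \<open>A Landau-Kolmogorov inequality in scale invariant form. One descends from the top order: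
  a point where the j-th derivative is small exists by \<open>small_derivative_point\<close>, and
  the bound already known for order j + 1 carries it to the whole interval.\<close>

lemma intermediate_derivatives:
  "\<exists>K\<ge>1. \<forall>d a b B. a < b \<longrightarrow> 0 \<le> B \<longrightarrow>
     (\<forall>j<n. \<forall>x\<in>{a..b}. (d j has_real_derivative d (Suc j) x) (at x within {a..b})) \<longrightarrow>
     (\<forall>x\<in>{a..b}. \<bar>d 0 x\<bar> \<le> B) \<longrightarrow> (\<forall>x\<in>{a..b}. (b - a) ^ n * \<bar>d n x\<bar> \<le> B) \<longrightarrow>
     (\<forall>i\<le>n. \<forall>x\<in>{a..b}. (b - a) ^ i * \<bar>d i x\<bar> \<le> K * B)"
proof -
  have "\<forall>i. \<exists>K\<ge>0. \<forall>d a b B. a < b \<longrightarrow> 0 \<le> B \<longrightarrow>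
     (\<forall>j<i. \<forall>x\<in>{a..b}. (d j has_real_derivative d (Suc j) x) (at x within {a..b})) \<longrightarrow>
     (\<forall>x\<in>{a..b}. \<bar>d 0 x\<bar> \<le> B) \<longrightarrow> (\<exists>\<xi>\<in>{a..b}. (b - a) ^ i * \<bar>d i \<xi>\<bar> \<le> K * B)"
    using small_derivative_point by blast
  then obtain K where K: "\<And>i. K i \<ge> 0" and KP: "\<And>i d a b B. a < b \<Longrightarrow> 0 \<le> B \<Longrightarrow>
     (\<forall>j<i. \<forall>x\<in>{a..b}. (d j has_real_derivative d (Suc j) x) (at x within {a..b})) \<Longrightarrow>
     (\<forall>x\<in>{a..b}. \<bar>d 0 x\<bar> \<le> B) \<Longrightarrow> (\<exists>\<xi>\<in>{a..b}. (b - a) ^ i * \<bar>d i \<xi>\<bar> \<le> K i * B)" by metis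
  \<comment> \<open>After m descents from order n the constants of the orders n - 1 down to n - m
    have been added to the initial 1.\<close>
  define L where "L m = 1 + (\<Sum>j<m. K (n - Suc j))" for m
  show ?thesis
  proof (intro exI[of _ "L n"] conjI allI impI ballI)
    show "1 \<le> L n" using K by (auto simp: L_def intro: sum_nonneg)
    fix d :: "nat \<Rightarrow> real \<Rightarrow> real" and a b B :: real and i x
    assume ab: "a < b" and B: "0 \<le> B"
      and d: "\<forall>j<n. \<forall>x\<in>{a..b}. (d j has_real_derivative d (Suc j) x) (at x within {a..b})"
      and d0: "\<forall>x\<in>{a..b}. \<bar>d 0 x\<bar> \<le> B" and dn: "\<forall>x\<in>{a..b}. (b - a) ^ n * \<bar>d n x\<bar> \<le> B"
      and i: "i \<le> n" and x: "x \<in> {a..b}"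
    have down: "m \<le> n \<Longrightarrow> \<forall>x\<in>{a..b}. (b - a) ^ (n - m) * \<bar>d (n - m) x\<bar> \<le> L m * B" for m
    proof (induction m)
      case 0
      then show ?case using dn by (simp add: L_def)
    next
      case (Suc m)
      define j where "j = n - Suc m"
      have j: "n - m = Suc j" "j < n" using Suc.prems by (auto simp: j_def)
      obtain \<xi> where \<xi>: "\<xi> \<in> {a..b}" "(b - a) ^ j * \<bar>d j \<xi>\<bar> \<le> K j * B"
        using KP[OF ab B, of j d] d d0 j by auto
      show ?case
      proof
        fix x assume x: "x \<in> {a..b}"
        have b: "\<bar>d (Suc j) z\<bar> \<le> L m * B / (b - a) ^ Suc j" if "z \<in> {a..b}" for z
          using Suc that ab by (simp add: j field_simps)
        have "0 \<le> L m * B / (b - a) ^ Suc j" using b[OF x] by linarith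
        have "\<bar>d j x - d j \<xi>\<bar> \<le> L m * B / (b - a) ^ Suc j * \<bar>x - \<xi>\<bar>"
          by (rule bound_within[of "{a..b}" "d j" "d (Suc j)"]) (use d j b x \<xi> in auto)
        also have "\<dots> \<le> L m * B / (b - a) ^ Suc j * (b - a)"
          using x \<xi> \<open>0 \<le> L m * B / (b - a) ^ Suc j\<close> by (intro mult_left_mono) auto
        also have "\<dots> = L m * B / (b - a) ^ j" using ab by simp
        finally have "(b - a) ^ j * \<bar>d j x - d j \<xi>\<bar> \<le> L m * B"
          using ab by (simp add: field_simps)
        moreover have "\<bar>d j x\<bar> \<le> \<bar>d j x - d j \<xi>\<bar> + \<bar>d j \<xi>\<bar>" by simp
        then have "(b - a) ^ j * \<bar>d j x\<bar> \<le> (b - a) ^ j * (\<bar>d j x - d j \<xi>\<bar> + \<bar>d j \<xi>\<bar>)"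
          using ab by (intro mult_left_mono) auto
        ultimately have "(b - a) ^ j * \<bar>d j x\<bar> \<le> L m * B + K j * B"
          using \<xi> by (simp add: algebra_simps)
        then show "(b - a) ^ (n - Suc m) * \<bar>d (n - Suc m) x\<bar> \<le> L (Suc m) * B"
          by (simp add: L_def j_def algebra_simps)
      qed
    qed
    have "L (n - i) * B \<le> L n * B"
      unfolding L_def using B K by (intro mult_right_mono add_left_mono sum_mono2) auto
    then show "(b - a) ^ i * \<bar>d i x\<bar> \<le> L n * B"
      using down[of "n - i"] i x by fastforce
  qed
qed

lemma pderiv_sum_real: "pderiv (\<Sum>i\<in>A. f i) = (\<Sum>i\<in>A. pderiv (f i :: real poly))"
  by (induction A rule: infinite_finite_induct) (auto simp: pderiv_add)

lemma poly_antiderivative: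
  fixes q :: "real poly"
  shows "\<exists>p. pderiv p = q \<and> degree p \<le> Suc (degree q)"
proof (intro exI conjI)
  let ?p = "\<Sum>i\<le>degree q. monom (coeff q i / (real i + 1)) (Suc i)"
  have "pderiv ?p = (\<Sum>i\<le>degree q. monom (coeff q i) i)"
    by (simp add: pderiv_sum_real pderiv_monom add.commute)
  then show "pderiv ?p = q" by (simp add: poly_as_sum_of_monoms)
  show "degree ?p \<le> Suc (degree q)"
    by (intro degree_sum_le) (auto intro: order_trans[OF degree_monom_le])
qed

text \<open>Obtained by integrating an approximant of the derivative and matching the value at a.
  The factorial of Taylor's formula is given up, which is harmless here.\<close>

lemma taylor_poly_approx:
  fixes d :: "nat \<Rightarrow> real \<Rightarrow> real"
  assumes "a \<le> b" "0 \<le> Y"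
    "\<And>j x. j < n \<Longrightarrow> x \<in> {a..b} \<Longrightarrow> (d j has_real_derivative d (Suc j) x) (at x within {a..b})"
    "\<And>x. x \<in> {a..b} \<Longrightarrow> \<bar>d n x\<bar> \<le> Y"
  shows "\<exists>q. degree q \<le> n \<and> (\<forall>x\<in>{a..b}. \<bar>d 0 x - poly q x\<bar> \<le> Y * (b - a) ^ n)"
  using assms(3,4)
proof (induction n arbitrary: d)
  case 0
  then show ?case by (intro exI[of _ 0]) auto
next
  case (Suc n)
  obtain q where q: "degree q \<le> n" "\<And>x. x\<in>{a..b} \<Longrightarrow> \<bar>d (Suc 0) x - poly q x\<bar> \<le> Y * (b - a) ^ n"
    using Suc.IH[of "\<lambda>i. d (Suc i)"] Suc.prems by auto
  obtain p where p: "pderiv p = q" "degree p \<le> Suc (degree q)" using poly_antiderivative by blast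
  define p' where "p' = p + [:d 0 a - poly p a:]"
  have p': "pderiv p' = q" "degree p' \<le> Suc n" "poly p' a = d 0 a"
    using p q by (auto simp: p'_def pderiv_add pderiv_pCons intro: order_trans[OF degree_add_le_max])
  have "\<bar>d 0 x - poly p' x\<bar> \<le> Y * (b - a) ^ Suc n" if "x \<in> {a..b}" for x
  proof -
    have "((\<lambda>x. d 0 x - poly p' x) has_real_derivative d (Suc 0) z - poly q z) (at z within {a..b})"
      if "z \<in> {a..b}" for z
      using Suc.prems(1)[of 0 z] that
      by (auto intro!: derivative_eq_intros has_field_derivative_at_within[OF poly_DERIV] simp: p')
    from bound_within[OF _ this, of "Y * (b - a) ^ n" x a] q(2) that assms(1)
    have "\<bar>(d 0 x - poly p' x) - (d 0 a - poly p' a)\<bar> \<le> Y * (b - a) ^ n * \<bar>x - a\<bar>" by auto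
    also have "\<dots> \<le> Y * (b - a) ^ n * (b - a)"
      using that assms(1,2) by (intro mult_left_mono) auto
    finally show ?thesis using p' by (simp add: mult_ac)
  qed
  then show ?case using p' by blast
qed

section \<open>Reparametrisation of level sets\<close>

lemma finite_cuts_interval:
  fixes x :: real
  assumes "finite R" "R \<subseteq> {a<..<b}" "x \<in> {a<..<b}" "x \<notin> R"
  obtains e where "e \<in> insert a R" "e < x" "x < Min ({r\<in>R. e < r} \<union> {b})"
    "{e<..<Min ({r\<in>R. e < r} \<union> {b})} \<inter> R = {}"
proof -
  define e where "e = Max {r\<in>insert a R. r < x}"
  have fin: "finite {r\<in>insert a R. r < x}" using assms by auto
  have ne: "{r\<in>insert a R. r < x} \<noteq> {}" using assms by auto
  have e: "e \<in> insert a R" "e < x" using Max_in[OF fin ne] by (auto simp: e_def)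
  have emax: "r \<le> e" if "r \<in> R" "r < x" for r
    unfolding e_def by (rule Max_ge[OF fin]) (use that in auto)
  have xr: "x < r" if "r \<in> R" "e < r" for r
    using emax[OF that(1)] that assms(4) by (metis linorder_cases not_less)
  have 1: "x < Min ({r\<in>R. e < r} \<union> {b})" using assms xr by (auto)
  have 2: "{e<..<Min ({r\<in>R. e < r} \<union> {b})} \<inter> R = {}"
    using assms by auto
  show ?thesis using that e 1 2 by blast
qed

text \<open>A nonconstant q takes each of the values l1, -l1, l2, -l2 at most n times. These points
  cut {a..b} into at most 4 * n + 1 intervals, and on each of them |q| stays inside or outside the
  band. A general smooth function admits no such count; this is why w is replaced by polynomials
  below.\<close>

lemma poly_level_intervals:
  fixes q :: "real poly"
  assumes "degree q \<le> n" "0 < l1" "l1 < l2" "a < b"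
  shows "\<exists>\<I> R. finite \<I> \<and> card \<I> \<le> 4 * n + 1 \<and> finite R \<and>
    (\<forall>(\<alpha>,\<beta>)\<in>\<I>. a \<le> \<alpha> \<and> \<alpha> < \<beta> \<and> \<beta> \<le> b \<and> (\<forall>x\<in>{\<alpha>..\<beta>}. l1 \<le> \<bar>poly q x\<bar> \<and> \<bar>poly q x\<bar> \<le> l2)) \<and>
    {x\<in>{a..b}. l1 \<le> \<bar>poly q x\<bar> \<and> \<bar>poly q x\<bar> \<le> l2} \<subseteq> R \<union> (\<Union>(\<alpha>,\<beta>)\<in>\<I>. {\<alpha><..<\<beta>})"
proof (cases "degree q = 0")
  \<comment> \<open>A constant polynomial may equal a level everywhere, so that the root count
    fails.\<close>
  case True
  then obtain c where c: "q = [:c:]" by (meson degree_eq_zeroE)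
  show ?thesis
  proof (cases "l1 \<le> \<bar>c\<bar> \<and> \<bar>c\<bar> \<le> l2")
    case True
    then show ?thesis using assms c by (intro exI[of _ "{(a,b)}"] exI[of _ "{a,b}"]) auto
  next
    case False
    then show ?thesis using c by (intro exI[of _ "{}"]) auto
  qed
next
  case False
  have sub: "finite {x. poly q x = c} \<and> card {x. poly q x = c} \<le> n" for c
  proof -
    have "degree (q - [:c:]) = degree q"
      using False by (metis degree_pCons_0 degree_add_eq_left degree_minus diff_conv_add_uminus gr0I)
    then have "q - [:c:] \<noteq> 0" "degree (q - [:c:]) \<le> n" using False assms(1) by auto
    moreover have "{x. poly q x = c} = {x. poly (q - [:c:]) x = 0}" by auto
    ultimately show ?thesis
      by (metis card_poly_roots_bound poly_roots_finite order_trans)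
  qed
  define R0 where "R0 = {x. poly q x = l1} \<union> {x. poly q x = -l1} \<union> {x. poly q x = l2} \<union> {x. poly q x = -l2}"
  define R where "R = R0 \<inter> {a<..<b}"
  have fR0: "finite R0" using sub by (simp add: R0_def)
  have cR0: "card R0 \<le> 4 * n"
  proof -
    have "card R0 \<le> ((n + n) + n) + n"
      unfolding R0_def using sub
      by (intro order_trans[OF card_Un_le] add_mono) auto
    then show ?thesis by simp
  qed
  have fR: "finite R" "R \<subseteq> {a<..<b}" "card R \<le> 4 * n" using fR0 cR0 card_mono[OF fR0, of R]
    by (auto simp: R_def)
  define nx where "nx e = Min ({r\<in>R. e < r} \<union> {b})" for e
  define E where "E = {e\<in>insert a R. \<forall>x\<in>{e..nx e}. l1 \<le> \<bar>poly q x\<bar> \<and> \<bar>poly q x\<bar> \<le> l2}"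
  define \<I> where "\<I> = (\<lambda>e. (e, nx e)) ` E"
  have "finite E" using fR by (auto simp: E_def)
  have "card E \<le> card (insert a R)" using fR by (intro card_mono) (auto simp: E_def)
  also have "\<dots> \<le> 4 * n + 1" using fR by (simp add: card_insert_if)
  finally have c: "card \<I> \<le> 4 * n + 1" "finite \<I>"
    using card_image_le[OF \<open>finite E\<close>, of "\<lambda>e. (e, nx e)"] \<open>finite E\<close> by (auto simp: \<I>_def)
  have 1: "\<forall>(\<alpha>,\<beta>)\<in>\<I>. a \<le> \<alpha> \<and> \<alpha> < \<beta> \<and> \<beta> \<le> b \<and> (\<forall>x\<in>{\<alpha>..\<beta>}. l1 \<le> \<bar>poly q x\<bar> \<and> \<bar>poly q x\<bar> \<le> l2)"
    using fR assms(4) by (auto simp: \<I>_def E_def nx_def)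
  have 2: "x \<in> (R0 \<union> {a,b}) \<union> (\<Union>(\<alpha>,\<beta>)\<in>\<I>. {\<alpha><..<\<beta>})"
    if x: "x \<in> {a..b}" "l1 \<le> \<bar>poly q x\<bar>" "\<bar>poly q x\<bar> \<le> l2" for x
  proof (cases "x \<in> R0 \<union> {a,b}")
    case False
    then have "x \<in> {a<..<b}" "x \<notin> R" using x by (auto simp: R_def)
    from finite_cuts_interval[OF fR(1,2) this] obtain e where e: "e \<in> insert a R" "e < x" "x < nx e"
      "{e<..<nx e} \<inter> R = {}" unfolding nx_def by blast
    have nxb: "nx e \<le> b" "a \<le> e" using fR e by (auto simp: nx_def)
    have st: "l1 < \<bar>poly q x\<bar>" "\<bar>poly q x\<bar> < l2"
    proof -
      have "\<bar>poly q x\<bar> \<noteq> l1" "\<bar>poly q x\<bar> \<noteq> l2" using False unfolding R0_def by (auto simp: abs_if)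
      then show "l1 < \<bar>poly q x\<bar>" "\<bar>poly q x\<bar> < l2" using x by auto
    qed
    have noroot: "\<bar>poly q z\<bar> \<noteq> l1 \<and> \<bar>poly q z\<bar> \<noteq> l2" if "z \<in> {e<..<nx e}" for z
    proof -
      have "z \<notin> R0" using e(4) that nxb by (auto simp: R_def)
      then show ?thesis by (auto simp: R0_def abs_if)
    qed
    have cont: "continuous_on T (\<lambda>z. \<bar>poly q z\<bar>)" for T by (intro continuous_intros)
    \<comment> \<open>If |q| crossed a level between x and y, the intermediate value theorem would
      produce a cut point strictly between two neighbouring cuts.\<close>
    have lv: False if y: "y \<in> {e..nx e}" and l: "(\<bar>poly q y\<bar> < l \<and> l < \<bar>poly q x\<bar>) \<or> (\<bar>poly q y\<bar> > l \<and>
      l > \<bar>poly q x\<bar>)"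
      and l12: "l = l1 \<or> l = l2" for y l
    proof -
      have "\<exists>z. (x \<le> z \<and> z \<le> y \<or> y \<le> z \<and> z \<le> x) \<and> \<bar>poly q z\<bar> = l"
      proof (cases "x \<le> y")
        case True
        then show ?thesis using l IVT'[of "\<lambda>z. \<bar>poly q z\<bar>" x l y] IVT2'[of "\<lambda>z. \<bar>poly q z\<bar>" y l x] cont
          by (metis less_eq_real_def)
      next
        case False
        then show ?thesis using l IVT'[of "\<lambda>z. \<bar>poly q z\<bar>" y l x] IVT2'[of "\<lambda>z. \<bar>poly q z\<bar>" x l y] cont
          by (metis less_eq_real_def linorder_le_cases)
      qed
      then obtain z where z: "x \<le> z \<and> z \<le> y \<or> y \<le> z \<and> z \<le> x" "\<bar>poly q z\<bar> = l" by blast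
      then have "z \<noteq> y" using l by auto
      then have "z \<in> {e<..<nx e}" using z y e by auto
      then show False using noroot z l12 by blast
    qed
    have "\<forall>y\<in>{e..nx e}. l1 \<le> \<bar>poly q y\<bar> \<and> \<bar>poly q y\<bar> \<le> l2"
      using lv[of _ l1] lv[of _ l2] st by (meson linorder_not_less)
    then have "(e, nx e) \<in> \<I>" using e by (auto simp: \<I>_def E_def)
    then show ?thesis using e by force
  qed auto
  show ?thesis
  proof (intro exI[of _ \<I>] exI[of _ "R0 \<union> {a,b}"] conjI)
    show "finite (R0 \<union> {a,b})" using fR0 by simp
    show "{x\<in>{a..b}. l1 \<le> \<bar>poly q x\<bar> \<and> \<bar>poly q x\<bar> \<le> l2} \<subseteq>
        (R0 \<union> {a,b}) \<union> (\<Union>(\<alpha>,\<beta>)\<in>\<I>. {\<alpha><..<\<beta>})"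
    proof
      fix x assume "x \<in> {x\<in>{a..b}. l1 \<le> \<bar>poly q x\<bar> \<and> \<bar>poly q x\<bar> \<le> l2}"
      then have "x \<in> {a..b}" "l1 \<le> \<bar>poly q x\<bar>" "\<bar>poly q x\<bar> \<le> l2" by blast+
      then show "x \<in> (R0 \<union> {a,b}) \<union> (\<Union>(\<alpha>,\<beta>)\<in>\<I>. {\<alpha><..<\<beta>})" by (rule 2)
    qed
  qed (fact c 1)+
qed

lemma equal_split:
  fixes \<alpha> \<beta> x :: real
  assumes "\<alpha> < \<beta>" "0 < s" "x \<in> {\<alpha>..\<beta>}"
  defines "l \<equiv> (\<beta> - \<alpha>) / real s"
  shows "x \<in> (\<lambda>j. \<alpha> + real j * l) ` {..s} \<or> (\<exists>j<s. x \<in> {\<alpha> + real j * l<..<\<alpha> + real j * l + l})"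
proof -
  have l: "0 < l" "real s * l = \<beta> - \<alpha>" using assms by (auto simp: l_def)
  define j where "j = nat \<lfloor>(x - \<alpha>) / l\<rfloor>"
  have pos: "0 \<le> (x - \<alpha>) / l" using assms(3) l by simp
  have j: "real j \<le> (x - \<alpha>) / l" "(x - \<alpha>) / l < real j + 1"
    using pos unfolding j_def by linarith+
  then have x: "real j * l \<le> x - \<alpha>" "x - \<alpha> < (real j + 1) * l"
    using l by (simp_all add: pos_le_divide_eq pos_divide_less_eq)
  have "real j * l \<le> real s * l" using x l assms(3) by auto
  then have "real j \<le> real s" using l(1) by (metis mult_le_cancel_right_pos)
  then have js: "j \<le> s" by simp
  show ?thesis
  proof (cases "x = \<alpha> + real j * l")
    case True
    then show ?thesis using js by auto
  next
    case False
    then have "real j * l < real s * l" using x l assms(3) by auto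
    then have "real j < real s" using l(1) by (metis mult_less_cancel_right_pos)
    then have "j < s" by simp
    then show ?thesis using x False by (auto simp: algebra_simps)
  qed
qed

text \<open>On a tame interval the function varies at most by a factor of two, and its affine reparametrisation
  has derivatives bounded by the supremum.\<close>

definition tame :: "nat \<Rightarrow> (real \<Rightarrow> real) \<Rightarrow> real \<Rightarrow> real \<Rightarrow> bool" where
  "tame n w \<alpha> \<tau> \<longleftrightarrow> 0 \<le> \<alpha> \<and> 0 < \<tau> \<and> \<alpha> + \<tau> \<le> 1 \<and>
     (\<exists>a>0. (\<forall>t\<in>{\<alpha>..\<alpha> + \<tau>}. a / 2 \<le> \<bar>w t\<bar>) \<and> bnd n a {0..1} (\<lambda>s. w (\<alpha> + \<tau> * s)))"

text \<open>The condition (\<beta> - \<alpha>) ^ n * Y \<le> 2 * b makes the rescaled n-th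
  derivative comparable with the function, so interpolation bounds all rescaled intermediate
  derivatives by a multiple of b. Cutting into s \<ge> 16 * K / c pieces brings every derivative of
  positive order below c * b / 8, a quarter of the least value c * b / 2 of the function. Then the
  function is almost constant on a piece, and its supremum bounds all derivatives.\<close>

lemma tame_pieces:
  assumes n: "1 \<le> n"
  shows "\<exists>K\<ge>1. \<forall>d Y b c \<alpha> \<beta> s j. 0 < b \<longrightarrow> 0 < c \<longrightarrow>
    (\<forall>i<n. \<forall>x\<in>{0..1}. (d i has_real_derivative d (Suc i) x) (at x within {0..1})) \<longrightarrow>
    (\<forall>x\<in>{0..1}. \<bar>d n x\<bar> \<le> Y) \<longrightarrow> 0 \<le> \<alpha> \<longrightarrow> \<alpha> < \<beta> \<longrightarrow> \<beta> \<le> 1 \<longrightarrow> (\<beta> - \<alpha>) ^ n * Y \<le> 2 * b \<longrightarrow>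
    (\<forall>x\<in>{\<alpha>..\<beta>}. c * b / 2 \<le> \<bar>d 0 x\<bar> \<and> \<bar>d 0 x\<bar> \<le> 2 * b) \<longrightarrow> 16 * K / c \<le> real s \<longrightarrow> j < s \<longrightarrow>
    tame n (d 0) (\<alpha> + real j * ((\<beta> - \<alpha>) / real s)) ((\<beta> - \<alpha>) / real s)"
proof -
  obtain K where K: "K \<ge> 1" "\<And>d a b B. a < b \<Longrightarrow> 0 \<le> B \<Longrightarrow>
     (\<forall>j<n. \<forall>x\<in>{a..b}. (d j has_real_derivative d (Suc j) x) (at x within {a..b})) \<Longrightarrow>
     (\<forall>x\<in>{a..b}. \<bar>d 0 x\<bar> \<le> B) \<Longrightarrow> (\<forall>x\<in>{a..b}. (b - a) ^ n * \<bar>d n x\<bar> \<le> B) \<Longrightarrow>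
     (\<forall>i\<le>n. \<forall>x\<in>{a..b}. (b - a) ^ i * \<bar>d i x\<bar> \<le> K * B)"
    using intermediate_derivatives[of n] by blast
  show ?thesis
  proof (intro exI[of _ K] conjI allI impI)
    show "1 \<le> K" by fact
    fix d :: "nat \<Rightarrow> real \<Rightarrow> real" and Y b c \<alpha> \<beta> :: real and s j :: nat
    assume b: "0 < b" and c: "0 < c"
      and d: "\<forall>i<n. \<forall>x\<in>{0..1}. (d i has_real_derivative d (Suc i) x) (at x within {0..1})"
      and dn: "\<forall>x\<in>{0..1}. \<bar>d n x\<bar> \<le> Y" and ab: "0 \<le> \<alpha>" "\<alpha> < \<beta>" "\<beta> \<le> 1"
      and Y: "(\<beta> - \<alpha>) ^ n * Y \<le> 2 * b"
      and lev: "\<forall>x\<in>{\<alpha>..\<beta>}. c * b / 2 \<le> \<bar>d 0 x\<bar> \<and> \<bar>d 0 x\<bar> \<le> 2 * b"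
      and s: "16 * K / c \<le> real s" and j: "j < s"
    have sub: "{\<alpha>..\<beta>} \<subseteq> {0..1}" using ab by auto
    have d': "\<forall>i<n. \<forall>x\<in>{\<alpha>..\<beta>}. (d i has_real_derivative d (Suc i) x) (at x within {\<alpha>..\<beta>})"
      using d sub by (meson has_field_derivative_subset subsetD)
    have dn': "(\<beta> - \<alpha>) ^ n * \<bar>d n x\<bar> \<le> 2 * b" if "x \<in> {\<alpha>..\<beta>}" for x
    proof -
      have "(\<beta> - \<alpha>) ^ n * \<bar>d n x\<bar> \<le> (\<beta> - \<alpha>) ^ n * Y" using dn that sub ab by (intro mult_left_mono) auto
      then show ?thesis using Y by simp
    qed
    have LK: "(\<beta> - \<alpha>) ^ i * \<bar>d i x\<bar> \<le> K * (2 * b)" if "i \<le> n" "x \<in> {\<alpha>..\<beta>}" for i x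
      using K(2)[of \<alpha> \<beta> "2 * b" d] d' dn' lev b ab that by auto
    have s0: "0 < real s" using j by simp
    define \<tau> where "\<tau> = (\<beta> - \<alpha>) / real s"
    define \<alpha>' where "\<alpha>' = \<alpha> + real j * \<tau>"
    have \<tau>: "0 < \<tau>" "real s * \<tau> = \<beta> - \<alpha>" using ab s0 by (auto simp: \<tau>_def)
    have "(real j + 1) * \<tau> \<le> real s * \<tau>" using j \<tau>(1) by (intro mult_right_mono) auto
    then have piece: "\<alpha> \<le> \<alpha>'" "\<alpha>' + \<tau> \<le> \<beta>" using \<tau> by (auto simp: \<alpha>'_def algebra_simps)
    \<comment> \<open>Shrinking by s divides the i-th rescaled derivative by s ^ i, so at least one
      factor s is gained for i \<ge> 1.\<close>
    have small: "\<tau> ^ i * \<bar>d i x\<bar> \<le> c * b / 8" if "1 \<le> i" "i \<le> n" "x \<in> {\<alpha>..\<beta>}" for i x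
    proof -
      have "real s \<le> real s ^ i" using that s0 j by (cases i) (auto intro!: mult_left_mono simp: one_le_power)
      then have "real s * (\<tau> ^ i * \<bar>d i x\<bar>) \<le> real s ^ i * (\<tau> ^ i * \<bar>d i x\<bar>)"
        using \<tau> by (intro mult_right_mono) auto
      also have "\<dots> = (\<beta> - \<alpha>) ^ i * \<bar>d i x\<bar>"
        by (simp add: power_mult_distrib[symmetric] \<tau>(2) mult.assoc[symmetric])
      also have "\<dots> \<le> K * (2 * b)" using LK that by blast
      also have "\<dots> \<le> real s * (c * b / 8)"
        using s c b by (simp add: field_simps)
      finally show ?thesis using s0 by simp
    qed
    have "continuous_on {\<alpha>'..\<alpha>'+\<tau>} (\<lambda>x. \<bar>d 0 x\<bar>)"
    proof -
      have "continuous_on {\<alpha>..\<beta>} (d 0)" using d' n by (intro DERIV_continuous_on[of _ _ "d (Suc 0)"]) auto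
      then show ?thesis using piece by (intro continuous_intros) (auto elim: continuous_on_subset)
    qed
    then obtain m where m: "m \<in> {\<alpha>'..\<alpha>'+\<tau>}" "\<And>x. x \<in> {\<alpha>'..\<alpha>'+\<tau>} \<Longrightarrow> \<bar>d 0 x\<bar> \<le> \<bar>d 0 m\<bar>"
      using continuous_attains_sup[of "{\<alpha>'..\<alpha>'+\<tau>}" "\<lambda>x. \<bar>d 0 x\<bar>"] \<tau> by auto
    define a where "a = \<bar>d 0 m\<bar>"
    have "m \<in> {\<alpha>..\<beta>}" using m(1) piece by auto
    then have a1: "c * b / 2 \<le> a" using lev by (simp add: a_def)
    have a: "c * b / 2 \<le> a" "0 < a" using a1 mult_pos_pos[OF c b] by linarith+
    have low: "a / 2 \<le> \<bar>d 0 t\<bar>" if "t \<in> {\<alpha>'..\<alpha>'+\<tau>}" for t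
    proof -
      have "\<bar>d 0 t - d 0 m\<bar> \<le> (c * b / 8 / \<tau>) * \<bar>t - m\<bar>"
      proof (rule bound_within[of "{\<alpha>..\<beta>}" _ "d (Suc 0)"])
        show "\<bar>d (Suc 0) z\<bar> \<le> c * b / 8 / \<tau>" if "z \<in> {\<alpha>..\<beta>}" for z
          using small[of 1 z] that n \<tau> by (simp add: field_simps)
      qed (use d' n that m piece in auto)
      also have "\<dots> \<le> (c * b / 8 / \<tau>) * \<tau>"
        using that m \<tau> b c by (intro mult_left_mono) auto
      also have "\<dots> = c * b / 8" using \<tau> by simp
      finally have "a - \<bar>d 0 t\<bar> \<le> c * b / 8" unfolding a_def by linarith
      then show ?thesis using a by linarith
    qed
    have "bnd n a {0..1} (\<lambda>t. \<tau> ^ 0 * d 0 (\<alpha>' + \<tau> * t))"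
    proof (rule chain_bnd[where d = "\<lambda>i t. \<tau> ^ i * d i (\<alpha>' + \<tau> * t)"]; intro allI ballI impI)
      have in': "\<alpha>' + \<tau> * t \<in> {\<alpha>'..\<alpha>'+\<tau>}" if "t \<in> {0..1}" for t
        using that \<tau> by auto
      have in2: "\<alpha>' + \<tau> * t \<in> {\<alpha>..\<beta>}" if "t \<in> {0..1}" for t using in'[OF that] piece by auto
      fix i t assume t: "t \<in> {0..1::real}"
      { assume "i < n"
        then show "((\<lambda>t. \<tau> ^ i * d i (\<alpha>' + \<tau> * t)) has_real_derivative \<tau> ^ Suc i * d (Suc i) (\<alpha>' +
          \<tau> * t)) (at t within {0..1})"
          using chain_affine[of n "{\<alpha>..\<beta>}" d "{0..1}" \<alpha>' \<tau> i t] d' in2 t by auto }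
      assume "i \<le> n"
      show "\<bar>\<tau> ^ i * d i (\<alpha>' + \<tau> * t)\<bar> \<le> a"
      proof (cases "i = 0")
        case True
        then show ?thesis using m in'[OF t] by (auto simp: a_def)
      next
        case False
        then have "\<tau> ^ i * \<bar>d i (\<alpha>' + \<tau> * t)\<bar> \<le> c * b / 8" using small \<open>i \<le> n\<close> in2[OF t] by auto
        moreover have "0 < c * b" using b c by simp
        ultimately show ?thesis using a \<tau> by (simp add: abs_mult)
      qed
    qed
    then have "tame n (d 0) \<alpha>' \<tau>"
      unfolding tame_def using piece ab \<tau> a low by auto
    then show "tame n (d 0) (\<alpha> + real j * ((\<beta> - \<alpha>) / real s)) ((\<beta> - \<alpha>) / real s)"
      by (simp add: \<alpha>'_def \<tau>_def)
  qed
qed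

text \<open>The reparametrisation step in the sense of Yomdin. On intervals whose length is of order
  2 ^ (-k) the Taylor error Y * 2 ^ (- n * k) has the same order as the height of the level, so
  there the level set of w is governed by that of a polynomial of degree n and splits into boundedly
  many intervals. The number of pieces thus grows only like the n-th root of the ratio between Y and
  the height, and this is what high smoothness buys.\<close>

lemma level_set_cover:
  assumes n: "1 \<le> n" and c: "0 < c" "c \<le> 1"
  shows "\<exists>Q>0. \<forall>k w Y. 0 < Y \<longrightarrow> bnd n Y {0..1} w \<longrightarrow>
    (\<exists>\<T> R. finite \<T> \<and> real (card \<T>) \<le> Q * 2 ^ k \<and> finite R \<and> (\<forall>(\<alpha>,\<tau>)\<in>\<T>. tame n w \<alpha> \<tau>) \<and>
      {t\<in>{0..1}. c * (Y / 2 ^ (n * k)) \<le> \<bar>w t\<bar> \<and> \<bar>w t\<bar> \<le> Y / 2 ^ (n * k)} \<subseteq>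
        R \<union> (\<Union>(\<alpha>,\<tau>)\<in>\<T>. {\<alpha><..<\<alpha> + \<tau>}))"
proof -
  obtain K where K: "K \<ge> 1" and tame: "\<And>d Y b c \<alpha> \<beta> s j. 0 < b \<Longrightarrow> 0 < c \<Longrightarrow>
    (\<forall>i<n. \<forall>x\<in>{0..1}. (d i has_real_derivative d (Suc i) x) (at x within {0..1})) \<Longrightarrow>
    (\<forall>x\<in>{0..1}. \<bar>d n x\<bar> \<le> Y) \<Longrightarrow> 0 \<le> \<alpha> \<Longrightarrow> \<alpha> < \<beta> \<Longrightarrow> \<beta> \<le> 1 \<Longrightarrow> (\<beta> - \<alpha>) ^ n * Y \<le> 2 * b \<Longrightarrow>
    (\<forall>x\<in>{\<alpha>..\<beta>}. c * b / 2 \<le> \<bar>d 0 x\<bar> \<and> \<bar>d 0 x\<bar> \<le> 2 * b) \<Longrightarrow> 16 * K / c \<le> real s \<Longrightarrow> j < s \<Longrightarrow>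
    tame n (d 0) (\<alpha> + real j * ((\<beta> - \<alpha>) / real s)) ((\<beta> - \<alpha>) / real s)"
    using tame_pieces[OF n] by blast
  define s where "s = nat \<lceil>16 * K / c\<rceil>"
  have s: "16 * K / c \<le> real s" unfolding s_def by linarith
  have s0: "0 < s" using s K c by (intro gr0I) (auto simp: divide_le_0_iff)
  \<comment> \<open>M \<ge> 4 / c pushes the Taylor error on an interval of length 1 / (M * 2 ^ k)
    below c * b / 4, a quarter of the lower level.\<close>
  define M where "M = nat \<lceil>4 / c\<rceil>"
  have M: "4 / c \<le> real M" unfolding M_def by linarith
  have M1: "1 \<le> real M"
  proof -
    have "1 \<le> 4 / c" using c by simp
    then show ?thesis using M by linarith
  qed
  define Q where "Q = real M * (real (4 * n + 1) * real s)"
  show ?thesis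
  proof (intro exI[of _ Q] conjI allI impI)
    show "0 < Q" using M1 s0 by (simp add: Q_def)
    fix k :: nat and w Y assume Y: "0 < (Y::real)" and w: "bnd n Y {0..1} w"
    obtain d where d: "d 0 = w" "\<forall>i<n. \<forall>x\<in>{0..1}. (d i has_real_derivative d (Suc i) x) (at x within {0..1})"
     "\<forall>i\<le>n. \<forall>x\<in>{0..1}. \<bar>d i x\<bar> \<le> Y" using bnd_chain[OF w] by blast
    define b where "b = Y / 2 ^ (n * k)"
    define m where "m = M * 2 ^ k"
    have b: "0 < b" using Y by (simp add: b_def)
    have m: "0 < m" using M1 by (auto simp: m_def)
    then have "1 \<le> real m" by simp
    have "(1 / real m) ^ n * Y = b / real M ^ n"
      by (simp add: m_def b_def power_mult_distrib power_mult[symmetric] power_divide mult.commute)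
    also have "\<dots> \<le> b / real M"
      using M1 n b by (intro divide_left_mono) (auto simp: self_le_power)
    also have "\<dots> \<le> c * b / 4" using M M1 b c by (simp add: field_simps)
    finally have mY: "(1 / real m) ^ n * Y \<le> c * b / 4" .
    define L where "L = {t\<in>{0..1}. c * b \<le> \<bar>w t\<bar> \<and> \<bar>w t\<bar> \<le> b}"
    define P where "P i = {real i / m .. real i / m + 1 / m}" for i :: nat
    have "\<exists>\<T> R. finite \<T> \<and> card \<T> \<le> (4 * n + 1) * s \<and> finite R \<and> (\<forall>(\<alpha>,\<tau>)\<in>\<T>. tame n w \<alpha> \<tau>) \<and>
      L \<inter> P i \<subseteq> R \<union> (\<Union>(\<alpha>,\<tau>)\<in>\<T>. {\<alpha><..<\<alpha> + \<tau>})" if i: "i < m" for i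
    proof -
      define p where "p = real i / m"
      have p: "0 \<le> p" "p + 1 / m \<le> 1" using i by (auto simp: p_def field_simps)
      have sub: "{p..p+1/m} \<subseteq> {0..1}" using p by auto
      have d': "(d j has_real_derivative d (Suc j) x) (at x within {p..p+1/m})"
        if "j < n" "x \<in> {p..p+1/m}" for j x
        using has_field_derivative_subset[OF _ sub] d(2) that sub by (meson subsetD)
      have dn': "\<bar>d n x\<bar> \<le> Y" if "x \<in> {p..p+1/m}" for x using d(3) that sub by auto
      have pp: "p \<le> p + 1 / real m" using m by simp
      obtain q where q: "degree q \<le> n" "\<forall>x\<in>{p..p+1/m}. \<bar>d 0 x - poly q x\<bar> \<le> Y * (p + 1 / m - p) ^ n"
        using taylor_poly_approx[OF pp, of Y n d] Y d' dn' by auto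
      have q2: "\<bar>w x - poly q x\<bar> \<le> c * b / 4" if "x \<in> {p..p+1/m}" for x
        using q(2)[rule_format, OF that] mY d by (simp add: mult.commute)
      have cb: "c * b \<le> b" "0 < c * b" using c b by auto
      have lt: "3/4 * (c * b) < b + c * b / 4" "0 < 3/4 * (c * b)" "p < p + 1 / m" using cb m b
        by (linarith, simp_all)
      \<comment> \<open>The band is widened by the Taylor error on both sides: the polynomial
        intervals then contain the level set of w, and on them |w| still lies between c * b / 2 and
        2 * b.\<close>
      obtain \<I> R where \<I>: "finite \<I>" "card \<I> \<le> 4 * n + 1" "finite R"
        and \<I>1: "\<forall>(\<alpha>,\<beta>)\<in>\<I>. p \<le> \<alpha> \<and> \<alpha> < \<beta> \<and> \<beta> \<le> p + 1/m \<and>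
           (\<forall>x\<in>{\<alpha>..\<beta>}. 3/4 * (c * b) \<le> \<bar>poly q x\<bar> \<and> \<bar>poly q x\<bar> \<le> b + c * b / 4)"
        and \<I>2: "{x\<in>{p..p+1/m}. 3/4 * (c * b) \<le> \<bar>poly q x\<bar> \<and> \<bar>poly q x\<bar> \<le> b + c * b / 4} \<subseteq>
           R \<union> (\<Union>(\<alpha>,\<beta>)\<in>\<I>. {\<alpha><..<\<beta>})"
        using poly_level_intervals[OF q(1) lt(2,1,3)] by (elim exE conjE) (rule that)
      define piece where "piece = (\<lambda>((\<alpha>::real,\<beta>),j). (\<alpha> + real j * ((\<beta> - \<alpha>) / real s), (\<beta> - \<alpha>) / real s))"
      define \<T> where "\<T> = piece ` (\<I> \<times> {..<s})"
      define R' where "R' = R \<union> (\<Union>(\<alpha>,\<beta>)\<in>\<I>. (\<lambda>j. \<alpha> + real j * ((\<beta> - \<alpha>) / real s)) ` {..s})"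
      have "card \<T> \<le> card (\<I> \<times> {..<s})" unfolding \<T>_def by (rule card_image_le) (use \<I> in auto)
      also have "\<dots> = card \<I> * s" by (simp add: card_cartesian_product)
      also have "\<dots> \<le> (4 * n + 1) * s" using \<I> by (intro mult_right_mono) auto
      finally have card: "card \<T> \<le> (4 * n + 1) * s" .
      have t: "tame n w \<alpha> \<tau>" if mem: "(\<alpha>,\<tau>) \<in> \<T>" for \<alpha> \<tau>
      proof -
        obtain \<alpha>0 \<beta> j where 1: "(\<alpha>0,\<beta>) \<in> \<I>" "j < s" "\<alpha> = \<alpha>0 + real j * ((\<beta> - \<alpha>0) / real s)"
          "\<tau> = (\<beta> - \<alpha>0) / real s"
          using mem by (auto simp: \<T>_def piece_def)
        have 2: "p \<le> \<alpha>0" "\<alpha>0 < \<beta>" "\<beta> \<le> p + 1/m"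
           "\<And>x. x\<in>{\<alpha>0..\<beta>} \<Longrightarrow> 3/4 * (c * b) \<le> \<bar>poly q x\<bar> \<and> \<bar>poly q x\<bar> \<le> b + c * b / 4"
          using \<I>1 1 by auto
        have "(\<beta> - \<alpha>0) ^ n * Y \<le> (1 / real m) ^ n * Y"
          using 2 Y by (intro mult_right_mono power_mono) auto
        then have 3: "(\<beta> - \<alpha>0) ^ n * Y \<le> 2 * b" using mY cb by simp
        have 4: "\<forall>x\<in>{\<alpha>0..\<beta>}. c * b / 2 \<le> \<bar>d 0 x\<bar> \<and> \<bar>d 0 x\<bar> \<le> 2 * b"
        proof
          fix x assume x: "x \<in> {\<alpha>0..\<beta>}"
          have "\<bar>w x - poly q x\<bar> \<le> c * b / 4" using q2 x 2 by auto
          then show "c * b / 2 \<le> \<bar>d 0 x\<bar> \<and> \<bar>d 0 x\<bar> \<le> 2 * b"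
            using 2(4)[OF x] cb unfolding d(1) by linarith
        qed
        show ?thesis
          using tame[of b c d Y \<alpha>0 \<beta> s j] b c d 2 3 4 s 1 p by auto
      qed
      have cov: "x \<in> R' \<union> (\<Union>(\<alpha>,\<tau>)\<in>\<T>. {\<alpha><..<\<alpha> + \<tau>})" if x: "x \<in> L \<inter> P i" for x
      proof -
        have xp: "x \<in> {p..p+1/m}" using x by (auto simp: P_def p_def)
        have xl: "c * b \<le> \<bar>w x\<bar>" "\<bar>w x\<bar> \<le> b" using x by (auto simp: L_def)
        have "\<bar>w x - poly q x\<bar> \<le> c * b / 4" by (rule q2[OF xp])
        then have "3/4 * (c * b) \<le> \<bar>poly q x\<bar> \<and> \<bar>poly q x\<bar> \<le> b + c * b / 4"
          using xl by linarith
        then have "x \<in> R \<union> (\<Union>(\<alpha>,\<beta>)\<in>\<I>. {\<alpha><..<\<beta>})" using \<I>2 xp by blast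
        then consider "x \<in> R" | \<alpha> \<beta> where "(\<alpha>,\<beta>) \<in> \<I>" "x \<in> {\<alpha><..<\<beta>}" by auto
        then show ?thesis
        proof cases
          case 2
          then have "\<alpha> < \<beta>" "x \<in> {\<alpha>..\<beta>}" by auto
          from equal_split[OF this(1) s0 this(2)]
          consider "x \<in> (\<lambda>j. \<alpha> + real j * ((\<beta> - \<alpha>) / real s)) ` {..s}"
            | j where "j < s" "x \<in> {\<alpha> + real j * ((\<beta> - \<alpha>) / real s)<..<\<alpha> + real j * ((\<beta> - \<alpha>) / real s) +
              (\<beta> - \<alpha>) / real s}"
            by blast
          then show ?thesis
          proof cases
            case 1
            then show ?thesis using 2(1) unfolding R'_def by blast
          next
            case (2 j)
            then have "piece ((\<alpha>,\<beta>),j) \<in> \<T>" using \<open>(\<alpha>,\<beta>) \<in> \<I>\<close> by (auto simp: \<T>_def)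
            then show ?thesis using 2 by (force simp: piece_def)
          qed
        qed (auto simp: R'_def)
      qed
      show ?thesis
      proof (intro exI[of _ \<T>] exI[of _ R'] conjI)
        show "finite \<T>" "finite R'" using \<I> by (auto simp: \<T>_def R'_def)
        show "L \<inter> P i \<subseteq> R' \<union> (\<Union>(\<alpha>,\<tau>)\<in>\<T>. {\<alpha><..<\<alpha> + \<tau>})" using cov by blast
      qed (use card t in auto)
    qed
    then have "\<forall>i\<in>{..<m}. \<exists>TR. finite (fst TR) \<and> card (fst TR) \<le> (4 * n + 1) * s \<and> finite (snd TR) \<and>
      (\<forall>(\<alpha>,\<tau>)\<in>fst TR. tame n w \<alpha> \<tau>) \<and> L \<inter> P i \<subseteq> snd TR \<union> (\<Union>(\<alpha>,\<tau>)\<in>fst TR. {\<alpha><..<\<alpha> + \<tau>})"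
      by (metis (no_types, lifting) fst_conv snd_conv lessThan_iff)
    from bchoice[OF this] obtain TR where TR0: "\<And>i. i < m \<Longrightarrow> finite (fst (TR i)) \<and>
      card (fst (TR i)) \<le> (4 * n + 1) * s \<and> finite (snd (TR i)) \<and>
      (\<forall>(\<alpha>,\<tau>)\<in>fst (TR i). tame n w \<alpha> \<tau>) \<and> L \<inter> P i \<subseteq> snd (TR i) \<union> (\<Union>(\<alpha>,\<tau>)\<in>fst (TR i). {\<alpha><..<\<alpha> + \<tau>})"
      by blast
    define \<T> where "\<T> i = fst (TR i)" for i
    define R where "R i = snd (TR i)" for i
    have TR: "\<And>i. i < m \<Longrightarrow> finite (\<T> i)" "\<And>i. i < m \<Longrightarrow> card (\<T> i) \<le> (4 * n + 1) * s"
      "\<And>i. i < m \<Longrightarrow> finite (R i)" "\<And>i. i < m \<Longrightarrow> \<forall>(\<alpha>,\<tau>)\<in>\<T> i. tame n w \<alpha> \<tau>"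
      "\<And>i. i < m \<Longrightarrow> L \<inter> P i \<subseteq> R i \<union> (\<Union>(\<alpha>,\<tau>)\<in>\<T> i. {\<alpha><..<\<alpha> + \<tau>})"
      using TR0 unfolding \<T>_def R_def by blast+
    show "\<exists>\<T> R. finite \<T> \<and> real (card \<T>) \<le> Q * 2 ^ k \<and> finite R \<and> (\<forall>(\<alpha>,\<tau>)\<in>\<T>. tame n w \<alpha> \<tau>) \<and>
      {t\<in>{0..1}. c * (Y / 2 ^ (n * k)) \<le> \<bar>w t\<bar> \<and> \<bar>w t\<bar> \<le> Y / 2 ^ (n * k)} \<subseteq>
        R \<union> (\<Union>(\<alpha>,\<tau>)\<in>\<T>. {\<alpha><..<\<alpha> + \<tau>})"
    proof (intro exI[of _ "\<Union>i<m. \<T> i"] exI[of _ "\<Union>i<m. R i"] conjI)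
      show "finite (\<Union>i<m. \<T> i)" "finite (\<Union>i<m. R i)" using TR by auto
      have "card (\<Union>i<m. \<T> i) \<le> (\<Sum>i<m. card (\<T> i))" by (rule card_UN_le) auto
      also have "\<dots> \<le> (\<Sum>i<m. (4 * n + 1) * s)" using TR by (intro sum_mono) auto
      finally have "card (\<Union>i<m. \<T> i) \<le> m * ((4 * n + 1) * s)" by simp
      then have "real (card (\<Union>i<m. \<T> i)) \<le> real (m * ((4 * n + 1) * s))" by (simp only: of_nat_le_iff)
      then show "real (card (\<Union>i<m. \<T> i)) \<le> Q * 2 ^ k" by (simp add: m_def Q_def algebra_simps)
      show "\<forall>(\<alpha>,\<tau>)\<in>(\<Union>i<m. \<T> i). tame n w \<alpha> \<tau>" using TR(4) by auto
      show "{t\<in>{0..1}. c * (Y / 2 ^ (n * k)) \<le> \<bar>w t\<bar> \<and> \<bar>w t\<bar> \<le> Y / 2 ^ (n * k)} \<subseteq>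
        (\<Union>i<m. R i) \<union> (\<Union>(\<alpha>,\<tau>)\<in>(\<Union>i<m. \<T> i). {\<alpha><..<\<alpha> + \<tau>})"
      proof
        fix x assume x: "x \<in> {t\<in>{0..1}. c * (Y / 2 ^ (n * k)) \<le> \<bar>w t\<bar> \<and> \<bar>w t\<bar> \<le> Y / 2 ^ (n * k)}"
        then have xL: "x \<in> L" by (auto simp: L_def b_def)
        obtain i where i: "i < m" "x \<in> P i"
        proof -
          have "x \<in> {0..1}" using x by auto
          from equal_split[OF _ m(1) this]
          consider j where "j \<le> m" "x = real j / m" | j where "j < m" "x \<in> {real j / m<..<real j / m + 1 / m}"
            by (auto simp: image_iff)
          then show ?thesis
          proof cases
            case 1
            show ?thesis
            proof (cases "j = m")
              case True
              then show ?thesis using 1 m that[of "m - 1"] by (auto simp: P_def field_simps of_nat_diff)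
            next
              case False
              then show ?thesis using 1 m that[of j] by (auto simp: P_def)
            qed
          next
            case 2
            then show ?thesis using that[of j] by (auto simp: P_def)
          qed
        qed
        show "x \<in> (\<Union>i<m. R i) \<union> (\<Union>(\<alpha>,\<tau>)\<in>(\<Union>i<m. \<T> i). {\<alpha><..<\<alpha> + \<tau>})"
        proof -
          have "x \<in> R i \<union> (\<Union>(\<alpha>,\<tau>)\<in>\<T> i. {\<alpha><..<\<alpha> + \<tau>})" using TR(5)[OF i(1)] xL i(2) by blast
          then show ?thesis
          proof
            assume "x \<in> (\<Union>(\<alpha>,\<tau>)\<in>\<T> i. {\<alpha><..<\<alpha> + \<tau>})"
            then obtain y where "y \<in> \<T> i" "x \<in> (case y of (\<alpha>,\<tau>) \<Rightarrow> {\<alpha><..<\<alpha> + \<tau>})" by (rule UN_E)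
            then show ?thesis using i(1) by blast
          qed (use i(1) in blast)
        qed
      qed
    qed
  qed
qed

text \<open>Factor by which the bound on all derivatives of (F' \<circ> u) * u' exceeds the trivial
  sup bound A * a for a curve of size a. The 2 ^ n is the outer product, the rest is the chain rule
  for F' \<circ> u; see \<open>derivative_along_curve\<close>.\<close>

definition jet_const :: "nat \<Rightarrow> real" where
  "jet_const n = 2 ^ n * (2 ^ (n - 1) * comp_const (n - 1) 1)"

lemma jet_const_ge_1: "1 \<le> jet_const n"
proof -
  have "1 * (1 * 1) \<le> (2::real) ^ n * (2 ^ (n - 1) * comp_const (n - 1) 1)"
    using comp_const_ge_1[of 1 "n - 1"] by (intro mult_mono) auto
  then show ?thesis by (simp add: jet_const_def)
qed

lemma jet_const_pos: "0 < jet_const n"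
  using jet_const_ge_1[of n] by simp

text \<open>A choice function makes it visible that the constant depends on n alone: it is part of
  the growth rate per step and has to be fixed before the iterate is chosen. The lower ratio has
  three sources: 2 ^ n is the width of a level, 2 the variation of u' along a curve, and
  \<open>jet_const n\<close> the passage from A * a to the bound Y on all derivatives.\<close>

definition cover_const :: "nat \<Rightarrow> real" where
  "cover_const n = (SOME Q. Q > 0 \<and> (\<forall>k w Y. 0 < Y \<longrightarrow> bnd n Y {0..1} w \<longrightarrow>
    (\<exists>\<T> R. finite \<T> \<and> real (card \<T>) \<le> Q * 2 ^ k \<and> finite R \<and> (\<forall>(\<alpha>,\<tau>)\<in>\<T>. tame n w \<alpha> \<tau>) \<and>
      {t\<in>{0..1}. 1 / (2 ^ (n + 1) * jet_const n) * (Y / 2 ^ (n * k)) \<le> \<bar>w t\<bar> \<and> \<bar>w t\<bar> \<le> Y / 2 ^ (n * k)} \<subseteq>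
        R \<union> (\<Union>(\<alpha>,\<tau>)\<in>\<T>. {\<alpha><..<\<alpha> + \<tau>}))))"

lemma cover_const:
  assumes "1 \<le> n"
  shows "cover_const n > 0" "\<And>k w Y. 0 < Y \<Longrightarrow> bnd n Y {0..1} w \<Longrightarrow>
    (\<exists>\<T> R. finite \<T> \<and> real (card \<T>) \<le> cover_const n * 2 ^ k \<and> finite R \<and> (\<forall>(\<alpha>,\<tau>)\<in>\<T>. tame n w \<alpha> \<tau>) \<and>
      {t\<in>{0..1}. 1 / (2 ^ (n + 1) * jet_const n) * (Y / 2 ^ (n * k)) \<le> \<bar>w t\<bar> \<and> \<bar>w t\<bar> \<le> Y / 2 ^ (n * k)} \<subseteq>
        R \<union> (\<Union>(\<alpha>,\<tau>)\<in>\<T>. {\<alpha><..<\<alpha> + \<tau>}))"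
proof -
  have "1 * 1 \<le> (2::real) ^ (n + 1) * jet_const n"
    using jet_const_ge_1[of n] by (intro mult_mono one_le_power) auto
  then have c: "0 < 1 / (2 ^ (n + 1) * jet_const n)" "1 / (2 ^ (n + 1) * jet_const n) \<le> 1"
    by (simp_all add: divide_le_eq_1 jet_const_pos)
  note * = someI_ex[OF level_set_cover[OF assms c], folded cover_const_def]
  show "cover_const n > 0" using * by blast
  fix k w Y assume "0 < (Y::real)" "bnd n Y {0..1} w"
  then show "\<exists>\<T> R. finite \<T> \<and> real (card \<T>) \<le> cover_const n * 2 ^ k \<and> finite R \<and> (\<forall>(\<alpha>,\<tau>)\<in>\<T>. tame n w \<alpha> \<tau>) \<and>
      {t\<in>{0..1}. 1 / (2 ^ (n + 1) * jet_const n) * (Y / 2 ^ (n * k)) \<le> \<bar>w t\<bar> \<and> \<bar>w t\<bar> \<le> Y / 2 ^ (n * k)} \<subseteq>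
        R \<union> (\<Union>(\<alpha>,\<tau>)\<in>\<T>. {\<alpha><..<\<alpha> + \<tau>})" using * by blast
qed

lemma dyadic_level:
  assumes "0 < y" "y \<le> 1" "1 \<le> (n::nat)"
  shows "\<exists>k. 1 / 2 ^ (n * Suc k) < y \<and> y \<le> 1 / (2::real) ^ (n * k)"
proof -
  have "\<exists>k. 1 / 2 ^ (n * Suc k) < y"
  proof -
    obtain k where k: "(1 / 2) ^ k < y" using real_arch_pow_inv[OF assms(1), of "1/2"] by auto
    have "1 * k \<le> n * Suc k" using assms(3) by (intro mult_mono) auto
    then have "(1 / 2 :: real) ^ (n * Suc k) \<le> (1 / 2) ^ k" by (intro power_decreasing) auto
    then show ?thesis using k by (auto simp: power_divide intro!: exI[of _ k])
  qed
  then have ex: "1 / 2 ^ (n * Suc (LEAST k. 1 / 2 ^ (n * Suc k) < y)) < y" by (rule LeastI_ex)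
  define k where "k = (LEAST k. 1 / 2 ^ (n * Suc k) < y)"
  have "y \<le> 1 / 2 ^ (n * k)"
  proof (cases k)
    case 0
    then show ?thesis using assms by simp
  next
    case (Suc j)
    then have "\<not> 1 / 2 ^ (n * Suc j) < y" using not_less_Least[of j "\<lambda>k. 1 / 2 ^ (n * Suc k) < y"]
      by (simp add: k_def)
    then show ?thesis using Suc by simp
  qed
  then show ?thesis using ex by (auto simp: k_def)
qed

section \<open>Growth of curves under iteration\<close>

definition dprod :: "(real \<Rightarrow> real) \<Rightarrow> (real \<Rightarrow> real) \<Rightarrow> nat \<Rightarrow> real \<Rightarrow> real" where
  "dprod F F' m x = (\<Prod>i<m. F' ((F ^^ i) x))"

lemma dprod_0 [simp]: "dprod F F' 0 x = 1"
  by (simp add: dprod_def)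

lemma dprod_Suc: "dprod F F' (Suc m) x = F' x * dprod F F' m (F x)"
  unfolding dprod_def prod.lessThan_Suc_shift by (simp add: funpow_swap1)

text \<open>M bounds the higher derivatives of F and may be far larger than A. The scale \<epsilon>
  with M * \<epsilon> \<le> A hides this: composed with a curve of size \<epsilon>, F' has
  derivatives of order A only, so M does not enter the growth rate. E is the expansion demanded at
  the last step before a good time.\<close>

locale smooth_bounds =
  fixes J :: "real set" and F F' :: "real \<Rightarrow> real" and A M :: real and n :: nat and \<epsilon> E :: real
  assumes n: "1 \<le> n" and FJ: "x \<in> J \<Longrightarrow> F x \<in> J"
    and dF: "x \<in> J \<Longrightarrow> (F has_real_derivative F' x) (at x within J)"
    and bF: "bnd n M J F'" and FA: "x \<in> J \<Longrightarrow> \<bar>F' x\<bar> \<le> A" and A: "1 \<le> A" and M: "0 \<le> M"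
    and \<epsilon>: "0 < \<epsilon>" "\<epsilon> \<le> 1" "M * \<epsilon> \<le> A" and E: "1 \<le> E"
begin

abbreviation DF :: "nat \<Rightarrow> real \<Rightarrow> real" where "DF \<equiv> dprod F F'"

lemma funpow_J: "x \<in> J \<Longrightarrow> (F ^^ i) x \<in> J"
  by (induction i) (auto intro: FJ)

lemma continuous_F: "continuous_on J F"
  using dF by (intro DERIV_continuous_on)

lemma continuous_funpow: "continuous_on J (F ^^ i)"
proof (induction i)
  case (Suc i)
  have "continuous_on J (\<lambda>x. F ((F ^^ i) x))"
    by (rule continuous_on_compose2[OF continuous_F Suc]) (auto intro: funpow_J)
  then show ?case by simp
qed (simp add: continuous_on_id)

lemma continuous_F': "continuous_on J F'"
  using bF n bnd_continuous_on[of "n - 1"] by (cases n) auto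

lemma continuous_F'_funpow: "continuous_on J (\<lambda>x. F' ((F ^^ i) x))"
  by (rule continuous_on_compose2[OF continuous_F' continuous_funpow]) (auto intro: funpow_J)

lemma continuous_DF: "continuous_on J (DF m)"
  unfolding dprod_def by (intro continuous_on_prod continuous_F'_funpow)

text \<open>All derivatives of u' are bounded by a number a that exceeds |u'| at most by a factor of
  two, so bounded distortion is part of the definition. The size a is existential because it changes
  along the iteration, below the fixed ceiling \<epsilon>.\<close>

definition curve :: "(real \<Rightarrow> real) \<Rightarrow> (real \<Rightarrow> real) \<Rightarrow> bool" where
  "curve u u' \<longleftrightarrow> u ` {0..1} \<subseteq> J \<and> (\<forall>t\<in>{0..1}. (u has_real_derivative u' t) (at t within {0..1})) \<and>
     (\<exists>a>0. a \<le> \<epsilon> \<and> (\<forall>t\<in>{0..1}. a / 2 \<le> \<bar>u' t\<bar>) \<and> bnd n a {0..1} u')"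

text \<open>Good times are those at which a piece of the iterated curve had become longer than \<open>\<epsilon>\<close> and was cut;
  the pieces then have definite size, which is expressed through the derivative at \<open>t\<close>.\<close>

definition good :: "(real \<Rightarrow> real) \<Rightarrow> (real \<Rightarrow> real) \<Rightarrow> nat \<Rightarrow> real \<Rightarrow> bool" where
  "good u u' m t \<longleftrightarrow> (\<exists>a b. 0 \<le> a \<and> a < t \<and> t < b \<and> b \<le> 1 \<and> (\<forall>s\<in>{a<..<b}. DF m (u s) * u' s \<noteq> 0) \<and>
     \<epsilon> / 8 < \<bar>DF m (u t) * u' t\<bar> * (b - a) \<and>
     (\<forall>s\<in>{a<..<b}. \<forall>s'\<in>{a<..<b}. \<bar>(F ^^ m) (u s) - (F ^^ m) (u s')\<bar> \<le> \<epsilon>)) \<and>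
     E \<le> \<bar>F' ((F ^^ (m - 1)) (u t))\<bar>"

text \<open>A long image has size at most 2 * A * \<epsilon> and is cut into pieces of size at least
  \<epsilon> / 2; so 4 * A bounds the number of pieces.\<close>

definition wt :: "(real \<Rightarrow> real) \<Rightarrow> (real \<Rightarrow> real) \<Rightarrow> nat \<Rightarrow> real \<Rightarrow> real" where
  "wt u u' m t = (if good u u' m t then 1 / (4 * A) else 1)"

text \<open>The integral of this weight grows at a rate independent of \<open>A\<close>: the power of \<open>DF N\<close> compensates the
  number of pieces needed near critical points, and the
  factors \<open>wt\<close> compensate the number of pieces of length \<open>\<epsilon>\<close> into which long images are cut.\<close>

definition weight :: "(real \<Rightarrow> real) \<Rightarrow> (real \<Rightarrow> real) \<Rightarrow> nat \<Rightarrow> real \<Rightarrow> real" where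
  "weight u u' N t = \<bar>DF N (u t) * u' t\<bar> * (\<bar>DF N (u t)\<bar> / A ^ N) powr (2 / real n) *
     (\<Prod>m\<in>{1..N}. wt u u' m t)"

lemma wt_bounds: "0 \<le> wt u u' m t" "wt u u' m t \<le> 1"
  using A by (auto simp: wt_def divide_le_eq_1)

lemma weight_nonneg: "0 \<le> weight u u' N t"
  unfolding weight_def by (intro mult_nonneg_nonneg prod_nonneg) (auto intro: wt_bounds)

lemma
  assumes "u ` {0..1} \<subseteq> J" "continuous_on {0..1} u" "continuous_on {0..1} u'"
  shows good_measurable: "{t \<in> {0<..<1}. good u u' m t} \<in> sets borel" (is ?A)
    and weight_measurable: "(\<lambda>t. weight u u' N t * indicator {0<..<1} t) \<in> borel_measurable borel" (is ?B)
proof -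
  have cu: "continuous_on {0<..<1} u" "continuous_on {0<..<1} u'" "u ` {0<..<1} \<subseteq> J"
    using assms by (auto elim: continuous_on_subset)
  have c1: "continuous_on {0<..<1} (\<lambda>t. DF m (u t))" for m
    by (rule continuous_on_compose2[OF continuous_DF cu(1,3)])
  have c2: "continuous_on {0<..<1} (\<lambda>t. \<bar>DF m (u t) * u' t\<bar>)" for m
    by (intro continuous_intros c1 cu)
  have c3: "continuous_on {0<..<1} (\<lambda>t. \<bar>F' ((F ^^ (m - 1)) (u t))\<bar>)" for m
    by (intro continuous_intros continuous_on_compose2[OF continuous_F'_funpow cu(1,3)])
  have b1: "(\<lambda>t. DF m (u t) * indicator {0<..<1} t) \<in> borel_measurable borel" for m
    using borel_measurable_continuous_on_indicator[OF _ c1] by (simp add: mult.commute)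
  have b2: "(\<lambda>t. \<bar>DF m (u t) * u' t\<bar> * indicator {0<..<1} t) \<in> borel_measurable borel" for m
    using borel_measurable_continuous_on_indicator[OF _ c2] by (simp add: mult.commute)
  have b3: "(\<lambda>t. \<bar>F' ((F ^^ (m - 1)) (u t))\<bar> * indicator {0<..<1} t) \<in> borel_measurable borel" for m
    using borel_measurable_continuous_on_indicator[OF _ c3] by (simp add: mult.commute)
  have gm: "{t \<in> {0<..<1}. good u u' m t} \<in> sets borel" for m
  proof -
    define ok where "ok a b \<longleftrightarrow> 0 \<le> a \<and> b \<le> 1 \<and> (\<forall>s\<in>{a<..<b}. DF m (u s) * u' s \<noteq> 0) \<and>
      (\<forall>s\<in>{a<..<b}. \<forall>s'\<in>{a<..<b}. \<bar>(F ^^ m) (u s) - (F ^^ m) (u s')\<bar> \<le> \<epsilon>)" for a b :: real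
    define G where "G a b = {t \<in> {0<..<1}. a < t \<and> t < b \<and> \<epsilon> / 8 < \<bar>DF m (u t) * u' t\<bar> * (b - a) \<and>
       E \<le> \<bar>F' ((F ^^ (m - 1)) (u t))\<bar>}" for a b :: real
    have Gm: "G a b \<in> sets borel" for a b
    proof -
      have "G a b = {t \<in> space borel. 0 < t \<and> t < 1 \<and> a < t \<and> t < b \<and>
        \<epsilon> / 8 < (\<bar>DF m (u t) * u' t\<bar> * indicator {0<..<1} t) * (b - a) \<and>
       E \<le> \<bar>F' ((F ^^ (m - 1)) (u t))\<bar> * indicator {0<..<1} t}"
        by (auto simp: G_def)
      also have "\<dots> \<in> sets borel" using b2[of m] b3[of m] by measurable
      finally show ?thesis .
    qed
    \<comment> \<open>Rational end points suffice: the length condition is strict, so the interval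
      can be shrunk by less than \<eta> at either end, and the other conditions pass to
      subintervals.\<close>
    have "{t \<in> {0<..<1}. good u u' m t} = (\<Union>a\<in>\<rat>. \<Union>b\<in>{b\<in>\<rat>. ok a b}. G a b)"
    proof safe
      fix t assume t: "t \<in> {0<..<1}" "good u u' m t"
      then obtain a b where ab: "ok a b" "a < t" "t < b" "\<epsilon> / 8 < \<bar>DF m (u t) * u' t\<bar> * (b - a)"
        "E \<le> \<bar>F' ((F ^^ (m - 1)) (u t))\<bar>" unfolding good_def ok_def by blast
      define p where "p = \<bar>DF m (u t) * u' t\<bar>"
      have p: "0 < p" "\<epsilon> / 8 / p < b - a"
      proof -
        show "0 < p" using ab \<epsilon> by (cases "p = 0") (auto simp: p_def)
        then show "\<epsilon> / 8 / p < b - a" using ab(4) unfolding p_def[symmetric]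
          by (simp add: pos_divide_less_eq mult_ac)
      qed
      define \<eta> where "\<eta> = (b - a - \<epsilon> / 8 / p) / 2"
      have \<eta>: "0 < \<eta>" using p by (simp add: \<eta>_def)
      obtain a' where a': "a' \<in> \<rat>" "a < a'" "a' < min t (a + \<eta>)"
        using Rats_dense_in_real[of a "min t (a + \<eta>)"] ab \<eta> by auto
      obtain b' where b': "b' \<in> \<rat>" "max t (b - \<eta>) < b'" "b' < b"
        using Rats_dense_in_real[of "max t (b - \<eta>)" b] ab \<eta> by auto
      have "a' < a + \<eta>" "b - \<eta> < b'" using a' b' by auto
      then have "\<epsilon> / 8 / p < b' - a'" unfolding \<eta>_def by argo
      then have "\<epsilon> / 8 < p * (b' - a')" using pos_divide_less_eq[OF p(1), of "\<epsilon> / 8" "b' - a'"]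
        by (simp add: mult.commute)
      moreover have "ok a' b'" using ab(1) a' b' by (auto simp: ok_def)
      ultimately have "b' \<in> {b\<in>\<rat>. ok a' b}" "t \<in> G a' b'"
        using a' b' ab t by (auto simp: G_def p_def)
      then show "t \<in> (\<Union>a\<in>\<rat>. \<Union>b\<in>{b\<in>\<rat>. ok a b}. G a b)" using a'(1) by blast
    qed (auto simp: G_def ok_def good_def)
    also have "\<dots> \<in> sets borel"
      using Gm by (intro sets.countable_UN'' countable_rat countable_subset[OF _ countable_rat]) auto
    finally show ?thesis .
  qed
  then show ?A .
  have wm: "(\<lambda>t. wt u u' m t * indicator {0<..<1} t) \<in> borel_measurable borel" for m
  proof -
    have "(\<lambda>t. wt u u' m t * indicator {0<..<1} t) =
      (\<lambda>t. (1 / (4 * A)) * indicator {t \<in> {0<..<1}. good u u' m t} t +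
         (indicator {0<..<1} t - indicator {t \<in> {0<..<1}. good u u' m t} t))"
      by (auto simp: wt_def fun_eq_iff indicator_def)
    also have "\<dots> \<in> borel_measurable borel" using gm[of m] by measurable
    finally show ?thesis .
  qed
  have "(\<lambda>t. weight u u' N t * indicator {0<..<1} t) =
     (\<lambda>t. (\<bar>DF N (u t) * u' t\<bar> * indicator {0<..<1} t) *
       (\<bar>DF N (u t) * indicator {0<..<1} t\<bar> / A ^ N) powr (2 / real n) *
       (\<Prod>m\<in>{1..N}. wt u u' m t * indicator {0<..<1} t))"
  proof
    fix t
    show "weight u u' N t * indicator {0<..<1} t = (\<bar>DF N (u t) * u' t\<bar> * indicator {0<..<1} t) *
       (\<bar>DF N (u t) * indicator {0<..<1} t\<bar> / A ^ N) powr (2 / real n) *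
       (\<Prod>m\<in>{1..N}. wt u u' m t * indicator {0<..<1} t)"
      by (cases "t \<in> {0<..<1}") (simp_all add: weight_def)
  qed
  also have "\<dots> \<in> borel_measurable borel"
    using b1[of N] b2[of N] wm by measurable
  finally show ?B .
qed

lemma curve_continuous:
  assumes c: "curve u u'"
  shows "continuous_on {0..1} u" "continuous_on {0..1} u'"
proof -
  from c have "\<And>t. t \<in> {0..1} \<Longrightarrow> (u has_real_derivative u' t) (at t within {0..1})" unfolding curve_def by blast
  then show "continuous_on {0..1} u" by (rule DERIV_continuous_on)
  from c obtain a where "bnd n a {0..1} u'" unfolding curve_def by blast
  then show "continuous_on {0..1} u'" using n bnd_continuous_on[of "n - 1" a "{0..1}" u'] by simp
qed

lemma curve_weight_measurable:
  assumes c: "curve u u'"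
  shows "(\<lambda>t. weight u u' N t * indicator {0<..<1} t) \<in> borel_measurable borel"
  by (rule weight_measurable) (use c curve_continuous[OF c] in \<open>auto simp: curve_def\<close>)

text \<open>Each differentiation of F' \<circ> u brings out a factor u' of size a, and M * a \<le> A
  because a \<le> \<epsilon>. Hence the higher derivatives of F do no more harm than its first
  one.\<close>

lemma derivative_along_curve:
  assumes "u ` {0..1} \<subseteq> J" "\<And>t. t \<in> {0..1} \<Longrightarrow> (u has_real_derivative u' t) (at t within {0..1})"
    "bnd n a {0..1} u'" "0 < a" "a \<le> \<epsilon>"
  shows "bnd n (jet_const n * (A * a)) {0..1} (\<lambda>t. F' (u t) * u' t)"
proof -
  obtain n' where n': "n = Suc n'" using n by (cases n) auto
  obtain F2 where F2: "\<And>x. x \<in> J \<Longrightarrow> (F' has_real_derivative F2 x) (at x within J)" "bnd n' M J F2"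
    using bF unfolding n' by auto
  have a1: "a \<le> 1" using assms \<epsilon> by simp
  have ba: "bnd n' a {0..1} u'" using assms(3) unfolding n' by (rule bnd_Suc_D)
  have "bnd (n' - 1) 1 {0..1} u'"
  proof -
    have "bnd (n' - 1) a {0..1} u'" using ba bnd_Suc_D[of "n' - 1"] by (cases n') auto
    then show ?thesis using bnd_mono a1 by blast
  qed
  from bnd_comp[OF F2(2) assms(1,2) this M]
  have "bnd n' (comp_const n' 1 * M) {0..1} (\<lambda>t. F2 (u t))" by simp
  from bnd_mult[OF this ba]
  have "bnd n' (2 ^ n' * (comp_const n' 1 * M * a)) {0..1} (\<lambda>t. F2 (u t) * u' t)"
    using comp_const_ge_1[of 1 n'] M assms by auto
  moreover have "M * a \<le> A" using \<epsilon> assms M by (meson mult_left_mono order_trans)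
  then have "2 ^ n' * (comp_const n' 1 * M * a) \<le> 2 ^ n' * comp_const n' 1 * A"
    using comp_const_ge_1[of 1 n'] by (simp add: mult.assoc)
  ultimately have 1: "bnd n' (2 ^ n' * comp_const n' 1 * A) {0..1} (\<lambda>t. F2 (u t) * u' t)"
    using bnd_mono by blast
  have ge: "1 \<le> 2 ^ n' * comp_const n' 1"
    using comp_const_ge_1[of 1 n'] mult_mono[of 1 "2 ^ n'" 1 "comp_const n' 1"] by simp
  have 2: "\<bar>F' (u t)\<bar> \<le> 2 ^ n' * comp_const n' 1 * A" if "t \<in> {0..1}" for t
  proof -
    have "\<bar>F' (u t)\<bar> \<le> 1 * A" using FA[of "u t"] assms(1) that by (auto simp: image_subset_iff)
    also have "1 * A \<le> 2 ^ n' * comp_const n' 1 * A" using A by (intro mult_right_mono ge) auto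
    finally show ?thesis by simp
  qed
  have "((\<lambda>t. F' (u t)) has_real_derivative F2 (u t) * u' t) (at t within {0..1})" if "t \<in> {0..1}" for t
    by (rule has_real_derivative_comp_within[OF F2(1) assms(1) assms(2)]) (use that assms(1) in auto)
  then have "bnd n (2 ^ n' * comp_const n' 1 * A) {0..1} (\<lambda>t. F' (u t))"
    unfolding n' using 1 2 by (intro bnd.simps(2)[THEN iffD2] conjI exI[of _ "\<lambda>t. F2 (u t) * u' t"]) auto
  from bnd_mult[OF this assms(3)]
  have "bnd n (2 ^ n * (2 ^ n' * comp_const n' 1 * A * a)) {0..1} (\<lambda>t. F' (u t) * u' t)"
    using mult_nonneg_nonneg[of "2 ^ n' * comp_const n' 1" A] ge A assms(4) by simp
  then show ?thesis by (simp add: jet_const_def n' mult_ac)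
qed

lemma child_curve:
  assumes u: "u ` {0..1} \<subseteq> J" "\<And>t. t \<in> {0..1} \<Longrightarrow> (u has_real_derivative u' t) (at t within {0..1})"
    and \<tau>: "0 \<le> \<alpha>" "0 < \<tau>" "\<alpha> + \<tau> \<le> 1"
    and b: "bnd n a {0..1} (\<lambda>s. F' (u (\<alpha> + \<tau> * s)) * u' (\<alpha> + \<tau> * s))"
    and low: "\<And>t. t \<in> {\<alpha>..\<alpha> + \<tau>} \<Longrightarrow> a / 2 \<le> \<bar>F' (u t) * u' t\<bar>" and a: "0 < a" "\<tau> * a \<le> \<epsilon>"
  shows "curve (\<lambda>s. F (u (\<alpha> + \<tau> * s))) (\<lambda>s. \<tau> * (F' (u (\<alpha> + \<tau> * s)) * u' (\<alpha> + \<tau> * s)))"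
proof -
  have mem: "\<alpha> + \<tau> * s \<in> {\<alpha>..\<alpha>+\<tau>}" if "s \<in> {0..1}" for s
  proof -
    have "\<tau> * s \<le> \<tau> * 1" using that \<tau> by (intro mult_left_mono) auto
    moreover have "0 \<le> \<tau> * s" using that \<tau> by simp
    ultimately show ?thesis using \<tau> unfolding atLeastAtMost_iff by linarith
  qed
  have mem1: "\<alpha> + \<tau> * s \<in> {0..1}" if "s \<in> {0..1}" for s
    using mem[OF that] \<tau> unfolding atLeastAtMost_iff by linarith
  have "((\<lambda>t. F (u t)) has_real_derivative F' (u t) * u' t) (at t within {0..1})" if "t \<in> {0..1}" for t
    by (rule has_real_derivative_comp_within[OF dF u(1) u(2)]) (use that u(1) in auto)
  from has_real_derivative_affine[OF this mem1]
  have 1: "((\<lambda>s. F (u (\<alpha> + \<tau> * s))) has_real_derivative \<tau> * (F' (u (\<alpha> + \<tau> * s)) * u' (\<alpha> +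
    \<tau> * s))) (at s within {0..1})"
    if "s \<in> {0..1}" for s using mem1[OF that] .
  have 2: "\<tau> * a / 2 \<le> \<bar>\<tau> * (F' (u (\<alpha> + \<tau> * s)) * u' (\<alpha> + \<tau> * s))\<bar>" if "s \<in> {0..1}" for s
    using mult_left_mono[OF low[OF mem[OF that]], of \<tau>] \<tau> by (simp add: abs_mult)
  have 3: "bnd n (\<tau> * a) {0..1} (\<lambda>s. \<tau> * (F' (u (\<alpha> + \<tau> * s)) * u' (\<alpha> + \<tau> * s)))"
    using bnd_cmult[OF b, of \<tau>] \<tau> by simp
  have 4: "(\<lambda>s. F (u (\<alpha> + \<tau> * s))) ` {0..1} \<subseteq> J" using FJ u(1) mem1 by blast
  show ?thesis unfolding curve_def
    using 1 2 3 4 a \<tau> by (intro conjI exI[of _ "\<tau> * a"]) auto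
qed

text \<open>The conditions in \<open>good\<close> are invariant under affine reparametrisation: the
  factor \<tau> in the derivative cancels against the length b - a. With 1 \<le> m the step before
  time m of the child is the step before time Suc m of the parent.\<close>

lemma good_child:
  assumes "0 \<le> \<alpha>" "0 < \<tau>" "\<alpha> + \<tau> \<le> 1" "1 \<le> m"
    "good (\<lambda>s. F (u (\<alpha> + \<tau> * s))) (\<lambda>s. \<tau> * (F' (u (\<alpha> + \<tau> * s)) * u' (\<alpha> + \<tau> * s))) m s"
  shows "good u u' (Suc m) (\<alpha> + \<tau> * s)"
proof -
  define v where "v s = F (u (\<alpha> + \<tau> * s))" for s
  define v' where "v' s = \<tau> * (F' (u (\<alpha> + \<tau> * s)) * u' (\<alpha> + \<tau> * s))" for s
  have DFv: "DF m (v s) * v' s = \<tau> * (DF (Suc m) (u (\<alpha> + \<tau> * s)) * u' (\<alpha> + \<tau> * s))" for s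
    by (simp add: dprod_Suc v_def v'_def)
  have Fv: "(F ^^ m) (v s) = (F ^^ Suc m) (u (\<alpha> + \<tau> * s))" for s
    by (simp add: v_def funpow_swap1)
  have Fv': "(F ^^ (m - 1)) (v s) = (F ^^ (Suc m - 1)) (u (\<alpha> + \<tau> * s))" for s
    using assms(4) by (cases m) (simp_all add: v_def funpow_swap1)
  obtain a b where ab: "0 \<le> a" "a < s" "s < b" "b \<le> 1" "\<And>s. s\<in>{a<..<b} \<Longrightarrow> DF m (v s) * v' s \<noteq> 0"
     "\<epsilon> / 8 < \<bar>DF m (v s) * v' s\<bar> * (b - a)"
     "\<And>s s'. s\<in>{a<..<b} \<Longrightarrow> s'\<in>{a<..<b} \<Longrightarrow> \<bar>(F ^^ m) (v s) - (F ^^ m) (v s')\<bar> \<le> \<epsilon>"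
     "E \<le> \<bar>F' ((F ^^ (m - 1)) (v s))\<bar>"
    using assms(5) unfolding good_def v_def[symmetric] v'_def[symmetric] by blast
  have preim: "\<exists>s\<in>{a<..<b}. t = \<alpha> + \<tau> * s" if "t \<in> {\<alpha> + \<tau> * a<..<\<alpha> + \<tau> * b}" for t
    using that assms(2) by (intro bexI[of _ "(t - \<alpha>) / \<tau>"]) (auto simp: field_simps)
  show ?thesis unfolding good_def
  proof (rule conjI, rule exI[of _ "\<alpha> + \<tau> * a"], rule exI[of _ "\<alpha> + \<tau> * b"], intro conjI ballI)
    show "0 \<le> \<alpha> + \<tau> * a" using assms ab by simp
    show "\<alpha> + \<tau> * a < \<alpha> + \<tau> * s" "\<alpha> + \<tau> * s < \<alpha> + \<tau> * b" using assms ab by auto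
    have "\<tau> * b \<le> \<tau>" using assms ab by (intro mult_left_le) auto
    then show "\<alpha> + \<tau> * b \<le> 1" using assms(3) by linarith
    show "\<epsilon> / 8 < \<bar>DF (Suc m) (u (\<alpha> + \<tau> * s)) * u' (\<alpha> + \<tau> * s)\<bar> * (\<alpha> + \<tau> * b - (\<alpha> + \<tau> * a))"
      using ab(6) assms(2) unfolding DFv by (simp add: abs_mult algebra_simps)
    show "E \<le> \<bar>F' ((F ^^ (Suc m - 1)) (u (\<alpha> + \<tau> * s)))\<bar>" using ab(8) unfolding Fv' .
    fix t assume t: "t \<in> {\<alpha> + \<tau> * a<..<\<alpha> + \<tau> * b}"
    then obtain r where r: "r \<in> {a<..<b}" "t = \<alpha> + \<tau> * r" using preim by blast
    then show "DF (Suc m) (u t) * u' t \<noteq> 0" using ab(5)[OF r(1)] unfolding DFv by simp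
    fix t' assume "t' \<in> {\<alpha> + \<tau> * a<..<\<alpha> + \<tau> * b}"
    then obtain r' where r': "r' \<in> {a<..<b}" "t' = \<alpha> + \<tau> * r'" using preim by blast
    show "\<bar>(F ^^ Suc m) (u t) - (F ^^ Suc m) (u t')\<bar> \<le> \<epsilon>"
      using ab(7)[OF r(1) r'(1)] unfolding Fv r(2) r'(2) .
  qed
qed

text \<open>The exponent 2 / n is chosen for this estimate: on level k, where |F'| \<le> A / 2 ^ (n
  * k), it yields 4 ^ (-k), which beats the 2 ^ k pieces of \<open>level_set_cover\<close> with a
  summable factor to spare. The factor \<tau> is the Jacobian of the change of variables and turns
  u' into the derivative of the child.\<close>

lemma weight_child:
  assumes \<tau>: "0 \<le> \<alpha>" "0 < \<tau>" "\<alpha> + \<tau> \<le> 1" and s: "s \<in> {0<..<1}"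
    and lev: "\<bar>F' (u (\<alpha> + \<tau> * s))\<bar> \<le> A / 2 ^ (n * k)" and g: "wt u u' 1 (\<alpha> + \<tau> * s) \<le> g"
  shows "\<tau> * weight u u' (Suc N) (\<alpha> + \<tau> * s) \<le> (1 / 4) ^ k * g *
     weight (\<lambda>s. F (u (\<alpha> + \<tau> * s))) (\<lambda>s. \<tau> * (F' (u (\<alpha> + \<tau> * s)) * u' (\<alpha> + \<tau> * s))) N s"
proof -
  define v where "v = (\<lambda>s. F (u (\<alpha> + \<tau> * s)))"
  define v' where "v' = (\<lambda>s. \<tau> * (F' (u (\<alpha> + \<tau> * s)) * u' (\<alpha> + \<tau> * s)))"
  define t where "t = \<alpha> + \<tau> * s"
  have 1: "\<tau> * \<bar>DF (Suc N) (u t) * u' t\<bar> = \<bar>DF N (v s) * v' s\<bar>"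
    using \<tau> by (simp add: dprod_Suc v_def v'_def t_def abs_mult)
  have "(\<bar>F' (u t)\<bar> / A) powr (2 / real n) \<le> (1 / 2 ^ (n * k)) powr (2 / real n)"
    using lev A by (intro powr_mono2) (auto simp: t_def field_simps)
  also have "\<dots> = (1 / 4) ^ k"
  proof -
    have "(1 / 2 ^ (n * k) :: real) = (1 / 2) ^ (n * k)" by (simp add: power_one_over)
    also have "\<dots> = (1 / 2) powr real (n * k)" by (rule powr_realpow[symmetric]) simp
    also have "\<dots> powr (2 / real n) = (1 / 2) powr real (2 * k)"
      using n by (simp add: powr_powr mult.commute)
    also have "\<dots> = (1 / 2) ^ (2 * k)" by (rule powr_realpow) simp
    also have "\<dots> = (1 / 4) ^ k" by (simp add: power_mult power2_eq_square)
    finally show ?thesis .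
  qed
  finally have *: "(\<bar>F' (u t)\<bar> / A) powr (2 / real n) \<le> (1 / 4) ^ k" .
  have 2: "(\<bar>DF (Suc N) (u t)\<bar> / A ^ Suc N) powr (2 / real n) \<le>
     (1 / 4) ^ k * (\<bar>DF N (v s)\<bar> / A ^ N) powr (2 / real n)"
  proof -
    have "\<bar>DF (Suc N) (u t)\<bar> / A ^ Suc N = (\<bar>F' (u t)\<bar> / A) * (\<bar>DF N (v s)\<bar> / A ^ N)"
      by (simp add: dprod_Suc v_def t_def abs_mult)
    also have "\<dots> powr (2 / real n) = (\<bar>F' (u t)\<bar> / A) powr (2 / real n) * (\<bar>DF N (v s)\<bar> / A ^ N) powr (2 /
      real n)"
      by (rule powr_mult)
    also have "\<dots> \<le> (1 / 4) ^ k * (\<bar>DF N (v s)\<bar> / A ^ N) powr (2 / real n)"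
      using * by (intro mult_right_mono) auto
    finally show ?thesis .
  qed
  have 3: "(\<Prod>m\<in>{1..Suc N}. wt u u' m t) \<le> g * (\<Prod>m\<in>{1..N}. wt v v' m s)"
  proof -
    have "(\<Prod>m\<in>{1..Suc N}. wt u u' m t) = wt u u' 1 t * (\<Prod>m\<in>{2..Suc N}. wt u u' m t)"
      by (subst prod.atLeast_Suc_atMost) (auto simp: numeral_2_eq_2)
    also have "(\<Prod>m\<in>{2..Suc N}. wt u u' m t) = (\<Prod>m\<in>{1..N}. wt u u' (Suc m) t)"
      by (rule prod.reindex_bij_witness[of _ Suc "\<lambda>m. m - 1"]) auto
    also have "wt u u' 1 t * \<dots> \<le> g * (\<Prod>m\<in>{1..N}. wt v v' m s)"
    proof (intro mult_mono prod_mono conjI)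
      show "wt u u' 1 t \<le> g" using g by (simp add: t_def)
      then show "0 \<le> g" using wt_bounds(1) order_trans by blast
      fix m assume m: "m \<in> {1..N}"
      \<comment> \<open>Good times of the child are good times of the parent, so passing to the
        child can only raise the factor.\<close>
      show "wt u u' (Suc m) t \<le> wt v v' m s"
      proof (cases "good v v' m s")
        case True
        then have "good u u' (Suc m) t" unfolding t_def using m \<tau>
          by (intro good_child) (simp_all add: v_def v'_def)
        then show ?thesis using True by (simp add: wt_def)
      next
        case False
        then show ?thesis using wt_bounds(2)[of u u' "Suc m" t] unfolding wt_def[of v] by simp
      qed
    qed (auto intro: prod_nonneg wt_bounds)
    finally show ?thesis .
  qed
  have "\<tau> * weight u u' (Suc N) t = \<bar>DF N (v s) * v' s\<bar> *
     ((\<bar>DF (Suc N) (u t)\<bar> / A ^ Suc N) powr (2 / real n) * (\<Prod>m\<in>{1..Suc N}. wt u u' m t))"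
    unfolding weight_def 1[symmetric] by (simp only: mult_ac)
  also have "\<dots> \<le> \<bar>DF N (v s) * v' s\<bar> *
     (((1 / 4) ^ k * (\<bar>DF N (v s)\<bar> / A ^ N) powr (2 / real n)) * (g * (\<Prod>m\<in>{1..N}. wt v v' m s)))"
    using A by (intro mult_left_mono mult_mono 2 3 prod_nonneg wt_bounds mult_nonneg_nonneg) auto
  also have "\<dots> = (1 / 4) ^ k * g * weight v v' N s"
    by (simp add: weight_def mult_ac)
  finally show ?thesis by (simp add: v_def v'_def t_def)
qed

definition W :: "(real \<Rightarrow> real) \<Rightarrow> (real \<Rightarrow> real) \<Rightarrow> nat \<Rightarrow> ennreal" where
  "W u u' N = (\<integral>\<^sup>+t. ennreal (weight u u' N t * indicator {0<..<1} t) \<partial>lborel)"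

definition level :: "(real \<Rightarrow> real) \<Rightarrow> nat \<Rightarrow> real set" where
  "level u k = {t \<in> {0<..<1}. A / 2 ^ (n * Suc k) < \<bar>F' (u t)\<bar> \<and> \<bar>F' (u t)\<bar> \<le> A / 2 ^ (n * k)}"

lemma level_measurable:
  assumes "curve u u'"
  shows "level u k \<in> sets borel"
proof -
  have cu: "continuous_on {0<..<1} u" "u ` {0<..<1} \<subseteq> J"
    using curve_continuous[OF assms] assms by (auto simp: curve_def elim: continuous_on_subset)
  have "continuous_on {0<..<1} (\<lambda>t. F' (u t))"
    by (rule continuous_on_compose2[OF continuous_F' cu])
  then have "(\<lambda>t. indicator {0<..<1} t * F' (u t)) \<in> borel_measurable borel"
    using borel_measurable_continuous_on_indicator[of "{0<..<1}" "\<lambda>t. F' (u t)"] by simp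
  then have "{t \<in> space borel. 0 < t \<and> t < 1 \<and> A / 2 ^ (n * Suc k) < \<bar>indicator {0<..<1} t * F' (u t)\<bar>
     \<and> \<bar>indicator {0<..<1} t * F' (u t)\<bar> \<le> A / 2 ^ (n * k)} \<in> sets borel"
    by measurable
  also have "{t \<in> space borel. 0 < t \<and> t < 1 \<and> A / 2 ^ (n * Suc k) < \<bar>indicator {0<..<1} t * F' (u t)\<bar>
     \<and> \<bar>indicator {0<..<1} t * F' (u t)\<bar> \<le> A / 2 ^ (n * k)} = level u k"
    by (auto simp: level_def)
  finally show ?thesis .
qed

lemma W_child:
  assumes c: "curve u u'" and \<tau>: "0 \<le> \<alpha>" "0 < \<tau>" "\<alpha> + \<tau> \<le> 1"
    and g: "0 \<le> g" "\<And>t. t \<in> {\<alpha><..<\<alpha>+\<tau>} \<Longrightarrow> wt u u' 1 t \<le> g"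
  shows "(\<integral>\<^sup>+t. ennreal (weight u u' (Suc N) t * indicator {0<..<1} t) * indicator (level u k \<inter> {\<alpha><..<\<alpha>+\<tau>})
    t \<partial>lborel)
    \<le> ennreal ((1 / 4) ^ k * g) * W (\<lambda>s. F (u (\<alpha> + \<tau> * s))) (\<lambda>s. \<tau> * (F' (u (\<alpha> + \<tau> * s)) * u' (\<alpha> + \<tau> * s))) N"
    (is "?L \<le> _ * W ?v ?v' N")
proof (cases "(\<lambda>t. weight ?v ?v' N t * indicator {0<..<1} t) \<in> borel_measurable borel")
  case meas: True
  let ?f = "\<lambda>t. ennreal (weight u u' (Suc N) t * indicator {0<..<1} t) * indicator (level u k \<inter> {\<alpha><..<\<alpha>+\<tau>}) t"
  have m: "?f \<in> borel_measurable borel"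
    using curve_weight_measurable[OF c, of "Suc N"] level_measurable[OF c, of k] by measurable
  have "?L = \<bar>\<tau>\<bar> * (\<integral>\<^sup>+s. ?f (\<alpha> + \<tau> * s) \<partial>lborel)"
    using m \<tau> by (intro nn_integral_real_affine) auto
  also have "\<dots> = (\<integral>\<^sup>+s. ennreal \<tau> * ?f (\<alpha> + \<tau> * s) \<partial>lborel)"
    using \<tau> m by (subst nn_integral_cmult) auto
  also have "\<dots> \<le> (\<integral>\<^sup>+s. ennreal ((1 / 4) ^ k * g) * ennreal (weight ?v ?v' N s * indicator {0<..<1} s) \<partial>lborel)"
  proof (rule nn_integral_mono)
    fix s :: real
    show "ennreal \<tau> * ?f (\<alpha> + \<tau> * s) \<le> ennreal ((1 / 4) ^ k * g) * ennreal (weight ?v ?v' N s * indicator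
      {0<..<1} s)"
    proof (cases "\<alpha> + \<tau> * s \<in> level u k \<inter> {\<alpha><..<\<alpha>+\<tau>}")
      case True
      then have s: "s \<in> {0<..<1}" using \<tau> by (auto simp: zero_less_mult_iff)
      have t01: "\<alpha> + \<tau> * s \<in> {0<..<1}" using True by (auto simp: level_def)
      have "u (\<alpha> + \<tau> * s) \<in> J" using c t01 by (auto simp: curve_def image_subset_iff)
      then have "\<tau> * weight u u' (Suc N) (\<alpha> + \<tau> * s) \<le> (1 / 4) ^ k * g * weight ?v ?v' N s"
        using True g(2) by (intro weight_child \<tau> s) (auto simp: level_def)
      moreover have "indicat_real {0<..<1} (\<alpha> + \<tau> * s) = 1" using t01 by (rule indicator_simps)
      ultimately show ?thesis using True s \<tau> g(1) weight_nonneg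
        by (simp add: ennreal_mult[symmetric])
    qed auto
  qed
  also have "\<dots> = ennreal ((1 / 4) ^ k * g) * W ?v ?v' N"
    unfolding W_def using meas by (subst nn_integral_cmult) auto
  finally show ?thesis .
next
  \<comment> \<open>This case is void: the child and its derivative are continuous, whether or not
    the child is a \<open>curve\<close>, so its weight is measurable.\<close>
  case False
  have cu: "u ` {0..1} \<subseteq> J" using c by (simp add: curve_def)
  have mem: "\<alpha> + \<tau> * s \<in> {0..1}" if "s \<in> {0..1}" for s
  proof -
    have "\<tau> * s \<le> \<tau>" using that \<tau> by (intro mult_left_le) auto
    moreover have "0 \<le> \<tau> * s" using that \<tau> by simp
    ultimately show ?thesis using \<tau> unfolding atLeastAtMost_iff by linarith
  qed
  have a: "continuous_on {0..1} (\<lambda>s. \<alpha> + \<tau> * s)" "(\<lambda>s. \<alpha> + \<tau> * s) ` {0..1} \<subseteq> {0..1}"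
    using mem by (auto intro!: continuous_intros simp del: atLeastAtMost_iff)
  have cu2: "continuous_on {0..1} (\<lambda>s. u (\<alpha> + \<tau> * s))" "(\<lambda>s. u (\<alpha> + \<tau> * s)) ` {0..1} \<subseteq> J"
    and cu3: "continuous_on {0..1} (\<lambda>s. u' (\<alpha> + \<tau> * s))"
    using continuous_on_compose2[OF curve_continuous(1)[OF c] a] continuous_on_compose2[OF
      curve_continuous(2)[OF c] a]
      mem cu by blast+
  have "(\<lambda>t. weight ?v ?v' N t * indicator {0<..<1} t) \<in> borel_measurable borel"
  proof (rule weight_measurable)
    show "?v ` {0..1} \<subseteq> J" using cu2(2) FJ by blast
    show "continuous_on {0..1} ?v" by (rule continuous_on_compose2[OF continuous_F cu2])
    show "continuous_on {0..1} ?v'"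
      by (intro continuous_intros cu3 continuous_on_compose2[OF continuous_F' cu2])
  qed
  then show ?thesis using False by blast
qed

lemma nn_integral_finite_cover:
  fixes f :: "real \<Rightarrow> ennreal"
  assumes "f \<in> borel_measurable borel" "finite I" "\<And>i. i \<in> I \<Longrightarrow> C i \<in> sets borel" "S \<in> sets borel" "countable R"
    "S \<subseteq> R \<union> (\<Union>i\<in>I. C i)"
  shows "(\<integral>\<^sup>+t. f t * indicator S t \<partial>lborel) \<le> (\<Sum>i\<in>I. \<integral>\<^sup>+t. f t * indicator (S \<inter> C i) t \<partial>lborel)"
proof -
  have "(\<integral>\<^sup>+t. f t * indicator S t \<partial>lborel) \<le> (\<integral>\<^sup>+t. (\<Sum>i\<in>I. f t * indicator (S \<inter> C i) t) \<partial>lborel)"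
  proof (rule nn_integral_mono_AE)
    have "AE t in lborel. t \<notin> R"
      using countable_imp_null_set_lborel[OF assms(5)] by (rule AE_not_in)
    then show "AE t in lborel. f t * indicator S t \<le> (\<Sum>i\<in>I. f t * indicator (S \<inter> C i) t)"
    proof eventually_elim
      case (elim t)
      show ?case
      proof (cases "t \<in> S")
        case True
        then obtain i where i: "i \<in> I" "t \<in> C i" using elim assms(6) by auto
        have "f t * indicator S t = f t * indicator (S \<inter> C i) t" using True i by simp
        also have "\<dots> \<le> (\<Sum>i\<in>I. f t * indicator (S \<inter> C i) t)"
          using i assms(2) by (intro member_le_sum) auto
        finally show ?thesis .
      qed simp
    qed
  qed
  also have "\<dots> = (\<Sum>i\<in>I. \<integral>\<^sup>+t. f t * indicator (S \<inter> C i) t \<partial>lborel)"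
    using assms by (intro nn_integral_sum) auto
  finally show ?thesis .
qed

text \<open>A piece whose image is longer than \<epsilon> is cut into s equal parts. If |F'| \<ge> E
  on the whole piece, time 1 is good for all parts, and the weight 1 / (4 * A) pays for s \<le> 4 *
  A. If |F'| < E somewhere, bounded distortion limits the length of the image to a multiple of E *
  \<epsilon>, so s \<le> 4 * E, and this loss goes into the growth rate. In either case s times the
  weight is at most 4 * E, independently of A.\<close>

lemma W_tame:
  assumes c: "curve u u'" and t: "tame n (\<lambda>t. F' (u t) * u' t) \<alpha> \<tau>"
    and K: "0 \<le> K" "\<And>v v'. curve v v' \<Longrightarrow> W v v' N \<le> ennreal K"
  shows "(\<integral>\<^sup>+t. ennreal (weight u u' (Suc N) t * indicator {0<..<1} t) * indicator (level u k \<inter> {\<alpha><..<\<alpha>+\<tau>})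
    t \<partial>lborel)
    \<le> ennreal ((1 / 4) ^ k * (4 * E) * K)"
proof -
  define w where "w t = F' (u t) * u' t" for t
  obtain a where a: "0 < a" "\<And>t. t \<in> {\<alpha>..\<alpha>+\<tau>} \<Longrightarrow> a / 2 \<le> \<bar>w t\<bar>" "bnd n a {0..1} (\<lambda>s. w (\<alpha> + \<tau> * s))"
    and \<tau>: "0 \<le> \<alpha>" "0 < \<tau>" "\<alpha> + \<tau> \<le> 1" using t unfolding tame_def w_def by blast
  obtain au where au: "0 < au" "au \<le> \<epsilon>" "bnd n au {0..1} u'" using c unfolding curve_def by blast
  have u: "u ` {0..1} \<subseteq> J" "\<And>t. t \<in> {0..1} \<Longrightarrow> (u has_real_derivative u' t) (at t within {0..1})"
    using c unfolding curve_def by auto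
  have sub: "{\<alpha>..\<alpha>+\<tau>} \<subseteq> {0..1}" using \<tau> by auto
  have u'\<epsilon>: "\<bar>u' t\<bar> \<le> \<epsilon>" if "t \<in> {0..1}" for t using bnd_bound[OF au(3) that] au by simp
  have wa: "\<bar>w t\<bar> \<le> a" if "t \<in> {\<alpha>..\<alpha>+\<tau>}" for t
    using bnd_bound[OF a(3), of "(t - \<alpha>) / \<tau>"] that \<tau> by auto
  have wF: "\<bar>w t\<bar> \<le> \<bar>F' (u t)\<bar> * \<epsilon>" if "t \<in> {0..1}" for t
    using u'\<epsilon>[OF that] by (auto simp: w_def abs_mult intro: mult_left_mono)
  \<comment> \<open>When a cut is made the quotient exceeds 1, so rounding up at most doubles it;
    each part then still has size at least \<epsilon> / 2.\<close>
  define s where "s = (if \<tau> * a \<le> \<epsilon> then 1 else nat \<lceil>\<tau> * a / \<epsilon>\<rceil>)"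
  have pos: "0 < \<tau> * a" using \<tau> a by simp
  have s1: "1 \<le> s" using pos \<epsilon> by (auto simp: s_def Suc_le_eq)
  have sl: "\<tau> * a / \<epsilon> \<le> real s"
  proof (cases "\<tau> * a \<le> \<epsilon>")
    case True
    then show ?thesis using \<epsilon> by (simp add: s_def)
  next
    case False
    then show ?thesis by (simp add: s_def real_nat_ceiling_ge)
  qed
  have su: "real s \<le> 2 * (\<tau> * a) / \<epsilon>" if "\<not> \<tau> * a \<le> \<epsilon>"
  proof -
    have "1 < \<tau> * a / \<epsilon>" using that \<epsilon> by simp
    moreover have "real s \<le> \<tau> * a / \<epsilon> + 1" using that pos \<epsilon> by (simp add: s_def)
    ultimately show ?thesis by simp
  qed
  have s\<epsilon>: "\<tau> * a / real s \<le> \<epsilon>" using sl \<epsilon> s1 by (simp add: field_simps)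
  define l where "l = \<tau> / real s"
  have l: "0 < l" "real s * l = \<tau>" using \<tau> s1 by (auto simp: l_def)
  have la: "l * a \<le> \<epsilon>" using s\<epsilon> by (simp add: l_def)
  define p where "p j = \<alpha> + real j * l" for j
  have pj: "\<alpha> \<le> p j" "p j + l \<le> \<alpha> + \<tau>" if "j < s" for j
  proof -
    show "\<alpha> \<le> p j" using l by (simp add: p_def)
    have "(real j + 1) * l \<le> real s * l" using that l by (intro mult_right_mono) auto
    then show "p j + l \<le> \<alpha> + \<tau>" using l by (simp add: p_def algebra_simps)
  qed
  have child: "curve (\<lambda>s. F (u (p j + l * s))) (\<lambda>s. l * (F' (u (p j + l * s)) * u' (p j + l * s)))"
    if j: "j < s" for j
  proof (rule child_curve[OF u, where a = a])
    show "0 \<le> p j" "0 < l" "p j + l \<le> 1" using pj[OF j] \<tau> l by auto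
    show "a / 2 \<le> \<bar>F' (u t) * u' t\<bar>" if "t \<in> {p j..p j + l}" for t
      using a(2)[of t] that pj[OF j] unfolding w_def by auto
    show "0 < a" "l * a \<le> \<epsilon>" using a la by auto
    have rescale: "p j + l * r = \<alpha> + \<tau> * ((p j - \<alpha>) / \<tau> + (l / \<tau>) * r)" for r
      using \<tau> by (simp add: field_simps)
    have "bnd n a {0..1} (\<lambda>r. w (\<alpha> + \<tau> * ((p j - \<alpha>) / \<tau> + (l / \<tau>) * r)))"
    proof (rule bnd_affine[OF a(3)])
      show "0 \<le> l / \<tau>" "l / \<tau> \<le> 1" using l \<tau> s1 by (auto simp: l_def divide_le_eq_1)
      fix r :: real assume r: "r \<in> {0..1}"
      have "l * r \<le> l" using r l by (intro mult_left_le) auto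
      moreover have "0 \<le> l * r" using r l by simp
      ultimately have "0 \<le> p j - \<alpha> + l * r" "p j - \<alpha> + l * r \<le> \<tau>" using pj[OF j] by linarith+
      then have "(p j - \<alpha> + l * r) / \<tau> \<in> {0..1}" using \<tau> by simp
      then show "(p j - \<alpha>) / \<tau> + (l / \<tau>) * r \<in> {0..1}" by (simp add: add_divide_distrib)
    qed
    then show "bnd n a {0..1} (\<lambda>s. F' (u (p j + l * s)) * u' (p j + l * s))"
      unfolding rescale[symmetric] w_def .
  qed
  \<comment> \<open>An upper bound for the weight factor at time 1: the discount is claimed only
    when a cut is made and the expansion E holds on the whole piece.\<close>
  define g where "g = (if \<tau> * a \<le> \<epsilon> \<or> (\<exists>t\<in>{\<alpha>..\<alpha>+\<tau>}. \<bar>F' (u t)\<bar> < E) then 1 else 1 / (4 * A))"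
  have g0: "0 \<le> g" using A by (auto simp: g_def)
  have gs: "real s * g \<le> 4 * E"
  proof (cases "\<tau> * a \<le> \<epsilon>")
    case True
    then show ?thesis using E by (simp add: g_def s_def)
  next
    case False
    have "a * \<tau> \<le> a" using a \<tau> by (intro mult_left_le) auto
    then have ta: "\<tau> * a \<le> a" by (simp add: mult.commute)
    show ?thesis
    proof (cases "\<exists>t\<in>{\<alpha>..\<alpha>+\<tau>}. \<bar>F' (u t)\<bar> < E")
      case True
      then obtain t where t: "t \<in> {\<alpha>..\<alpha>+\<tau>}" "\<bar>F' (u t)\<bar> < E" by blast
      have "\<bar>F' (u t)\<bar> * \<epsilon> \<le> E * \<epsilon>" using t \<epsilon> by (intro mult_right_mono) auto
      then have "\<tau> * a \<le> 2 * (E * \<epsilon>)" using a(2)[OF t(1)] wF[of t] ta t sub by force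
      then have "2 * (\<tau> * a) / \<epsilon> \<le> 4 * E" using \<epsilon> by (simp add: field_simps)
      then show ?thesis using su[OF False] True by (simp add: g_def)
    next
      case F: False
      have "\<alpha> \<in> {\<alpha>..\<alpha>+\<tau>}" "\<alpha> \<in> {0..1}" using \<tau> by auto
      then have "u \<alpha> \<in> J" using u(1) by blast
      then have "\<bar>F' (u \<alpha>)\<bar> * \<epsilon> \<le> A * \<epsilon>" using \<epsilon> by (intro mult_right_mono FA) auto
      then have "\<tau> * a \<le> 2 * (A * \<epsilon>)" using a(2)[of \<alpha>] wF[of \<alpha>] ta \<open>\<alpha> \<in> {0..1}\<close> \<tau> by force
      then have "2 * (\<tau> * a) / \<epsilon> \<le> 4 * A" using \<epsilon> by (simp add: field_simps)
      then have "real s \<le> 4 * A" using su[OF False] by simp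
      then have "real s * g \<le> 1" using F False A by (simp add: g_def)
      then show ?thesis using E by simp
    qed
  qed
  have gw: "wt u u' 1 t \<le> g" if j: "j < s" and t: "t \<in> {p j<..<p j + l}" for j t
  proof (cases "\<tau> * a \<le> \<epsilon> \<or> (\<exists>t\<in>{\<alpha>..\<alpha>+\<tau>}. \<bar>F' (u t)\<bar> < E)")
    case True
    then show ?thesis using wt_bounds(2)[of u u' 1 t] unfolding g_def by simp
  next
    case False
    have inT: "r \<in> {\<alpha>..\<alpha>+\<tau>}" if "r \<in> {p j<..<p j + l}" for r using that pj[OF j] by auto
    have DF1: "DF 1 x = F' x" for x by (simp add: dprod_def)
    have la2: "\<epsilon> / 2 \<le> l * a"
    proof -
      have "real s * \<epsilon> \<le> 2 * (\<tau> * a)" using su False \<epsilon> by (simp add: field_simps)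
      then show ?thesis using s1 by (simp add: l_def field_simps)
    qed
    have "good u u' 1 t" unfolding good_def
    proof (rule conjI, rule exI[of _ "p j"], rule exI[of _ "p j + l"], intro conjI ballI)
      show "0 \<le> p j" "p j < t" "t < p j + l" "p j + l \<le> 1" using pj[OF j] \<tau> t by auto
      show "DF 1 (u r) * u' r \<noteq> 0" if "r \<in> {p j<..<p j + l}" for r
        using a(2)[OF inT[OF that]] a(1) unfolding DF1 w_def by auto
      \<comment> \<open>From l * a \<ge> \<epsilon> / 2 and |w| \<ge> a / 2 one gets \<epsilon> / 4;
        the constant \<epsilon> / 8 in \<open>good\<close> leaves room for a strict
        inequality.\<close>
      have "\<epsilon> / 8 < l * a / 2" using la2 \<epsilon> by simp
      also have "\<dots> \<le> \<bar>w t\<bar> * l" using mult_left_mono[OF a(2)[OF inT[OF t]], of l] l by (simp add: mult.commute)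
      finally show "\<epsilon> / 8 < \<bar>DF 1 (u t) * u' t\<bar> * (p j + l - p j)" unfolding DF1 w_def by simp
      show "E \<le> \<bar>F' ((F ^^ (1 - 1)) (u t))\<bar>" using False inT[OF t] by (auto simp: not_less)
      fix r r' assume r: "r \<in> {p j<..<p j + l}" "r' \<in> {p j<..<p j + l}"
      have "\<bar>F (u r) - F (u r')\<bar> \<le> a * \<bar>r - r'\<bar>"
      proof (rule bound_within[of "{\<alpha>..\<alpha>+\<tau>}" _ w])
        show "((\<lambda>t. F (u t)) has_real_derivative w z) (at z within {\<alpha>..\<alpha>+\<tau>})" if z: "z \<in> {\<alpha>..\<alpha>+\<tau>}" for z
          unfolding w_def
          by (rule has_field_derivative_subset[OF _ sub], rule has_real_derivative_comp_within[OF dF u(1) u(2)])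
            (use z sub u(1) in auto)
      qed (use wa inT r in auto)
      also have "\<dots> \<le> a * l" using r a by (intro mult_left_mono) auto
      finally show "\<bar>(F ^^ 1) (u r) - (F ^^ 1) (u r')\<bar> \<le> \<epsilon>" using la by (simp add: mult.commute)
    qed
    then show ?thesis using False by (simp add: wt_def g_def)
  qed
  define f where "f t = ennreal (weight u u' (Suc N) t * indicator {0<..<1} t)" for t
  have fm: "f \<in> borel_measurable borel" unfolding f_def using curve_weight_measurable[OF c, of "Suc N"]
    by measurable
  have lm: "level u k \<inter> {\<alpha><..<\<alpha>+\<tau>} \<in> sets borel" using level_measurable[OF c] by auto
  have "(\<integral>\<^sup>+t. f t * indicator (level u k \<inter> {\<alpha><..<\<alpha>+\<tau>}) t \<partial>lborel) \<le>
      (\<Sum>j\<in>{..<s}. \<integral>\<^sup>+t. f t * indicator ((level u k \<inter> {\<alpha><..<\<alpha>+\<tau>}) \<inter> {p j<..<p j + l}) t \<partial>lborel)"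
  proof (rule nn_integral_finite_cover[OF fm _ _ lm, where R = "p ` {..s}"])
    show "level u k \<inter> {\<alpha><..<\<alpha>+\<tau>} \<subseteq> p ` {..s} \<union> (\<Union>j\<in>{..<s}. {p j<..<p j + l})"
    proof
      fix x assume "x \<in> level u k \<inter> {\<alpha><..<\<alpha>+\<tau>}"
      then have "x \<in> {\<alpha>..\<alpha>+\<tau>}" by auto
      from equal_split[OF _ _ this, of s] \<tau> s1
      show "x \<in> p ` {..s} \<union> (\<Union>j\<in>{..<s}. {p j<..<p j + l})" unfolding p_def l_def by auto
    qed
  qed (auto intro: countable_finite)
  also have "\<dots> \<le> (\<Sum>j\<in>{..<s}. ennreal ((1 / 4) ^ k * g * K))"
  proof (rule sum_mono)
    fix j assume "j \<in> {..<s}"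
    then have j: "j < s" by simp
    have "(\<integral>\<^sup>+t. f t * indicator ((level u k \<inter> {\<alpha><..<\<alpha>+\<tau>}) \<inter> {p j<..<p j + l}) t \<partial>lborel) \<le>
       (\<integral>\<^sup>+t. f t * indicator (level u k \<inter> {p j<..<p j + l}) t \<partial>lborel)"
      by (intro nn_integral_mono mult_left_mono) (auto simp: indicator_def)
    also have "\<dots> \<le> ennreal ((1 / 4) ^ k * g) * W (\<lambda>s. F (u (p j + l * s))) (\<lambda>s. l * (F' (u (p j +
      l * s)) * u' (p j + l * s))) N"
      unfolding f_def by (rule W_child[OF c]) (use pj[OF j] \<tau> l g0 gw[OF j] in auto)
    also have "\<dots> \<le> ennreal ((1 / 4) ^ k * g) * ennreal K"
      by (intro mult_left_mono K(2) child j) auto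
    also have "\<dots> = ennreal ((1 / 4) ^ k * g * K)" using g0 K by (simp add: ennreal_mult[symmetric])
    finally show "(\<integral>\<^sup>+t. f t * indicator ((level u k \<inter> {\<alpha><..<\<alpha>+\<tau>}) \<inter> {p j<..<p j + l}) t \<partial>lborel) \<le>
      ennreal ((1 / 4) ^ k * g * K)" .
  qed
  also have "\<dots> = ennreal (real s * ((1 / 4) ^ k * g * K))"
    using g0 K by (subst sum_ennreal) auto
  also have "\<dots> \<le> ennreal ((1 / 4) ^ k * (4 * E) * K)"
  proof (rule ennreal_leI)
    have "((1 / 4) ^ k * K) * (real s * g) \<le> ((1 / 4) ^ k * K) * (4 * E)"
      using gs K by (intro mult_left_mono) auto
    then show "real s * ((1 / 4) ^ k * g * K) \<le> (1 / 4) ^ k * (4 * E) * K" by (simp only: mult_ac)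
  qed
  finally show ?thesis unfolding f_def .
qed

text \<open>Level \<open>k\<close> of \<open>F' \<circ> u\<close> is covered by \<open>O(2\<^sup>k)\<close> curves, each contributing a factor \<open>4\<^sup>-\<^sup>k\<close>; hence the
  sum over the levels converges.\<close>

theorem W_bound:
  assumes "curve u u'"
  shows "W u u' N \<le> ennreal (\<epsilon> * (8 * cover_const n * E) ^ N)"
  using assms
proof (induction N arbitrary: u u')
  case 0
  then obtain a where a: "a \<le> \<epsilon>" "bnd n a {0..1} u'" unfolding curve_def by blast
  have "W u u' 0 \<le> (\<integral>\<^sup>+t. ennreal \<epsilon> * indicator {0<..<1::real} t \<partial>lborel)"
    unfolding W_def
  proof (rule nn_integral_mono)
    fix t :: real
    show "ennreal (weight u u' 0 t * indicator {0<..<1} t) \<le> ennreal \<epsilon> * indicator {0<..<1} t"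
    proof (cases "t \<in> {0<..<1}")
      case True
      then have "\<bar>u' t\<bar> \<le> \<epsilon>" using bnd_bound[OF a(2), of t] a(1) by auto
      then show ?thesis using True by (simp add: weight_def ennreal_leI)
    qed simp
  qed
  also have "\<dots> = ennreal \<epsilon>" by (simp add: nn_integral_cmult)
  finally show ?case by simp
next
  case (Suc N)
  note c = Suc.prems
  define K where "K = \<epsilon> * (8 * cover_const n * E) ^ N"
  have Q: "0 < cover_const n" using cover_const(1)[OF n] .
  have K0: "0 \<le> K" using \<epsilon> Q E by (auto simp: K_def)
  obtain a where a: "0 < a" "a \<le> \<epsilon>" "\<And>t. t\<in>{0..1} \<Longrightarrow> a / 2 \<le> \<bar>u' t\<bar>" "bnd n a {0..1} u'"
    and u: "u ` {0..1} \<subseteq> J" "\<And>t. t \<in> {0..1} \<Longrightarrow> (u has_real_derivative u' t) (at t within {0..1})"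
    using c unfolding curve_def by blast
  define w where "w t = F' (u t) * u' t" for t
  define Y where "Y = jet_const n * (A * a)"
  have Y: "0 < Y" using jet_const_pos[of n] A a by (simp add: Y_def)
  have bw: "bnd n Y {0..1} w" unfolding w_def Y_def by (rule derivative_along_curve[OF u a(4,1,2)])
  have "\<forall>k. \<exists>\<T>. finite \<T> \<and> real (card \<T>) \<le> cover_const n * 2 ^ k \<and> (\<forall>(\<alpha>,\<tau>)\<in>\<T>. tame n w \<alpha> \<tau>) \<and>
      (\<exists>R. finite R \<and> level u k \<subseteq> R \<union> (\<Union>x\<in>\<T>. {fst x<..<fst x + snd x}))"
  proof
    fix k
    obtain \<T> R where TR: "finite \<T>" "real (card \<T>) \<le> cover_const n * 2 ^ k" "finite R" "\<forall>(\<alpha>,\<tau>)\<in>\<T>. tame n w \<alpha> \<tau>"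
      "{t\<in>{0..1}. 1 / (2 ^ (n + 1) * jet_const n) * (Y / 2 ^ (n * k)) \<le> \<bar>w t\<bar> \<and> \<bar>w t\<bar> \<le> Y / 2 ^ (n * k)} \<subseteq>
        R \<union> (\<Union>(\<alpha>,\<tau>)\<in>\<T>. {\<alpha><..<\<alpha> + \<tau>})" using cover_const(2)[OF n Y bw, of k] by (elim exE conjE)
    have "level u k \<subseteq> {t\<in>{0..1}. 1 / (2 ^ (n + 1) * jet_const n) * (Y / 2 ^ (n * k)) \<le> \<bar>w t\<bar> \<and>
      \<bar>w t\<bar> \<le> Y / 2 ^ (n * k)}"
    proof
      fix t assume t: "t \<in> level u k"
      then have t1: "t \<in> {0..1}" "A / 2 ^ (n * Suc k) < \<bar>F' (u t)\<bar>" "\<bar>F' (u t)\<bar> \<le> A / 2 ^ (n * k)"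
        by (auto simp: level_def)
      have "1 / (2 ^ (n + 1) * jet_const n) * (Y / 2 ^ (n * k)) = (A / 2 ^ (n * Suc k)) * (a / 2)"
        using jet_const_pos[of n] by (simp add: Y_def power_add mult_ac)
      also have "\<dots> \<le> \<bar>F' (u t)\<bar> * \<bar>u' t\<bar>"
        using t1 a(1) a(3)[OF t1(1)] by (intro mult_mono) auto
      finally have 1: "1 / (2 ^ (n + 1) * jet_const n) * (Y / 2 ^ (n * k)) \<le> \<bar>w t\<bar>"
        by (simp add: w_def abs_mult)
      have "\<bar>w t\<bar> \<le> (A / 2 ^ (n * k)) * a"
        unfolding w_def abs_mult using t1 A bnd_bound[OF a(4) t1(1)] by (intro mult_mono) auto
      also have "\<dots> = 1 * (A * a / 2 ^ (n * k))" by simp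
      also have "\<dots> \<le> jet_const n * (A * a / 2 ^ (n * k))" using jet_const_ge_1 A a
        by (intro mult_right_mono) auto
      finally have "\<bar>w t\<bar> \<le> Y / 2 ^ (n * k)" by (simp add: Y_def)
      then show "t \<in> {t\<in>{0..1}. 1 / (2 ^ (n + 1) * jet_const n) * (Y / 2 ^ (n * k)) \<le> \<bar>w t\<bar> \<and>
        \<bar>w t\<bar> \<le> Y / 2 ^ (n * k)}"
        using 1 t1(1) by blast
    qed
    then have "level u k \<subseteq> R \<union> (\<Union>x\<in>\<T>. {fst x<..<fst x + snd x})" using TR(5) unfolding case_prod_beta
      by (rule order_trans)
    then show "\<exists>\<T>. finite \<T> \<and> real (card \<T>) \<le> cover_const n * 2 ^ k \<and> (\<forall>(\<alpha>,\<tau>)\<in>\<T>. tame n w \<alpha> \<tau>) \<and>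
      (\<exists>R. finite R \<and> level u k \<subseteq> R \<union> (\<Union>x\<in>\<T>. {fst x<..<fst x + snd x}))" using TR(1-4) by blast
  qed
  from choice[OF this] obtain \<T> where "\<forall>k. finite (\<T> k) \<and> real (card (\<T> k)) \<le> cover_const n * 2 ^ k \<and>
    (\<forall>(\<alpha>,\<tau>)\<in>\<T> k. tame n w \<alpha> \<tau>) \<and>
      (\<exists>R. finite R \<and> level u k \<subseteq> R \<union> (\<Union>x\<in>\<T> k. {fst x<..<fst x + snd x}))" by (elim exE) (rule that)
  then have T: "\<And>k. finite (\<T> k)" "\<And>k. real (card (\<T> k)) \<le> cover_const n * 2 ^ k"
    "\<And>k \<alpha> \<tau>. (\<alpha>,\<tau>)\<in>\<T> k \<Longrightarrow> tame n w \<alpha> \<tau>"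
    "\<And>k. \<exists>R. finite R \<and> level u k \<subseteq> R \<union> (\<Union>x\<in>\<T> k. {fst x<..<fst x + snd x})"
    by (simp, simp, fastforce, simp)
  define f where "f t = ennreal (weight u u' (Suc N) t * indicator {0<..<1} t)" for t
  have fm: "f \<in> borel_measurable borel" unfolding f_def using curve_weight_measurable[OF c, of "Suc N"]
    by measurable
  have piece: "(\<integral>\<^sup>+t. f t * indicator (level u k) t \<partial>lborel) \<le> ennreal ((1 / 2) ^ k * (4 * cover_const n * E
    * K))" for k
  proof -
    obtain R where R: "finite R" "level u k \<subseteq> R \<union> (\<Union>x\<in>\<T> k. {fst x<..<fst x + snd x})" using T(4) by blast
    have "(\<integral>\<^sup>+t. f t * indicator (level u k) t \<partial>lborel) \<le>
      (\<Sum>x\<in>\<T> k. \<integral>\<^sup>+t. f t * indicator (level u k \<inter> {fst x<..<fst x + snd x}) t \<partial>lborel)"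
      by (rule nn_integral_finite_cover[OF fm T(1) _ level_measurable[OF c] countable_finite[OF R(1)] R(2)])
        auto
    also have "\<dots> \<le> (\<Sum>x\<in>\<T> k. ennreal ((1 / 4) ^ k * (4 * E) * K))"
    proof (rule sum_mono)
      fix x assume "x \<in> \<T> k"
      then have t: "tame n w (fst x) (snd x)" using T(3)[of "fst x" "snd x" k] by simp
      show "(\<integral>\<^sup>+t. f t * indicator (level u k \<inter> {fst x<..<fst x + snd x}) t \<partial>lborel) \<le>
        ennreal ((1 / 4) ^ k * (4 * E) * K)"
        unfolding f_def
        by (rule W_tame[OF c t[unfolded w_def] K0]) (use Suc.IH in \<open>simp add: K_def\<close>)
    qed
    also have "\<dots> = ennreal (real (card (\<T> k)) * ((1 / 4) ^ k * (4 * E) * K))"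
      using K0 E by (subst sum_ennreal) auto
    also have "\<dots> \<le> ennreal ((cover_const n * 2 ^ k) * ((1 / 4) ^ k * (4 * E) * K))"
      using T(2)[of k] K0 E by (intro ennreal_leI mult_right_mono) auto
    also have "(cover_const n * 2 ^ k) * ((1 / 4) ^ k * (4 * E) * K) =
      (2 ^ k * (1 / 4) ^ k) * (4 * cover_const n * E * K)"
      by (simp only: mult_ac)
    also have "(2 ^ k * (1 / 4) ^ k) = (1 / 2 :: real) ^ k"
      by (simp add: power_mult_distrib[symmetric])
    finally show ?thesis .
  qed
  have "W u u' (Suc N) \<le> (\<integral>\<^sup>+t. (\<Sum>k. f t * indicator (level u k) t) \<partial>lborel)"
    unfolding W_def f_def[symmetric]
  proof (rule nn_integral_mono)
    fix t :: real
    show "f t \<le> (\<Sum>k. f t * indicator (level u k) t)"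
    proof (cases "t \<in> {0<..<1} \<and> F' (u t) \<noteq> 0")
      case True
      have "u t \<in> J" using True u(1) by (auto simp: image_subset_iff)
      then have "0 < \<bar>F' (u t)\<bar> / A" "\<bar>F' (u t)\<bar> / A \<le> 1" using FA[of "u t"] A True by auto
      from dyadic_level[OF this n] obtain k where k: "t \<in> level u k"
        using A True by (auto simp: level_def field_simps)
      have "f t = (\<Sum>i\<in>{k}. f t * indicator (level u i) t)" using k by simp
      also have "\<dots> \<le> (\<Sum>k. f t * indicator (level u k) t)" by (rule sum_le_suminf) auto
      finally show ?thesis .
    next
      \<comment> \<open>Critical points lie on no level, but the weight vanishes there.\<close>
      case False
      then have "f t = 0" by (auto simp: f_def weight_def dprod_Suc)
      then show ?thesis by simp
    qed
  qed
  also have "\<dots> = (\<Sum>k. \<integral>\<^sup>+t. f t * indicator (level u k) t \<partial>lborel)"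
    using fm level_measurable[OF c] by (intro nn_integral_suminf) auto
  also have "\<dots> \<le> (\<Sum>k. ennreal ((1 / 2) ^ k * (4 * cover_const n * E * K)))"
    by (intro suminf_le piece) auto
  also have "\<dots> = ennreal (\<Sum>k. (1 / 2) ^ k * (4 * cover_const n * E * K))"
    using K0 Q E by (intro suminf_ennreal2 summable_mult2 summable_geometric) auto
  \<comment> \<open>The geometric series contributes 2, which together with 4 * E per tame piece
    gives the 8 in the growth rate.\<close>
  also have "(\<Sum>k. (1 / 2) ^ k * (4 * cover_const n * E * K)) = 2 * (4 * cover_const n * E * K)"
    by (subst suminf_mult2[symmetric]) (auto simp: suminf_geometric)
  also have "\<dots> = \<epsilon> * (8 * cover_const n * E) ^ Suc N" by (simp add: K_def)
  finally show ?case .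
qed

end

section \<open>Rare good times and push-forward of Lebesgue measure\<close>

lemma open_interval_of_connected:
  fixes C :: "real set"
  assumes "open C" "connected C" "bounded C" "C \<noteq> {}"
  shows "C = {Inf C<..<Sup C}"
proof -
  have bb: "bdd_below C" "bdd_above C" using assms(3)
    by (auto simp: bounded_imp_bdd_below bounded_imp_bdd_above)
  have "x \<noteq> Sup C \<and> x \<noteq> Inf C" if x: "x \<in> C" for x
  proof -
    obtain e where e: "e > 0" "ball x e \<subseteq> C" using assms(1) x openE by blast
    then have "x + e / 2 \<in> C" "x - e / 2 \<in> C" by (auto simp: subset_iff dist_real_def)
    then have "x + e / 2 \<le> Sup C" "Inf C \<le> x - e / 2" using bb by (auto intro: cSup_upper cInf_lower)
    then show ?thesis using e(1) by auto
  qed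
  then have 1: "C \<subseteq> {Inf C<..<Sup C}" using bb by (force simp: less_le intro: cSup_upper cInf_lower)
  have "x \<in> C" if x: "x \<in> {Inf C<..<Sup C}" for x
  proof -
    obtain y z where "y \<in> C" "y < x" "z \<in> C" "x < z"
      using x cInf_lessD[OF assms(4), of x] less_cSup_iff[OF assms(4) bb(2), of x] by auto
    then show ?thesis using assms(2) by (meson connected_contains_Icc atLeastAtMost_iff less_imp_le subsetD)
  qed
  then show ?thesis using 1 by blast
qed

text \<open>Exhaustion by compact intervals, on which the substitution rule is available; on a
  component of the noncritical set nothing is assumed at the end points.\<close>

lemma nn_integral_open_interval_le:
  fixes f :: "real \<Rightarrow> ennreal"
  assumes f: "(\<lambda>x. f x * indicator {l<..<r} x) \<in> borel_measurable borel"
    and le: "\<And>a b. l < a \<Longrightarrow> a < b \<Longrightarrow> b < r \<Longrightarrow> (\<integral>\<^sup>+x. f x * indicator {a..b} x \<partial>lborel) \<le> K"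
  shows "(\<integral>\<^sup>+x. f x * indicator {l<..<r} x \<partial>lborel) \<le> K"
proof (cases "l < r")
  case True
  \<comment> \<open>The summand 3 keeps a k < b k from k = 0 on.\<close>
  define a where "a k = l + (r - l) / (real k + 3)" for k :: nat
  define b where "b k = r - (r - l) / (real k + 3)" for k :: nat
  have ab: "l < a k" "a k < b k" "b k < r" for k
  proof -
    define X where "X = (r - l) / (real k + 3)"
    have "X \<le> (r - l) / 3" unfolding X_def using True by (intro divide_left_mono) auto
    moreover have "0 < X" unfolding X_def using True by simp
    ultimately have "l < l + X \<and> l + X < r - X \<and> r - X < r" using True by auto
    then show "l < a k" "a k < b k" "b k < r" unfolding a_def b_def X_def by blast+
  qed
  have mono: "(r - l) / (real k' + 3) \<le> (r - l) / (real k + 3)" if "k \<le> k'" for k k' :: nat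
    using True that by (intro divide_left_mono) auto
  let ?g = "\<lambda>k x. f x * indicator {a k..b k} x"
  have "f x * indicator {l<..<r} x = (SUP k. ?g k x)" for x
  proof (cases "x \<in> {l<..<r}")
    case x: True
    define d where "d = min (x - l) (r - x)"
    have d: "0 < d" using x by (auto simp: d_def)
    obtain k :: nat where k: "(r - l) / d < real k" using reals_Archimedean2 by blast
    have "(r - l) < d * (real k + 3)" using k d by (simp add: pos_divide_less_eq algebra_simps)
    then have "(r - l) / (real k + 3) < d" by (simp add: pos_divide_less_eq)
    then have "x \<in> {a k..b k}" by (auto simp: a_def b_def d_def)
    then have "f x \<le> (SUP k. ?g k x)" by (intro SUP_upper2[of k]) auto
    moreover have "(SUP k. ?g k x) \<le> f x" by (intro SUP_least) (auto simp: indicator_def)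
    ultimately show ?thesis using x by (auto intro: antisym)
  next
    case False
    then have "x \<notin> {a k..b k}" for k using ab(1)[of k] ab(3)[of k] by auto
    then show ?thesis using False by simp
  qed
  then have "(\<integral>\<^sup>+x. f x * indicator {l<..<r} x \<partial>lborel) = (\<integral>\<^sup>+x. (SUP k. ?g k x) \<partial>lborel)" by simp
  also have "\<dots> = (SUP k. \<integral>\<^sup>+x. ?g k x \<partial>lborel)"
  proof (rule nn_integral_monotone_convergence_SUP)
    show "incseq ?g"
    proof (intro incseq_SucI le_funI mult_left_mono indicator_leI)
      fix k x assume "x \<in> {a k..b k}"
      then show "x \<in> {a (Suc k)..b (Suc k)}"
        using mono[of k "Suc k"] unfolding a_def b_def atLeastAtMost_iff by linarith
    qed simp
    fix k
    have "?g k = (\<lambda>x. (f x * indicator {l<..<r} x) * indicator {a k..b k} x)"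
      using ab(1)[of k] ab(3)[of k] by (auto simp: indicator_def fun_eq_iff)
    also have "\<dots> \<in> borel_measurable lborel" using f by simp
    finally show "?g k \<in> borel_measurable lborel" .
  qed
  also have "\<dots> \<le> K" using le ab by (intro SUP_least) auto
  finally show ?thesis .
qed simp

lemma monotone_image_integral_pos:
  fixes g g' :: "real \<Rightarrow> real"
  assumes d: "\<And>x. x \<in> {l<..<r} \<Longrightarrow> (g has_real_derivative g' x) (at x)"
    and c: "continuous_on {l<..<r} g'" and pos: "\<And>x. x \<in> {l<..<r} \<Longrightarrow> 0 \<le> g' x" and pq: "p \<le> q"
  shows "(\<integral>\<^sup>+x. ennreal (indicator {p<..<q} (g x) * g' x) * indicator {l<..<r} x \<partial>lborel) \<le> ennreal (q - p)"
proof (rule nn_integral_open_interval_le)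
  have cg: "continuous_on {l<..<r} g" by (rule DERIV_continuous_on[OF has_field_derivative_at_within[OF d]])
  have m1: "(\<lambda>x. g x * indicator {l<..<r} x) \<in> borel_measurable borel"
    "(\<lambda>x. g' x * indicator {l<..<r} x) \<in> borel_measurable borel"
    using borel_measurable_continuous_on_indicator[OF _ cg] borel_measurable_continuous_on_indicator[OF _ c]
    by (simp_all add: mult.commute)
  have "(\<lambda>x. ennreal (indicator {p<..<q} (g x) * g' x) * indicator {l<..<r} x) =
     (\<lambda>x. ennreal (indicator {p<..<q} (g x * indicator {l<..<r} x) * (g' x * indicator {l<..<r} x)))"
    by (auto simp: fun_eq_iff indicator_def)
  also have "\<dots> \<in> borel_measurable borel" using m1 by measurable
  finally show "(\<lambda>x. ennreal (indicator {p<..<q} (g x) * g' x) * indicator {l<..<r} x) \<in> borel_measurable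
    borel" .
  fix a b assume ab: "l < a" "a < b" "b < r"
  have "(\<integral>\<^sup>+x. (indicator {p<..<q} x :: ennreal) * indicator {g a..g b} x \<partial>lborel) =
        (\<integral>\<^sup>+x. indicator {p<..<q} (g x) * ennreal (g' x) * indicator {a..b} x \<partial>lborel)"
    by (rule nn_integral_substitution_aux)
      (use ab d pos in \<open>auto intro: continuous_on_subset[OF c]\<close>)
  moreover have "(\<integral>\<^sup>+x. (indicator {p<..<q} x :: ennreal) * indicator {g a..g b} x \<partial>lborel) \<le>
     (\<integral>\<^sup>+x. indicator {p<..<q} x \<partial>lborel)" by (intro nn_integral_mono) (auto simp: indicator_def)
  moreover have "\<dots> = ennreal (q - p)" using pq by simp
  ultimately have "(\<integral>\<^sup>+x. indicator {p<..<q} (g x) * ennreal (g' x) * indicator {a..b} x \<partial>lborel) \<le>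
    ennreal (q - p)"
    by simp
  moreover have "ennreal (indicator {p<..<q} (g x) * g' x) = indicator {p<..<q} (g x) * ennreal (g' x)" for x
    by (auto simp: indicator_def)
  ultimately show "(\<integral>\<^sup>+x. ennreal (indicator {p<..<q} (g x) * g' x) * indicator {a..b} x \<partial>lborel) \<le>
    ennreal (q - p)"
    by simp
qed

text \<open>A continuous nonvanishing derivative has constant sign on an interval. So g is injective
  there, and integrating |g'| over the preimage of an interval gives at most its length.\<close>

lemma monotone_image_integral:
  fixes g g' :: "real \<Rightarrow> real"
  assumes d: "\<And>x. x \<in> {l<..<r} \<Longrightarrow> (g has_real_derivative g' x) (at x)"
    and c: "continuous_on {l<..<r} g'" and nz: "\<And>x. x \<in> {l<..<r} \<Longrightarrow> g' x \<noteq> 0" and pq: "p \<le> q"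
  shows "(\<integral>\<^sup>+x. ennreal (indicator {p<..<q} (g x) * \<bar>g' x\<bar>) * indicator {l<..<r} x \<partial>lborel) \<le> ennreal (q - p)"
proof -
  have "connected (g' ` {l<..<r})" using c by (intro connected_continuous_image) auto
  then have "(\<forall>x\<in>{l<..<r}. 0 \<le> g' x) \<or> (\<forall>x\<in>{l<..<r}. g' x \<le> 0)"
  proof (rule contrapos_pp)
    assume "\<not> ?thesis"
    then obtain x y where "x \<in> {l<..<r}" "g' x < 0" "y \<in> {l<..<r}" "0 < g' y" by force
    then have "g' x \<in> g' ` {l<..<r}" "g' y \<in> g' ` {l<..<r}" "0 \<in> {g' x..g' y}" "0 \<notin> g' ` {l<..<r}" using nz
      by force+
    then show "\<not> connected (g' ` {l<..<r})" by (meson connected_contains_Icc subsetD)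
  qed
  then show ?thesis
  proof
    assume pos: "\<forall>x\<in>{l<..<r}. 0 \<le> g' x"
    have "(\<integral>\<^sup>+x. ennreal (indicator {p<..<q} (g x) * \<bar>g' x\<bar>) * indicator {l<..<r} x \<partial>lborel) =
       (\<integral>\<^sup>+x. ennreal (indicator {p<..<q} (g x) * g' x) * indicator {l<..<r} x \<partial>lborel)"
      using pos by (intro nn_integral_cong) (auto simp: indicator_def)
    then show ?thesis using monotone_image_integral_pos[of l r g g' p q] assms pos by simp
  next
    assume neg: "\<forall>x\<in>{l<..<r}. g' x \<le> 0"
    have "(\<integral>\<^sup>+x. ennreal (indicator {p<..<q} (g x) * \<bar>g' x\<bar>) * indicator {l<..<r} x \<partial>lborel) =
       (\<integral>\<^sup>+x. ennreal (indicator {-q<..<-p} (- g x) * (- g' x)) * indicator {l<..<r} x \<partial>lborel)"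
      using neg by (intro nn_integral_cong) (auto simp: indicator_def)
    also have "\<dots> \<le> ennreal (- p - - q)"
      using neg pq
        by (intro monotone_image_integral_pos) (auto intro!: derivative_eq_intros d continuous_intros c)
    finally show ?thesis by simp
  qed
qed

lemma emeasure_disjoint_components_le:
  fixes U S :: "real set"
  assumes U: "open U" and S: "S \<subseteq> U" "S \<in> sets borel"
    and le: "\<And>C. C \<in> components U \<Longrightarrow> emeasure lborel (S \<inter> C) \<le> k * emeasure lborel C"
  shows "emeasure lborel S \<le> k * emeasure lborel U"
proof -
  have op: "open C" if "C \<in> components U" for C using open_components[OF U that] .
  have cnt: "countable (components U)"
    by (rule countable_disjoint_open_subsets[OF op])
      (use pairwise_disjoint_components[of U] in \<open>auto simp: pairwise_def disjnt_def\<close>)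
  have dj: "disjoint_family_on (\<lambda>C. C) (components U)"
    using pairwise_disjoint_components[of U] by (simp add: disjoint_family_on_def pairwise_def)
  have dj2: "disjoint_family_on (\<lambda>C. S \<inter> C) (components U)"
    using dj by (auto simp: disjoint_family_on_def)
  have "emeasure lborel S = emeasure lborel (\<Union>C\<in>components U. S \<inter> C)"
    using S(1) Union_components[of U] by (intro arg_cong[where f = "emeasure lborel"]) blast
  also have "\<dots> = (\<integral>\<^sup>+C. emeasure lborel (S \<inter> C) \<partial>count_space (components U))"
    using S(2) op cnt dj2 by (intro emeasure_UN_countable) auto
  also have "\<dots> \<le> (\<integral>\<^sup>+C. k * emeasure lborel C \<partial>count_space (components U))"
    by (intro nn_integral_mono) (auto intro: le)
  also have "\<dots> = k * (\<integral>\<^sup>+C. emeasure lborel C \<partial>count_space (components U))"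
    by (intro nn_integral_cmult) auto
  also have "(\<integral>\<^sup>+C. emeasure lborel C \<partial>count_space (components U)) = emeasure lborel (\<Union>C\<in>components U. C)"
    using op cnt dj by (intro emeasure_UN_countable[symmetric]) auto
  also have "(\<Union>C\<in>components U. C) = U" using Union_components[of U] by auto
  finally show ?thesis .
qed

section \<open>Good times on a cell of the parameter line\<close>

context smooth_bounds begin

lemma funpow_derivative: "x \<in> J \<Longrightarrow> ((F ^^ m) has_real_derivative DF m x) (at x within J)"
proof (induction m arbitrary: x)
  case 0
  have "((\<lambda>x. x) has_real_derivative 1) (at x within J)" by (rule DERIV_ident)
  then show ?case by (simp add: id_def)
next
  case (Suc m)
  have "((\<lambda>x. (F ^^ m) (F x)) has_real_derivative DF m (F x) * F' x) (at x within J)"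
    by (rule has_real_derivative_comp_within[OF Suc.IH _ dF]) (use Suc.prems FJ in auto)
  then show ?case by (simp add: dprod_Suc funpow_Suc_right o_def mult.commute del: funpow.simps)
qed

text \<open>\<open>good\<close> for the affine curve onto {c..c + \<tau>}, expressed at the point
  itself instead of its parameter, so that cells can be compared and glued.\<close>

definition goodx :: "real \<Rightarrow> real \<Rightarrow> nat \<Rightarrow> real \<Rightarrow> bool" where
  "goodx c \<tau> m x \<longleftrightarrow> (\<exists>a b. c \<le> a \<and> a < x \<and> x < b \<and> b \<le> c + \<tau> \<and> (\<forall>s\<in>{a<..<b}. DF m s \<noteq> 0) \<and>
     \<epsilon> / 8 < \<bar>DF m x\<bar> * (b - a) \<and>
     (\<forall>s\<in>{a<..<b}. \<forall>s'\<in>{a<..<b}. \<bar>(F ^^ m) s - (F ^^ m) s'\<bar> \<le> \<epsilon>)) \<and>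
     E \<le> \<bar>F' ((F ^^ (m - 1)) x)\<bar>"

lemma good_iff_goodx:
  assumes \<tau>: "0 < \<tau>"
  shows "good (\<lambda>s. c + \<tau> * s) (\<lambda>_. \<tau>) m s \<longleftrightarrow> goodx c \<tau> m (c + \<tau> * s)"
proof
  assume "good (\<lambda>s. c + \<tau> * s) (\<lambda>_. \<tau>) m s"
  then obtain a b where ab: "0 \<le> a" "a < s" "s < b" "b \<le> 1" "\<And>s. s\<in>{a<..<b} \<Longrightarrow> DF m (c + \<tau> * s) * \<tau> \<noteq> 0"
     "\<epsilon> / 8 < \<bar>DF m (c + \<tau> * s) * \<tau>\<bar> * (b - a)"
     "\<And>s s'. s\<in>{a<..<b} \<Longrightarrow> s'\<in>{a<..<b} \<Longrightarrow> \<bar>(F ^^ m) (c + \<tau> * s) - (F ^^ m) (c + \<tau> * s')\<bar> \<le> \<epsilon>"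
     "E \<le> \<bar>F' ((F ^^ (m - 1)) (c + \<tau> * s))\<bar>" unfolding good_def by blast
  have preim: "\<exists>s\<in>{a<..<b}. t = c + \<tau> * s" if "t \<in> {c + \<tau> * a<..<c + \<tau> * b}" for t
    using that \<tau> by (intro bexI[of _ "(t - c) / \<tau>"]) (auto simp: field_simps)
  have "\<tau> * b \<le> \<tau>" using \<tau> ab by (intro mult_left_le) auto
  then have bnds: "c \<le> c + \<tau> * a" "c + \<tau> * b \<le> c + \<tau>" "c + \<tau> * a < c + \<tau> * s" "c + \<tau> * s < c + \<tau> * b"
    using \<tau> ab by auto
  have "\<epsilon> / 8 < \<bar>DF m (c + \<tau> * s)\<bar> * ((c + \<tau> * b) - (c + \<tau> * a))"
    using ab(6) \<tau> by (simp add: abs_mult algebra_simps)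
  moreover have "\<forall>t\<in>{c + \<tau> * a<..<c + \<tau> * b}. DF m t \<noteq> 0"
    using preim ab(5) by fastforce
  moreover have "\<forall>t\<in>{c + \<tau> * a<..<c + \<tau> * b}. \<forall>t'\<in>{c + \<tau> * a<..<c + \<tau> * b}. \<bar>(F ^^ m) t - (F ^^ m) t'\<bar> \<le> \<epsilon>"
    using preim ab(7) by metis
  ultimately show "goodx c \<tau> m (c + \<tau> * s)"
    unfolding goodx_def using bnds ab(8) by blast
next
  assume "goodx c \<tau> m (c + \<tau> * s)"
  then obtain a b where ab: "c \<le> a" "a < c + \<tau> * s" "c + \<tau> * s < b" "b \<le> c + \<tau>" "\<And>t. t\<in>{a<..<b} \<Longrightarrow> DF m t \<noteq> 0"
     "\<epsilon> / 8 < \<bar>DF m (c + \<tau> * s)\<bar> * (b - a)"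
     "\<And>t t'. t\<in>{a<..<b} \<Longrightarrow> t'\<in>{a<..<b} \<Longrightarrow> \<bar>(F ^^ m) t - (F ^^ m) t'\<bar> \<le> \<epsilon>"
     "E \<le> \<bar>F' ((F ^^ (m - 1)) (c + \<tau> * s))\<bar>" unfolding goodx_def by blast
  have im: "c + \<tau> * r \<in> {a<..<b}" if "r \<in> {(a - c) / \<tau><..<(b - c) / \<tau>}" for r
    using that \<tau> by (auto simp: field_simps)
  have len: "\<bar>DF m (c + \<tau> * s) * \<tau>\<bar> * ((b - c) / \<tau> - (a - c) / \<tau>) = \<bar>DF m (c + \<tau> * s)\<bar> * (b - a)"
    using \<tau> by (simp add: abs_mult diff_divide_distrib[symmetric])
  show "good (\<lambda>s. c + \<tau> * s) (\<lambda>_. \<tau>) m s" unfolding good_def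
  proof (rule conjI, rule exI[of _ "(a - c) / \<tau>"], rule exI[of _ "(b - c) / \<tau>"], intro conjI ballI)
    show "0 \<le> (a - c) / \<tau>" "(a - c) / \<tau> < s" "s < (b - c) / \<tau>" "(b - c) / \<tau> \<le> 1"
      using ab \<tau> by (auto simp: field_simps)
    show "\<epsilon> / 8 < \<bar>DF m (c + \<tau> * s) * \<tau>\<bar> * ((b - c) / \<tau> - (a - c) / \<tau>)" unfolding len by (rule ab)
    show "E \<le> \<bar>F' ((F ^^ (m - 1)) (c + \<tau> * s))\<bar>" by (rule ab)
    fix r assume r: "r \<in> {(a - c) / \<tau><..<(b - c) / \<tau>}"
    show "DF m (c + \<tau> * r) * \<tau> \<noteq> 0" using ab(5)[OF im[OF r]] \<tau> by simp
    fix r' assume r': "r' \<in> {(a - c) / \<tau><..<(b - c) / \<tau>}"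
    show "\<bar>(F ^^ m) (c + \<tau> * r) - (F ^^ m) (c + \<tau> * r')\<bar> \<le> \<epsilon>" by (rule ab(7)[OF im[OF r] im[OF r']])
  qed
qed

lemma affine_curve:
  assumes "0 < \<tau>" "\<tau> \<le> \<epsilon>" "{c..c+\<tau>} \<subseteq> J"
  shows "curve (\<lambda>s. c + \<tau> * s) (\<lambda>_. \<tau>)"
proof -
  have "c + \<tau> * s \<in> {c..c+\<tau>}" if "s \<in> {0..1}" for s
  proof -
    have "\<tau> * s \<le> \<tau>" using that assms by (intro mult_left_le) auto
    moreover have "0 \<le> \<tau> * s" using that assms by simp
    ultimately show ?thesis unfolding atLeastAtMost_iff by linarith
  qed
  moreover have "((\<lambda>s. c + \<tau> * s) has_real_derivative \<tau>) (at t within {0..1})" for t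
    by (auto intro!: derivative_eq_intros)
  ultimately show ?thesis unfolding curve_def using assms
    by (intro conjI exI[of _ \<tau>] bnd_const) auto
qed

lemma goodx_measurable:
  assumes "0 < \<tau>" "\<tau> \<le> \<epsilon>" "{c..c+\<tau>} \<subseteq> J"
  shows "{x \<in> {c<..<c+\<tau>}. goodx c \<tau> m x} \<in> sets borel"
proof -
  note cu = affine_curve[OF assms]
  have "{t \<in> {0<..<1}. good (\<lambda>s. c + \<tau> * s) (\<lambda>_. \<tau>) m t} \<in> sets borel"
    by (rule good_measurable) (use cu curve_continuous[OF cu] in \<open>auto simp: curve_def\<close>)
  moreover have "(\<lambda>x. (x - c) / \<tau>) \<in> borel_measurable borel" by measurable
  ultimately have "(\<lambda>x. (x - c) / \<tau>) -` {t \<in> {0<..<1}. good (\<lambda>s. c +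
    \<tau> * s) (\<lambda>_. \<tau>) m t} \<inter> space borel \<in> sets borel"
    by (rule measurable_sets[rotated])
  also have "(\<lambda>x. (x - c) / \<tau>) -` {t \<in> {0<..<1}. good (\<lambda>s. c + \<tau> * s) (\<lambda>_. \<tau>) m t} \<inter> space borel =
    {x \<in> {c<..<c+\<tau>}. goodx c \<tau> m x}"
  proof -
    have "c + \<tau> * ((x - c) / \<tau>) = x" for x using assms(1) by simp
    moreover have "0 < (x - c) / \<tau> \<longleftrightarrow> c < x" "(x - c) / \<tau> < 1 \<longleftrightarrow> x < c + \<tau>" for x
      using assms(1) by (auto simp: zero_less_divide_iff divide_less_eq)
    ultimately show ?thesis by (auto simp: good_iff_goodx[OF assms(1)])
  qed
  finally show ?thesis .
qed

definition bad :: "real \<Rightarrow> real \<Rightarrow> real \<Rightarrow> real \<Rightarrow> nat \<Rightarrow> real set" where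
  "bad c \<tau> h \<beta> N = {x \<in> {c<..<c+\<tau>}. exp (h * real N) \<le> \<bar>DF N x\<bar> \<and>
     (\<Sum>m\<in>{1..N}. indicator {x \<in> {c<..<c+\<tau>}. goodx c \<tau> m x} x) \<le> \<beta> * real N}"

lemma DF_measurable:
  assumes "{c..c+\<tau>} \<subseteq> J"
  shows "(\<lambda>x. DF N x * indicator {c<..<c+\<tau>} x) \<in> borel_measurable borel"
proof -
  have "continuous_on {c<..<c+\<tau>} (DF N)"
    using assms by (intro continuous_on_subset[OF continuous_DF]) auto
  then show ?thesis using borel_measurable_continuous_on_indicator[of "{c<..<c+\<tau>}" "DF N"]
    by (simp add: mult.commute)
qed

lemma bad_measurable:
  assumes "0 < \<tau>" "\<tau> \<le> \<epsilon>" "{c..c+\<tau>} \<subseteq> J"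
  shows "bad c \<tau> h \<beta> N \<in> sets borel"
proof -
  have "bad c \<tau> h \<beta> N = {x \<in> space borel. c < x \<and> x < c + \<tau> \<and>
    exp (h * real N) \<le> \<bar>DF N x * indicator {c<..<c+\<tau>} x\<bar> \<and>
     (\<Sum>m\<in>{1..N}. indicator {x \<in> {c<..<c+\<tau>}. goodx c \<tau> m x} x) \<le> \<beta> * real N}"
    by (auto simp: bad_def)
  also have "\<dots> \<in> sets borel" using DF_measurable[OF assms(3), of N] goodx_measurable[OF assms] by measurable
  finally show ?thesis .
qed

text \<open>Chebyshev's inequality for \<open>weight\<close>. On the bad set its factors are at
  least \<tau> * exp (h * N), then A to the power -2 * N / n, and 4 * A to the power -\<beta> * N;
  dividing the bound of \<open>W_bound\<close> by their product leaves the rate \<gamma>. Since 0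
  \<le> h, fast points satisfy |DF N| \<ge> 1, which gives the second factor.\<close>

lemma bad_small:
  assumes \<tau>: "0 < \<tau>" "\<tau> \<le> \<epsilon>" "{c..c+\<tau>} \<subseteq> J" and h: "0 \<le> h"
    and \<gamma>_def: "\<gamma> = h - ln (8 * cover_const n * E) - 2 / real n * ln A - \<beta> * ln (4 * A)"
  shows "emeasure lborel (bad c \<tau> h \<beta> N) \<le> ennreal (\<epsilon> * exp (- \<gamma> * real N))"
proof -
  let ?u = "\<lambda>s. c + \<tau> * s" and ?u' = "\<lambda>_::real. \<tau>"
  have cu: "curve ?u ?u'" by (rule affine_curve[OF \<tau>])
  have Q: "0 < 8 * cover_const n * E" using cover_const(1)[OF n] E by simp
  have A4: "1 \<le> 4 * A" using A by simp
  define L where "L = exp (h * real N) * exp (- (2 / real n * ln A * real N)) * exp (- (\<beta> * ln (4 * A) *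
    real N))"
  have Lpos: "0 < L" by (simp add: L_def)
  have low: "\<tau> * L \<le> weight ?u ?u' N s" if s: "c + \<tau> * s \<in> bad c \<tau> h \<beta> N" for s
  proof -
    have DF: "exp (h * real N) \<le> \<bar>DF N (c + \<tau> * s)\<bar>" using s by (simp add: bad_def)
    have in': "c + \<tau> * s \<in> {c<..<c+\<tau>}" using s by (simp add: bad_def)
    have "exp (- (2 / real n * ln A * real N)) = (1 / A ^ N) powr (2 / real n)"
    proof -
      have "ln (1 / A ^ N) = - (real N * ln A)" using A by (simp add: ln_div ln_realpow)
      then show ?thesis using A by (simp add: powr_def mult_ac)
    qed
    also have "\<dots> \<le> (\<bar>DF N (c + \<tau> * s)\<bar> / A ^ N) powr (2 / real n)"
    proof (intro powr_mono2 divide_right_mono)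
      have "1 \<le> exp (h * real N)" using h by simp
      then show "1 \<le> \<bar>DF N (c + \<tau> * s)\<bar>" using DF by linarith
    qed (use A in auto)
    finally have 2: "exp (- (2 / real n * ln A * real N)) \<le> (\<bar>DF N (c + \<tau> * s)\<bar> / A ^ N) powr (2 / real n)" .
    define k where "k = card {m\<in>{1..N}. goodx c \<tau> m (c + \<tau> * s)}"
    have "(\<Prod>m\<in>{1..N}. wt ?u ?u' m s) = (\<Prod>m\<in>{m\<in>{1..N}. goodx c \<tau> m (c + \<tau> * s)}. 1 / (4 * A))"
      unfolding wt_def good_iff_goodx[OF \<tau>(1)] by (simp add: prod.inter_filter[symmetric])
    also have "\<dots> = (1 / (4 * A)) ^ k" by (simp add: k_def)
    finally have pk: "(\<Prod>m\<in>{1..N}. wt ?u ?u' m s) = (1 / (4 * A)) ^ k" .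
    have "(\<Sum>m\<in>{1..N}. indicator {x \<in> {c<..<c+\<tau>}. goodx c \<tau> m x} (c + \<tau> * s)) =
      (\<Sum>m\<in>{1..N}. if goodx c \<tau> m (c + \<tau> * s) then 1 else (0::real))"
      using in' by (intro sum.cong) (auto simp: indicator_def)
    also have "\<dots> = real k" unfolding k_def by (simp add: sum.inter_filter[symmetric])
    finally have ks: "(\<Sum>m\<in>{1..N}. indicator {x \<in> {c<..<c+\<tau>}. goodx c \<tau> m x} (c + \<tau> * s)) = real k" .
    have kb: "real k \<le> \<beta> * real N" unfolding ks[symmetric] using s unfolding bad_def by blast
    have "exp (- (\<beta> * ln (4 * A) * real N)) \<le> exp (- (real k * ln (4 * A)))"
      using mult_right_mono[OF kb, of "ln (4 * A)"] A4 by (simp add: mult_ac)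
    also have "\<dots> = (1 / (4 * A)) ^ k"
    proof -
      have "exp (- (real k * ln (4 * A))) = inverse (exp (ln (4 * A)) ^ k)"
        by (simp only: exp_minus exp_of_nat_mult)
      also have "exp (ln (4 * A)) = 4 * A" using A by simp
      finally show ?thesis by (simp only: power_one_over[symmetric] inverse_eq_divide)
    qed
    finally have 3: "exp (- (\<beta> * ln (4 * A) * real N)) \<le> (\<Prod>m\<in>{1..N}. wt ?u ?u' m s)" unfolding pk .
    have "L \<le> \<bar>DF N (c + \<tau> * s)\<bar> * (\<bar>DF N (c + \<tau> * s)\<bar> / A ^ N) powr (2 / real n) * (\<Prod>m\<in>{1..N}. wt ?u ?u' m s)"
      unfolding L_def by (intro mult_mono DF 2 3 mult_nonneg_nonneg) auto
    then have "\<tau> * L \<le> \<tau> * (\<bar>DF N (c + \<tau> * s)\<bar> * (\<bar>DF N (c +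
      \<tau> * s)\<bar> / A ^ N) powr (2 / real n) * (\<Prod>m\<in>{1..N}. wt ?u ?u' m s))"
      using \<tau> by (intro mult_left_mono) auto
    then show ?thesis using \<tau> by (simp add: weight_def abs_mult mult_ac)
  qed
  have bm: "bad c \<tau> h \<beta> N \<in> sets borel" by (rule bad_measurable[OF \<tau>])
  have "ennreal L * emeasure lborel (bad c \<tau> h \<beta> N) = (\<integral>\<^sup>+x. ennreal L * indicator (bad c \<tau> h \<beta> N) x \<partial>lborel)"
    using bm by (simp add: nn_integral_cmult)
  also have "\<dots> = \<bar>\<tau>\<bar> * (\<integral>\<^sup>+s. ennreal L * indicator (bad c \<tau> h \<beta> N) (c + \<tau> * s) \<partial>lborel)"
    using bm \<tau> by (intro nn_integral_real_affine) auto
  also have "\<dots> = (\<integral>\<^sup>+s. ennreal \<tau> * (ennreal L * indicator (bad c \<tau> h \<beta> N) (c + \<tau> * s)) \<partial>lborel)"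
    using bm \<tau> by (subst nn_integral_cmult) auto
  also have "\<dots> \<le> W ?u ?u' N" unfolding W_def
  proof (rule nn_integral_mono)
    fix s :: real
    show "ennreal \<tau> * (ennreal L * indicator (bad c \<tau> h \<beta> N) (c + \<tau> * s)) \<le>
      ennreal (weight ?u ?u' N s * indicator {0<..<1} s)"
    proof (cases "c + \<tau> * s \<in> bad c \<tau> h \<beta> N")
      case True
      then have "s \<in> {0<..<1}" using \<tau> by (auto simp: bad_def zero_less_mult_iff)
      then show ?thesis using low[OF True] True \<tau> Lpos by (simp add: ennreal_mult[symmetric] ennreal_leI)
    qed simp
  qed
  also have "\<dots> \<le> ennreal (\<epsilon> * (8 * cover_const n * E) ^ N)" by (rule W_bound[OF cu])
  finally have *: "ennreal L * emeasure lborel (bad c \<tau> h \<beta> N) \<le> ennreal (\<epsilon> * (8 * cover_const n * E) ^ N)" .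
  have "emeasure lborel (bad c \<tau> h \<beta> N) = ennreal (1 / L) * (ennreal L * emeasure lborel (bad c \<tau> h \<beta> N))"
    using Lpos by (simp add: mult.assoc[symmetric] ennreal_mult[symmetric])
  also have "\<dots> \<le> ennreal (1 / L) * ennreal (\<epsilon> * (8 * cover_const n * E) ^ N)"
    by (intro mult_left_mono *) auto
  also have "\<dots> = ennreal ((1 / L) * (\<epsilon> * (8 * cover_const n * E) ^ N))"
    using Lpos by (subst ennreal_mult') auto
  also have "(1 / L) * (\<epsilon> * (8 * cover_const n * E) ^ N) = \<epsilon> * exp (- \<gamma> * real N)"
  proof -
    have "(8 * cover_const n * E) ^ N = exp (ln (8 * cover_const n * E) * real N)"
      using Q by (metis exp_ln exp_of_nat2_mult)
    then show ?thesis unfolding L_def \<gamma>_def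
      by (simp add: exp_add[symmetric] exp_diff[symmetric] exp_minus[symmetric] divide_inverse algebra_simps)
  qed
  finally show ?thesis .
qed

lemma cell_derivative:
  assumes "{c..c+\<tau>} \<subseteq> J" "x \<in> {c<..<c+\<tau>}"
  shows "((F ^^ m) has_real_derivative DF m x) (at x)"
proof -
  have "((F ^^ m) has_real_derivative DF m x) (at x within {c<..<c+\<tau>})"
    by (rule has_field_derivative_subset[OF funpow_derivative]) (use assms in auto)
  then show ?thesis using assms(2) at_within_open[of x "{c<..<c+\<tau>}"] by simp
qed

text \<open>Its components are pieces of laps of F^m: intervals on which F^m is strictly monotone
  with values near {p<..<q}. The image of a good interval has diameter at most \<epsilon>, so the
  margin 2 * \<epsilon> ensures that a good interval whose marked point is mapped into {p<..<q} lies
  in a single component.\<close>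

definition lapset :: "real \<Rightarrow> real \<Rightarrow> nat \<Rightarrow> real \<Rightarrow> real \<Rightarrow> real set" where
  "lapset c \<tau> m p q = {x \<in> {c<..<c+\<tau>}. DF m x \<noteq> 0 \<and> (F ^^ m) x \<in> {p - 2 * \<epsilon><..<q + 2 * \<epsilon>}}"

lemma open_lapset:
  assumes "{c..c+\<tau>} \<subseteq> J"
  shows "open (lapset c \<tau> m p q)"
proof -
  have c1: "continuous_on {c<..<c+\<tau>} (DF m)" "continuous_on {c<..<c+\<tau>} (F ^^ m)"
    using assms
      by (auto intro!: continuous_on_subset[OF continuous_DF] continuous_on_subset[OF continuous_funpow])
  have "open ({c<..<c+\<tau>} \<inter> DF m -` (- {0}))" "open ({c<..<c+\<tau>} \<inter> (F ^^ m) -` {p - 2 * \<epsilon><..<q + 2 * \<epsilon>})"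
    using c1 by (auto intro!: continuous_open_preimage)
  moreover have "lapset c \<tau> m p q = ({c<..<c+\<tau>} \<inter> DF m -` (- {0})) \<inter> ({c<..<c+\<tau>} \<inter> (F ^^ m) -` {p - 2 *
    \<epsilon><..<q + 2 * \<epsilon>})"
    by (auto simp: lapset_def)
  ultimately show ?thesis by auto
qed

lemma good_image_measurable:
  assumes \<tau>: "0 < \<tau>" "\<tau> \<le> \<epsilon>" "{c..c+\<tau>} \<subseteq> J" and V: "V \<in> sets borel"
  shows "{x \<in> {c<..<c+\<tau>}. goodx c \<tau> m x \<and> (F ^^ m) x \<in> V} \<in> sets borel"
proof -
  have c1: "continuous_on {c<..<c+\<tau>} (F ^^ m)"
    using \<tau> by (auto intro!: continuous_on_subset[OF continuous_funpow])
  have "(\<lambda>x. (F ^^ m) x * indicator {c<..<c+\<tau>} x) \<in> borel_measurable borel"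
    using borel_measurable_continuous_on_indicator[OF _ c1] by (simp add: mult.commute)
  from measurable_sets[OF this V]
  have "(\<lambda>x. (F ^^ m) x * indicator {c<..<c+\<tau>} x) -` V \<in> sets borel" by simp
  moreover have "{x \<in> {c<..<c+\<tau>}. goodx c \<tau> m x \<and> (F ^^ m) x \<in> V} =
     {x \<in> {c<..<c+\<tau>}. goodx c \<tau> m x} \<inter> (\<lambda>x. (F ^^ m) x * indicator {c<..<c+\<tau>} x) -` V" by auto
  ultimately show ?thesis using goodx_measurable[OF \<tau>] by auto
qed

text \<open>At a good point x of a component of length r - l the derivative satisfies |DF m x| * (r
  - l) \<ge> \<epsilon> / 8, so the indicator is at most 8 * (r - l) / \<epsilon> * |DF m x|. The
  integral of |DF m| over the preimage of {p<..<q} is at most q - p by monotonicity, and the lengths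
  of the components add up. Derivatives at different points are never compared; this is why
  \<open>good\<close> records the derivative at the point itself.\<close>

lemma push_bound:
  assumes \<tau>: "0 < \<tau>" "\<tau> \<le> \<epsilon>" "{c..c+\<tau>} \<subseteq> J" and pq: "p \<le> q"
  shows "emeasure lborel {x \<in> {c<..<c+\<tau>}. goodx c \<tau> m x \<and> (F ^^ m) x \<in> {p<..<q}} \<le>
     ennreal (8 * (q - p) / \<epsilon>) * emeasure lborel (lapset c \<tau> m p q)"
proof (rule emeasure_disjoint_components_le)
  let ?S = "{x \<in> {c<..<c+\<tau>}. goodx c \<tau> m x \<and> (F ^^ m) x \<in> {p<..<q}}"
  let ?U = "lapset c \<tau> m p q"
  show U: "open ?U" by (rule open_lapset[OF \<tau>(3)])
  show Sm: "?S \<in> sets borel" by (rule good_image_measurable[OF \<tau>]) simp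
  have lap: "{a<..<b} \<subseteq> ?U"
    if "c \<le> a" "b \<le> c + \<tau>" "\<forall>s\<in>{a<..<b}. DF m s \<noteq> 0" "x \<in> {a<..<b}" "(F ^^ m) x \<in> {p<..<q}"
      "\<forall>s\<in>{a<..<b}. \<forall>s'\<in>{a<..<b}. \<bar>(F ^^ m) s - (F ^^ m) s'\<bar> \<le> \<epsilon>" for a b x
  proof
    fix s assume s: "s \<in> {a<..<b}"
    have "\<bar>(F ^^ m) s - (F ^^ m) x\<bar> \<le> \<epsilon>" using that s by blast
    then have "(F ^^ m) s \<in> {p - 2 * \<epsilon><..<q + 2 * \<epsilon>}" using that(5) \<epsilon> by auto
    then show "s \<in> ?U" using s that by (auto simp: lapset_def)
  qed
  show "?S \<subseteq> ?U"
  proof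
    fix x assume x: "x \<in> ?S"
    then have "goodx c \<tau> m x" "(F ^^ m) x \<in> {p<..<q}" by blast+
    then obtain a b where "c \<le> a" "b \<le> c + \<tau>" "\<forall>s\<in>{a<..<b}. DF m s \<noteq> 0" "x \<in> {a<..<b}"
      "\<forall>s\<in>{a<..<b}. \<forall>s'\<in>{a<..<b}. \<bar>(F ^^ m) s - (F ^^ m) s'\<bar> \<le> \<epsilon>"
      unfolding goodx_def by (elim exE conjE) (rule that; simp)
    then show "x \<in> ?U" using lap[of a b x] \<open>(F ^^ m) x \<in> {p<..<q}\<close> by blast
  qed
  fix C assume C: "C \<in> components ?U"
  have CU: "C \<subseteq> ?U" and Cne: "C \<noteq> {}" and Cc: "connected C" and Co: "open C"
    using in_components_subset[OF C] in_components_nonempty[OF C] in_components_connected[OF C]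
      open_components[OF U C] by auto
  have Ccell: "C \<subseteq> {c<..<c+\<tau>}" using CU unfolding lapset_def by blast
  have Cb: "bounded C" using bounded_subset[OF bounded_closed_interval[of c "c + \<tau>"], of C] Ccell by force
  define l where "l = Inf C"
  define r where "r = Sup C"
  have Ceq: "C = {l<..<r}" using open_interval_of_connected[OF Co Cc Cb Cne] by (simp add: l_def r_def)
  have lr: "l < r" using Cne Ceq by auto
  have sub: "{l<..<r} \<subseteq> {c<..<c+\<tau>}" using CU Ceq by (auto simp: lapset_def)
  \<comment> \<open>The good interval around x is connected and contained in the lap set, hence in
    the component through x.\<close>
  have len: "\<epsilon> / 8 \<le> \<bar>DF m x\<bar> * (r - l)" if x: "x \<in> ?S \<inter> C" for x
  proof -
    obtain a b where ab: "c \<le> a" "b \<le> c + \<tau>" "\<forall>s\<in>{a<..<b}. DF m s \<noteq> 0" "x \<in> {a<..<b}"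
      "\<forall>s\<in>{a<..<b}. \<forall>s'\<in>{a<..<b}. \<bar>(F ^^ m) s - (F ^^ m) s'\<bar> \<le> \<epsilon>" "\<epsilon> / 8 < \<bar>DF m x\<bar> * (b - a)"
    proof -
      have "goodx c \<tau> m x" using x by blast
      then show ?thesis unfolding goodx_def by (elim exE conjE) (rule that; simp)
    qed
    have s1: "{a<..<b} \<subseteq> ?U" using lap[of a b x] ab x by blast
    have "C \<inter> {a<..<b} \<noteq> {}" using ab(4) x by blast
    then have "{a<..<b} \<subseteq> C" using components_maximal[OF C connected_Ioo s1] by blast
    then have "b - a \<le> r - l" using ab(4) unfolding Ceq
      by (auto simp: greaterThanLessThan_subseteq_greaterThanLessThan)
    then have "\<bar>DF m x\<bar> * (b - a) \<le> \<bar>DF m x\<bar> * (r - l)" by (intro mult_left_mono) auto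
    then show ?thesis using ab(6) by linarith
  qed
  have cont: "continuous_on {l<..<r} (DF m)"
    by (rule continuous_on_subset[OF continuous_DF]) (use sub \<tau>(3) in force)
  have "emeasure lborel (?S \<inter> C) = (\<integral>\<^sup>+x. indicator (?S \<inter> C) x \<partial>lborel)"
    using Sm Co by (subst nn_integral_indicator) auto
  also have "\<dots> \<le> (\<integral>\<^sup>+x. ennreal (8 * (r - l) / \<epsilon>) * (ennreal (indicator {p<..<q} ((F ^^ m) x) * \<bar>DF m x\<bar>) *
    indicator {l<..<r} x) \<partial>lborel)"
  proof (rule nn_integral_mono)
    fix x
    show "indicator (?S \<inter> C) x \<le> ennreal (8 * (r - l) / \<epsilon>) * (ennreal (indicator {p<..<q} ((F ^^ m) x) * \<bar>DF
      m x\<bar>) * indicator {l<..<r} x)"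
    proof (cases "x \<in> ?S \<inter> C")
      case True
      have "1 \<le> 8 * (r - l) / \<epsilon> * \<bar>DF m x\<bar>" using len[OF True] \<epsilon> by (simp add: field_simps)
      then have "ennreal 1 \<le> ennreal (8 * (r - l) / \<epsilon> * \<bar>DF m x\<bar>)" by (rule ennreal_leI)
      then have "1 \<le> ennreal (8 * (r - l) / \<epsilon>) * ennreal \<bar>DF m x\<bar>"
        using lr \<epsilon> by (subst (asm) ennreal_mult) auto
      then show ?thesis using True Ceq by simp
    qed simp
  qed
  also have "\<dots> = ennreal (8 * (r - l) / \<epsilon>) * (\<integral>\<^sup>+x. ennreal (indicator {p<..<q} ((F ^^ m) x) * \<bar>DF m x\<bar>) *
    indicator {l<..<r} x \<partial>lborel)"
  proof (rule nn_integral_cmult)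
    have c2: "continuous_on {l<..<r} (F ^^ m)"
      by (rule continuous_on_subset[OF continuous_funpow]) (use sub \<tau>(3) in force)
    have m1: "(\<lambda>x. (F ^^ m) x * indicator {l<..<r} x) \<in> borel_measurable borel"
      "(\<lambda>x. DF m x * indicator {l<..<r} x) \<in> borel_measurable borel"
      using borel_measurable_continuous_on_indicator[OF _ c2] borel_measurable_continuous_on_indicator[OF _
        cont]
      by (simp_all add: mult.commute)
    have "(\<lambda>x. ennreal (indicator {p<..<q} ((F ^^ m) x) * \<bar>DF m x\<bar>) * indicator {l<..<r} x) =
     (\<lambda>x. ennreal (indicator {p<..<q} ((F ^^ m) x * indicator {l<..<r} x) * \<bar>DF m x * indicator {l<..<r} x\<bar>))"
      by (auto simp: fun_eq_iff indicator_def)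
    also have "\<dots> \<in> borel_measurable borel" using m1 by measurable
    finally show "(\<lambda>x. ennreal (indicator {p<..<q} ((F ^^ m) x) * \<bar>DF m x\<bar>) * indicator {l<..<r} x) \<in>
      borel_measurable lborel"
      by simp
  qed
  also have "\<dots> \<le> ennreal (8 * (r - l) / \<epsilon>) * ennreal (q - p)"
  proof (intro mult_left_mono monotone_image_integral)
    show "((F ^^ m) has_real_derivative DF m x) (at x)" if "x \<in> {l<..<r}" for x
      using cell_derivative[OF \<tau>(3)] that sub by blast
    show "DF m x \<noteq> 0" if "x \<in> {l<..<r}" for x using that CU Ceq by (auto simp: lapset_def)
  qed (use cont pq in auto)
  also have "\<dots> = ennreal (8 * (q - p) / \<epsilon>) * ennreal (r - l)"
    using lr pq \<epsilon> by (simp add: ennreal_mult[symmetric]) (simp add: algebra_simps)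
  also have "ennreal (r - l) = emeasure lborel C" using lr by (simp add: Ceq)
  finally show "emeasure lborel (?S \<inter> C) \<le> ennreal (8 * (q - p) / \<epsilon>) * emeasure lborel C" .
qed

text \<open>Translates by the period name the same points of the curve. The gap of at least 4 *
  \<epsilon> between consecutive translates makes their lap sets disjoint, so together they measure
  at most \<tau>, and infinitely many translates cost no more than one.\<close>

lemma push_bound_periodic:
  assumes \<tau>: "0 < \<tau>" "\<tau> \<le> \<epsilon>" "{c..c+\<tau>} \<subseteq> J" and pq: "p \<le> q" and P: "q - p + 4 * \<epsilon> \<le> P"
  shows "emeasure lborel {x \<in> {c<..<c+\<tau>}. goodx c \<tau> m x \<and> (F ^^ m) x \<in> (\<Union>k::int. {p + k * P<..<q + k * P})} \<le>
     ennreal (8 * (q - p) / \<epsilon> * \<tau>)"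
proof -
  let ?S = "\<lambda>k::int. {x \<in> {c<..<c+\<tau>}. goodx c \<tau> m x \<and> (F ^^ m) x \<in> {p + k * P<..<q + k * P}}"
  let ?U = "\<lambda>k::int. lapset c \<tau> m (p + k * P) (q + k * P)"
  have P0: "0 < P" using P pq \<epsilon> by linarith
  have Sm: "?S k \<in> sets borel" for k by (rule good_image_measurable[OF \<tau>]) simp
  have Uo: "open (?U k)" for k by (rule open_lapset[OF \<tau>(3)])
  have dj: "disjoint_family ?U"
  proof (unfold disjoint_family_on_def, intro ballI impI)
    have *: False if "i < j" "y \<in> {p + i * P - 2 * \<epsilon><..<q + i * P + 2 * \<epsilon>}"
      "y \<in> {p + j * P - 2 * \<epsilon><..<q + j * P + 2 * \<epsilon>}" for i j :: int and y
    proof -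
      have "(real_of_int i + 1) * P \<le> real_of_int j * P" using that(1) P0 by (intro mult_right_mono) auto
      then show False using that P by (auto simp: algebra_simps)
    qed
    show "?U i \<inter> ?U j = {}" if "i \<noteq> j" for i j
      using that *[of i j] *[of j i] unfolding lapset_def by (cases "i < j") fastforce+
  qed
  have dj2: "disjoint_family ?S"
  proof (unfold disjoint_family_on_def, intro ballI impI)
    have *: False if "i < j" "y \<in> {p + i * P<..<q + i * P}" "y \<in> {p + j * P<..<q + j * P}" for i j :: int and y
    proof -
      have "(real_of_int i + 1) * P \<le> real_of_int j * P" using that(1) P0 by (intro mult_right_mono) auto
      then show False using that P \<epsilon> by (auto simp: algebra_simps)
    qed
    show "?S i \<inter> ?S j = {}" if "i \<noteq> j" for i j
      using that *[of i j] *[of j i] by (cases "i < j") fastforce+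
  qed
  have "emeasure lborel {x \<in> {c<..<c+\<tau>}. goodx c \<tau> m x \<and> (F ^^ m) x \<in> (\<Union>k::int. {p + k * P<..<q + k * P})}
     = emeasure lborel (\<Union>k. ?S k)" by (intro arg_cong[where f = "emeasure lborel"]) auto
  also have "\<dots> = (\<integral>\<^sup>+k. emeasure lborel (?S k) \<partial>count_space UNIV)"
    using Sm dj2 by (intro emeasure_UN_countable) auto
  also have "\<dots> \<le> (\<integral>\<^sup>+k. ennreal (8 * (q - p) / \<epsilon>) * emeasure lborel (?U k) \<partial>count_space UNIV)"
  proof (intro nn_integral_mono)
    fix k :: int
    show "emeasure lborel (?S k) \<le> ennreal (8 * (q - p) / \<epsilon>) * emeasure lborel (?U k)"
      using push_bound[OF \<tau>, of "p + k * P" "q + k * P" m] pq by simp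
  qed
  also have "\<dots> = ennreal (8 * (q - p) / \<epsilon>) * emeasure lborel (\<Union>k. ?U k)"
    using Uo dj by (subst emeasure_UN_countable) (auto simp: nn_integral_cmult)
  also have "\<dots> \<le> ennreal (8 * (q - p) / \<epsilon>) * emeasure lborel {c<..<c+\<tau>}"
    by (intro mult_left_mono emeasure_mono) (auto simp: lapset_def)
  also have "\<dots> = ennreal (8 * (q - p) / \<epsilon> * \<tau>)" using \<tau> pq \<epsilon> by (simp add: ennreal_mult[symmetric])
  finally show ?thesis .
qed

end

section \<open>Approximation of densities by step functions\<close>

definition cell :: "real \<Rightarrow> nat \<Rightarrow> nat \<Rightarrow> real set" where
  "cell L N i = {L * real i / real N <..< L * real i / real N + L / real N}"

lemma cell_disjoint:
  assumes "0 < L" "x \<in> cell L N i" "x \<in> cell L N j"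
  shows "i = j"
proof (rule ccontr)
  have *: False if "i < j" "x \<in> cell L N i" "x \<in> cell L N j" for i j
  proof -
    have N: "0 < N" using that by (cases N) (auto simp: cell_def)
    have "L * (real i + 1) / N \<le> L * real j / N" using that assms(1)
      by (intro divide_right_mono mult_left_mono) auto
    then show False using that(2,3) by (auto simp: cell_def add_divide_distrib distrib_left)
  qed
  assume "i \<noteq> j"
  then show False using *[of i j] *[of j i] assms by (meson linorder_neqE_nat)
qed

lemma cell_cover:
  assumes "0 < L" "0 < N" "x \<in> {0..L}"
  shows "x \<in> (\<lambda>j. L * real j / real N) ` {..N} \<or> (\<exists>i<N. x \<in> cell L N i)"
  using equal_split[OF assms] by (simp add: cell_def mult.commute)

definition step_fun :: "real \<Rightarrow> nat \<Rightarrow> (nat \<Rightarrow> real) \<Rightarrow> real \<Rightarrow> real" where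
  "step_fun L N w x = (\<Sum>i<N. w i * indicator (cell L N i) x)"

lemma step_fun_measurable [measurable]: "step_fun L N w \<in> borel_measurable borel"
  unfolding step_fun_def cell_def by measurable

lemma step_fun_cell: "0 < L \<Longrightarrow> i < N \<Longrightarrow> x \<in> cell L N i \<Longrightarrow> step_fun L N w x = w i"
proof -
  assume *: "0 < L" "i < N" "x \<in> cell L N i"
  have "step_fun L N w x = (\<Sum>j<N. if j = i then w i else 0)"
    unfolding step_fun_def using * cell_disjoint[OF *(1)] by (intro sum.cong) (auto simp: indicator_def)
  then show ?thesis using * by simp
qed

text \<open>Approximation in L1 on every sufficiently fine equidistant grid: "for all N beyond N0"
  lets approximations of two functions share a grid, and lets the mesh be taken below
  \<epsilon>.\<close>

definition step_approx :: "real \<Rightarrow> (real \<Rightarrow> real) \<Rightarrow> bool" where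
  "step_approx L f \<longleftrightarrow> (\<forall>\<eta>>0. \<exists>N0. \<forall>N\<ge>N0. \<exists>w.
     (\<integral>\<^sup>+x. ennreal \<bar>f x - step_fun L N w x\<bar> * indicator {0..L} x \<partial>lborel) \<le> ennreal \<eta>)"

text \<open>Regularity puts a compact K inside and an open U outside the set, both with small error.
  Once the mesh is smaller than the distance from K to the complement of U, the cells that meet K
  lie in U, and their union differs from the set only inside the two error sets.\<close>

lemma step_approx_indicator:
  assumes L: "0 < L" and A: "A \<in> sets lborel"
  shows "step_approx L (indicator A)"
  unfolding step_approx_def
proof (intro allI impI)
  fix \<eta> :: real assume \<eta>: "0 < \<eta>"
  have A': "A \<inter> {0..L} \<in> sets lebesgue" using A by auto
  obtain U where U: "open U" "A \<inter> {0..L} \<subseteq> U" "U - A \<inter> {0..L} \<in> lmeasurable"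
    "emeasure lebesgue (U - A \<inter> {0..L}) < ennreal (\<eta> / 2)"
    using sets_lebesgue_outer_open[OF A', of "\<eta> / 2"] \<eta> by auto
  obtain K where K: "closed K" "K \<subseteq> A \<inter> {0..L}" "A \<inter> {0..L} - K \<in> lmeasurable"
    "emeasure lebesgue (A \<inter> {0..L} - K) < ennreal (\<eta> / 2)"
    using sets_lebesgue_inner_closed[OF A', of "\<eta> / 2"] \<eta> by auto
  have Kc: "compact K" using compact_Int_closed[OF compact_Icc[of 0 L] K(1)] K(2) by (simp add: Int_absorb1)
  obtain d where d: "d > 0" "\<And>x y. x \<in> K \<Longrightarrow> \<bar>x - y\<bar> < d \<Longrightarrow> y \<in> U"
  proof -
    have "K \<subseteq> U" using K U by blast
    from compact_subset_open_imp_ball_epsilon_subset[OF Kc U(1) this]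
    obtain e where "e > 0" "(\<Union>x\<in>K. ball x e) \<subseteq> U" by blast
    then show ?thesis using that[of e] by (force simp: dist_real_def)
  qed
  obtain N0 :: nat where N0: "L / d < real N0" using reals_Archimedean2 by blast
  show "\<exists>N0. \<forall>N\<ge>N0. \<exists>w. (\<integral>\<^sup>+x. ennreal \<bar>indicator A x - step_fun L N w x\<bar> * indicator {0..L} x \<partial>lborel) \<le>
    ennreal \<eta>"
  proof (intro exI[of _ N0] allI impI)
    fix N assume N: "N0 \<le> N"
    have N1: "0 < N" "L / real N < d"
    proof -
      have "0 \<le> L / d" using L d by simp
      then have "0 < real N0" using N0 by linarith
      then show "0 < N" using N by simp
      have "L / d < real N" using N0 N by linarith
      then show "L / real N < d" using \<open>0 < N\<close> d L by (simp add: field_simps)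
    qed
    define w where "w i = (if cell L N i \<inter> K \<noteq> {} then 1 else 0 :: real)" for i
    let ?R = "(\<lambda>j. L * real j / real N) ` {..N}"
    have "AE x in lborel. x \<notin> ?R"
      by (intro AE_not_in countable_imp_null_set_lborel countable_finite) auto
    then have "(\<integral>\<^sup>+x. ennreal \<bar>indicator A x - step_fun L N w x\<bar> * indicator {0..L} x \<partial>lborel) \<le>
       (\<integral>\<^sup>+x. indicator ((U - A \<inter> {0..L}) \<union> (A \<inter> {0..L} - K)) x \<partial>lborel)"
    proof (intro nn_integral_mono_AE, eventually_elim)
      fix x assume xR: "x \<notin> ?R"
      show "ennreal \<bar>indicator A x - step_fun L N w x\<bar> * indicator {0..L} x \<le>
        indicator ((U - A \<inter> {0..L}) \<union> (A \<inter> {0..L} - K)) x"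
      proof (cases "x \<in> {0..L}")
        case True
        then obtain i where i: "i < N" "x \<in> cell L N i" using cell_cover[OF L N1(1) True] xR by blast
        have s: "step_fun L N w x = w i" by (rule step_fun_cell[OF L i])
        have close: "\<bar>y - x\<bar> < d" if "y \<in> cell L N i" for y using that i(2) N1(2) by (auto simp: cell_def)
        show ?thesis
        proof (cases "cell L N i \<inter> K \<noteq> {}")
          case wi: True
          then have "x \<in> U" using d(2) close by blast
          then show ?thesis using True wi unfolding s w_def by (auto simp: indicator_def)
        next
          case False
          then have "x \<notin> K" using i by blast
          then show ?thesis using True False unfolding s w_def by (auto simp: indicator_def)
        qed
      qed simp
    qed
    also have "\<dots> = emeasure lebesgue ((U - A \<inter> {0..L}) \<union> (A \<inter> {0..L} - K))"
      using A U(1) K(1) by (subst nn_integral_indicator) auto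
    also have "\<dots> \<le> emeasure lebesgue (U - A \<inter> {0..L}) + emeasure lebesgue (A \<inter> {0..L} - K)"
      using U(3) K(3) by (intro emeasure_subadditive) (auto simp: fmeasurable_def)
    also have "\<dots> \<le> ennreal (\<eta> / 2) + ennreal (\<eta> / 2)"
      using U(4) K(4) by (intro add_mono) auto
    also have "\<dots> = ennreal \<eta>" using \<eta> by (simp add: ennreal_plus[symmetric] del: ennreal_plus)
    finally show "\<exists>w. (\<integral>\<^sup>+x. ennreal \<bar>indicator A x - step_fun L N w x\<bar> * indicator {0..L} x \<partial>lborel) \<le>
      ennreal \<eta>"
      by blast
  qed
qed

lemma step_approx_integrable:
  fixes f :: "real \<Rightarrow> real"
  assumes L: "0 < L" and f: "integrable lborel f"
  shows "step_approx L f"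
  using f
proof (induction rule: integrable_induct)
  case (base A c)
  have 1: "step_approx L (indicator A)" using step_approx_indicator[OF L base(1)] .
  show ?case unfolding step_approx_def
  proof (intro allI impI)
    fix \<eta> :: real assume \<eta>: "0 < \<eta>"
    then have "0 < \<eta> / (\<bar>c\<bar> + 1)" by auto
    then obtain N0
      where N0: "\<And>N. N \<ge> N0 \<Longrightarrow> \<exists>w. (\<integral>\<^sup>+x. ennreal \<bar>indicator A x - step_fun L N w x\<bar> * indicator {0..L} x
      \<partial>lborel) \<le> ennreal (\<eta> / (\<bar>c\<bar> + 1))"
      using 1 unfolding step_approx_def by blast
    show "\<exists>N0. \<forall>N\<ge>N0. \<exists>w. (\<integral>\<^sup>+x. ennreal \<bar>indicator A x *\<^sub>R c - step_fun L N w x\<bar> * indicator {0..L} x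
      \<partial>lborel) \<le> ennreal \<eta>"
    proof (intro exI[of _ N0] allI impI)
      fix N assume "N0 \<le> N"
      then obtain w
        where w: "(\<integral>\<^sup>+x. ennreal \<bar>indicator A x - step_fun L N w x\<bar> * indicator {0..L} x \<partial>lborel) \<le>
        ennreal (\<eta> / (\<bar>c\<bar> + 1))"
        using N0 by blast
      have "step_fun L N (\<lambda>i. c * w i) x = c * step_fun L N w x" for x
        by (simp only: step_fun_def sum_distrib_left mult.assoc)
      then have "\<bar>indicator A x *\<^sub>R c - step_fun L N (\<lambda>i. c * w i) x\<bar> =
        \<bar>c\<bar> * \<bar>indicator A x - step_fun L N w x\<bar>" for x
        by (simp add: abs_mult[symmetric] right_diff_distrib mult.commute)
      then have "(\<integral>\<^sup>+x. ennreal \<bar>indicator A x *\<^sub>R c - step_fun L N (\<lambda>i. c * w i) x\<bar> * indicator {0..L} x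
        \<partial>lborel) =
        (\<integral>\<^sup>+x. ennreal \<bar>c\<bar> * (ennreal \<bar>indicator A x - step_fun L N w x\<bar> * indicator {0..L} x) \<partial>lborel)"
        by (simp add: ennreal_mult mult.assoc)
      also have "\<dots> = ennreal \<bar>c\<bar> * (\<integral>\<^sup>+x. ennreal \<bar>indicator A x - step_fun L N w x\<bar> * indicator {0..L} x
        \<partial>lborel)"
      proof (rule nn_integral_cmult)
        have [measurable]: "A \<in> sets borel" using base(1) by simp
        have "(\<lambda>x. ennreal \<bar>indicator A x - step_fun L N w x\<bar> * indicator {0..L} x) \<in> borel_measurable borel"
          by measurable
        then show "(\<lambda>x. ennreal \<bar>indicator A x - step_fun L N w x\<bar> * indicator {0..L} x) \<in> borel_measurable
          lborel"
          by simp
      qed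
      also have "\<dots> \<le> ennreal \<bar>c\<bar> * ennreal (\<eta> / (\<bar>c\<bar> + 1))" by (intro mult_left_mono w) auto
      also have "\<dots> = ennreal (\<bar>c\<bar> * (\<eta> / (\<bar>c\<bar> + 1)))" using \<eta> by (intro ennreal_mult[symmetric]) auto
      also have "\<dots> \<le> ennreal \<eta>" using \<eta> by (intro ennreal_leI) (simp add: field_simps)
      finally show "\<exists>w. (\<integral>\<^sup>+x. ennreal \<bar>indicator A x *\<^sub>R c - step_fun L N w x\<bar> * indicator {0..L} x
        \<partial>lborel) \<le> ennreal \<eta>"
        by blast
    qed
  qed
next
  case (add f g)
  show ?case unfolding step_approx_def
  proof (intro allI impI)
    fix \<eta> :: real assume \<eta>: "0 < \<eta>"
    then have "0 < \<eta> / 2" by simp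
    then obtain N1 N2 where
      N1: "\<And>N. N \<ge> N1 \<Longrightarrow> \<exists>w. (\<integral>\<^sup>+x. ennreal \<bar>f x - step_fun L N w x\<bar> * indicator {0..L} x \<partial>lborel) \<le>
        ennreal (\<eta> / 2)" and
      N2: "\<And>N. N \<ge> N2 \<Longrightarrow> \<exists>w. (\<integral>\<^sup>+x. ennreal \<bar>g x - step_fun L N w x\<bar> * indicator {0..L} x \<partial>lborel) \<le>
        ennreal (\<eta> / 2)"
      using add.IH unfolding step_approx_def by meson
    show "\<exists>N0. \<forall>N\<ge>N0. \<exists>w. (\<integral>\<^sup>+x. ennreal \<bar>f x + g x - step_fun L N w x\<bar> * indicator {0..L} x \<partial>lborel) \<le>
      ennreal \<eta>"
    proof (intro exI[of _ "max N1 N2"] allI impI)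
      fix N assume "max N1 N2 \<le> N"
      then obtain v w where
        v: "(\<integral>\<^sup>+x. ennreal \<bar>f x - step_fun L N v x\<bar> * indicator {0..L} x \<partial>lborel) \<le> ennreal (\<eta> / 2)" and
        w: "(\<integral>\<^sup>+x. ennreal \<bar>g x - step_fun L N w x\<bar> * indicator {0..L} x \<partial>lborel) \<le> ennreal (\<eta> / 2)"
        using N1[of N] N2[of N] by auto
      have s: "step_fun L N (\<lambda>i. v i + w i) x = step_fun L N v x + step_fun L N w x" for x
        by (simp add: step_fun_def sum.distrib distrib_right)
      have "(\<integral>\<^sup>+x. ennreal \<bar>f x + g x - step_fun L N (\<lambda>i. v i + w i) x\<bar> * indicator {0..L} x \<partial>lborel) \<le>
        (\<integral>\<^sup>+x. ennreal \<bar>f x - step_fun L N v x\<bar> * indicator {0..L} x + ennreal \<bar>g x - step_fun L N w x\<bar> *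
          indicator {0..L} x \<partial>lborel)"
      proof (rule nn_integral_mono)
        fix x
        have "\<bar>f x + g x - (step_fun L N v x + step_fun L N w x)\<bar> \<le> \<bar>f x - step_fun L N v x\<bar> +
          \<bar>g x - step_fun L N w x\<bar>" by linarith
        then have "ennreal \<bar>f x + g x - step_fun L N (\<lambda>i. v i + w i) x\<bar> \<le> ennreal \<bar>f x - step_fun L N v x\<bar> +
          ennreal \<bar>g x - step_fun L N w x\<bar>"
          unfolding s by (simp add: ennreal_plus[symmetric] ennreal_leI del: ennreal_plus)
        then show "ennreal \<bar>f x + g x - step_fun L N (\<lambda>i. v i + w i) x\<bar> * indicator {0..L} x \<le>
           ennreal \<bar>f x - step_fun L N v x\<bar> * indicator {0..L} x + ennreal \<bar>g x - step_fun L N w x\<bar> *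
             indicator {0..L} x"
          by (simp add: indicator_def)
      qed
      also have "\<dots> = (\<integral>\<^sup>+x. ennreal \<bar>f x - step_fun L N v x\<bar> * indicator {0..L} x \<partial>lborel) +
         (\<integral>\<^sup>+x. ennreal \<bar>g x - step_fun L N w x\<bar> * indicator {0..L} x \<partial>lborel)"
        using add.hyps by (intro nn_integral_add) (auto dest: borel_measurable_integrable)
      also have "\<dots> \<le> ennreal (\<eta> / 2) + ennreal (\<eta> / 2)" by (intro add_mono v w)
      also have "\<dots> = ennreal \<eta>" using \<eta> by (simp add: ennreal_plus[symmetric] del: ennreal_plus)
      finally show "\<exists>w. (\<integral>\<^sup>+x. ennreal \<bar>f x + g x - step_fun L N w x\<bar> * indicator {0..L} x \<partial>lborel) \<le> ennreal \<eta>"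
        by blast
    qed
  qed
next
  case (lim f s)
  show ?case unfolding step_approx_def
  proof (intro allI impI)
    fix \<eta> :: real assume \<eta>: "0 < \<eta>"
    have "(\<lambda>i. \<integral>x. norm (s i x - f x) \<partial>lborel) \<longlonglongrightarrow> (\<integral>x. 0 \<partial>(lborel :: real measure))"
    proof (rule integral_dominated_convergence[where w = "\<lambda>x. 3 * norm (f x)"])
      show "AE x in lborel. (\<lambda>i. norm (s i x - f x)) \<longlonglongrightarrow> 0"
      proof (rule AE_I2)
        fix x :: real
        have "(\<lambda>i. s i x) \<longlonglongrightarrow> f x" using lim by simp
        then show "(\<lambda>i. norm (s i x - f x)) \<longlonglongrightarrow> 0" by (intro tendsto_norm_zero) (simp add: LIM_zero_iff)
      qed
      fix i
      show "AE x in lborel. norm (norm (s i x - f x)) \<le> 3 * norm (f x)"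
      proof (rule AE_I2)
        fix x :: real
        have "norm (s i x) \<le> 2 * norm (f x)" using lim by simp
        then show "norm (norm (s i x - f x)) \<le> 3 * norm (f x)" using norm_triangle_ineq4[of "s i x" "f x"]
          by simp
      qed
      show "(\<lambda>x. norm (s i x - f x)) \<in> borel_measurable lborel" using lim
        by (auto dest!: borel_measurable_integrable)
    qed (use lim in auto)
    then have "\<forall>\<^sub>F i in sequentially. (\<integral>x. norm (s i x - f x) \<partial>lborel) < \<eta> / 2"
      using \<eta> by (intro order_tendstoD(2)[where y = 0]) auto
    then obtain i where i: "(\<integral>x. norm (s i x - f x) \<partial>lborel) < \<eta> / 2" by (auto dest: eventually_happens)
    have int: "integrable lborel (s i)" "integrable lborel f" using lim by auto
    have i': "(\<integral>\<^sup>+x. ennreal \<bar>f x - s i x\<bar> \<partial>lborel) \<le> ennreal (\<eta> / 2)"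
      using i int by (subst nn_integral_eq_integral) (auto simp: abs_minus_commute intro!: ennreal_leI)
    have "0 < \<eta> / 2" using \<eta> by simp
    then obtain N0
      where N0: "\<And>N. N \<ge> N0 \<Longrightarrow> \<exists>w. (\<integral>\<^sup>+x. ennreal \<bar>s i x - step_fun L N w x\<bar> * indicator {0..L} x \<partial>lborel) \<le>
      ennreal (\<eta> / 2)"
      using lim.IH[of i] unfolding step_approx_def by meson
    show "\<exists>N0. \<forall>N\<ge>N0. \<exists>w. (\<integral>\<^sup>+x. ennreal \<bar>f x - step_fun L N w x\<bar> * indicator {0..L} x \<partial>lborel) \<le> ennreal \<eta>"
    proof (intro exI[of _ N0] allI impI)
      fix N assume "N0 \<le> N"
      then obtain w where w: "(\<integral>\<^sup>+x. ennreal \<bar>s i x - step_fun L N w x\<bar> * indicator {0..L} x \<partial>lborel) \<le>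
        ennreal (\<eta> / 2)"
        using N0 by blast
      have "(\<integral>\<^sup>+x. ennreal \<bar>f x - step_fun L N w x\<bar> * indicator {0..L} x \<partial>lborel) \<le>
        (\<integral>\<^sup>+x. ennreal \<bar>f x - s i x\<bar> + ennreal \<bar>s i x - step_fun L N w x\<bar> * indicator {0..L} x \<partial>lborel)"
      proof (rule nn_integral_mono)
        fix x
        have "\<bar>f x - step_fun L N w x\<bar> \<le> \<bar>f x - s i x\<bar> + \<bar>s i x - step_fun L N w x\<bar>" by linarith
        then have "ennreal \<bar>f x - step_fun L N w x\<bar> \<le> ennreal \<bar>f x - s i x\<bar> +
          ennreal \<bar>s i x - step_fun L N w x\<bar>"
          by (simp add: ennreal_plus[symmetric] ennreal_leI del: ennreal_plus)
        then show "ennreal \<bar>f x - step_fun L N w x\<bar> * indicator {0..L} x \<le>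
           ennreal \<bar>f x - s i x\<bar> + ennreal \<bar>s i x - step_fun L N w x\<bar> * indicator {0..L} x"
          by (simp add: indicator_def)
      qed
      also have "\<dots> = (\<integral>\<^sup>+x. ennreal \<bar>f x - s i x\<bar> \<partial>lborel) +
         (\<integral>\<^sup>+x. ennreal \<bar>s i x - step_fun L N w x\<bar> * indicator {0..L} x \<partial>lborel)"
        using int by (intro nn_integral_add) (auto dest!: borel_measurable_integrable)
      also have "\<dots> \<le> ennreal (\<eta> / 2) + ennreal (\<eta> / 2)" by (intro add_mono i' w)
      also have "\<dots> = ennreal \<eta>" using \<eta> by (simp add: ennreal_plus[symmetric] del: ennreal_plus)
      finally show "\<exists>w. (\<integral>\<^sup>+x. ennreal \<bar>f x - step_fun L N w x\<bar> * indicator {0..L} x \<partial>lborel) \<le> ennreal \<eta>"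
        by blast
    qed
  qed
qed

lemma cell_sets [measurable]: "cell L N i \<in> sets borel"
  by (simp add: cell_def)

lemma cell_subset:
  assumes "0 < L" "i < N"
  shows "{L * real i / real N .. L * real i / real N + L / real N} \<subseteq> {0..L}"
proof -
  have "L * (real i + 1) / real N \<le> L * real N / real N"
    using assms by (intro divide_right_mono mult_left_mono) auto
  then have "L * real i / real N + L / real N \<le> L" using assms by (simp add: add_divide_distrib distrib_left)
  then show ?thesis using assms by auto
qed

lemma step_fun_abs:
  assumes "0 < L"
  shows "\<bar>step_fun L N w x\<bar> = (\<Sum>i<N. \<bar>w i\<bar> * indicator (cell L N i) x)"
proof (cases "\<exists>i<N. x \<in> cell L N i")
  case True
  then obtain i where i: "i < N" "x \<in> cell L N i" by blast
  show ?thesis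
    using step_fun_cell[OF assms i, of w] step_fun_cell[OF assms i, of "\<lambda>i. \<bar>w i\<bar>"] by (simp add: step_fun_def)
next
  case False
  then show ?thesis by (simp add: step_fun_def)
qed

text \<open>On each cell the measure is dominated by a multiple of Lebesgue measure, up to a total
  error \<eta>. The multiples w i may be enormous, but their total mass is at most 1 + \<eta>. Only
  this total reaches the constants below, so no bound on the density is required.\<close>

lemma step_domination:
  fixes \<mu> :: "real measure"
  assumes \<mu>: "prob_space \<mu>" "sets \<mu> = sets borel" "absolutely_continuous lborel \<mu>"
    and L: "0 < L" and \<eta>: "0 < \<eta>" and e: "0 < e"
  shows "\<exists>N w. 0 < N \<and> L / real N \<le> e \<and> (\<forall>i. 0 \<le> w i) \<and> (\<Sum>i<N. w i * (L / real N)) \<le> 1 + \<eta> \<and>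
    (\<forall>B\<in>sets borel. B \<subseteq> {0..L} \<longrightarrow> measure \<mu> B \<le> (\<Sum>i<N. w i * measure lborel (B \<inter> cell L N i)) + \<eta>)"
proof -
  interpret prob_space \<mu> by fact
  obtain D where D: "D \<in> borel_measurable lborel" "AE x in lborel. RN_deriv lborel \<mu> x = ennreal (D x)"
    "\<And>x. 0 \<le> D x"
  proof (rule sigma_finite_measure.real_RN_deriv[OF sigma_finite_lborel finite_measure_axioms \<mu>(3)])
    show "sets \<mu> = sets lborel" using \<mu>(2) by simp
  qed (rule that)
  have "density lborel (\<lambda>x. ennreal (D x)) = density lborel (RN_deriv lborel \<mu>)"
    using D by (intro density_cong) auto
  also have "\<dots> = \<mu>" using \<mu>(2)
    by (intro sigma_finite_measure.density_RN_deriv[OF sigma_finite_lborel] \<mu>(3)) simp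
  finally have dens: "density lborel (\<lambda>x. ennreal (D x)) = \<mu>" .
  have em: "emeasure \<mu> B = (\<integral>\<^sup>+x. ennreal (D x) * indicator B x \<partial>lborel)" if "B \<in> sets borel" for B
    using D that unfolding dens[symmetric] by (subst emeasure_density) auto
  have tot: "(\<integral>\<^sup>+x. ennreal (D x) \<partial>lborel) = 1"
    using em[of UNIV] emeasure_space_1 sets_eq_imp_space_eq[OF \<mu>(2)] by simp
  then have "integrable lborel D" using D by (intro integrableI_nonneg) auto
  from step_approx_integrable[OF L this] obtain N0 where N0:
    "\<And>N. N \<ge> N0 \<Longrightarrow> \<exists>w. (\<integral>\<^sup>+x. ennreal \<bar>D x - step_fun L N w x\<bar> * indicator {0..L} x \<partial>lborel) \<le> ennreal \<eta>"
    using \<eta> unfolding step_approx_def by meson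
  obtain N1 :: nat where N1: "L / e < real N1" using reals_Archimedean2 by blast
  define N where "N = max N0 N1"
  have N: "0 < N" "L / real N \<le> e"
  proof -
    have "0 < L / e" using L e by simp
    then show 0: "0 < N" using N1 by (auto simp: N_def)
    have "L / e < real N" using N1 by (simp add: N_def)
    then show "L / real N \<le> e" using 0 e by (simp add: field_simps)
  qed
  obtain w where w: "(\<integral>\<^sup>+x. ennreal \<bar>D x - step_fun L N w x\<bar> * indicator {0..L} x \<partial>lborel) \<le> ennreal \<eta>"
    using N0[of N] by (auto simp: N_def)
  have meas: "(\<lambda>x. ennreal \<bar>D x - step_fun L N w x\<bar> * indicator {0..L} x) \<in> borel_measurable lborel"
    using D(1) by measurable
  have absw: "ennreal \<bar>step_fun L N w x\<bar> = (\<Sum>i<N. ennreal \<bar>w i\<bar> * indicator (cell L N i) x)" for x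
  proof -
    have "ennreal \<bar>step_fun L N w x\<bar> = ennreal (\<Sum>i<N. \<bar>w i\<bar> * indicator (cell L N i) x)"
      by (simp add: step_fun_abs[OF L])
    also have "\<dots> = (\<Sum>i<N. ennreal (\<bar>w i\<bar> * indicator (cell L N i) x))" by (subst sum_ennreal) auto
    finally show ?thesis by (simp add: ennreal_mult ennreal_indicator)
  qed
  have int: "(\<integral>\<^sup>+x. ennreal \<bar>step_fun L N w x\<bar> * indicator B x \<partial>lborel) =
    (\<Sum>i<N. ennreal \<bar>w i\<bar> * emeasure lborel (B \<inter> cell L N i))"
    if B: "B \<in> sets borel" for B
  proof -
    have "(\<integral>\<^sup>+x. ennreal \<bar>step_fun L N w x\<bar> * indicator B x \<partial>lborel) =
      (\<integral>\<^sup>+x. (\<Sum>i<N. ennreal \<bar>w i\<bar> * indicator (B \<inter> cell L N i) x) \<partial>lborel)"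
      by (intro nn_integral_cong) (auto simp: absw indicator_def sum_distrib_right intro!: sum.cong)
    also have "\<dots> = (\<Sum>i<N. \<integral>\<^sup>+x. ennreal \<bar>w i\<bar> * indicator (B \<inter> cell L N i) x \<partial>lborel)"
      using B by (intro nn_integral_sum) auto
    also have "\<dots> = (\<Sum>i<N. ennreal \<bar>w i\<bar> * emeasure lborel (B \<inter> cell L N i))"
      using B by (intro sum.cong nn_integral_cmult_indicator) auto
    finally show ?thesis .
  qed
  have celle: "emeasure lborel (B \<inter> cell L N i) = ennreal (measure lborel (B \<inter> cell L N i))" for B i
  proof -
    have "emeasure lborel (B \<inter> cell L N i) \<le> emeasure lborel {L * real i / real N .. L * real i / real N +
      L / real N}"
      by (intro emeasure_mono) (auto simp: cell_def)
    also have "\<dots> < \<infinity>" using L by simp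
    finally show ?thesis by (intro emeasure_eq_ennreal_measure) auto
  qed
  have dom: "measure \<mu> B \<le> (\<Sum>i<N. \<bar>w i\<bar> * measure lborel (B \<inter> cell L N i)) + \<eta>"
    if B: "B \<in> sets borel" "B \<subseteq> {0..L}" for B
  proof -
    have "ennreal (measure \<mu> B) = (\<integral>\<^sup>+x. ennreal (D x) * indicator B x \<partial>lborel)"
      using em[OF B(1)] by (simp add: emeasure_eq_measure)
    also have "\<dots> \<le> (\<integral>\<^sup>+x. ennreal \<bar>step_fun L N w x\<bar> * indicator B x +
      ennreal \<bar>D x - step_fun L N w x\<bar> * indicator {0..L} x \<partial>lborel)"
    proof (rule nn_integral_mono)
      fix x
      have "D x \<le> \<bar>step_fun L N w x\<bar> + \<bar>D x - step_fun L N w x\<bar>" by linarith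
      then have "ennreal (D x) \<le> ennreal \<bar>step_fun L N w x\<bar> + ennreal \<bar>D x - step_fun L N w x\<bar>"
        by (simp add: ennreal_plus[symmetric] ennreal_leI del: ennreal_plus)
      then show "ennreal (D x) * indicator B x \<le> ennreal \<bar>step_fun L N w x\<bar> * indicator B x +
        ennreal \<bar>D x - step_fun L N w x\<bar> * indicator {0..L} x"
        using B(2) by (auto simp: indicator_def)
    qed
    also have "\<dots> = (\<integral>\<^sup>+x. ennreal \<bar>step_fun L N w x\<bar> * indicator B x \<partial>lborel) +
      (\<integral>\<^sup>+x. ennreal \<bar>D x - step_fun L N w x\<bar> * indicator {0..L} x \<partial>lborel)"
      using B meas by (intro nn_integral_add) auto
    also have "\<dots> \<le> (\<Sum>i<N. ennreal \<bar>w i\<bar> * emeasure lborel (B \<inter> cell L N i)) + ennreal \<eta>"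
      using w unfolding int[OF B(1)] by (intro add_left_mono)
    also have "\<dots> = ennreal ((\<Sum>i<N. \<bar>w i\<bar> * measure lborel (B \<inter> cell L N i)) + \<eta>)"
      using \<eta> unfolding celle by (simp add: ennreal_mult[symmetric] sum_nonneg)
    finally show ?thesis using \<eta> by (subst (asm) ennreal_le_iff) (auto intro!: add_nonneg_nonneg sum_nonneg)
  qed
  have "ennreal (\<Sum>i<N. \<bar>w i\<bar> * (L / real N)) = (\<integral>\<^sup>+x. ennreal \<bar>step_fun L N w x\<bar> * indicator {0..L} x \<partial>lborel)"
  proof -
    have "emeasure lborel ({0..L} \<inter> cell L N i) = ennreal (L / real N)" if "i < N" for i
    proof -
      have "{0..L} \<inter> cell L N i = cell L N i" using cell_subset[OF L that] by (auto simp: cell_def)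
      then show ?thesis using L by (simp add: cell_def)
    qed
    then show ?thesis using L by (subst int) (auto simp: ennreal_mult[symmetric] intro!: sum_ennreal[symmetric])
  qed
  also have "\<dots> \<le> (\<integral>\<^sup>+x. ennreal (D x) + ennreal \<bar>D x - step_fun L N w x\<bar> * indicator {0..L} x \<partial>lborel)"
  proof (rule nn_integral_mono)
    fix x
    have "\<bar>step_fun L N w x\<bar> \<le> D x + \<bar>D x - step_fun L N w x\<bar>" using D(3)[of x] by linarith
    then have "ennreal \<bar>step_fun L N w x\<bar> \<le> ennreal (D x) + ennreal \<bar>D x - step_fun L N w x\<bar>"
      using D(3)[of x] by (simp add: ennreal_plus[symmetric] ennreal_leI del: ennreal_plus)
    then show "ennreal \<bar>step_fun L N w x\<bar> * indicator {0..L} x \<le> ennreal (D x) +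
      ennreal \<bar>D x - step_fun L N w x\<bar> * indicator {0..L} x"
      by (auto simp: indicator_def)
  qed
  also have "\<dots> = (\<integral>\<^sup>+x. ennreal (D x) \<partial>lborel) + (\<integral>\<^sup>+x. ennreal \<bar>D x - step_fun L N w x\<bar> * indicator {0..L}
    x \<partial>lborel)"
    using D(1) meas by (intro nn_integral_add) auto
  also have "\<dots> \<le> 1 + ennreal \<eta>" unfolding tot by (intro add_left_mono w)
  also have "\<dots> = ennreal (1 + \<eta>)" using \<eta> by simp
  finally have "(\<Sum>i<N. \<bar>w i\<bar> * (L / real N)) \<le> 1 + \<eta>" using \<eta> by (subst (asm) ennreal_le_iff) auto
  then show ?thesis using N dom by (intro exI[of _ N] exI[of _ "\<lambda>i. \<bar>w i\<bar>"]) auto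
qed

section \<open>The key inequality\<close>

context smooth_bounds begin

text \<open>Fast points outside the bad set have more than \<beta> * N good times up to N. By
  averaging, some m \<le> N is good on a set of measure at least \<beta> * cc, up to \<eta>. There
  F^m either lands in the given intervals, which the push-forward estimate controls, or the point is
  counted by s. How large N must be depends on the density, but neither N nor m occurs in the
  conclusion.\<close>

lemma key_inequality:
  fixes \<mu> :: "real measure" and r :: nat and p q :: "nat \<Rightarrow> real"
  assumes \<mu>: "prob_space \<mu>" "sets \<mu> = sets borel" "absolutely_continuous lborel \<mu>"
    and L: "0 < L" "{0..L} \<subseteq> J"
    and h: "0 \<le> h" and \<beta>: "0 < \<beta>"
    and \<gamma>: "0 < h - ln (8 * cover_const n * E) - 2 / real n * ln A - \<beta> * ln (4 * A)"
    and fast: "\<And>N. N \<ge> N1 \<Longrightarrow> cc \<le> measure \<mu> {x \<in> {0..L}. exp (h * real N) \<le> \<bar>DF N x\<bar>}"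
    and Pq: "\<And>j. j < r \<Longrightarrow> p j \<le> q j \<and> q j - p j + 4 * \<epsilon> \<le> P"
    and s: "\<And>m. 1 \<le> m \<Longrightarrow> measure \<mu> {x \<in> {0..L}. E \<le> \<bar>F' ((F ^^ (m - 1)) x)\<bar> \<and>
      (F ^^ m) x \<notin> (\<Union>j<r. \<Union>k::int. {p j + k * P<..<q j + k * P})} \<le> s"
  shows "\<beta> * cc \<le> 8 / \<epsilon> * (\<Sum>j<r. q j - p j) + s"
proof -
  interpret prob_space \<mu> by fact
  define S where "S = (\<Sum>j<r. q j - p j)"
  have S0: "0 \<le> S" unfolding S_def using Pq by (intro sum_nonneg) auto
  define \<gamma>' where "\<gamma>' = h - ln (8 * cover_const n * E) - 2 / real n * ln A - \<beta> * ln (4 * A)"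
  have main: "\<beta> * (cc - 2 * \<eta>) \<le> 8 / \<epsilon> * S * (1 + \<eta>) + \<eta> + s" if \<eta>: "0 < \<eta>" for \<eta>
  proof -
    obtain K w where K: "0 < K" "L / real K \<le> \<epsilon>" and w: "\<And>i. 0 \<le> w i" "(\<Sum>i<K. w i * (L / real K)) \<le> 1 + \<eta>"
      and dom: "\<And>B. B\<in>sets borel \<Longrightarrow> B \<subseteq> {0..L} \<Longrightarrow> measure \<mu> B \<le> (\<Sum>i<K. w i * measure lborel (B \<inter> cell L K i)) + \<eta>"
      using step_domination[OF \<mu> L(1) \<eta> \<epsilon>(1)] by blast
    define \<tau> where "\<tau> = L / real K"
    define c where "c i = L * real i / real K" for i
    have \<tau>: "0 < \<tau>" "\<tau> \<le> \<epsilon>" using K L by (auto simp: \<tau>_def)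
    have cJ: "{c i..c i + \<tau>} \<subseteq> J" and cL: "{c i..c i + \<tau>} \<subseteq> {0..L}" if "i < K" for i
      using cell_subset[OF L(1) that] L(2) by (auto simp: c_def \<tau>_def)
    have cell: "cell L K i = {c i<..<c i + \<tau>}" for i by (simp add: cell_def c_def \<tau>_def)
    define Em where "Em m = (\<Union>i<K. {x \<in> {c i<..<c i+\<tau>}. goodx (c i) \<tau> m x})" for m
    define B where "B N = (\<Union>i<K. bad (c i) \<tau> h \<beta> N)" for N
    have Em: "Em m \<in> sets borel" for m
      unfolding Em_def by (intro sets.finite_UN goodx_measurable \<tau> cJ) auto
    have Em_cell: "Em m \<inter> cell L K i = {x \<in> {c i<..<c i+\<tau>}. goodx (c i) \<tau> m x}" if "i < K" for m i
    proof -
      have "j = i" if "x \<in> cell L K i" "x \<in> {c j<..<c j+\<tau>}" for x j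
        using cell_disjoint[OF L(1) that(1), of j] that(2) by (simp add: cell)
      then show ?thesis using that unfolding Em_def cell by blast
    qed
    have EmL: "Em m \<subseteq> {0..L}" for m using cL unfolding Em_def by fastforce
    have Bb: "B N \<in> sets borel" for N
      unfolding B_def by (intro sets.finite_UN bad_measurable \<tau> cJ) auto
    have BL: "B N \<subseteq> {0..L}" for N using cL unfolding B_def bad_def by fastforce
    have B_cell: "B N \<inter> cell L K i = bad (c i) \<tau> h \<beta> N" if "i < K" for N i
    proof -
      have "j = i" if "x \<in> cell L K i" "x \<in> bad (c j) \<tau> h \<beta> N" for x j
        using cell_disjoint[OF L(1) that(1), of j] that(2) by (simp add: cell bad_def)
      moreover have "bad (c i) \<tau> h \<beta> N \<subseteq> cell L K i" by (auto simp: cell bad_def)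
      ultimately show ?thesis using that unfolding B_def by blast
    qed
    have Bsmall: "measure \<mu> (B N) \<le> (\<Sum>i<K. w i) * \<epsilon> * exp (- \<gamma>' * real N) + \<eta>" for N
    proof -
      have "measure lborel (B N \<inter> cell L K i) \<le> \<epsilon> * exp (- \<gamma>' * real N)" if "i < K" for i
      proof -
        have "emeasure lborel (bad (c i) \<tau> h \<beta> N) \<le> ennreal (\<epsilon> * exp (- \<gamma>' * real N))"
          by (rule bad_small[OF \<tau> cJ[OF that] h \<gamma>'_def])
        then show ?thesis unfolding B_cell[OF that] measure_def using \<epsilon> by (intro enn2real_leI) auto
      qed
      then have "(\<Sum>i<K. w i * measure lborel (B N \<inter> cell L K i)) \<le> (\<Sum>i<K. w i * (\<epsilon> * exp (- \<gamma>' * real N)))"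
        using w by (intro sum_mono mult_left_mono) auto
      also have "\<dots> = (\<Sum>i<K. w i) * \<epsilon> * exp (- \<gamma>' * real N)" by (simp add: sum_distrib_right mult.assoc)
      finally show ?thesis using dom[OF Bb BL, of N] by linarith
    qed
    \<comment> \<open>The weights depend on the density and may be huge, but they are fixed before
      N, so exponential decay overcomes them.\<close>
    have "(\<lambda>N. (\<Sum>i<K. w i) * \<epsilon> * exp (- \<gamma>' * real N)) \<longlonglongrightarrow> 0"
    proof (rule tendsto_mult_right_zero)
      have "(\<lambda>N. exp (- \<gamma>') ^ N) \<longlonglongrightarrow> 0" using \<gamma> by (intro LIMSEQ_realpow_zero) (auto simp: \<gamma>'_def)
      then show "(\<lambda>N. exp (- \<gamma>' * real N)) \<longlonglongrightarrow> 0" by (simp only: exp_of_nat2_mult)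
    qed
    then have "\<forall>\<^sub>F N in sequentially. (\<Sum>i<K. w i) * \<epsilon> * exp (- \<gamma>' * real N) < \<eta>"
      using \<eta> by (rule order_tendstoD(2))
    then obtain N2 where N2: "\<And>N. N \<ge> N2 \<Longrightarrow> (\<Sum>i<K. w i) * \<epsilon> * exp (- \<gamma>' * real N) < \<eta>"
      unfolding eventually_sequentially by blast
    define N where "N = Suc (max N1 N2)"
    have N: "N1 \<le> N" "N2 \<le> N" "1 \<le> N" by (auto simp: N_def)
    have BN: "measure \<mu> (B N) \<le> 2 * \<eta>" using Bsmall[of N] N2[OF N(2)] by linarith
    define G where "G = {x \<in> {0..L}. exp (h * real N) \<le> \<bar>DF N x\<bar>}"
    have Gm: "G \<in> sets borel"
    proof -
      have "continuous_on {0..L} (\<lambda>x. \<bar>DF N x\<bar>)" using L(2)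
        by (intro continuous_intros continuous_on_subset[OF continuous_DF])
      then have "closed {x \<in> {0..L}. exp (h * real N) \<le> \<bar>DF N x\<bar>}"
        by (intro continuous_on_closed_Collect_le) auto
      then show ?thesis unfolding G_def by simp
    qed
    define R where "R = (\<lambda>j. L * real j / real K) ` {..K}"
    have Rm: "R \<in> sets borel" unfolding R_def by (intro borel_closed finite_imp_closed) auto
    have R0: "measure \<mu> R = 0"
    proof -
      have "R \<in> null_sets lborel" unfolding R_def by (intro countable_imp_null_set_lborel countable_finite) auto
      then have "R \<in> null_sets \<mu>" using \<mu>(3) by (auto simp: absolutely_continuous_def)
      then show ?thesis by (simp add: measure_eq_0_null_sets)
    qed
    define I where "I x = (\<Sum>m\<in>{1..N}. indicat_real (Em m) x)" for x
    have many: "\<beta> * real N \<le> I x" if x: "x \<in> G - B N - R" for x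
    proof -
      have "x \<in> {0..L}" using x by (simp add: G_def)
      then obtain i where i: "i < K" "x \<in> cell L K i" using cell_cover[OF L(1) K(1), of x] x unfolding R_def
        by blast
      have "x \<notin> bad (c i) \<tau> h \<beta> N" using x i by (auto simp: B_def)
      then have "\<beta> * real N < (\<Sum>m\<in>{1..N}. indicator {x \<in> {c i<..<c i+\<tau>}. goodx (c i) \<tau> m x} x)"
        using x i(2) unfolding bad_def G_def cell by auto
      also have "\<dots> \<le> I x" unfolding I_def
        using i(1) by (intro sum_mono) (auto simp: Em_def indicator_def)
      finally show ?thesis by simp
    qed
    have Iint: "integrable \<mu> I" "(\<integral>x. I x \<partial>\<mu>) = (\<Sum>m\<in>{1..N}. measure \<mu> (Em m))"
    proof -
      have "integrable \<mu> (indicat_real (Em m))" "(\<integral>x. indicat_real (Em m) x \<partial>\<mu>) = measure \<mu> (Em m)" for m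
        using Em[of m] \<mu>(2) sets_eq_imp_space_eq[OF \<mu>(2)] by (auto simp: emeasure_eq_measure)
      then show "integrable \<mu> I" "(\<integral>x. I x \<partial>\<mu>) = (\<Sum>m\<in>{1..N}. measure \<mu> (Em m))" unfolding I_def by auto
    qed
    have "cc \<le> measure \<mu> G" using fast[OF N(1)] by (simp add: G_def)
    also have "measure \<mu> G \<le> measure \<mu> ((G - B N - R) \<union> (B N \<union> R))"
      using Gm Bb Rm \<mu>(2) by (intro finite_measure_mono) auto
    also have "\<dots> \<le> measure \<mu> (G - B N - R) + measure \<mu> (B N \<union> R)"
      using Gm Bb Rm \<mu>(2) by (intro measure_subadditive) auto
    also have "measure \<mu> (B N \<union> R) \<le> measure \<mu> (B N) + measure \<mu> R"
      using Bb Rm \<mu>(2) by (intro measure_subadditive) auto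
    finally have G1: "cc - 2 * \<eta> \<le> measure \<mu> (G - B N - R)" using BN R0 by linarith
    have "\<beta> * real N * (cc - 2 * \<eta>) \<le> \<beta> * real N * measure \<mu> (G - B N - R)"
      using \<beta> G1 by (intro mult_left_mono) auto
    also have "\<dots> = (\<integral>x. \<beta> * real N * indicator (G - B N - R) x \<partial>\<mu>)"
      using Gm Bb Rm \<mu>(2) sets_eq_imp_space_eq[OF \<mu>(2)] by simp
    also have "\<dots> \<le> (\<integral>x. I x \<partial>\<mu>)"
    proof (rule integral_mono)
      show "integrable \<mu> (\<lambda>x. \<beta> * real N * indicator (G - B N - R) x)"
        using Gm Bb Rm \<mu>(2) by (auto simp: emeasure_eq_measure)
      show "\<beta> * real N * indicator (G - B N - R) x \<le> I x" for x
        using many[of x] by (cases "x \<in> G - B N - R") (auto simp: I_def intro: sum_nonneg)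
    qed (fact Iint)
    finally have sumE: "\<beta> * (cc - 2 * \<eta>) * real N \<le> (\<Sum>m\<in>{1..N}. measure \<mu> (Em m))" by (simp add: Iint mult_ac)
    \<comment> \<open>Pigeonhole: a sum of N measures that is at least N times a number has a term
      at least as large.\<close>
    obtain m where m: "m \<in> {1..N}" "\<beta> * (cc - 2 * \<eta>) \<le> measure \<mu> (Em m)"
    proof (rule ccontr)
      assume "\<not> thesis"
      then have "\<And>m. m \<in> {1..N} \<Longrightarrow> measure \<mu> (Em m) < \<beta> * (cc - 2 * \<eta>)" using that by force
      then have "(\<Sum>m\<in>{1..N}. measure \<mu> (Em m)) < (\<Sum>m\<in>{1..N}. \<beta> * (cc - 2 * \<eta>))"
        using N(3) by (intro sum_strict_mono) auto
      then show False using sumE by (simp add: mult.commute)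
    qed
    define V where "V j = (\<Union>k::int. {p j + k * P<..<q j + k * P})" for j
    have Vm: "V j \<in> sets borel" for j unfolding V_def by (intro borel_open open_UN) auto
    define T where "T = {x \<in> {0..L}. E \<le> \<bar>F' ((F ^^ (m - 1)) x)\<bar> \<and> (F ^^ m) x \<notin> (\<Union>j<r. V j)}"
    have cF: "continuous_on {0..L} (\<lambda>x. \<bar>F' ((F ^^ (m - 1)) x)\<bar>)" "continuous_on {0..L} (F ^^ m)"
      using L(2)
        by (auto intro!: continuous_intros continuous_on_subset[OF continuous_F'_funpow]
        continuous_on_subset[OF continuous_funpow])
    have opV: "open (\<Union>j<r. V j)" unfolding V_def by (intro open_UN ballI) auto
    have Tm: "T \<in> sets borel"
    proof -
      have "closed {x \<in> {0..L}. E \<le> \<bar>F' ((F ^^ (m - 1)) x)\<bar>}"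
        using cF(1) by (intro continuous_on_closed_Collect_le) auto
      moreover have "closed ({0..L} \<inter> (F ^^ m) -` (- (\<Union>j<r. V j)))"
        by (rule continuous_closed_preimage[OF cF(2) closed_atLeastAtMost closed_Compl[OF opV]])
      moreover have "T = {x \<in> {0..L}. E \<le> \<bar>F' ((F ^^ (m - 1)) x)\<bar>} \<inter> ({0..L} \<inter> (F ^^ m) -` (- (\<Union>j<r. V j)))"
        unfolding T_def by blast
      ultimately show ?thesis by (simp add: closed_Int)
    qed
    \<comment> \<open>A good time m includes the expansion E at step m - 1; hence points of X, being
      outside T, are mapped into the intervals.\<close>
    define X where "X = Em m - T"
    have Xm: "X \<in> sets borel" "X \<subseteq> {0..L}" using Em EmL Tm by (auto simp: X_def)
    have "measure \<mu> (Em m) \<le> measure \<mu> (X \<union> T)" using Xm Tm \<mu>(2)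
      by (intro finite_measure_mono sets.Un) (blast | simp add: X_def)+
    also have "\<dots> \<le> measure \<mu> X + measure \<mu> T" using Xm Tm \<mu>(2) by (intro measure_subadditive) auto
    also have "measure \<mu> T \<le> s" using s[of m] m(1) unfolding T_def V_def by simp
    also have "measure \<mu> X \<le> (\<Sum>i<K. w i * measure lborel (X \<inter> cell L K i)) + \<eta>" by (rule dom[OF Xm])
    also have "(\<Sum>i<K. w i * measure lborel (X \<inter> cell L K i)) \<le> (\<Sum>i<K. w i * (8 / \<epsilon> * S * \<tau>))"
    proof (intro sum_mono mult_left_mono)
      fix i assume "i \<in> {..<K}"
      then have i: "i < K" by simp
      let ?Y = "\<lambda>j. {x \<in> {c i<..<c i+\<tau>}. goodx (c i) \<tau> m x \<and> (F ^^ m) x \<in> V j}"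
      have Ym: "?Y j \<in> sets borel" "(\<Union>j<r. ?Y j) \<in> sets borel" for j
        using good_image_measurable[OF \<tau> cJ[OF i] Vm, of m]
          by (blast, auto intro!: sets.finite_UN simp del: greaterThanLessThan_iff)
      have "X \<inter> cell L K i \<subseteq> (\<Union>j<r. ?Y j)"
      proof
        fix x assume x: "x \<in> X \<inter> cell L K i"
        then have g: "x \<in> {c i<..<c i+\<tau>}" "goodx (c i) \<tau> m x" using Em_cell[OF i, of m] by (auto simp: X_def)
        have "x \<in> {0..L}" using g(1) cL[OF i] by auto
        moreover have "E \<le> \<bar>F' ((F ^^ (m - 1)) x)\<bar>" using g(2) unfolding goodx_def by blast
        ultimately have "(F ^^ m) x \<in> (\<Union>j<r. V j)" using x unfolding X_def T_def by blast
        then show "x \<in> (\<Union>j<r. ?Y j)" using g by blast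
      qed
      then have "emeasure lborel (X \<inter> cell L K i) \<le> emeasure lborel (\<Union>j<r. ?Y j)"
        using Ym by (intro emeasure_mono) simp_all
      also have "\<dots> \<le> (\<Sum>j<r. emeasure lborel (?Y j))"
        using Ym(1)
          by (intro emeasure_subadditive_finite) (simp_all add: image_subset_iff del: greaterThanLessThan_iff)
      also have "\<dots> \<le> (\<Sum>j<r. ennreal (8 * (q j - p j) / \<epsilon> * \<tau>))"
        unfolding V_def using Pq by (intro sum_mono push_bound_periodic[OF \<tau> cJ[OF i]]) auto
      also have "\<dots> = ennreal (\<Sum>j<r. 8 * (q j - p j) / \<epsilon> * \<tau>)"
        using Pq \<epsilon> \<tau> by (intro sum_ennreal) (auto intro!: mult_nonneg_nonneg divide_nonneg_nonneg)
      also have "(\<Sum>j<r. 8 * (q j - p j) / \<epsilon> * \<tau>) = 8 / \<epsilon> * S * \<tau>"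
        by (simp add: S_def sum_distrib_left sum_distrib_right)
      finally have "emeasure lborel (X \<inter> cell L K i) \<le> ennreal (8 / \<epsilon> * S * \<tau>)" .
      then show "measure lborel (X \<inter> cell L K i) \<le> 8 / \<epsilon> * S * \<tau>"
        unfolding measure_def using S0 \<epsilon> \<tau> by (intro enn2real_leI) auto
    qed (use w in auto)
    \<comment> \<open>All cells have the same length \<tau>, so only the total mass of the step
      function enters.\<close>
    also have "(\<Sum>i<K. w i * (8 / \<epsilon> * S * \<tau>)) = 8 / \<epsilon> * S * (\<Sum>i<K. w i * (L / real K))"
      by (simp add: sum_distrib_left \<tau>_def mult_ac)
    also have "\<dots> \<le> 8 / \<epsilon> * S * (1 + \<eta>)" using w(2) S0 \<epsilon> by (intro mult_left_mono) auto
    finally show ?thesis using m(2) by linarith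
  qed
  have "((\<lambda>\<eta>. 8 / \<epsilon> * S * (1 + \<eta>) + \<eta> + s) \<longlongrightarrow> 8 / \<epsilon> * S * (1 + 0) + 0 + s) (at_right 0)"
    "((\<lambda>\<eta>. \<beta> * (cc - 2 * \<eta>)) \<longlongrightarrow> \<beta> * (cc - 2 * 0)) (at_right 0)"
    by (intro tendsto_intros)+
  moreover have "\<forall>\<^sub>F \<eta> in at_right 0. \<beta> * (cc - 2 * \<eta>) \<le> 8 / \<epsilon> * S * (1 + \<eta>) + \<eta> + s"
    using main unfolding eventually_at_right_field by (auto intro: exI[of _ 1])
  ultimately have "\<beta> * (cc - 2 * 0) \<le> 8 / \<epsilon> * S * (1 + 0) + 0 + s"
    by (intro tendsto_le[of "at_right 0"]) auto
  then show ?thesis by (simp add: S_def)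
qed

end

section \<open>Entropy of simple functions\<close>

context prob_space begin

text \<open>Probability of the fibre of X through \<omega>; thus
  \<open>- ln (fib X \<omega>)\<close> is the information function of the partition generated by X,
  and its mean \<open>Hent\<close> the Shannon entropy. With functions of arbitrary type in place of
  partitions, joins become pairs and iterated joins become lists.\<close>

definition fib :: "('a \<Rightarrow> 'b) \<Rightarrow> 'a \<Rightarrow> real" where
  "fib X \<omega> = prob {\<omega>' \<in> space M. X \<omega>' = X \<omega>}"

definition Hent :: "('a \<Rightarrow> 'b) \<Rightarrow> real" where
  "Hent X = (\<integral>\<omega>. - ln (fib X \<omega>) \<partial>M)"

lemma simple_fiber:
  "simple_function M X \<Longrightarrow> {\<omega>' \<in> space M. X \<omega>' = x} \<in> events"
proof -
  assume "simple_function M X"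
  from simple_functionD(2)[OF this, of "{x}"] have "X -` {x} \<inter> space M \<in> events" .
  also have "X -` {x} \<inter> space M = {\<omega>' \<in> space M. X \<omega>' = x}" by auto
  finally show ?thesis .
qed

lemma simple_integral_sum:
  fixes F :: "'b \<Rightarrow> real"
  assumes X: "simple_function M X"
  shows "integrable M (\<lambda>\<omega>. F (X \<omega>))" "(\<integral>\<omega>. F (X \<omega>) \<partial>M) = (\<Sum>x\<in>X ` space M. F x * prob {\<omega>' \<in> space M. X \<omega>' = x})"
proof -
  have fin: "finite (X ` space M)" using X by (rule simple_functionD)
  define G where "G \<omega> = (\<Sum>x\<in>X ` space M. F x * indicator {\<omega>' \<in> space M. X \<omega>' = x} \<omega>)" for \<omega>
  have eq: "F (X \<omega>) = G \<omega>" if "\<omega> \<in> space M" for \<omega>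
  proof -
    have "G \<omega> = (\<Sum>x\<in>X ` space M. if x = X \<omega> then F x else 0)"
      unfolding G_def using that by (intro sum.cong) (auto simp: indicator_def)
    then show ?thesis using fin that by simp
  qed
  have int: "integrable M (\<lambda>\<omega>. F x * indicator {\<omega>' \<in> space M. X \<omega>' = x} \<omega>)" for x
    using simple_fiber[OF X, of x]
      by (intro integrable_mult_right integrable_real_indicator) (auto simp: emeasure_eq_measure)
  have "integrable M G" "(\<integral>\<omega>. G \<omega> \<partial>M) = (\<Sum>x\<in>X ` space M. F x * prob {\<omega>' \<in> space M. X \<omega>' = x})"
    unfolding G_def using int simple_fiber[OF X] by (auto simp: Int_absorb2[OF sets.sets_into_space])
  then show "integrable M (\<lambda>\<omega>. F (X \<omega>))"
    "(\<integral>\<omega>. F (X \<omega>) \<partial>M) = (\<Sum>x\<in>X ` space M. F x * prob {\<omega>' \<in> space M. X \<omega>' = x})"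
    using eq Bochner_Integration.integrable_cong[of M M
      "\<lambda>\<omega>. F (X \<omega>)" G] Bochner_Integration.integral_cong[of M M "\<lambda>\<omega>. F (X \<omega>)" G] by auto
qed

lemma fib_AE_pos:
  assumes X: "simple_function M X"
  shows "AE \<omega> in M. 0 < fib X \<omega>"
proof -
  let ?N = "\<Union>x\<in>{x \<in> X ` space M. prob {\<omega>' \<in> space M. X \<omega>' = x} = 0}. {\<omega>' \<in> space M. X \<omega>' = x}"
  have "?N \<in> null_sets M"
    using simple_functionD(1)[OF X] simple_fiber[OF X]
    by (intro null_sets_UN' countable_finite) (auto simp: null_sets_def emeasure_eq_measure)
  then have "AE \<omega> in M. \<omega> \<notin> ?N" by (rule AE_not_in)
  then show ?thesis
  proof (rule AE_mp, intro AE_I2 impI)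
    fix \<omega> assume "\<omega> \<in> space M" "\<omega> \<notin> ?N"
    then have "fib X \<omega> \<noteq> 0" by (auto simp: fib_def)
    then show "0 < fib X \<omega>" using measure_nonneg[of M] by (simp add: fib_def less_le)
  qed
qed

lemma Hent_integrable: "simple_function M X \<Longrightarrow> integrable M (\<lambda>\<omega>. - ln (fib X \<omega>))"
  unfolding fib_def by (rule simple_integral_sum(1)[where F = "\<lambda>x. - ln (prob {\<omega>' \<in> space M. X \<omega>' = x})"])

lemma Hent_cong:
  "(\<And>\<omega> \<omega>'. \<omega> \<in> space M \<Longrightarrow> \<omega>' \<in> space M \<Longrightarrow> X \<omega> = X \<omega>' \<longleftrightarrow> Y \<omega> = Y \<omega>') \<Longrightarrow> Hent X = Hent Y"
proof -
  assume *: "\<And>\<omega> \<omega>'. \<omega> \<in> space M \<Longrightarrow> \<omega>' \<in> space M \<Longrightarrow> X \<omega> = X \<omega>' \<longleftrightarrow> Y \<omega> = Y \<omega>'"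
  have "fib X \<omega> = fib Y \<omega>" if "\<omega> \<in> space M" for \<omega>
  proof -
    have "{\<omega>' \<in> space M. X \<omega>' = X \<omega>} = {\<omega>' \<in> space M. Y \<omega>' = Y \<omega>}"
      by (intro Collect_cong conj_cong refl *) (use that in auto)
    then show ?thesis by (simp only: fib_def)
  qed
  then show ?thesis unfolding Hent_def by (intro Bochner_Integration.integral_cong refl) simp
qed

lemma Hent_mono:
  assumes X: "simple_function M X" and Y: "simple_function M Y"
    and *: "\<And>\<omega> \<omega>'. \<omega> \<in> space M \<Longrightarrow> \<omega>' \<in> space M \<Longrightarrow> Y \<omega> = Y \<omega>' \<Longrightarrow> X \<omega> = X \<omega>'"
  shows "Hent X \<le> Hent Y"
  unfolding Hent_def
proof (rule integral_mono_AE[OF Hent_integrable[OF X] Hent_integrable[OF Y]])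
  show "AE \<omega> in M. - ln (fib X \<omega>) \<le> - ln (fib Y \<omega>)"
    using fib_AE_pos[OF Y]
  proof (rule AE_mp, intro AE_I2 impI)
    fix \<omega> assume \<omega>: "\<omega> \<in> space M" "0 < fib Y \<omega>"
    have "fib Y \<omega> \<le> fib X \<omega>" unfolding fib_def
    proof (rule finite_measure_mono)
      show "{\<omega>' \<in> space M. Y \<omega>' = Y \<omega>} \<subseteq> {\<omega>' \<in> space M. X \<omega>' = X \<omega>}" using *[OF _ \<omega>(1)] by blast
    qed (rule simple_fiber[OF X])
    then show "- ln (fib X \<omega>) \<le> - ln (fib Y \<omega>)" using \<omega> by simp
  qed
qed

text \<open>Gibbs' inequality. Applied to different transition weights \<open>r\<close> it yields the submodularity of
  entropy as well as all bounds on conditional entropy that are needed.\<close>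

lemma Gibbs_conditional:
  fixes r :: "'b \<Rightarrow> 'c \<Rightarrow> real"
  assumes X: "simple_function M X" and Y: "simple_function M Y"
    and r: "\<And>x y. 0 \<le> r x y" "\<And>y. y \<in> Y ` space M \<Longrightarrow> (\<Sum>x\<in>X ` space M. r x y) \<le> 1"
    and pos: "AE \<omega> in M. 0 < r (X \<omega>) (Y \<omega>)"
  shows "Hent (\<lambda>\<omega>. (X \<omega>, Y \<omega>)) - Hent Y \<le> (\<integral>\<omega>. - ln (r (X \<omega>) (Y \<omega>)) \<partial>M)"
proof -
  let ?XY = "\<lambda>\<omega>. (X \<omega>, Y \<omega>)"
  have XY: "simple_function M ?XY" using X Y by (rule simple_function_Pair)
  define py where "py y = prob {\<omega>' \<in> space M. Y \<omega>' = y}" for y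
  define pz where "pz z = prob {\<omega>' \<in> space M. ?XY \<omega>' = z}" for z
  let ?F = "\<lambda>z. py (snd z) * r (fst z) (snd z) / pz z"
  have int: "integrable M (\<lambda>\<omega>. ?F (?XY \<omega>))" and intr: "integrable M (\<lambda>\<omega>. - ln (r (X \<omega>) (Y \<omega>)))"
    using simple_integral_sum(1)[OF XY, of ?F] simple_integral_sum(1)[OF XY, of
      "\<lambda>z. - ln (r (fst z) (snd z))"] by auto
  have intd: "integrable M (\<lambda>\<omega>. (- ln (fib ?XY \<omega>)) - (- ln (fib Y \<omega>)) - (- ln (r (X \<omega>) (Y \<omega>))))"
    by (intro Bochner_Integration.integrable_diff Hent_integrable XY Y intr)
  have "(Hent ?XY - Hent Y) - (\<integral>\<omega>. - ln (r (X \<omega>) (Y \<omega>)) \<partial>M) =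
     (\<integral>\<omega>. (- ln (fib ?XY \<omega>)) - (- ln (fib Y \<omega>)) - (- ln (r (X \<omega>) (Y \<omega>))) \<partial>M)"
    unfolding Hent_def using Hent_integrable[OF XY] Hent_integrable[OF Y] intr
    by (subst Bochner_Integration.integral_diff, auto)+
  also have "\<dots> \<le> (\<integral>\<omega>. ?F (?XY \<omega>) - 1 \<partial>M)"
  proof (rule integral_mono_AE)
    show "AE \<omega> in M. (- ln (fib ?XY \<omega>)) - (- ln (fib Y \<omega>)) - (- ln (r (X \<omega>) (Y \<omega>))) \<le> ?F (?XY \<omega>) - 1"
      using fib_AE_pos[OF XY] fib_AE_pos[OF Y] pos
    proof (eventually_elim)
      case (elim \<omega>)
      have F: "?F (?XY \<omega>) = fib Y \<omega> * r (X \<omega>) (Y \<omega>) / fib ?XY \<omega>" by (simp add: fib_def py_def pz_def)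
      have "ln (?F (?XY \<omega>)) = ln (fib Y \<omega>) + ln (r (X \<omega>) (Y \<omega>)) - ln (fib ?XY \<omega>)"
        unfolding F using elim by (simp add: ln_mult ln_div)
      moreover have "ln (?F (?XY \<omega>)) \<le> ?F (?XY \<omega>) - 1"
        unfolding F using elim by (intro ln_le_minus_one) simp
      ultimately show ?case by simp
    qed
  qed (use intd int in auto)
  also have "\<dots> = (\<integral>\<omega>. ?F (?XY \<omega>) \<partial>M) - 1" using int by (simp add: prob_space)
  also have "(\<integral>\<omega>. ?F (?XY \<omega>) \<partial>M) = (\<Sum>z\<in>?XY ` space M. ?F z * pz z)"
    unfolding pz_def by (rule simple_integral_sum(2)[OF XY])
  also have "\<dots> \<le> (\<Sum>z\<in>?XY ` space M. py (snd z) * r (fst z) (snd z))"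
    using r by (intro sum_mono) (auto simp: py_def)
  also have "\<dots> \<le> (\<Sum>z\<in>(X ` space M) \<times> (Y ` space M). py (snd z) * r (fst z) (snd z))"
    using r simple_functionD(1)[OF X] simple_functionD(1)[OF Y] by (intro sum_mono2) (auto simp: py_def)
  also have "\<dots> = (\<Sum>x\<in>X ` space M. \<Sum>y\<in>Y ` space M. py y * r x y)"
    by (simp add: sum.cartesian_product case_prod_beta)
  also have "\<dots> = (\<Sum>y\<in>Y ` space M. py y * (\<Sum>x\<in>X ` space M. r x y))"
    by (subst sum.swap) (simp add: sum_distrib_left)
  also have "\<dots> \<le> (\<Sum>y\<in>Y ` space M. py y * 1)"
    using r(2) by (intro sum_mono mult_left_mono) (auto simp: py_def)
  also have "\<dots> = (\<Sum>y\<in>Y ` space M. 1 * py y)" by simp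
  also have "\<dots> = (\<integral>\<omega>. 1 \<partial>M)" unfolding py_def by (rule simple_integral_sum(2)[OF Y, symmetric])
  also have "\<dots> = 1" by (simp add: prob_space)
  finally show ?thesis by simp
qed

text \<open>Gibbs' inequality with the transition weights P(X = x | Z = z), which ignore Y:
  conditioning on Y as well cannot increase the entropy of X.\<close>

lemma Hent_submodular:
  assumes X: "simple_function M X" and Y: "simple_function M Y" and Z: "simple_function M Z"
  shows "Hent (\<lambda>\<omega>. (X \<omega>, Y \<omega>, Z \<omega>)) \<le> Hent (\<lambda>\<omega>. (Y \<omega>, Z \<omega>)) + (Hent (\<lambda>\<omega>. (X \<omega>, Z \<omega>)) - Hent Z)"
proof -
  define p where "p x z = prob {\<omega>' \<in> space M. (X \<omega>', Z \<omega>') = (x, z)}" for x z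
  define pz where "pz z = prob {\<omega>' \<in> space M. Z \<omega>' = z}" for z
  have XZ: "simple_function M (\<lambda>\<omega>. (X \<omega>, Z \<omega>))" using X Z by (rule simple_function_Pair)
  have YZ: "simple_function M (\<lambda>\<omega>. (Y \<omega>, Z \<omega>))" using Y Z by (rule simple_function_Pair)
  have fibs: "fib (\<lambda>\<omega>. (X \<omega>, Z \<omega>)) \<omega> = p (X \<omega>) (Z \<omega>)" "fib Z \<omega> = pz (Z \<omega>)" for \<omega>
    by (auto simp: fib_def p_def pz_def)
  have "Hent (\<lambda>\<omega>. (X \<omega>, Y \<omega>, Z \<omega>)) - Hent (\<lambda>\<omega>. (Y \<omega>, Z \<omega>)) \<le>
     (\<integral>\<omega>. - ln ((\<lambda>x yz. p x (snd yz) / pz (snd yz)) (X \<omega>) (Y \<omega>, Z \<omega>)) \<partial>M)"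
  proof (rule Gibbs_conditional[OF X YZ])
    show "0 \<le> p x (snd y) / pz (snd y)" for x y by (simp add: p_def pz_def)
    show "AE \<omega> in M. 0 < p (X \<omega>) (snd (Y \<omega>, Z \<omega>)) / pz (snd (Y \<omega>, Z \<omega>))"
      using fib_AE_pos[OF XZ] fib_AE_pos[OF Z] unfolding fibs by eventually_elim simp
    fix y
    have "(\<Sum>x\<in>X ` space M. p x (snd y)) = prob (\<Union>x\<in>X ` space M. {\<omega>' \<in> space M. (X \<omega>', Z \<omega>') = (x, snd y)})"
      unfolding p_def using simple_functionD(1)[OF X] simple_fiber[OF XZ]
      by (intro finite_measure_finite_Union[symmetric]) (auto simp: disjoint_family_on_def)
    also have "(\<Union>x\<in>X ` space M. {\<omega>' \<in> space M. (X \<omega>', Z \<omega>') = (x, snd y)}) = {\<omega>' \<in> space M. Z \<omega>' = snd y}"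
      by auto
    finally have "(\<Sum>x\<in>X ` space M. p x (snd y)) = pz (snd y)" unfolding pz_def .
    then show "(\<Sum>x\<in>X ` space M. p x (snd y) / pz (snd y)) \<le> 1" by (simp add: sum_divide_distrib[symmetric])
  qed
  also have "\<dots> = (\<integral>\<omega>. (- ln (fib (\<lambda>\<omega>. (X \<omega>, Z \<omega>)) \<omega>)) - (- ln (fib Z \<omega>)) \<partial>M)"
  proof (rule integral_cong_AE)
    show "AE \<omega> in M. - ln (p (X \<omega>) (snd (Y \<omega>, Z \<omega>)) / pz (snd (Y \<omega>, Z \<omega>))) =
       (- ln (fib (\<lambda>\<omega>. (X \<omega>, Z \<omega>)) \<omega>)) - (- ln (fib Z \<omega>))"
      using fib_AE_pos[OF XZ] fib_AE_pos[OF Z] unfolding fibs by eventually_elim (simp add: ln_div)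
    show "(\<lambda>\<omega>. - ln (p (X \<omega>) (snd (Y \<omega>, Z \<omega>)) / pz (snd (Y \<omega>, Z \<omega>)))) \<in> borel_measurable M"
      using simple_integral_sum(1)[OF XZ, of "\<lambda>z. - ln (p (fst z) (snd z) / pz (snd z))"] by simp
    show "(\<lambda>\<omega>. - ln (fib (\<lambda>\<omega>. (X \<omega>, Z \<omega>)) \<omega>) - (- ln (fib Z \<omega>))) \<in> borel_measurable M"
      by (intro borel_measurable_diff borel_measurable_integrable Hent_integrable XZ Z)
  qed
  also have "\<dots> = Hent (\<lambda>\<omega>. (X \<omega>, Z \<omega>)) - Hent Z"
    unfolding Hent_def by (intro Bochner_Integration.integral_diff Hent_integrable XZ Z)
  finally show ?thesis by simp
qed

definition itin :: "('a \<Rightarrow> 'b) \<Rightarrow> ('a \<Rightarrow> 'a) \<Rightarrow> nat \<Rightarrow> 'a \<Rightarrow> 'b list" where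
  "itin X T n \<omega> = map (\<lambda>i. X ((T ^^ i) \<omega>)) [0..<n]"

lemma itin_eq_iff: "itin X T n \<omega> = itin X T n \<omega>' \<longleftrightarrow> (\<forall>i<n. X ((T ^^ i) \<omega>) = X ((T ^^ i) \<omega>'))"
  by (auto simp: itin_def)

context
  fixes T :: "'a \<Rightarrow> 'a"
  assumes T: "T \<in> measurable M M" "distr M M T = M"
begin

lemma funpow_preserving: "T ^^ i \<in> measurable M M" "distr M M (T ^^ i) = M"
proof (induction i)
  case 0
  { case 1 show ?case by (simp add: id_def) }
  { case 2 show ?case using distr_id[of M] by (simp add: id_def) }
next
  case (Suc i)
  { case 1 show ?case using Suc.IH(1) T(1) by (simp add: o_def) }
  { case 2
    have "distr M M (T \<circ> T ^^ i) = M" using distr_distr[OF T(1) Suc.IH(1)] Suc.IH(2) T(2) by simp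
    then show ?case by (simp only: funpow.simps) }
qed

lemma simple_funpow: "simple_function M X \<Longrightarrow> simple_function M (\<lambda>\<omega>. X ((T ^^ i) \<omega>))"
proof -
  assume X: "simple_function M X"
  have m: "X \<in> measurable M (count_space UNIV)" "finite (X ` space M)"
    using X measurable_simple_function by (auto dest: simple_functionD)
  have "(\<lambda>\<omega>. X ((T ^^ i) \<omega>)) ` space M \<subseteq> X ` space M"
    using measurable_space[OF funpow_preserving(1)[of i]] by auto
  then have "finite ((\<lambda>\<omega>. X ((T ^^ i) \<omega>)) ` space M)" using m(2) finite_subset by blast
  moreover have "(\<lambda>\<omega>. X ((T ^^ i) \<omega>)) \<in> measurable M (count_space UNIV)"
    by (rule measurable_compose[OF funpow_preserving(1) m(1)])
  ultimately show ?thesis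
    unfolding simple_function_def using measurable_sets[of _ M "count_space UNIV" "{_}"] by auto
qed

lemma simple_itin: "simple_function M X \<Longrightarrow> simple_function M (itin X T n)"
proof (induction n)
  case 0
  then show ?case by (simp add: itin_def simple_function_const)
next
  case (Suc n)
  have "simple_function M (\<lambda>\<omega>. (\<lambda>(l, x). l @ [x]) (itin X T n \<omega>, X ((T ^^ n) \<omega>)))"
    by (rule simple_function_compose1[OF simple_function_Pair[OF Suc.IH[OF Suc.prems] simple_funpow[OF
      Suc.prems]]])
  then show ?case by (simp add: itin_def)
qed

lemma Hent_funpow:
  assumes X: "simple_function M X"
  shows "Hent (\<lambda>\<omega>. X ((T ^^ i) \<omega>)) = Hent X"
proof -
  have f: "fib (\<lambda>\<omega>. X ((T ^^ i) \<omega>)) \<omega> = fib X ((T ^^ i) \<omega>)" for \<omega>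
  proof -
    have "prob {\<omega>' \<in> space M. X \<omega>' = X ((T ^^ i) \<omega>)} = measure (distr M M (T ^^ i)) {\<omega>' \<in> space M. X \<omega>' =
      X ((T ^^ i) \<omega>)}"
      by (simp add: funpow_preserving(2))
    also have "\<dots> = prob ((T ^^ i) -` {\<omega>' \<in> space M. X \<omega>' = X ((T ^^ i) \<omega>)} \<inter> space M)"
      by (rule measure_distr[OF funpow_preserving(1) simple_fiber[OF X]])
    also have "(T ^^ i) -` {\<omega>' \<in> space M. X \<omega>' = X ((T ^^ i) \<omega>)} \<inter> space M =
      {\<omega>' \<in> space M. X ((T ^^ i) \<omega>') = X ((T ^^ i) \<omega>)}"
      using measurable_space[OF funpow_preserving(1)[of i]] by auto
    finally show ?thesis by (simp add: fib_def)
  qed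
  have "Hent X = (\<integral>\<omega>. - ln (fib X \<omega>) \<partial>distr M M (T ^^ i))" by (simp add: Hent_def funpow_preserving(2))
  also have "\<dots> = (\<integral>\<omega>. - ln (fib X ((T ^^ i) \<omega>)) \<partial>M)"
    by (rule integral_distr[OF funpow_preserving(1) borel_measurable_integrable[OF Hent_integrable[OF X]]])
  finally show ?thesis by (simp add: Hent_def f)
qed

text \<open>Symbols are split off from the end, each costing at most the conditional entropy of R
  given Q. The list W collects the symbols of Q already passed, so that the full itinerary of Q
  stays in the condition during the induction.\<close>

lemma Hent_itin_compare:
  fixes Q :: "'a \<Rightarrow> 'c" and W :: "'a \<Rightarrow> 'c list"
  assumes R: "simple_function M R" and Q: "simple_function M Q" and W: "simple_function M W"
  shows "Hent (\<lambda>\<omega>. (itin R T n \<omega>, itin Q T n \<omega>, W \<omega>)) \<le> Hent (\<lambda>\<omega>. (itin Q T n \<omega>, W \<omega>)) +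
    real n * (Hent (\<lambda>\<omega>. (R \<omega>, Q \<omega>)) - Hent Q)"
  using W
proof (induction n arbitrary: W)
  case 0
  have "Hent (\<lambda>\<omega>. (itin R T 0 \<omega>, itin Q T 0 \<omega>, W \<omega>)) = Hent (\<lambda>\<omega>. (itin Q T 0 \<omega>, W \<omega>))"
    by (rule Hent_cong) (auto simp: itin_def)
  then show ?case by simp
next
  case (Suc n)
  let ?R = "\<lambda>\<omega>. R ((T ^^ n) \<omega>)" and ?Q = "\<lambda>\<omega>. Q ((T ^^ n) \<omega>)"
  let ?Y = "\<lambda>\<omega>. (itin R T n \<omega>, itin Q T n \<omega>, W \<omega>)"
  have s: "simple_function M ?R" "simple_function M ?Q" "simple_function M ?Y"
    using R Q Suc.prems by (auto intro!: simple_funpow simple_function_Pair simple_itin)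
  have "Hent (\<lambda>\<omega>. (itin R T (Suc n) \<omega>, itin Q T (Suc n) \<omega>, W \<omega>)) = Hent (\<lambda>\<omega>. (?R \<omega>, ?Y \<omega>, ?Q \<omega>))"
    by (rule Hent_cong) (auto simp: itin_def)
  also have "\<dots> \<le> Hent (\<lambda>\<omega>. (?Y \<omega>, ?Q \<omega>)) + (Hent (\<lambda>\<omega>. (?R \<omega>, ?Q \<omega>)) - Hent ?Q)"
    by (rule Hent_submodular[OF s(1,3,2)])
  also have "Hent (\<lambda>\<omega>. (?R \<omega>, ?Q \<omega>)) = Hent (\<lambda>\<omega>. (R \<omega>, Q \<omega>))"
    by (rule Hent_funpow[OF simple_function_Pair[OF R Q], of n])
  also have "Hent ?Q = Hent Q" by (rule Hent_funpow[OF Q])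
  also have "Hent (\<lambda>\<omega>. (?Y \<omega>, ?Q \<omega>)) = Hent (\<lambda>\<omega>. (itin R T n \<omega>, itin Q T n \<omega>, ?Q \<omega> # W \<omega>))"
    by (rule Hent_cong) auto
  also have "\<dots> \<le> Hent (\<lambda>\<omega>. (itin Q T n \<omega>, ?Q \<omega> # W \<omega>)) + real n * (Hent (\<lambda>\<omega>. (R \<omega>, Q \<omega>)) - Hent Q)"
    using simple_function_compose1[OF simple_function_Pair[OF s(2) Suc.prems], of "\<lambda>(q, w). q # w"]
    by (intro Suc.IH) simp
  also have "Hent (\<lambda>\<omega>. (itin Q T n \<omega>, ?Q \<omega> # W \<omega>)) = Hent (\<lambda>\<omega>. (itin Q T (Suc n) \<omega>, W \<omega>))"
    by (rule Hent_cong) (auto simp: itin_def)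
  finally show ?case by (simp add: algebra_simps)
qed

text \<open>Submodularity discards all of the past but the last symbol, so every further step costs
  at most one transition entropy.\<close>

lemma Hent_itin_chain:
  assumes Q: "simple_function M Q"
  shows "Hent (itin Q T (Suc n)) \<le> Hent Q + real n * (Hent (\<lambda>\<omega>. (Q (T \<omega>), Q \<omega>)) - Hent Q)"
proof (induction n)
  case 0
  have "Hent (itin Q T (Suc 0)) = Hent Q" by (rule Hent_cong) (auto simp: itin_def)
  then show ?case by simp
next
  case (Suc n)
  let ?X = "\<lambda>\<omega>. Q ((T ^^ Suc n) \<omega>)" and ?Z = "\<lambda>\<omega>. Q ((T ^^ n) \<omega>)"
  have TQ: "simple_function M (\<lambda>\<omega>. Q (T \<omega>))" using simple_funpow[OF Q, of 1] by simp
  have "Hent (itin Q T (Suc (Suc n))) = Hent (\<lambda>\<omega>. (?X \<omega>, itin Q T n \<omega>, ?Z \<omega>))"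
    by (rule Hent_cong) (auto simp: itin_def)
  also have "\<dots> \<le> Hent (\<lambda>\<omega>. (itin Q T n \<omega>, ?Z \<omega>)) + (Hent (\<lambda>\<omega>. (?X \<omega>, ?Z \<omega>)) - Hent ?Z)"
    by (rule Hent_submodular[OF simple_funpow[OF Q] simple_itin[OF Q] simple_funpow[OF Q]])
  also have "Hent (\<lambda>\<omega>. (itin Q T n \<omega>, ?Z \<omega>)) = Hent (itin Q T (Suc n))"
    by (rule Hent_cong) (auto simp: itin_def)
  also have "Hent ?Z = Hent Q" by (rule Hent_funpow[OF Q])
  also have "Hent (\<lambda>\<omega>. (?X \<omega>, ?Z \<omega>)) = Hent (\<lambda>\<omega>. (Q (T \<omega>), Q \<omega>))"
    using Hent_funpow[OF simple_function_Pair[OF TQ Q], of n] by simp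
  finally show ?case using Suc.IH by (simp add: algebra_simps)
qed

end

text \<open>Time is regrouped into blocks of length q. The partition Q is followed along T^q at the
  price \<kappa> per block, and given Q, a whole block of X costs \<Delta>. For a fine Q the second
  price is small, so that \<kappa> / q becomes the entropy bound.\<close>

lemma itin_rate_bound:
  fixes Q :: "'a \<Rightarrow> 'c"
  assumes T: "T \<in> measurable M M" "distr M M T = M" and X: "simple_function M X" and Q: "simple_function M Q"
    and q: "0 < q" and n: "0 < n"
    and \<kappa>: "Hent (\<lambda>\<omega>. (Q ((T ^^ q) \<omega>), Q \<omega>)) - Hent Q \<le> \<kappa>" "Hent (\<lambda>\<omega>. (itin X T q \<omega>, Q \<omega>)) - Hent Q \<le> \<Delta>"
  shows "Hent (itin X T n) \<le> Hent Q + (real n / real q + 1) * (\<kappa> + \<Delta>)"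
proof -
  define S where "S = T ^^ q"
  have S: "S \<in> measurable M M" "distr M M S = M" unfolding S_def using funpow_preserving[OF T] by auto
  define R where "R = itin X T q"
  have R: "simple_function M R" unfolding R_def by (rule simple_itin[OF T X])
  define a where "a = n div q"
  have na: "n < Suc a * q" using q by (simp add: a_def dividend_less_div_times)
  have aq: "real a \<le> real n / real q" using q by (simp add: a_def of_nat_div_le_of_nat)
  have \<kappa>0: "0 \<le> Hent (\<lambda>\<omega>. (Q (S \<omega>), Q \<omega>)) - Hent Q" "0 \<le> Hent (\<lambda>\<omega>. (R \<omega>, Q \<omega>)) - Hent Q"
  proof -
    have "simple_function M (\<lambda>\<omega>. Q (S \<omega>))" using simple_funpow[OF S Q, of 1] by simp
    then show "0 \<le> Hent (\<lambda>\<omega>. (Q (S \<omega>), Q \<omega>)) - Hent Q" "0 \<le> Hent (\<lambda>\<omega>. (R \<omega>, Q \<omega>)) - Hent Q"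
      using R Q by (auto intro!: Hent_mono simple_function_Pair)
  qed
  \<comment> \<open>Suc a blocks cover the time n, and adjoining the itinerary of Q can only
    increase entropy. The empty list is the start value for the induction in
    \<open>Hent_itin_compare\<close>.\<close>
  have "Hent (itin X T n) \<le> Hent (\<lambda>\<omega>. (itin R S (Suc a) \<omega>, itin Q S (Suc a) \<omega>, [] :: 'c list))"
  proof (rule Hent_mono)
    show "simple_function M (itin X T n)" by (rule simple_itin[OF T X])
    show "simple_function M (\<lambda>\<omega>. (itin R S (Suc a) \<omega>, itin Q S (Suc a) \<omega>, [] :: 'c list))"
      by (intro simple_function_Pair simple_itin[OF S] R Q simple_function_const)
    fix \<omega> \<omega>' assume "(itin R S (Suc a) \<omega>, itin Q S (Suc a) \<omega>, [] :: 'c list) =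
      (itin R S (Suc a) \<omega>', itin Q S (Suc a) \<omega>', [] :: 'c list)"
    then have *: "\<And>j k. j < Suc a \<Longrightarrow> k < q \<Longrightarrow> X ((T ^^ k) ((S ^^ j) \<omega>)) = X ((T ^^ k) ((S ^^ j) \<omega>'))"
      by (simp add: itin_eq_iff R_def)
    have "X ((T ^^ i) \<omega>) = X ((T ^^ i) \<omega>')" if "i < n" for i
    proof -
      have "i div q < Suc a" "i mod q < q" using that na q by (auto simp: less_mult_imp_div_less)
      moreover have "(T ^^ i) \<omega> = (T ^^ (i mod q)) ((S ^^ (i div q)) \<omega>)" for \<omega>
      proof -
        have "(T ^^ i) \<omega> = (T ^^ (i mod q + q * (i div q))) \<omega>" by simp
        also have "\<dots> = (T ^^ (i mod q)) ((S ^^ (i div q)) \<omega>)"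
          unfolding S_def funpow_add by (simp add: funpow_mult)
        finally show ?thesis .
      qed
      ultimately show ?thesis using * by metis
    qed
    then show "itin X T n \<omega> = itin X T n \<omega>'" by (simp add: itin_eq_iff)
  qed
  also have "\<dots> \<le> Hent (\<lambda>\<omega>. (itin Q S (Suc a) \<omega>, [] :: 'c list)) + real (Suc a) * (Hent (\<lambda>\<omega>. (R \<omega>, Q \<omega>)) -
    Hent Q)"
    by (rule Hent_itin_compare[OF S R Q simple_function_const])
  also have "Hent (\<lambda>\<omega>. (itin Q S (Suc a) \<omega>, [] :: 'c list)) = Hent (itin Q S (Suc a))" by (rule Hent_cong) auto
  also have "\<dots> \<le> Hent Q + real a * (Hent (\<lambda>\<omega>. (Q (S \<omega>), Q \<omega>)) - Hent Q)" by (rule Hent_itin_chain[OF S Q])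
  finally have "Hent (itin X T n) \<le> Hent Q + real a * (Hent (\<lambda>\<omega>. (Q (S \<omega>), Q \<omega>)) - Hent Q) +
    real (Suc a) * (Hent (\<lambda>\<omega>. (R \<omega>, Q \<omega>)) - Hent Q)" by simp
  also have "\<dots> \<le> Hent Q + (real n / real q + 1) * \<kappa> + (real n / real q + 1) * \<Delta>"
    using aq \<kappa>0 \<kappa> unfolding S_def R_def by (intro add_mono mult_mono) auto
  finally show ?thesis by (simp add: algebra_simps add_divide_distrib)
qed

definition atom_of :: "'a set set \<Rightarrow> 'a \<Rightarrow> 'a set" where
  "atom_of P \<omega> = (THE A. A \<in> P \<and> \<omega> \<in> A)"

lemma atom_of:
  assumes P: "finite_partition M P" and \<omega>: "\<omega> \<in> space M"
  shows "atom_of P \<omega> \<in> P" "\<omega> \<in> atom_of P \<omega>" "A \<in> P \<Longrightarrow> \<omega> \<in> A \<Longrightarrow> atom_of P \<omega> = A"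
proof -
  have u: "A = B" if "A \<in> P" "\<omega> \<in> A" "B \<in> P" "\<omega> \<in> B" for A B
    using P that unfolding finite_partition_def disjoint_def by blast
  have "\<exists>A. A \<in> P \<and> \<omega> \<in> A" using P \<omega> unfolding finite_partition_def by blast
  then have "\<exists>!A. A \<in> P \<and> \<omega> \<in> A" using u by blast
  from theI'[OF this] show "atom_of P \<omega> \<in> P" "\<omega> \<in> atom_of P \<omega>" unfolding atom_of_def by auto
  then show "A \<in> P \<Longrightarrow> \<omega> \<in> A \<Longrightarrow> atom_of P \<omega> = A" using u by blast
qed

lemma simple_atom_of:
  assumes P: "finite_partition M P"
  shows "simple_function M (atom_of P)"
proof -
  have f: "finite P" "P \<subseteq> events" using P by (auto simp: finite_partition_def)
  have im: "atom_of P ` space M \<subseteq> P" using atom_of(1)[OF P] by blast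
  have "atom_of P -` {A} \<inter> space M \<in> events" if "A \<in> atom_of P ` space M" for A
  proof -
    have A: "A \<in> P" using that im by blast
    then have "atom_of P -` {A} \<inter> space M = A"
      using atom_of(2,3)[OF P] sets.sets_into_space[of A M] f by blast
    then show ?thesis using A f by auto
  qed
  then show ?thesis unfolding simple_function_def using finite_subset[OF im f(1)] by blast
qed

text \<open>Two points lie in the same member of the join exactly when their itineraries agree, so
  its nonempty members are the fibres of the itinerary.\<close>

lemma partition_entropy_itin:
  assumes T: "T \<in> measurable M M" "distr M M T = M" and P: "finite_partition M P"
  shows "partition_entropy M (iterated_join T M P n) = Hent (itin (atom_of P) T n)"
proof -
  let ?X = "atom_of P"
  let ?Y = "itin ?X T n"
  have f: "finite P" "P \<subseteq> events" using P by (auto simp: finite_partition_def)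
  have sp: "(T ^^ i) \<omega> \<in> space M" if "\<omega> \<in> space M" for i \<omega>
    using measurable_space[OF funpow_preserving(1)[OF T]] that .
  have fin: "finite (iterated_join T M P m)" for m
  proof (induction m)
    case (Suc m)
    have "iterated_join T M P (Suc m) \<subseteq> (\<lambda>(A, B). A \<inter> ((T ^^ m) -` B \<inter> space M)) ` (iterated_join T M P m \<times>
      P)" by auto
    then show ?case using Suc f(1) by (meson finite_SigmaI finite_imageI finite_subset)
  qed simp
  have atoms: "A = {\<omega>' \<in> space M. \<forall>i<m. ?X ((T ^^ i) \<omega>') = ?X ((T ^^ i) \<omega>)}"
    if "A \<in> iterated_join T M P m" "\<omega> \<in> A" for A \<omega> m
    using that
  proof (induction m arbitrary: A)
    case (Suc m)
    then obtain B C where BC: "A = B \<inter> ((T ^^ m) -` C \<inter> space M)" "B \<in> iterated_join T M P m" "C \<in> P" by auto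
    have B: "B = {\<omega>' \<in> space M. \<forall>i<m. ?X ((T ^^ i) \<omega>') = ?X ((T ^^ i) \<omega>)}"
      using Suc BC by blast
    have "?X ((T ^^ m) \<omega>) = C" using Suc.prems BC by (intro atom_of(3)[OF P]) (auto intro: sp)
    then have "(T ^^ m) \<omega>' \<in> C \<longleftrightarrow> ?X ((T ^^ m) \<omega>') = ?X ((T ^^ m) \<omega>)" if "\<omega>' \<in> space M" for \<omega>'
      using atom_of(2,3)[OF P sp[OF that, of m]] BC(3) by blast
    then show ?case unfolding BC(1) B by (auto simp: less_Suc_eq)
  qed auto
  have cover: "\<exists>A\<in>iterated_join T M P m. \<omega> \<in> A" if "\<omega> \<in> space M" for \<omega> m
  proof (induction m)
    case (Suc m)
    then obtain A where A: "A \<in> iterated_join T M P m" "\<omega> \<in> A" by blast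
    have "A \<inter> ((T ^^ m) -` ?X ((T ^^ m) \<omega>) \<inter> space M) \<in> iterated_join T M P (Suc m)"
      using A(1) atom_of(1)[OF P sp[OF that]] by auto
    moreover have "\<omega> \<in> A \<inter> ((T ^^ m) -` ?X ((T ^^ m) \<omega>) \<inter> space M)"
      using A(2) that atom_of(2)[OF P sp[OF that]] by auto
    ultimately show ?case by (rule bexI[rotated])
  next
    case 0
    have "space M \<in> iterated_join T M P 0" by simp
    then show ?case using that by (rule bexI[rotated])
  qed
  let ?fib = "\<lambda>y. {\<omega>' \<in> space M. ?Y \<omega>' = y}"
  have atY: "A = ?fib (?Y \<omega>)" if "A \<in> iterated_join T M P n" "\<omega> \<in> A" for A \<omega>
    using atoms[OF that] by (auto simp: itin_eq_iff)
  have bij: "bij_betw ?fib (?Y ` space M) (iterated_join T M P n - {{}})"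
  proof (rule bij_betw_imageI)
    show "inj_on ?fib (?Y ` space M)"
    proof (rule inj_onI)
      fix y y' assume "y \<in> ?Y ` space M" and eq: "?fib y = ?fib y'"
      then obtain \<omega> where "\<omega> \<in> space M" "y = ?Y \<omega>" by blast
      then have "\<omega> \<in> ?fib y'" using eq by blast
      then show "y = y'" using \<open>y = ?Y \<omega>\<close> by blast
    qed
    show "?fib ` (?Y ` space M) = iterated_join T M P n - {{}}"
    proof
      show "?fib ` (?Y ` space M) \<subseteq> iterated_join T M P n - {{}}"
      proof
        fix B assume "B \<in> ?fib ` (?Y ` space M)"
        then obtain \<omega> where \<omega>: "\<omega> \<in> space M" "B = ?fib (?Y \<omega>)" by blast
        obtain A where A: "A \<in> iterated_join T M P n" "\<omega> \<in> A" using cover[OF \<omega>(1)] by blast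
        then have "B = A" using atY \<omega>(2) by blast
        then show "B \<in> iterated_join T M P n - {{}}" using A by blast
      qed
      show "iterated_join T M P n - {{}} \<subseteq> ?fib ` (?Y ` space M)"
      proof
        fix A assume A: "A \<in> iterated_join T M P n - {{}}"
        then obtain \<omega> where \<omega>: "\<omega> \<in> A" by blast
        then have "A = ?fib (?Y \<omega>)" using atY A by blast
        then show "A \<in> ?fib ` (?Y ` space M)" using \<omega> by blast
      qed
    qed
  qed
  have "Hent ?Y = (\<Sum>y\<in>?Y ` space M. - ln (prob (?fib y)) * prob (?fib y))"
    unfolding Hent_def fib_def by (rule simple_integral_sum(2)[OF simple_itin[OF T simple_atom_of[OF P]],
      where F = "\<lambda>y. - ln (prob (?fib y))"])
  also have "\<dots> = (\<Sum>A\<in>iterated_join T M P n - {{}}. - ln (prob A) * prob A)"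
    by (rule sum.reindex_bij_betw[OF bij])
  \<comment> \<open>The join may contain the empty set, which contributes 0.\<close>
  also have "\<dots> = (\<Sum>A\<in>iterated_join T M P n. - ln (prob A) * prob A)"
    using fin by (intro sum.mono_neutral_left) auto
  finally show ?thesis by (simp add: partition_entropy_def sum_negf[symmetric] mult.commute)
qed

theorem entropy_wrt_le:
  assumes T: "T \<in> measurable M M" "distr M M T = M" and P: "finite_partition M P" and Q: "simple_function M Q"
    and q: "0 < q"
    and \<kappa>: "Hent (\<lambda>\<omega>. (Q ((T ^^ q) \<omega>), Q \<omega>)) - Hent Q \<le> \<kappa>"
      "Hent (\<lambda>\<omega>. (itin (atom_of P) T q \<omega>, Q \<omega>)) - Hent Q \<le> \<Delta>"
  shows "entropy_wrt T M P \<le> ereal ((\<kappa> + \<Delta>) / real q)"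
proof -
  let ?u = "\<lambda>n. (Hent Q + (real n / real q + 1) * (\<kappa> + \<Delta>)) / real n"
  have "entropy_wrt T M P \<le> limsup (\<lambda>n. ereal (?u n))"
    unfolding entropy_wrt_def
  proof (rule Limsup_mono)
    show "\<forall>\<^sub>F n in sequentially. ereal (partition_entropy M (iterated_join T M P n) / real n) \<le> ereal (?u n)"
      using eventually_gt_at_top[of 0]
    proof eventually_elim
      case (elim n)
      have "Hent (itin (atom_of P) T n) \<le> Hent Q + (real n / real q + 1) * (\<kappa> + \<Delta>)"
        by (rule itin_rate_bound[OF T simple_atom_of[OF P] Q q elim \<kappa>])
      then show ?case using elim by (simp add: partition_entropy_itin[OF T P] divide_right_mono)
    qed
  qed
  also have "(\<lambda>n. ereal (?u n)) \<longlonglongrightarrow> ereal ((\<kappa> + \<Delta>) / real q)"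
  proof -
    have "(\<lambda>n. (Hent Q + \<kappa> + \<Delta>) * (1 / real n) + (\<kappa> + \<Delta>) / real q) \<longlonglongrightarrow> (Hent Q + \<kappa> + \<Delta>) * 0 + (\<kappa> + \<Delta>) / real q"
      by (intro tendsto_intros lim_1_over_n)
    moreover have "\<forall>\<^sub>F n in sequentially. (Hent Q + \<kappa> + \<Delta>) * (1 / real n) + (\<kappa> + \<Delta>) / real q = ?u n"
      using eventually_gt_at_top[of 0]
    proof eventually_elim
      case (elim n)
      then show ?case using q by (simp add: field_simps)
    qed
    ultimately have "?u \<longlonglongrightarrow> (\<kappa> + \<Delta>) / real q" by (simp add: filterlim_cong)
    then show ?thesis by simp
  qed
  then have "limsup (\<lambda>n. ereal (?u n)) = ereal ((\<kappa> + \<Delta>) / real q)" by (intro lim_imp_Limsup) auto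
  finally show ?thesis .
qed

end

section \<open>Entropy relative to partitions of small diameter\<close>

lemma compact_inner_approx:
  fixes M :: "'a::euclidean_space measure"
  assumes "prob_space M" and M: "sets M = sets (restrict_space borel X)" "closed X" and S: "S \<in> sets M"
    and e: "0 < e"
  obtains K where "compact K" "K \<subseteq> S" "measure M (S - K) \<le> e"
proof -
  interpret prob_space M by fact
  have spX: "space M = X" using sets_eq_imp_space_eq[OF M(1)] by (simp add: space_restrict_space)
  \<comment> \<open>Inner regularity is applied on the whole Euclidean space, hence the push-forward
    under inclusion.\<close>
  define M' where "M' = distr M borel (\<lambda>x. x)"
  have id: "(\<lambda>x. x) \<in> measurable M borel"
    using measurable_cong_sets[OF M(1) refl, of borel] measurable_restrict_space1[OF
      measurable_ident_sets[of borel borel]] by auto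
  have em': "emeasure M' S = emeasure M (S \<inter> X)" if "S \<in> sets borel" for S
    unfolding M'_def using that id by (subst emeasure_distr) (auto simp: spX)
  have Sb: "S \<in> sets borel" "S \<subseteq> X" using S M(2) unfolding M(1) by (auto simp: sets_restrict_space_iff)
  have "emeasure M' S = (SUP K\<in>{K. K \<subseteq> S \<and> compact K}. emeasure M' K)"
    by (rule inner_regular) (use Sb in \<open>auto simp: M'_def emeasure_distr[OF id] emeasure_eq_measure\<close>)
  moreover have "emeasure M' S = ennreal (prob S)"
    using em'[OF Sb(1)] Sb(2) by (simp add: emeasure_eq_measure Int_absorb2)
  ultimately have sup: "ennreal (prob S) = (SUP K\<in>{K. K \<subseteq> S \<and> compact K}. emeasure M' K)" by simp
  show ?thesis
  proof (cases "prob S \<le> e")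
    case True
    then show ?thesis by (intro that[of "{}"]) auto
  next
    case False
    then have "ennreal (prob S - e) < (SUP K\<in>{K. K \<subseteq> S \<and> compact K}. emeasure M' K)"
      using e by (simp add: sup[symmetric] ennreal_lessI)
    then obtain K where K: "K \<subseteq> S" "compact K" "ennreal (prob S - e) < emeasure M' K"
      unfolding less_SUP_iff by blast
    have KX: "K \<subseteq> X" using K(1) Sb(2) by auto
    have Kb: "K \<in> sets borel" using K(2) by (simp add: borel_compact)
    have Ke: "K \<in> events" using Kb KX M(2) unfolding M(1) by (auto simp: sets_restrict_space_iff)
    have "emeasure M' K = ennreal (prob K)" using em'[OF Kb] KX by (simp add: Int_absorb2 emeasure_eq_measure)
    then have "prob S - e < prob K" using K(3) False by (simp add: ennreal_less_iff)
    then show ?thesis using K finite_measure_Diff[OF S Ke K(1)] by (intro that[of K]) auto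
  qed
qed

text \<open>Up to small measure the fibres of R can be replaced by compact sets, which have positive
  mutual distance d. A fibre of Q of smaller diameter meets at most one of them, so Q determines R
  off a small set. The number d works for all such Q at once. Full measure of \<Omega> suffices,
  which allows exceptional points of large distance.\<close>

lemma Hent_fine_partition:
  fixes M :: "'a::euclidean_space measure" and R :: "'a \<Rightarrow> 'b"
  assumes "prob_space M" and M: "sets M = sets (restrict_space borel X)" "closed X"
    and R: "simple_function M R" and \<eta>: "0 < \<eta>"
  shows "\<exists>d>0. \<forall>(Q :: 'a \<Rightarrow> 'c) \<Omega>. simple_function M Q \<longrightarrow> \<Omega> \<in> sets M \<longrightarrow> measure M \<Omega> = 1 \<longrightarrow>
    (\<forall>x\<in>\<Omega>. \<forall>y\<in>\<Omega>. Q x = Q y \<longrightarrow> dist x y < d) \<longrightarrow>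
    prob_space.Hent M (\<lambda>\<omega>. (R \<omega>, Q \<omega>)) - prob_space.Hent M Q \<le> \<eta>"
proof -
  interpret prob_space M by fact
  have spX: "space M = X" using sets_eq_imp_space_eq[OF M(1)] by (simp add: space_restrict_space)
  define B where "B = R ` space M"
  have finB: "finite B" using R by (simp add: B_def simple_functionD)
  define k where "k = real (card B) + 1"
  have k: "1 \<le> k" by (simp add: k_def)
  \<comment> \<open>\<theta> is the probability reserved for a wrong guess; it is so small that a
    right guess costs at most \<eta> / 2.\<close>
  define \<theta> where "\<theta> = min (1/2) (1 - exp (- \<eta> / 2))"
  have \<theta>: "0 < \<theta>" "\<theta> \<le> 1/2" using \<eta> unfolding \<theta>_def by (simp, linarith)
  have "exp (- \<eta> / 2) \<le> 1 - \<theta>" by (simp add: \<theta>_def)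
  then have "- \<eta> / 2 \<le> ln (1 - \<theta>)" using \<theta> by (subst ln_ge_iff) auto
  then have \<theta>2: "- ln (1 - \<theta>) \<le> \<eta> / 2" by simp
  define m where "m = - ln (\<theta> / k)"
  have m: "0 < m"
  proof -
    have "\<theta> / k \<le> \<theta> / 1" using \<theta> k by (intro divide_left_mono) auto
    then have "\<theta> / k < 1" using \<theta> by simp
    then show ?thesis using \<theta> k by (simp add: m_def)
  qed
  \<comment> \<open>Fewer than k fibres lose at most e each and a wrong guess costs at most m more,
    which adds up to \<eta> / 2.\<close>
  define e where "e = \<eta> / (2 * m * k)"
  have e: "0 < e" using \<eta> m k by (simp add: e_def)
  let ?A = "\<lambda>b. {\<omega> \<in> space M. R \<omega> = b}"
  have ev: "S \<in> events" if "S \<in> sets borel" "S \<subseteq> X" for S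
    using M(2) that unfolding M(1) by (subst sets_restrict_space_iff) auto
  have "\<exists>K. compact K \<and> K \<subseteq> ?A b \<and> prob (?A b - K) \<le> e" for b
    by (rule compact_inner_approx[OF prob_space_axioms M simple_fiber[OF R] e]) blast
  then have "\<forall>b. \<exists>K. compact K \<and> K \<subseteq> ?A b \<and> prob (?A b - K) \<le> e" by (intro allI)
  from choice[OF this] obtain K where K0: "\<forall>b. compact (K b) \<and> K b \<subseteq> ?A b \<and> prob (?A b - K b) \<le> e" by (elim exE)
  have K: "\<And>b. compact (K b)" "\<And>b. K b \<subseteq> ?A b" "\<And>b. prob (?A b - K b) \<le> e"
    using K0 by (simp, simp only:, simp only:)
  have Kev: "K b \<in> events" for b using K(1,2)[of b] spX by (intro ev) (auto simp: borel_compact)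
  have sep: "\<exists>d>0. \<forall>x\<in>K b. \<forall>y\<in>K c. d \<le> dist x y" if "b \<noteq> c" for b c
    using separate_compact_closed[OF K(1) compact_imp_closed[OF K(1)], of b c] K(2)[of b] K(2)[of c] that
      by blast
  obtain D where D: "\<And>b c. b \<noteq> c \<Longrightarrow> 0 < D b c" "\<And>b c x y. b \<noteq> c \<Longrightarrow> x \<in> K b \<Longrightarrow> y \<in> K c \<Longrightarrow> D b c \<le> dist x y"
  proof -
    have "\<forall>z. \<exists>d. fst z \<noteq> snd z \<longrightarrow> 0 < d \<and> (\<forall>x\<in>K (fst z). \<forall>y\<in>K (snd z). d \<le> dist x y)" using sep by blast
    from choice[OF this] obtain D0 where D0: "\<forall>z. fst z \<noteq> snd z \<longrightarrow> 0 < D0 z \<and>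
      (\<forall>x\<in>K (fst z). \<forall>y\<in>K (snd z). D0 z \<le> dist x y)" by blast
    show ?thesis
    proof (rule that[of "\<lambda>b c. D0 (b, c)"])
      show "0 < D0 (b, c)" if "b \<noteq> c" for b c using D0[rule_format, of "(b, c)"] that by simp
      show "D0 (b, c) \<le> dist x y" if "b \<noteq> c" "x \<in> K b" "y \<in> K c" for b c x y
        using D0[rule_format, of "(b, c)"] that by simp
    qed
  qed
  define d where "d = Min (insert 1 ((\<lambda>(b, c). D b c) ` {z \<in> B \<times> B. fst z \<noteq> snd z}))"
  have dfin: "finite (insert 1 ((\<lambda>(b, c). D b c) ` {z \<in> B \<times> B. fst z \<noteq> snd z}))" using finB by simp
  have "0 < d" unfolding d_def using dfin D(1) by (subst Min_gr_iff) auto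
  have dle: "d \<le> D b c" if "b \<in> B" "c \<in> B" "b \<noteq> c" for b c
    unfolding d_def using dfin that by (intro Min_le) force+
  show ?thesis
  proof (intro exI[of _ d] conjI allI impI)
    show "0 < d" by fact
    fix Q :: "'a \<Rightarrow> 'c" and \<Omega>
    assume Q: "simple_function M Q" and \<Omega>: "\<Omega> \<in> events" "prob \<Omega> = 1"
      and close: "\<forall>x\<in>\<Omega>. \<forall>y\<in>\<Omega>. Q x = Q y \<longrightarrow> dist x y < d"
    \<comment> \<open>The guess for R from the value q of Q: the fibre whose compact core is met by
      the fibre of Q.\<close>
    define \<psi> where "\<psi> q = (SOME b. b \<in> B \<and> (\<exists>x\<in>K b \<inter> \<Omega>. Q x = q))" for q
    have \<psi>: "\<psi> (Q x) = R x" if x: "x \<in> K b \<inter> \<Omega>" for x b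
    proof -
      have b: "b = R x" "x \<in> space M" using x K(2)[of b] by auto
      then have bB: "b \<in> B" by (simp add: B_def)
      have "\<exists>c. c \<in> B \<and> (\<exists>y\<in>K c \<inter> \<Omega>. Q y = Q x)" using x bB by blast
      from someI_ex[OF this] obtain y where y: "\<psi> (Q x) \<in> B" "y \<in> K (\<psi> (Q x)) \<inter> \<Omega>" "Q y = Q x"
        unfolding \<psi>_def by blast
      have "dist y x < d" using close x y by blast
      then show ?thesis using D(2)[of "\<psi> (Q x)" b y x] dle[OF y(1) bB] y x b(1)
        by (metis IntD1 linorder_not_less order_trans)
    qed
    define Bd where "Bd = space M - (\<Union>b\<in>B. K b \<inter> \<Omega>)"
    have Uev: "(\<Union>b\<in>B. K b \<inter> \<Omega>) \<in> events" using finB Kev \<Omega>(1) by (intro sets.finite_UN sets.Int)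
    have Bdev: "Bd \<in> events" unfolding Bd_def by (intro sets.compl_sets Uev)
    have Aev: "(\<Union>b\<in>B. ?A b - K b) \<in> events" by (intro sets.finite_UN finB sets.Diff simple_fiber[OF R] Kev)
    have Oev: "space M - \<Omega> \<in> events" by (intro sets.compl_sets \<Omega>(1))
    \<comment> \<open>Most of the mass is put on the guess, the rest is spread evenly so that the
      logarithm stays bounded off the guess.\<close>
    define r where "r b q = (if b = \<psi> q then 1 - \<theta> else \<theta> / k)" for b q
    have "Hent (\<lambda>\<omega>. (R \<omega>, Q \<omega>)) - Hent Q \<le> (\<integral>\<omega>. - ln (r (R \<omega>) (Q \<omega>)) \<partial>M)"
    proof (rule Gibbs_conditional[OF R Q])
      show "0 \<le> r b q" for b q using \<theta> k by (simp add: r_def)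
      show "AE \<omega> in M. 0 < r (R \<omega>) (Q \<omega>)" using \<theta> k by (intro AE_I2) (simp add: r_def)
      fix q
      have "(\<Sum>b\<in>B. r b q) \<le> (\<Sum>b\<in>B. (if b = \<psi> q then 1 - \<theta> else 0) + \<theta> / k)"
        using \<theta> k by (intro sum_mono) (auto simp: r_def)
      also have "\<dots> = (if \<psi> q \<in> B then 1 - \<theta> else 0) + real (card B) * (\<theta> / k)"
        using finB by (simp add: sum.distrib)
      also have "\<dots> \<le> (1 - \<theta>) + k * (\<theta> / k)" using \<theta> k by (intro add_mono mult_right_mono) (auto simp: k_def)
      also have "\<dots> = 1" using k by simp
      finally show "(\<Sum>b\<in>R ` space M. r b q) \<le> 1" by (simp add: B_def)
    qed
    also have "\<dots> \<le> (\<integral>\<omega>. - ln (1 - \<theta>) + m * indicator Bd \<omega> \<partial>M)"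
    proof (rule integral_mono)
      show "integrable M (\<lambda>\<omega>. - ln (r (R \<omega>) (Q \<omega>)))"
        using simple_integral_sum(1)[OF simple_function_Pair[OF R Q], of "\<lambda>z. - ln (r (fst z) (snd z))"] by simp
      show "integrable M (\<lambda>\<omega>. - ln (1 - \<theta>) + m * indicator Bd \<omega>)"
        using Bdev
          by (intro Bochner_Integration.integrable_add integrable_mult_right integrable_real_indicator)
          (auto simp: emeasure_eq_measure)
      fix \<omega> assume \<omega>: "\<omega> \<in> space M"
      have l1: "0 \<le> - ln (1 - \<theta>)" using \<theta> by simp
      show "- ln (r (R \<omega>) (Q \<omega>)) \<le> - ln (1 - \<theta>) + m * indicator Bd \<omega>"
      proof (cases "\<omega> \<in> (\<Union>b\<in>B. K b \<inter> \<Omega>)")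
        case True
        then have "\<psi> (Q \<omega>) = R \<omega>" using \<psi> by blast
        then show ?thesis using True m by (simp add: r_def)
      next
        case False
        then show ?thesis using \<omega> l1 m by (auto simp: r_def m_def Bd_def)
      qed
    qed
    also have "\<dots> = - ln (1 - \<theta>) + m * prob Bd"
      using Bdev
        by (subst Bochner_Integration.integral_add) (auto simp: prob_space emeasure_eq_measure
        Int_absorb2[OF sets.sets_into_space])
    also have "prob Bd \<le> k * e"
    proof -
      have "Bd \<subseteq> (\<Union>b\<in>B. ?A b - K b) \<union> (space M - \<Omega>)" by (auto simp: B_def Bd_def)
      then have "prob Bd \<le> prob ((\<Union>b\<in>B. ?A b - K b) \<union> (space M - \<Omega>))"
        by (rule finite_measure_mono[OF _ sets.Un[OF Aev Oev]])
      also have "\<dots> \<le> prob (\<Union>b\<in>B. ?A b - K b) + prob (space M - \<Omega>)"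
        using Aev Oev by (intro measure_subadditive) auto
      also have "prob (space M - \<Omega>) = 0" using \<Omega> by (simp add: prob_compl)
      also have "prob (\<Union>b\<in>B. ?A b - K b) \<le> (\<Sum>b\<in>B. prob (?A b - K b))"
        using Kev finB simple_fiber[OF R] by (intro measure_subadditive_finite) auto
      also have "\<dots> \<le> (\<Sum>b\<in>B. e)" by (intro sum_mono K)
      also have "\<dots> \<le> k * e" using e by (simp add: k_def)
      finally show ?thesis by simp
    qed
    also have "- ln (1 - \<theta>) + m * (k * e) \<le> \<eta>" using \<theta>2 m k by (simp add: e_def)
    finally show "Hent (\<lambda>\<omega>. (R \<omega>, Q \<omega>)) - Hent Q \<le> \<eta>" using m by simp
  qed
qed

section \<open>Lifts and Ruelle's inequality\<close>

text \<open>In a curve system the parameter \<open>t + L\<close>, when admissible, names the same point as \<open>t\<close>, and smooth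
  self-maps lift to the parameter line. For the interval \<open>L = 1\<close> and the period is vacuous.\<close>

locale curve_system =
  fixes I :: "'a::euclidean_space curve" and L :: real
  assumes L: "0 < L" and dom: "{0..L} \<subseteq> par_dom I" "convex (par_dom I)"
    and fund: "fund_dom I \<subseteq> {0..L}" "fund_dom I \<in> sets borel" "{0..<L} \<subseteq> fund_dom I"
    and surj: "par I ` {0..L} = points I" "bij_betw (par I) (fund_dom I) (points I)"
    and cont: "continuous_on (par_dom I) (par I)"
    and inv_meas: "inv_into (fund_dom I) (par I) \<in> borel_measurable (borel_on I)"
    and period: "\<And>s t. s \<in> par_dom I \<Longrightarrow> t \<in> par_dom I \<Longrightarrow> par I s = par I t \<Longrightarrow> \<exists>k::int. s = t + k * L"
    and bounded_deriv: "\<And>g n. smooth_map I g \<Longrightarrow>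
      \<exists>B. \<forall>t\<in>par_dom I. norm (nth_deriv (par_dom I) n (g \<circ> par I) t) \<le> B"
    and lift: "\<And>n B. \<exists>C\<ge>0. \<forall>g. smooth_map I g \<longrightarrow>
      (\<forall>i\<le>Suc n. \<forall>t\<in>par_dom I. norm (nth_deriv (par_dom I) i (g \<circ> par I) t) \<le> B) \<longrightarrow>
      (\<exists>G G'. (\<forall>t\<in>par_dom I. G t \<in> par_dom I \<and> par I (G t) = g (par I t) \<and>
          (G has_real_derivative G' t) (at t within par_dom I) \<and> \<bar>G' t\<bar> = abs_deriv I g (par I t)) \<and>
        bnd n C (par_dom I) G')"
begin

abbreviation "J \<equiv> par_dom I"
abbreviation "p \<equiv> par I"
abbreviation "X \<equiv> points I"

definition prm :: "'a \<Rightarrow> real" where "prm = inv_into (fund_dom I) p"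

lemma prm: "x \<in> X \<Longrightarrow> prm x \<in> fund_dom I" "x \<in> X \<Longrightarrow> p (prm x) = x"
  using surj(2) unfolding prm_def
  by (auto simp: bij_betw_def intro: inv_into_into f_inv_into_f)

lemma prm_mem: "x \<in> X \<Longrightarrow> prm x \<in> {0..L}" "x \<in> X \<Longrightarrow> prm x \<in> J"
  using prm(1) fund(1) dom(1) by blast+

lemma p_X: "t \<in> J \<Longrightarrow> p t \<in> X"
  by (simp add: points_def)

lemma cont_L: "continuous_on {0..L} p"
  by (rule continuous_on_subset[OF cont dom(1)])

lemma compact_X: "compact X" "closed X"
  using compact_continuous_image[OF cont_L] surj(1) by (auto intro: compact_imp_closed)

text \<open>By compactness of {0..L} the parametrisation is a closed map, so the curve carries the
  quotient topology and continuity can be tested in the parameter, also where the two ends are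
  glued.\<close>

lemma quotient:
  fixes \<phi> :: "'a \<Rightarrow> 'b::t2_space"
  assumes "continuous_on {0..L} (\<lambda>t. \<phi> (p t))"
  shows "continuous_on X \<phi>"
  unfolding continuous_on_closed_vimage[OF compact_X(2)]
proof (intro allI impI)
  fix B :: "'b set" assume "closed B"
  then have "closed ((\<lambda>t. \<phi> (p t)) -` B \<inter> {0..L})"
    using assms continuous_on_closed_vimage[of "{0..L}" "\<lambda>t. \<phi> (p t)"] by auto
  then have "compact ((\<lambda>t. \<phi> (p t)) -` B \<inter> {0..L})"
    by (auto simp: compact_eq_bounded_closed intro: bounded_subset[OF bounded_closed_interval])
  then have "compact (p ` ((\<lambda>t. \<phi> (p t)) -` B \<inter> {0..L}))"
    by (intro compact_continuous_image continuous_on_subset[OF cont_L]) auto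
  also have "p ` ((\<lambda>t. \<phi> (p t)) -` B \<inter> {0..L}) = \<phi> -` B \<inter> X" unfolding surj(1)[symmetric] by blast
  finally show "closed (\<phi> -` B \<inter> X)" by (rule compact_imp_closed)
qed

lemma bounded_derivs:
  assumes "smooth_map I g"
  shows "\<exists>B. \<forall>i\<le>k. \<forall>t\<in>J. norm (nth_deriv J i (g \<circ> p) t) \<le> B"
proof (induction k)
  case 0
  then show ?case using bounded_deriv[OF assms, of 0] by auto
next
  case (Suc k)
  then obtain B B' where B: "\<forall>i\<le>k. \<forall>t\<in>J. norm (nth_deriv J i (g \<circ> p) t) \<le> B"
    "\<forall>t\<in>J. norm (nth_deriv J (Suc k) (g \<circ> p) t) \<le> B'"
    using bounded_deriv[OF assms, of "Suc k"] by blast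
  have "norm (nth_deriv J i (g \<circ> p) t) \<le> max B B'" if "i \<le> Suc k" "t \<in> J" for i t
    using B that by (cases "i = Suc k") (auto simp: le_Suc_eq intro: le_max_iff_disj[THEN iffD2])
  then show ?case by blast
qed

lemma smooth_lift:
  assumes "smooth_map I g"
  obtains G G' C where "\<forall>t\<in>J. G t \<in> J" "\<forall>t\<in>J. p (G t) = g (p t)"
    "\<forall>t\<in>J. (G has_real_derivative G' t) (at t within J)"
    "\<forall>t\<in>J. \<bar>G' t\<bar> = abs_deriv I g (p t)" "bnd n C J G'"
proof -
  obtain B where "\<forall>i\<le>Suc n. \<forall>t\<in>J. norm (nth_deriv J i (g \<circ> p) t) \<le> B" using bounded_derivs[OF assms] by blast
  with lift[of n B] assms obtain C G G' where
    "(\<forall>t\<in>J. G t \<in> J \<and> p (G t) = g (p t) \<and> (G has_real_derivative G' t) (at t within J) \<and>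
      \<bar>G' t\<bar> = abs_deriv I g (p t))" "bnd n C J G'"
    by blast
  then show ?thesis by (intro that[of G G' C]) auto
qed

text \<open>The absolute derivative of the m-th iterate, taken as a product along the orbit so that
  its logarithm is the sum in \<open>lyapunov\<close>; \<open>lift_jac\<close> identifies it with
  the derivative of a lift.\<close>

definition jac :: "('a \<Rightarrow> 'a) \<Rightarrow> nat \<Rightarrow> 'a \<Rightarrow> real" where
  "jac g m x = (\<Prod>i<m. abs_deriv I g ((g ^^ i) x))"

lemma jac_nonneg: "0 \<le> jac g m x"
  unfolding jac_def by (intro prod_nonneg) (simp add: abs_deriv_def)

lemma smooth_X: "smooth_map I g \<Longrightarrow> x \<in> X \<Longrightarrow> g x \<in> X"
  by (auto simp: smooth_map_def)

lemma funpow_X: "smooth_map I g \<Longrightarrow> x \<in> X \<Longrightarrow> (g ^^ i) x \<in> X"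
  by (induction i) (auto intro: smooth_X)

lemma smooth_continuous: "smooth_map I g \<Longrightarrow> continuous_on X g"
proof -
  assume "smooth_map I g"
  then have "(g \<circ> p) differentiable_on J" unfolding smooth_map_def by (metis nth_deriv.simps(1))
  then have "continuous_on J (g \<circ> p)" by (rule differentiable_imp_continuous_on)
  then have "continuous_on {0..L} (\<lambda>t. g (p t))" using continuous_on_subset[OF _ dom(1)] by (simp add: o_def)
  then show ?thesis by (rule quotient)
qed

lemma funpow_continuous: "smooth_map I g \<Longrightarrow> continuous_on X (g ^^ i)"
proof (induction i)
  case (Suc i)
  have "continuous_on X (\<lambda>x. g ((g ^^ i) x))"
    by (rule continuous_on_compose2[OF smooth_continuous[OF Suc.prems] Suc.IH[OF Suc.prems]])
      (use funpow_X[OF Suc.prems] in auto)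
  then show ?case by simp
qed (simp add: continuous_on_id)

lemma abs_deriv_continuous: "smooth_map I g \<Longrightarrow> continuous_on X (abs_deriv I g)"
proof -
  assume g: "smooth_map I g"
  obtain G' C where G: "\<forall>t\<in>J. \<bar>G' t\<bar> = abs_deriv I g (p t)" "bnd 1 C J G'"
    by (rule smooth_lift[OF g, of 1])
  have "continuous_on J G'" using bnd_continuous_on[of 0 C J G'] G(2) by simp
  then have "continuous_on {0..L} (\<lambda>t. \<bar>G' t\<bar>)" using dom(1)
    by (intro continuous_on_rabs) (auto elim: continuous_on_subset)
  then have "continuous_on {0..L} (\<lambda>t. abs_deriv I g (p t))"
    using G(1) dom(1) by (subst continuous_on_cong[OF refl, of _ _ "\<lambda>t. \<bar>G' t\<bar>"]) auto
  then show ?thesis by (rule quotient)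
qed

lemma jac_continuous: "smooth_map I g \<Longrightarrow> continuous_on X (jac g m)"
  unfolding jac_def
  by (intro continuous_on_prod continuous_on_compose2[OF abs_deriv_continuous funpow_continuous])
    (auto intro: funpow_X)

lemma lift_funpow:
  assumes "\<forall>t\<in>J. G t \<in> J" "\<forall>t\<in>J. p (G t) = g (p t)" "t \<in> J"
  shows "(G ^^ m) t \<in> J" "p ((G ^^ m) t) = (g ^^ m) (p t)"
proof (induction m)
  case 0
  { case 1 show ?case using assms by simp }
  { case 2 show ?case by simp }
next
  case (Suc m)
  { case 1 show ?case using assms Suc by simp }
  { case 2 show ?case using assms Suc by simp }
qed

lemma lift_jac:
  assumes "\<forall>t\<in>J. G t \<in> J" "\<forall>t\<in>J. p (G t) = g (p t)"
    "\<forall>t\<in>J. \<bar>G' t\<bar> = abs_deriv I g (p t)" "t \<in> J"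
  shows "\<bar>dprod G G' m t\<bar> = jac g m (p t)"
  unfolding dprod_def jac_def abs_prod
  by (intro prod.cong) (auto simp: assms(3)[rule_format, OF lift_funpow(1)[OF assms(1,2,4)]]
    lift_funpow(2)[OF assms(1,2,4)])

lemma dprod_derivative:
  assumes "\<forall>t\<in>J. G t \<in> J" "\<forall>t\<in>J. (G has_real_derivative G' t) (at t within J)" "t \<in> J"
  shows "((G ^^ m) has_real_derivative dprod G G' m t) (at t within J)"
  using assms(3)
proof (induction m arbitrary: t)
  case 0
  have "((\<lambda>x. x) has_real_derivative 1) (at t within J)" by (rule DERIV_ident)
  then show ?case by (simp add: id_def)
next
  case (Suc m)
  have "((\<lambda>x. (G ^^ m) (G x)) has_real_derivative dprod G G' m (G t) * G' t) (at t within J)"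
    by (rule has_real_derivative_comp_within[OF Suc.IH _ assms(2)[rule_format]]) (use assms(1) Suc.prems in
      auto)
  then show ?case by (simp add: dprod_Suc funpow_Suc_right o_def mult.commute del: funpow.simps)
qed

lemma measurable_X:
  fixes \<phi> :: "'a \<Rightarrow> 'b::topological_space"
  assumes "sets \<mu> = sets (borel_on I)" "continuous_on X \<phi>"
  shows "\<phi> \<in> borel_measurable \<mu>"
  using borel_measurable_continuous_on_restrict[OF assms(2)] measurable_cong_sets[OF assms(1) refl, of borel]
  unfolding borel_on_def by auto

lemma space_X: "sets \<mu> = sets (borel_on I) \<Longrightarrow> space \<mu> = X"
  using sets_eq_imp_space_eq[of \<mu> "borel_on I"] by (simp add: borel_on_def space_restrict_space)

lemma sets_X: "sets \<mu> = sets (borel_on I) \<Longrightarrow> S \<in> sets \<mu> \<longleftrightarrow> S \<in> sets borel \<and> S \<subseteq> X"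
  using sets_restrict_space_iff[of X borel S] compact_X(2) unfolding borel_on_def by auto

lemma prm_measurable: "sets \<mu> = sets (borel_on I) \<Longrightarrow> prm \<in> borel_measurable \<mu>"
  using inv_meas measurable_cong_sets[of \<mu> "borel_on I" borel borel] by (simp add: prm_def)

lemma emeasure_lebesgue_on_curve:
  assumes "S \<in> sets (borel_on I)"
  shows "{t \<in> fund_dom I. p t \<in> S} \<in> sets borel"
    "emeasure (lebesgue_on_curve I) S = emeasure lborel {t \<in> fund_dom I. p t \<in> S}"
proof -
  have pm: "p \<in> measurable (restrict_space lborel (fund_dom I)) (borel_on I)"
  proof -
    have "p \<in> borel_measurable (restrict_space borel (fund_dom I))"
      using fund(1) by (intro borel_measurable_continuous_on_restrict continuous_on_subset[OF cont_L])
    then have "p \<in> measurable (restrict_space borel (fund_dom I)) (restrict_space borel X)"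
      using surj(2) by (intro measurable_restrict_space2) (auto simp: space_restrict_space bij_betw_def)
    then show ?thesis unfolding borel_on_def
      using measurable_cong_sets[OF sets_restrict_space_cong[OF sets_lborel] refl] by blast
  qed
  have eq: "p -` S \<inter> space (restrict_space lborel (fund_dom I)) = {t \<in> fund_dom I. p t \<in> S}"
    by (auto simp: space_restrict_space)
  show "{t \<in> fund_dom I. p t \<in> S} \<in> sets borel"
    using measurable_sets[OF pm assms] fund(2) unfolding eq by (auto simp: sets_restrict_space_iff)
  show "emeasure (lebesgue_on_curve I) S = emeasure lborel {t \<in> fund_dom I. p t \<in> S}"
    unfolding lebesgue_on_curve_def emeasure_distr[OF pm assms] eq
    using fund(2) by (intro emeasure_restrict_space) auto
qed

lemma null_prm:
  assumes \<mu>: "sets \<mu> = sets (borel_on I)" "absolutely_continuous (lebesgue_on_curve I) \<mu>"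
    and N: "N \<in> null_sets lborel"
  shows "{x \<in> X. prm x \<in> N} \<in> null_sets \<mu>"
proof -
  have Nb: "N \<in> sets borel" using N by auto
  have "prm -` N \<inter> space (borel_on I) \<in> sets (borel_on I)"
    using inv_meas Nb unfolding prm_def by (rule measurable_sets)
  also have "prm -` N \<inter> space (borel_on I) = {x \<in> X. prm x \<in> N}" by (auto simp: space_X)
  finally have S: "{x \<in> X. prm x \<in> N} \<in> sets (borel_on I)" .
  have "emeasure (lebesgue_on_curve I) {x \<in> X. prm x \<in> N} \<le> emeasure lborel N"
    unfolding emeasure_lebesgue_on_curve(2)[OF S] using Nb surj(2)
    by (intro emeasure_mono) (auto simp: prm_def bij_betw_def inv_into_f_f)
  also have "\<dots> = 0" using N by auto
  finally have "{x \<in> X. prm x \<in> N} \<in> null_sets (lebesgue_on_curve I)"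
    using S by (auto simp: null_sets_def lebesgue_on_curve_def)
  then show ?thesis using \<mu>(2) by (auto simp: absolutely_continuous_def)
qed

end

section \<open>Ruelle's inequality\<close>

lemma card_int_le:
  fixes F :: "int set"
  assumes "F \<noteq> {}" "\<And>a b. a \<in> F \<Longrightarrow> b \<in> F \<Longrightarrow> real_of_int (a - b) \<le> S + 1"
  shows "finite F" "real (card F) \<le> S + 2"
proof -
  obtain a0 where a0: "a0 \<in> F" using assms(1) by blast
  have "F \<subseteq> {a0 - \<lceil>S + 1\<rceil>..a0 + \<lceil>S + 1\<rceil>}"
  proof
    fix b assume b: "b \<in> F"
    have "a0 - b \<le> \<lceil>S + 1\<rceil>" "b - a0 \<le> \<lceil>S + 1\<rceil>" using assms(2)[OF a0 b] assms(2)[OF b a0] by linarith+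
    then show "b \<in> {a0 - \<lceil>S + 1\<rceil>..a0 + \<lceil>S + 1\<rceil>}" by auto
  qed
  then show fin: "finite F" by (rule finite_subset) simp
  have "F \<subseteq> {Min F..Max F}" using fin by auto
  then have "card F \<le> card {Min F..Max F}" by (intro card_mono) auto
  moreover have "Min F \<le> Max F" using fin assms(1) by (meson Max_ge Min_in)
  ultimately have "real (card F) \<le> real_of_int (Max F - Min F) + 1" by simp
  moreover have "real_of_int (Max F - Min F) \<le> S + 1" using fin assms(1) by (intro assms(2)) auto
  ultimately show "real (card F) \<le> S + 2" by simp
qed

context curve_system begin

text \<open>Number of the cell containing x in a division of the curve into N equal arcs. The extra
  value N occurs only at a point with prm x = L.\<close>

definition lab :: "nat \<Rightarrow> 'a \<Rightarrow> int" where
  "lab N x = \<lfloor>real N * prm x / L\<rfloor>"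

lemma lab_mem: "x \<in> X \<Longrightarrow> lab N x \<in> {0..int N}"
proof -
  assume "x \<in> X"
  then have x: "prm x \<in> {0..L}" by (rule prm_mem)
  have "real N * prm x \<le> real N * L" "0 \<le> real N * prm x" using x by (auto intro: mult_left_mono)
  then have "real N * prm x / L \<le> real N" "0 \<le> real N * prm x / L" using L by (auto simp: divide_le_eq)
  then show ?thesis unfolding lab_def by (simp add: floor_le_iff le_floor_iff)
qed

lemma simple_lab:
  assumes "sets \<mu> = sets (borel_on I)"
  shows "simple_function \<mu> (lab N)"
proof -
  have "lab N ` space \<mu> \<subseteq> {0..int N}" using lab_mem space_X[OF assms] by blast
  then have "finite (lab N ` space \<mu>)" by (rule finite_subset) simp
  moreover have "lab N \<in> measurable \<mu> (count_space UNIV)"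
    unfolding lab_def using prm_measurable[OF assms] by measurable
  ultimately show ?thesis
    unfolding simple_function_def using measurable_sets[of "lab N" \<mu> "count_space UNIV" "{_}"] by auto
qed

lemma lab_close:
  assumes "0 < N" "lab N x = lab N y"
  shows "\<bar>prm x - prm y\<bar> \<le> L / real N"
proof -
  have "\<bar>real N * prm x / L - real N * prm y / L\<bar> \<le> 1"
    using assms(2) unfolding lab_def by linarith
  moreover have "real N * prm x / L - real N * prm y / L = (prm x - prm y) / (L / real N)"
    using L by (simp add: field_simps)
  ultimately have "\<bar>prm x - prm y\<bar> / (L / real N) \<le> 1" using L by (simp add: abs_divide)
  moreover have "0 < L / real N" using L assms(1) by simp
  ultimately show ?thesis by (metis pos_divide_le_eq mult_1)
qed

text \<open>Under the q-th iterate of the lift a cell of length L / N around x has an image of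
  length at most (jac g q x + 1) * L / N, the 1 covering the variation of \<open>jac\<close> on the
  cell. This image meets at most jac g q x + 3 cells, and the logarithm of their number bounds the
  transition entropy. The additive 3 also takes care of critical points, and it is harmless once q
  is large.\<close>

theorem ruelle:
  assumes g: "smooth_map I g" and \<mu>: "invariant_prob I g \<mu>" "absolutely_continuous (lebesgue_on_curve I) \<mu>"
    and h: "ereal h1 < metric_entropy g \<mu>" and q: "0 < q"
  shows "real q * h1 \<le> (\<integral>x. ln (jac g q x + 3) \<partial>\<mu>)"
proof -
  have bp: "prob_space \<mu>" "sets \<mu> = sets (borel_on I)" and T: "g \<in> measurable \<mu> \<mu>" "distr \<mu> \<mu> g = \<mu>"
    using \<mu>(1) by (auto simp: invariant_prob_def borel_probs_def)
  interpret prob_space \<mu> by fact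
  have sp: "space \<mu> = X" by (rule space_X[OF bp(2)])
  obtain P where P: "finite_partition \<mu> P" "ereal h1 < entropy_wrt g \<mu> P"
    using h unfolding metric_entropy_def less_SUP_iff by blast
  obtain G G' where G: "\<forall>t\<in>J. G t \<in> J" "\<forall>t\<in>J. p (G t) = g (p t)"
    "\<forall>t\<in>J. (G has_real_derivative G' t) (at t within J)"
    "\<forall>t\<in>J. \<bar>G' t\<bar> = abs_deriv I g (p t)"
    by (rule smooth_lift[OF g, of 0])
  note jacG = lift_jac[OF G(1,2,4)]
  \<comment> \<open>Removes a possible point with the exceptional label N; it has measure zero by
    absolute continuity.\<close>
  define \<Omega> where "\<Omega> = {x \<in> X. prm x \<noteq> L}"
  have \<Omega>c: "X - \<Omega> \<in> null_sets \<mu>"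
  proof -
    have "X - \<Omega> = {x \<in> X. prm x \<in> {L}}" by (auto simp: \<Omega>_def)
    then show ?thesis using null_prm[OF bp(2) \<mu>(2) countable_imp_null_set_lborel[of "{L}"]] by simp
  qed
  have \<Omega>: "\<Omega> \<in> events" "prob \<Omega> = 1"
  proof -
    have eq: "\<Omega> = space \<mu> - (X - \<Omega>)" by (auto simp: \<Omega>_def sp)
    show "\<Omega> \<in> events" using \<Omega>c by (subst eq) auto
    have "prob (X - \<Omega>) = 0" using \<Omega>c by (rule measure_eq_0_null_sets)
    then show "prob \<Omega> = 1" using \<Omega>c prob_compl[of "X - \<Omega>"] by (subst eq) auto
  qed
  have jm: "(\<lambda>x. ln (jac g q x + 3)) \<in> borel_measurable \<mu>"
    using measurable_X[OF bp(2) jac_continuous[OF g]] by measurable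
  obtain Bj where Bj: "\<And>x. x \<in> X \<Longrightarrow> jac g q x \<le> Bj"
  proof -
    have "bounded (jac g q ` X)"
      by (intro compact_imp_bounded compact_continuous_image jac_continuous g compact_X)
    then obtain b where "\<forall>y\<in>jac g q ` X. norm y \<le> b" unfolding bounded_iff by blast
    then show ?thesis using that[of b] by fastforce
  qed
  have jint: "integrable \<mu> (\<lambda>x. ln (jac g q x + 3))"
  proof (rule integrable_const_bound[where B = "ln (Bj + 3)"])
    show "AE x in \<mu>. norm (ln (jac g q x + 3)) \<le> ln (Bj + 3)"
    proof (rule AE_I2)
      fix x assume "x \<in> space \<mu>"
      then have "0 \<le> ln (jac g q x + 3)" "ln (jac g q x + 3) \<le> ln (Bj + 3)"
        using Bj[of x] jac_nonneg[of g q x] sp by (auto simp: ln_ge_zero)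
      then show "norm (ln (jac g q x + 3)) \<le> ln (Bj + 3)" by simp
    qed
  qed (rule jm)
  have main: "real q * h1 \<le> (\<integral>x. ln (jac g q x + 3) \<partial>\<mu>) + \<eta>" if \<eta>: "0 < \<eta>" for \<eta>
  proof -
    have simR: "simple_function \<mu> (itin (atom_of P) g q)" by (rule simple_itin[OF T simple_atom_of[OF P(1)]])
    obtain d where d: "d > 0" "\<And>(Q :: 'a \<Rightarrow> int) \<Omega>. simple_function \<mu> Q \<Longrightarrow> \<Omega> \<in> events \<Longrightarrow> prob \<Omega> = 1 \<Longrightarrow>
      (\<forall>x\<in>\<Omega>. \<forall>y\<in>\<Omega>. Q x = Q y \<longrightarrow> dist x y < d) \<Longrightarrow> Hent (\<lambda>\<omega>. (itin (atom_of P) g q \<omega>, Q \<omega>)) - Hent Q \<le> \<eta>"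
      using Hent_fine_partition[OF prob_space_axioms bp(2)[unfolded borel_on_def] compact_X(2) simR \<eta>] by blast
    obtain e1 where e1: "e1 > 0" "\<And>s t. s \<in> {0..L} \<Longrightarrow> t \<in> {0..L} \<Longrightarrow> \<bar>s - t\<bar> < e1 \<Longrightarrow> dist (p s) (p t) < d"
      using compact_uniformly_continuous[OF cont_L compact_Icc] d(1)
        unfolding uniformly_continuous_on_def dist_real_def by metis
    have "continuous_on {0..L} (\<lambda>t. jac g q (p t))"
      by (rule continuous_on_compose2[OF jac_continuous[OF g] cont_L]) (use surj(1) in auto)
    from compact_uniformly_continuous[OF this compact_Icc]
    obtain e2 where e2: "e2 > 0" "\<And>s t. s \<in> {0..L} \<Longrightarrow> t \<in> {0..L} \<Longrightarrow> \<bar>s - t\<bar> < e2 \<Longrightarrow>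
      \<bar>jac g q (p s) - jac g q (p t)\<bar> < 1"
      unfolding uniformly_continuous_on_def dist_real_def by (metis zero_less_one)
    define e where "e = min e1 e2"
    have e: "0 < e" using e1 e2 by (simp add: e_def)
    obtain N :: nat where N: "L / e < real N" using reals_Archimedean2 by blast
    have N0: "0 < N" "L / real N < e"
    proof -
      have "0 < L / e" using L e by simp
      then show "0 < N" using N by (intro gr0I) auto
      then show "L / real N < e" using N e by (simp add: field_simps)
    qed
    let ?Q = "lab N"
    have Q: "simple_function \<mu> ?Q" by (rule simple_lab[OF bp(2)])
    have D: "Hent (\<lambda>\<omega>. (itin (atom_of P) g q \<omega>, ?Q \<omega>)) - Hent ?Q \<le> \<eta>"
    proof (rule d(2)[OF Q \<Omega>], intro ballI impI)
      fix x y assume xy: "x \<in> \<Omega>" "y \<in> \<Omega>" "lab N x = lab N y"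
      then have X: "x \<in> X" "y \<in> X" by (auto simp: \<Omega>_def)
      have "\<bar>prm x - prm y\<bar> < e1" using lab_close[OF N0(1) xy(3)] N0(2) by (simp add: e_def)
      then show "dist x y < d" using e1(2)[OF prm_mem(1)[OF X(1)] prm_mem(1)[OF X(2)]] prm(2) X by simp
    qed
    define cl where "cl c = {real_of_int c * L / N .. (real_of_int c + 1) * L / N} \<inter> {0..L}" for c :: int
    \<comment> \<open>The lift may leave {0..L}; counting is done on the line, where images of cells
      are intervals, and \<open>reach\<close> then reduces the labels modulo N.\<close>
    define fl where "fl c = (\<lambda>t. \<lfloor>real N * (G ^^ q) t / L\<rfloor>) ` cl c" for c
    define reach where "reach c = (\<lambda>z. z mod int N) ` fl c" for c
    have prmcl: "prm x \<in> cl (lab N x)" if "x \<in> X" for x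
    proof -
      have "real_of_int (lab N x) \<le> real N * prm x / L" "real N * prm x / L \<le> real_of_int (lab N x) + 1"
        unfolding lab_def by linarith+
      then show ?thesis using prm_mem(1)[OF that] L N0(1) by (auto simp: cl_def field_simps)
    qed
    have card: "finite (reach (lab N x))" "0 < card (reach (lab N x))" "real (card (reach (lab N x))) \<le>
      jac g q x + 3" if x: "x \<in> X" for x
    proof -
      let ?c = "lab N x"
      have ne: "fl ?c \<noteq> {}" using prmcl[OF x] by (auto simp: fl_def)
      have sub: "cl ?c \<subseteq> {0..L}" "convex (cl ?c)" by (auto simp: cl_def intro: convex_Int)
      have diff: "\<bar>(G ^^ q) s - (G ^^ q) t\<bar> \<le> (jac g q x + 1) * \<bar>s - t\<bar>" if st: "s \<in> cl ?c" "t \<in> cl ?c" for s t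
      proof (rule bound_within[OF sub(2)])
        fix z assume z: "z \<in> cl ?c"
        have zJ: "z \<in> J" using z sub dom by blast
        show "((G ^^ q) has_real_derivative dprod G G' q z) (at z within cl ?c)"
          by (rule has_field_derivative_subset[OF dprod_derivative[OF G(1,3) zJ]]) (use sub dom in auto)
        have "\<bar>z - prm x\<bar> \<le> L / real N" using z prmcl[OF x]
          by (auto simp: cl_def add_divide_distrib distrib_right abs_le_iff)
        then have "\<bar>z - prm x\<bar> < e2" using N0(2) by (simp add: e_def)
        then have "\<bar>jac g q (p z) - jac g q x\<bar> < 1"
          using e2(2)[of z "prm x"] z sub prm_mem(1)[OF x] prm(2)[OF x] by auto
        then show "\<bar>dprod G G' q z\<bar> \<le> jac g q x + 1" unfolding jacG[OF zJ] by simp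
      qed (use st in auto)
      have "real_of_int (a - b) \<le> (jac g q x + 1) + 1" if ab: "a \<in> fl ?c" "b \<in> fl ?c" for a b
      proof -
        obtain s t where st: "s \<in> cl ?c" "t \<in> cl ?c" "a = \<lfloor>real N * (G ^^ q) s / L\<rfloor>"
          "b = \<lfloor>real N * (G ^^ q) t / L\<rfloor>"
          using ab by (auto simp: fl_def)
        have "\<bar>s - t\<bar> \<le> L / real N" using st by (auto simp: cl_def add_divide_distrib distrib_right abs_le_iff)
        then have "(jac g q x + 1) * \<bar>s - t\<bar> \<le> (jac g q x + 1) * (L / real N)"
          using jac_nonneg[of g q x] by (intro mult_left_mono) auto
        then have "(G ^^ q) s - (G ^^ q) t \<le> (jac g q x + 1) * (L / real N)" using diff[OF st(1,2)] by linarith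
        then have "(real N / L) * ((G ^^ q) s - (G ^^ q) t) \<le> (real N / L) * ((jac g q x + 1) * (L / real N))"
          using L by (intro mult_left_mono) auto
        then have "real N * (G ^^ q) s / L - real N * (G ^^ q) t / L \<le> jac g q x + 1"
          using L N0(1) by (simp add: right_diff_distrib)
        then show ?thesis unfolding st(3,4) by linarith
      qed
      from card_int_le[OF ne this] have fin: "finite (fl ?c)" "real (card (fl ?c)) \<le> jac g q x + 3" by auto
      show "finite (reach ?c)" using fin(1) by (simp add: reach_def)
      then show "0 < card (reach ?c)" using ne by (simp add: card_gt_0_iff reach_def)
      have "card (reach ?c) \<le> card (fl ?c)" unfolding reach_def using fin(1) by (rule card_image_le)
      then show "real (card (reach ?c)) \<le> jac g q x + 3" using fin(2) by linarith
    qed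
    \<comment> \<open>With uniform weights on the reachable cells Gibbs' inequality becomes a bound
      by the logarithm of their number.\<close>
    define r where "r b c = (if b \<in> reach c then 1 / real (card (reach c)) else 0)" for b c
    have in_reach: "lab N ((g ^^ q) x) \<in> reach (lab N x)" if x: "x \<in> X" "(g ^^ q) x \<in> \<Omega>" for x
    proof -
      let ?t = "prm x" and ?y = "(g ^^ q) x"
      have tJ: "?t \<in> J" by (rule prm_mem(2)[OF x(1)])
      have yX: "?y \<in> X" by (rule funpow_X[OF g x(1)])
      have "p (prm ?y) = p ((G ^^ q) ?t)"
        using prm(2)[OF yX] prm(2)[OF x(1)] lift_funpow(2)[OF G(1,2) tJ] by simp
      from period[OF prm_mem(2)[OF yX] lift_funpow(1)[OF G(1,2) tJ] this]
      obtain k :: int where k: "prm ?y = (G ^^ q) ?t + k * L" by blast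
      have "real N * prm ?y / L = real N * (G ^^ q) ?t / L + real_of_int (int N * k)"
        unfolding k using L by (simp add: field_simps)
      then have "lab N ?y = \<lfloor>real N * (G ^^ q) ?t / L\<rfloor> + int N * k" unfolding lab_def
        by (simp only: floor_add_int[symmetric])
      then have m: "lab N ?y mod int N = \<lfloor>real N * (G ^^ q) ?t / L\<rfloor> mod int N" by simp
      have "prm ?y < L" using x(2) prm_mem(1)[OF yX] by (auto simp: \<Omega>_def)
      then have "real N * prm ?y / L < real N" using L N0(1) by (simp add: divide_less_eq)
      then have "lab N ?y < int N" unfolding lab_def by (simp add: floor_less_iff)
      moreover have "0 \<le> lab N ?y" using lab_mem[OF yX] by simp
      ultimately have "lab N ?y mod int N = lab N ?y" by simp
      then show ?thesis using m prmcl[OF x(1)] unfolding reach_def fl_def by (metis imageI)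
    qed
    have kappa: "Hent (\<lambda>\<omega>. (?Q ((g ^^ q) \<omega>), ?Q \<omega>)) - Hent ?Q \<le> (\<integral>x. ln (jac g q x + 3) \<partial>\<mu>)"
    proof -
      have Qq: "simple_function \<mu> (\<lambda>\<omega>. ?Q ((g ^^ q) \<omega>))" by (rule simple_funpow[OF T Q])
      have AEr: "AE x in \<mu>. lab N ((g ^^ q) x) \<in> reach (lab N x)"
      proof -
        have "AE x in \<mu>. x \<in> \<Omega>" using \<Omega>c sp by (intro AE_I'[OF \<Omega>c]) auto
        then have "AE x in distr \<mu> \<mu> (g ^^ q). x \<in> \<Omega>" by (subst funpow_preserving(2)[OF T])
        then have "AE x in \<mu>. (g ^^ q) x \<in> \<Omega>" using \<Omega>(1)
          by (subst (asm) AE_distr_iff[OF funpow_preserving(1)[OF T]]) auto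
        then show ?thesis using AE_space by eventually_elim (use in_reach sp in auto)
      qed
      have "Hent (\<lambda>\<omega>. (?Q ((g ^^ q) \<omega>), ?Q \<omega>)) - Hent ?Q \<le> (\<integral>\<omega>. - ln (r (?Q ((g ^^ q) \<omega>)) (?Q \<omega>)) \<partial>\<mu>)"
      proof (rule Gibbs_conditional[OF Qq Q])
        show "0 \<le> r x y" for x y by (simp add: r_def)
        show "AE \<omega> in \<mu>. 0 < r (?Q ((g ^^ q) \<omega>)) (?Q \<omega>)"
          using AEr AE_space by eventually_elim (use card sp in \<open>auto simp: r_def\<close>)
        fix y assume "y \<in> ?Q ` space \<mu>"
        then obtain x where x: "x \<in> X" "y = lab N x" using sp by blast
        have "(\<Sum>b\<in>(\<lambda>\<omega>. ?Q ((g ^^ q) \<omega>)) ` space \<mu>. r b y) \<le> (\<Sum>b\<in>reach y \<union> (\<lambda>\<omega>. ?Q ((g ^^ q) \<omega>)) ` space \<mu>. r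
          b y)"
          using card(1)[OF x(1)] x simple_functionD(1)[OF Qq] by (intro sum_mono2) (auto simp: r_def)
        also have "\<dots> = (\<Sum>b\<in>reach y. r b y)"
          using card(1)[OF x(1)] x simple_functionD(1)[OF Qq]
            by (intro sum.mono_neutral_right) (auto simp: r_def)
        also have "\<dots> = (\<Sum>b\<in>reach y. 1 / real (card (reach y)))" by (intro sum.cong) (auto simp: r_def)
        also have "\<dots> \<le> 1" by simp
        finally show "(\<Sum>b\<in>(\<lambda>\<omega>. ?Q ((g ^^ q) \<omega>)) ` space \<mu>. r b y) \<le> 1" .
      qed
      also have "\<dots> \<le> (\<integral>x. ln (jac g q x + 3) \<partial>\<mu>)"
      proof (rule integral_mono_AE[OF _ jint])
        show "integrable \<mu> (\<lambda>\<omega>. - ln (r (?Q ((g ^^ q) \<omega>)) (?Q \<omega>)))"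
          using simple_integral_sum(1)[OF simple_function_Pair[OF Qq Q], of "\<lambda>z. - ln (r (fst z) (snd z))"]
            by simp
        show "AE x in \<mu>. - ln (r (?Q ((g ^^ q) x)) (?Q x)) \<le> ln (jac g q x + 3)"
          using AEr AE_space
        proof eventually_elim
          case (elim x)
          then have x: "x \<in> X" using sp by simp
          have "- ln (r (?Q ((g ^^ q) x)) (?Q x)) = ln (real (card (reach (?Q x))))"
            using elim(1) card(2)[OF x] by (simp add: r_def ln_div)
          also have "\<dots> \<le> ln (jac g q x + 3)" using card(2,3)[OF x] by simp
          finally show ?case .
        qed
      qed
      finally show ?thesis .
    qed
    have "entropy_wrt g \<mu> P \<le> ereal (((\<integral>x. ln (jac g q x + 3) \<partial>\<mu>) + \<eta>) / real q)"
      by (rule entropy_wrt_le[OF T P(1) Q q kappa D])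
    from less_le_trans[OF P(2) this] have "h1 < ((\<integral>x. ln (jac g q x + 3) \<partial>\<mu>) + \<eta>) / real q" by simp
    then show ?thesis using q by (simp add: pos_less_divide_eq mult.commute)
  qed
  show ?thesis by (rule field_le_epsilon) (use main in auto)
qed

end

text \<open>The bound C' depends on C, n and k only and precedes G in the quantifiers, so one
  constant serves every map with the given derivative bounds.\<close>

lemma iterate_bnd:
  assumes "0 \<le> C"
  shows "\<exists>C'\<ge>0. \<forall>S G G'. (\<forall>x\<in>S. G x \<in> S) \<longrightarrow> (\<forall>x\<in>S. (G has_real_derivative G' x) (at x within S)) \<longrightarrow>
    bnd n C S G' \<longrightarrow> bnd n C' S (dprod G G' k)"
proof (induction k)
  case 0
  show ?case by (intro exI[of _ 1]) (auto intro: bnd_const)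
next
  case (Suc k)
  then obtain C' where C': "0 \<le> C'" "\<And>S G G'. (\<forall>x\<in>S. G x \<in> S) \<Longrightarrow>
    (\<forall>x\<in>S. (G has_real_derivative G' x) (at x within S)) \<Longrightarrow>
    bnd n C S G' \<Longrightarrow> bnd n C' S (dprod G G' k)" by blast
  have c1: "0 \<le> comp_const n C" using comp_const_ge_1[OF assms, of n] by simp
  show ?case
  proof (intro exI[of _ "2 ^ n * (C * (comp_const n C * C'))"] conjI allI impI)
    show "0 \<le> 2 ^ n * (C * (comp_const n C * C'))" using assms C'(1) c1 by simp
    fix S :: "real set" and G G' :: "real \<Rightarrow> real"
    assume G: "\<forall>x\<in>S. G x \<in> S" "\<forall>x\<in>S. (G has_real_derivative G' x) (at x within S)" "bnd n C S G'"
    have "bnd (n - 1) C S G'" using G(3) bnd_Suc_D[of "n - 1"] by (cases n) auto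
    then have "bnd n (comp_const n C * C') S (\<lambda>x. dprod G G' k (G x))"
      using G assms C' by (intro bnd_comp[where T = S and u' = G']) auto
    from bnd_mult[OF G(3) this] show "bnd n (2 ^ n * (C * (comp_const n C * C'))) S (dprod G G' (Suc k))"
      using assms C'(1) c1 by (simp add: dprod_Suc[abs_def])
  qed
qed

lemma dprod_add: "dprod G G' (k + m) t = dprod G G' k t * dprod G G' m ((G ^^ k) t)"
  by (induction k arbitrary: t) (auto simp: dprod_Suc funpow_swap1)

lemma dprod_iterate: "dprod (G ^^ k) (dprod G G' k) N t = dprod G G' (k * N) t"
  by (induction N arbitrary: t) (auto simp: dprod_Suc dprod_add)

section \<open>The core inequality with uniform constants\<close>

context curve_system begin

lemma funpow_preserves:
  assumes \<mu>: "invariant_prob I g \<mu>" and S: "S \<in> sets \<mu>"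
  shows "measure \<mu> {x \<in> X. (g ^^ i) x \<in> S} = measure \<mu> S"
proof -
  have bp: "prob_space \<mu>" "sets \<mu> = sets (borel_on I)" and T: "g \<in> measurable \<mu> \<mu>" "distr \<mu> \<mu> g = \<mu>"
    using \<mu> by (auto simp: invariant_prob_def borel_probs_def)
  note fp = prob_space.funpow_preserving[OF bp(1) T]
  have "measure \<mu> S = measure (distr \<mu> \<mu> (g ^^ i)) S" by (simp add: fp(2))
  also have "\<dots> = measure \<mu> ((g ^^ i) -` S \<inter> space \<mu>)" by (rule measure_distr[OF fp(1) S])
  also have "(g ^^ i) -` S \<inter> space \<mu> = {x \<in> X. (g ^^ i) x \<in> S}" using space_X[OF bp(2)] by auto
  finally show ?thesis by simp
qed

lemma jac_le:
  assumes "smooth_map I g" "\<And>x. x \<in> X \<Longrightarrow> abs_deriv I g x \<le> exp a" "x \<in> X"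
  shows "jac g q x \<le> exp (a * real q)"
proof -
  have "jac g q x \<le> (\<Prod>i<q. exp a)"
    unfolding jac_def using funpow_X[OF assms(1,3)] assms(2) by (intro prod_mono) (auto simp: abs_deriv_def)
  then show ?thesis by (simp add: exp_of_nat2_mult)
qed

lemma jac_set:
  assumes "smooth_map I g" "sets \<mu> = sets (borel_on I)"
  shows "{x \<in> X. c \<le> jac g q x} \<in> sets \<mu>"
proof -
  have "closed {x \<in> X. c \<le> jac g q x}"
    using jac_continuous[OF assms(1)] compact_X(2) by (intro continuous_on_closed_Collect_le) auto
  then show ?thesis by (subst sets_X[OF assms(2)]) auto
qed

text \<open>By Ruelle's inequality the mean of ln (jac g q + 3) is at least q * h1, while the
  function never exceeds ln 4 + a * q. Where \<open>jac\<close> is below exp (h1 / 2 * q) it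
  accounts for only half of the mean, up to ln 4 \<le> 3; the condition q \<ge> 12 / h1 absorbs the
  3 into a quarter of q * h1, and the remaining quarter forces the measure h1 / (4 * a).\<close>

lemma fast_points:
  assumes g: "smooth_map I g" and \<mu>: "invariant_prob I g \<mu>" "absolutely_continuous (lebesgue_on_curve I) \<mu>"
    and h: "ereal h1 < metric_entropy g \<mu>" "0 < h1" and a: "1 \<le> a" "\<And>x. x \<in> X \<Longrightarrow> abs_deriv I g x \<le> exp a"
    and q: "0 < q" "12 / h1 \<le> real q"
  shows "h1 / (4 * a) \<le> measure \<mu> {x \<in> X. exp (h1 / 2 * real q) \<le> jac g q x}"
proof -
  have bp: "prob_space \<mu>" "sets \<mu> = sets (borel_on I)"
    using \<mu>(1) by (auto simp: invariant_prob_def borel_probs_def)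
  interpret prob_space \<mu> by fact
  let ?S = "{x \<in> X. exp (h1 / 2 * real q) \<le> jac g q x}"
  have S: "?S \<in> events" by (rule jac_set[OF g bp(2)])
  have ln4: "ln (4::real) \<le> 3" using ln_le_minus_one[of "4::real"] by simp
  have b: "ln (jac g q x + 3) \<le> ln 4 + h1 / 2 * real q + a * real q * indicator ?S x" if x: "x \<in> X" for x
  proof (cases "x \<in> ?S")
    case True
    have "jac g q x + 3 \<le> 4 * exp (a * real q)"
    proof -
      have "1 \<le> exp (a * real q)" using a(1) by simp
      then show ?thesis using jac_le[OF g a(2) x, of q] by linarith
    qed
    then have "ln (jac g q x + 3) \<le> ln (4 * exp (a * real q))" using jac_nonneg[of g q x]
      by (intro ln_mono) auto
    also have "\<dots> = ln 4 + a * real q" by (simp add: ln_mult)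
    finally have "ln (jac g q x + 3) \<le> ln 4 + a * real q" .
    moreover have "0 \<le> h1 / 2 * real q" using h(2) by simp
    moreover have "indicat_real ?S x = 1" using True by (rule indicator_simps)
    ultimately show ?thesis by simp
  next
    case False
    then have "jac g q x \<le> exp (h1 / 2 * real q)" using x by auto
    moreover have "1 \<le> exp (h1 / 2 * real q)" using h(2) by simp
    ultimately have "jac g q x + 3 \<le> 4 * exp (h1 / 2 * real q)" by linarith
    then have "ln (jac g q x + 3) \<le> ln (4 * exp (h1 / 2 * real q))" using jac_nonneg[of g q x]
      by (intro ln_mono) auto
    also have "\<dots> = ln 4 + h1 / 2 * real q" by (simp add: ln_mult)
    finally show ?thesis using False by simp
  qed
  have int: "integrable \<mu> (\<lambda>x. ln 4 + h1 / 2 * real q + a * real q * indicator ?S x)"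
    using S by (intro Bochner_Integration.integrable_add integrable_mult_right integrable_real_indicator)
      (auto simp: emeasure_eq_measure)
  have "real q * h1 \<le> (\<integral>x. ln (jac g q x + 3) \<partial>\<mu>)" by (rule ruelle[OF g \<mu> h(1) q(1)])
  also have "\<dots> \<le> (\<integral>x. ln 4 + h1 / 2 * real q + a * real q * indicator ?S x \<partial>\<mu>)"
    using b space_X[OF bp(2)] h(2) a(1)
      by (intro integral_mono' int) (auto intro!: add_nonneg_nonneg mult_nonneg_nonneg)
  also have "\<dots> = ln 4 + h1 / 2 * real q + a * real q * prob ?S"
    using S by (subst Bochner_Integration.integral_add) (auto simp: prob_space emeasure_eq_measure
      Int_absorb2[OF sets.sets_into_space])
  finally have "real q * h1 \<le> ln 4 + h1 / 2 * real q + a * real q * prob ?S" .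
  moreover have "h1 / 2 * real q = real q * h1 / 2" by simp
  ultimately have "real q * h1 / 2 \<le> 3 + a * real q * prob ?S" using ln4 by linarith
  moreover have "3 \<le> real q * h1 / 4" using q h(2) by (simp add: field_simps)
  ultimately have "real q * (h1 / 4) \<le> real q * (a * prob ?S)" by (simp add: field_simps)
  then have "h1 / 4 \<le> a * prob ?S" using q(1) by simp
  then show ?thesis using a(1) by (simp add: field_simps)
qed

text \<open>The order of the quantifiers is the point. The order n, the lower bound \<beta>' and the
  threshold k0 depend on h1 and a alone. K depends in addition on the iterate k and on a bound B for
  finitely many derivatives; map, measure and intervals come last. So a whole convergent sequence of
  maps is served at once, and k may be enlarged without loss in \<beta>'.\<close>

theorem core_inequality:
  assumes h1: "0 < h1" and a: "1 \<le> a"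
  shows "\<exists>n \<beta>' k0. 0 < \<beta>' \<and> (\<forall>k\<ge>k0. \<forall>B. \<exists>K\<ge>0. \<forall>g \<mu> (r::nat) u v U.
    smooth_map I g \<longrightarrow> (\<forall>i\<le>Suc n. \<forall>t\<in>J. norm (nth_deriv J i (g \<circ> p) t) \<le> B) \<longrightarrow>
    (\<forall>x\<in>X. abs_deriv I g x \<le> exp a) \<longrightarrow> invariant_prob I g \<mu> \<longrightarrow> absolutely_continuous (lebesgue_on_curve I) \<mu> \<longrightarrow>
    ereal h1 < metric_entropy g \<mu> \<longrightarrow> U \<in> sets \<mu> \<longrightarrow> (\<forall>j<r. u j \<le> v j \<and> v j - u j \<le> L / 2) \<longrightarrow>
    U \<subseteq> p ` ((\<Union>j<r. {u j<..<v j}) \<inter> J) \<longrightarrow>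
    \<beta>' \<le> K * (\<Sum>j<r. v j - u j) + measure \<mu> {x \<in> X. exp (h1 / 16 * real k) \<le> jac g k x \<and> (g ^^ k) x \<notin> U})"
proof -
  \<comment> \<open>n \<ge> 32 * a / h1 limits the price 2 / n * ln A of critical points to h1 / 16
    * k.\<close>
  define n where "n = Suc (nat \<lceil>32 * a / h1\<rceil>)"
  \<comment> \<open>The good times cost \<beta> * ln (4 * A); with this \<beta> that is at most h1 /
    32 * k + 3 * h1 / 32.\<close>
  define \<beta> where "\<beta> = h1 / (32 * a)"
  define Q where "Q = 8 * cover_const n"
  have n: "1 \<le> n" "32 * a / h1 \<le> real n" unfolding n_def by (simp, simp, linarith)
  have Q: "0 < Q" using cover_const(1)[OF n(1)] by (simp add: Q_def)
  have \<beta>: "0 < \<beta>" using h1 a by (simp add: \<beta>_def)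
  \<comment> \<open>The constant Q per step of the iterate is beaten once k is large.\<close>
  obtain k0 :: nat where k0: "4 * ln Q / h1 < real k0" using reals_Archimedean2 by blast
  show ?thesis
  proof (rule exI[of _ n], rule exI[of _ "\<beta> * (h1 / (4 * a))"], rule exI[of _ "Suc k0"], intro conjI allI impI)
    show "0 < \<beta> * (h1 / (4 * a))" using \<beta> h1 a by simp
    fix k B assume "Suc k0 \<le> k"
    then have k: "1 \<le> k" "4 * ln Q / h1 < real k" using k0 by auto
    obtain C where C: "0 \<le> C" and lift': "\<And>g. smooth_map I g \<Longrightarrow>
      (\<forall>i\<le>Suc n. \<forall>t\<in>J. norm (nth_deriv J i (g \<circ> p) t) \<le> B) \<Longrightarrow>
      (\<exists>G G'. (\<forall>t\<in>J. G t \<in> J \<and> p (G t) = g (p t) \<and>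
          (G has_real_derivative G' t) (at t within J) \<and> \<bar>G' t\<bar> = abs_deriv I g (p t)) \<and> bnd n C J G')"
      using lift[of n B] by blast
    obtain M where M: "0 \<le> M" "\<And>S G G'. (\<forall>x\<in>S. G x \<in> S) \<Longrightarrow> (\<forall>x\<in>S. (G has_real_derivative G' x) (at x within S)) \<Longrightarrow>
      bnd n C S G' \<Longrightarrow> bnd n M S (dprod G G' k)" using iterate_bnd[OF C, of n k] by blast
    define A where "A = exp (a * real k)"
    define E where "E = exp (h1 / 16 * real k)"
    \<comment> \<open>L / 8 leaves the gap 4 * \<epsilon> between translates of intervals of length
      at most L / 2; A / (M + 1) gives M * \<epsilon> \<le> A.\<close>
    define \<epsilon> where "\<epsilon> = min (min 1 (L / 8)) (A / (M + 1))"
    have A: "1 \<le> A" using a by (simp add: A_def)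
    have E: "1 \<le> E" using h1 by (simp add: E_def)
    have \<epsilon>: "0 < \<epsilon>" "\<epsilon> \<le> 1" "\<epsilon> \<le> L / 8" "M * \<epsilon> \<le> A"
    proof -
      show "0 < \<epsilon>" using L A M(1) by (simp add: \<epsilon>_def)
      show "\<epsilon> \<le> 1" "\<epsilon> \<le> L / 8" unfolding \<epsilon>_def by (metis min.cobounded1 min.cobounded2 order_trans)+
      have "M * \<epsilon> \<le> (M + 1) * (A / (M + 1))" using M(1) A \<open>0 < \<epsilon>\<close> by (intro mult_mono) (auto simp: \<epsilon>_def)
      then show "M * \<epsilon> \<le> A" using M(1) by simp
    qed
    \<comment> \<open>The budget is h1 * k / 2: the constant Q takes less than 1/4 of h1 * k, the
      threshold E and the critical points 1/16 each, and the good times 1/32 + 3/32. The shares add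
      up to exactly 1/2, and the first one is strict.\<close>
    have \<gamma>: "0 < h1 / 2 * real k - ln (8 * cover_const n * E) - 2 / real n * ln A - \<beta> * ln (4 * A)"
    proof -
      have 1: "ln (8 * cover_const n * E) = ln Q + h1 / 16 * real k"
        using Q unfolding Q_def[symmetric] by (simp add: ln_mult E_def)
      have "2 / real n * ln A = (2 * a / real n) * real k" by (simp add: A_def)
      also have "\<dots> \<le> (h1 / 16) * real k"
        using n h1 a by (intro mult_right_mono) (auto simp: field_simps)
      finally have 2: "2 / real n * ln A \<le> h1 / 16 * real k" .
      have ln4: "ln (4::real) \<le> 3" using ln_le_minus_one[of "4::real"] by simp
      have "\<beta> * ln (4 * A) = \<beta> * ln 4 + \<beta> * a * real k" by (simp add: A_def ln_mult distrib_left)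
      also have "\<beta> * a = h1 / 32" using a by (simp add: \<beta>_def)
      also have "\<beta> * ln 4 \<le> h1 / 32 * 3"
      proof (rule mult_mono[OF _ ln4])
        have "h1 / (32 * a) \<le> h1 / (32 * 1)" using h1 a by (intro divide_left_mono) auto
        then show "\<beta> \<le> h1 / 32" by (simp add: \<beta>_def)
      qed (use h1 in auto)
      finally have 3: "\<beta> * ln (4 * A) \<le> h1 * 3 / 32 + h1 / 32 * real k" by simp
      have 4: "ln Q < h1 / 4 * real k" using k(2) h1 by (simp add: field_simps)
      have "h1 * 1 \<le> h1 * real k" using h1 k by (intro mult_left_mono) auto
      then show ?thesis using 1 2 3 4 by linarith
    qed
    show "\<exists>K\<ge>0. \<forall>g \<mu> (r::nat) u v U.
      smooth_map I g \<longrightarrow> (\<forall>i\<le>Suc n. \<forall>t\<in>J. norm (nth_deriv J i (g \<circ> p) t) \<le> B) \<longrightarrow>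
      (\<forall>x\<in>X. abs_deriv I g x \<le> exp a) \<longrightarrow> invariant_prob I g \<mu> \<longrightarrow> absolutely_continuous (lebesgue_on_curve I) \<mu> \<longrightarrow>
      ereal h1 < metric_entropy g \<mu> \<longrightarrow> U \<in> sets \<mu> \<longrightarrow> (\<forall>j<r. u j \<le> v j \<and> v j - u j \<le> L / 2) \<longrightarrow>
      U \<subseteq> p ` ((\<Union>j<r. {u j<..<v j}) \<inter> J) \<longrightarrow>
      \<beta> * (h1 / (4 * a)) \<le> K * (\<Sum>j<r. v j - u j) + measure \<mu> {x \<in> X. exp (h1 / 16 * real k) \<le> jac g k x \<and> (g
        ^^ k) x \<notin> U}"
    proof (intro exI[of _ "8 / \<epsilon>"] conjI allI impI)
      show "0 \<le> 8 / \<epsilon>" using \<epsilon> by simp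
      fix g \<mu> and r :: nat and u v U
      assume g: "smooth_map I g" "\<forall>i\<le>Suc n. \<forall>t\<in>J. norm (nth_deriv J i (g \<circ> p) t) \<le> B"
        and ga: "\<forall>x\<in>X. abs_deriv I g x \<le> exp a"
          and \<mu>: "invariant_prob I g \<mu>" "absolutely_continuous (lebesgue_on_curve I) \<mu>"
        and h: "ereal h1 < metric_entropy g \<mu>" and U: "U \<in> sets \<mu>" and uv: "\<forall>j<r. u j \<le> v j \<and> v j - u j \<le> L / 2"
        and Uuv: "U \<subseteq> p ` ((\<Union>j<r. {u j<..<v j}) \<inter> J)"
      have bp: "prob_space \<mu>" "sets \<mu> = sets (borel_on I)"
        using \<mu>(1) by (auto simp: invariant_prob_def borel_probs_def)
      interpret prob_space \<mu> by fact
      have sp: "space \<mu> = X" by (rule space_X[OF bp(2)])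
      obtain G G' where G0: "\<forall>t\<in>J. G t \<in> J \<and> p (G t) = g (p t) \<and>
          (G has_real_derivative G' t) (at t within J) \<and> \<bar>G' t\<bar> = abs_deriv I g (p t)" and Gb: "bnd n C J G'"
        using lift'[OF g] by blast
      have G: "\<forall>t\<in>J. G t \<in> J" "\<forall>t\<in>J. p (G t) = g (p t)" "\<forall>t\<in>J. (G has_real_derivative G' t) (at t within J)"
        "\<forall>t\<in>J. \<bar>G' t\<bar> = abs_deriv I g (p t)" using G0 by auto
      note jacG = lift_jac[OF G(1,2,4)]
      define F where "F = G ^^ k"
      define F' where "F' = dprod G G' k"
      have Fi: "F ^^ i = G ^^ (k * i)" for i by (simp add: F_def funpow_mult)
      interpret S: smooth_bounds J F F' A M n \<epsilon> E
      proof
        fix x assume x: "x \<in> J"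
        show "F x \<in> J" unfolding F_def by (rule lift_funpow(1)[OF G(1,2) x])
        show "(F has_real_derivative F' x) (at x within J)" unfolding F_def F'_def
          by (rule dprod_derivative[OF G(1,3) x])
        show "\<bar>F' x\<bar> \<le> A" unfolding F'_def jacG[OF x] A_def by (rule jac_le[OF g(1)]) (use ga p_X[OF x] in auto)
      qed (use n M(1) A E \<epsilon> M(2)[OF G(1,3) Gb] in \<open>auto simp: F'_def\<close>)
      define \<nu> where "\<nu> = distr \<mu> borel prm"
      have pm: "prm \<in> borel_measurable \<mu>" by (rule prm_measurable[OF bp(2)])
      have \<nu>: "prob_space \<nu>" "sets \<nu> = sets borel" unfolding \<nu>_def by (auto intro: prob_space_distr pm)
      have m\<nu>: "measure \<nu> S = measure \<mu> {x \<in> X. prm x \<in> S}" if "S \<in> sets borel" for S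
      proof -
        have "prm -` S \<inter> space \<mu> = {x \<in> X. prm x \<in> S}" using sp by auto
        then show ?thesis using measure_distr[OF pm that] by (simp add: \<nu>_def)
      qed
      have ac: "absolutely_continuous lborel \<nu>"
        unfolding absolutely_continuous_def
      proof
        fix N :: "real set" assume N: "N \<in> null_sets lborel"
        have "prm -` N \<inter> space \<mu> = {x \<in> X. prm x \<in> N}" using sp by auto
        then show "N \<in> null_sets \<nu>"
          using null_prm[OF bp(2) \<mu>(2) N] N pm by (simp add: \<nu>_def null_sets_def emeasure_distr)
      qed
      define Y where "Y = {x \<in> X. E \<le> jac g k x \<and> (g ^^ k) x \<notin> U}"
      have gk: "(g ^^ i) \<in> measurable \<mu> \<mu>" for i
        using \<mu>(1) by (intro funpow_preserving(1)) (auto simp: invariant_prob_def)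
      have Ym: "Y \<in> events"
      proof -
        have "Y = {x \<in> X. E \<le> jac g k x} - ((g ^^ k) -` U \<inter> space \<mu>)" using sp by (auto simp: Y_def)
        then show ?thesis using jac_set[OF g(1) bp(2)] measurable_sets[OF gk U] by auto
      qed
      have "\<beta> * (h1 / (4 * a)) \<le> 8 / \<epsilon> * (\<Sum>j<r. v j - u j) + measure \<mu> Y"
      proof (rule S.key_inequality[OF \<nu> ac L dom(1) _ \<beta> \<gamma>])
        show "0 \<le> h1 / 2 * real k" using h1 by simp
        show "u j \<le> v j \<and> v j - u j + 4 * \<epsilon> \<le> L" if "j < r" for j using uv that \<epsilon>(3) by force
      next
        fix N assume N: "Suc (nat \<lceil>12 / h1\<rceil>) \<le> N"
        have "real N \<le> real (k * N)" using k(1) by (simp add: mult_le_cancel_right1)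
        moreover have "12 / h1 \<le> real N" using N by linarith
        ultimately have kN2: "12 / h1 \<le> real (k * N)" by linarith
        have kN: "0 < k * N" using N k(1) by simp
        let ?S = "{x \<in> {0..L}. exp (h1 / 2 * real k * real N) \<le> \<bar>dprod F F' N x\<bar>}"
        have "continuous_on {0..L} (\<lambda>x. \<bar>dprod F F' N x\<bar>)"
          by (intro continuous_intros continuous_on_subset[OF S.continuous_DF dom(1)])
        from continuous_on_closed_Collect_le[OF continuous_on_const this closed_atLeastAtMost] have
          "closed ?S" .
        then have Sb: "?S \<in> sets borel" by (rule borel_closed)
        have "{x \<in> X. prm x \<in> ?S} = {x \<in> X. exp (h1 / 2 * real (k * N)) \<le> jac g (k * N) x}"
        proof (intro Collect_cong conj_cong refl)
          fix x assume x: "x \<in> X"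
          have "\<bar>dprod F F' N (prm x)\<bar> = jac g (k * N) x"
            unfolding F_def F'_def dprod_iterate using jacG[OF prm_mem(2)[OF x]] prm(2)[OF x] by simp
          then show "prm x \<in> ?S \<longleftrightarrow> exp (h1 / 2 * real (k * N)) \<le> jac g (k * N) x"
            using prm_mem(1)[OF x] by (simp add: mult_ac)
        qed
        then show "h1 / (4 * a) \<le> measure \<nu> ?S"
          using fast_points[OF g(1) \<mu> h h1 a _ kN kN2] ga unfolding m\<nu>[OF Sb] by simp
      next
        fix m :: nat assume m: "1 \<le> m"
        let ?T = "{x \<in> {0..L}. E \<le> \<bar>F' ((F ^^ (m - 1)) x)\<bar> \<and> (F ^^ m) x \<notin> (\<Union>j<r. \<Union>i::int. {u j +
          i * L<..<v j + i * L})}"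
        show "measure \<nu> ?T \<le> measure \<mu> Y"
        proof (cases "?T \<in> sets borel")
          \<comment> \<open>A set that is not measurable has \<open>measure\<close> 0.\<close>
          case False
          then have "measure \<nu> ?T = 0" using \<nu>(2) by (simp add: measure_notin_sets)
          then show ?thesis by simp
        next
          case True
          let ?i = "k * (m - 1)"
          \<comment> \<open>The event concerns the orbit at time k * (m - 1) and the k steps after
            it, so it is contained in a preimage of Y; invariance makes the bound independent of
            m.\<close>
          have "{x \<in> X. prm x \<in> ?T} \<subseteq> {x \<in> X. (g ^^ ?i) x \<in> Y}"
          proof safe
            fix x assume x: "x \<in> X" and xT: "E \<le> \<bar>F' ((F ^^ (m - 1)) (prm x))\<bar>"
              "(F ^^ m) (prm x) \<notin> (\<Union>j<r. \<Union>i::int. {u j + i * L<..<v j + i * L})"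
            have tJ: "prm x \<in> J" by (rule prm_mem(2)[OF x])
            let ?s = "(G ^^ ?i) (prm x)"
            have sJ: "?s \<in> J" and ps: "p ?s = (g ^^ ?i) x"
              using lift_funpow[OF G(1,2) tJ, of ?i] prm(2)[OF x] by auto
            have 1: "E \<le> jac g k ((g ^^ ?i) x)" using xT(1) jacG[OF sJ] unfolding F'_def Fi ps by simp
            have km: "k + ?i = k * m" using m by (cases m) auto
            have "(g ^^ k) ((g ^^ ?i) x) = (g ^^ (k * m)) x" using funpow_add[of k ?i g] unfolding km
              by (simp add: o_def)
            then have pk: "p ((F ^^ m) (prm x)) = (g ^^ k) ((g ^^ ?i) x)"
              unfolding Fi using lift_funpow(2)[OF G(1,2) tJ, of "k * m"] prm(2)[OF x] by simp
            have FJ: "(F ^^ m) (prm x) \<in> J" unfolding Fi by (rule lift_funpow(1)[OF G(1,2) tJ])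
            have 2: "(g ^^ k) ((g ^^ ?i) x) \<notin> U"
            proof
              assume "(g ^^ k) ((g ^^ ?i) x) \<in> U"
              then obtain s j where s: "j < r" "s \<in> {u j<..<v j}" "s \<in> J" "p ((F ^^ m) (prm x)) = p s"
                using Uuv unfolding pk[symmetric] by auto
              obtain i :: int where "(F ^^ m) (prm x) = s + i * L" using period[OF FJ s(3,4)] by blast
              then have "(F ^^ m) (prm x) \<in> {u j + i * L<..<v j + i * L}" using s(2) by simp
              then show False using xT(2) s(1) by blast
            qed
            show "(g ^^ ?i) x \<in> Y" unfolding Y_def using funpow_X[OF g(1) x] 1 2 by blast
          qed
          moreover have "{x \<in> X. (g ^^ ?i) x \<in> Y} \<in> events"
          proof -
            have "(g ^^ ?i) -` Y \<inter> space \<mu> = {x \<in> X. (g ^^ ?i) x \<in> Y}" using sp by auto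
            then show ?thesis using measurable_sets[OF gk Ym, of ?i] by simp
          qed
          ultimately have "measure \<mu> {x \<in> X. prm x \<in> ?T} \<le> measure \<mu> {x \<in> X. (g ^^ ?i) x \<in> Y}"
            by (rule finite_measure_mono)
          also have "\<dots> = measure \<mu> Y" by (rule funpow_preserves[OF \<mu>(1) Ym])
          finally show ?thesis unfolding m\<nu>[OF True] .
        qed
      qed
      then show "\<beta> * (h1 / (4 * a)) \<le> 8 / \<epsilon> * (\<Sum>j<r. v j - u j) + measure \<mu> {x \<in> X. exp (h1 / 16 * real k) \<le>
        jac g k x \<and> (g ^^ k) x \<notin> U}"
        by (simp add: Y_def E_def)
    qed
  qed
qed

end

section \<open>Passage to the weak limit\<close>

lemma ext_ln_mult: "0 \<le> a \<Longrightarrow> 0 \<le> b \<Longrightarrow> ext_ln (a * b) = ext_ln a + ext_ln b"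
  by (auto simp: ext_ln_def ln_mult)

lemma sum_ext_ln:
  assumes "\<And>i. 0 \<le> d i"
  shows "(\<Sum>i<n::nat. ext_ln (d i)) = ext_ln (\<Prod>i<n. d i)"
proof (induction n)
  case (Suc n)
  have "ext_ln (\<Prod>i<Suc n. d i) = ext_ln ((\<Prod>i<n. d i) * d n)" by simp
  also have "\<dots> = ext_ln (\<Prod>i<n. d i) + ext_ln (d n)" by (intro ext_ln_mult prod_nonneg assms)
  finally show ?case using Suc by simp
qed (simp add: ext_ln_def zero_ereal_def)

lemma ext_ln_le_iff:
  assumes "0 \<le> r" "0 < n"
  shows "ext_ln r / ereal (real n) \<le> ereal c \<longleftrightarrow> r \<le> exp (c * real n)"
proof (cases "r = 0")
  case False
  then have "ln r / real n \<le> c \<longleftrightarrow> ln r \<le> c * real n" using assms by (simp add: pos_divide_le_eq)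
  also have "\<dots> \<longleftrightarrow> r \<le> exp (c * real n)" using assms False by (subst ln_le_cancel_iff[symmetric, of r]) auto
  finally show ?thesis using False assms by (simp add: ext_ln_def)
qed (use assms in \<open>simp add: ext_ln_def\<close>)

context curve_system begin

lemma lyapunov_jac: "lyapunov I g x = limsup (\<lambda>n. ext_ln (jac g n x) / ereal (real n))"
  unfolding lyapunov_def jac_def by (subst sum_ext_ln) (auto simp: abs_deriv_def)

text \<open>Trades the extended real limit for growth bounds on \<open>jac\<close>, in which
  critical points need no separate treatment.\<close>

lemma lyapunov_le_0_iff:
  "lyapunov I g x \<le> 0 \<longleftrightarrow> (\<forall>c>0. \<forall>\<^sub>F n in sequentially. jac g n x \<le> exp (c * real n))"
proof
  assume l: "lyapunov I g x \<le> 0"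
  show "\<forall>c>0. \<forall>\<^sub>F n in sequentially. jac g n x \<le> exp (c * real n)"
  proof (intro allI impI)
    fix c :: real assume "0 < c"
    then have "limsup (\<lambda>n. ext_ln (jac g n x) / ereal (real n)) < ereal c"
      using l unfolding lyapunov_jac by (meson ereal_less(2) le_less_trans)
    then have "\<forall>\<^sub>F n in sequentially. ext_ln (jac g n x) / ereal (real n) < ereal c" by (rule Limsup_lessD)
    then show "\<forall>\<^sub>F n in sequentially. jac g n x \<le> exp (c * real n)"
      using eventually_gt_at_top[of 0]
    proof eventually_elim
      case (elim n)
      show ?case by (rule ext_ln_le_iff[OF jac_nonneg elim(2), THEN iffD1, OF less_imp_le[OF elim(1)]])
    qed
  qed
next
  assume e: "\<forall>c>0. \<forall>\<^sub>F n in sequentially. jac g n x \<le> exp (c * real n)"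
  have "lyapunov I g x \<le> ereal c" if "0 < c" for c
    unfolding lyapunov_jac
  proof (rule Limsup_bounded)
    show "\<forall>\<^sub>F n in sequentially. ext_ln (jac g n x) / ereal (real n) \<le> ereal c"
      using e[rule_format, OF that] eventually_gt_at_top[of 0]
    proof eventually_elim
      case (elim n)
      show ?case by (rule ext_ln_le_iff[OF jac_nonneg elim(2), THEN iffD2, OF elim(1)])
    qed
  qed
  then show "lyapunov I g x \<le> 0"
    using ereal_le_epsilon2[of "lyapunov I g x" 0] by simp
qed

lemma jac_Suc: "jac g (Suc n) x = abs_deriv I g x * jac g n (g x)"
  unfolding jac_def prod.lessThan_Suc_shift by (simp add: funpow_swap1)

lemma abs_deriv_bounded:
  assumes "smooth_map I g"
  obtains b where "1 \<le> b" "\<And>x. x \<in> X \<Longrightarrow> abs_deriv I g x \<le> b"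
proof -
  have "bounded (abs_deriv I g ` X)"
    by (intro compact_imp_bounded compact_continuous_image abs_deriv_continuous assms compact_X)
  then obtain b where b: "\<forall>y\<in>abs_deriv I g ` X. norm y \<le> b" unfolding bounded_iff by blast
  show ?thesis by (rule that[of "max 1 b"]) (use b in fastforce)+
qed

text \<open>The one additional factor is bounded above and disappears in the exponential rate. It
  may vanish, so at a critical point the converse implication can fail.\<close>

lemma lyapunov_preimage:
  assumes g: "smooth_map I g" and x: "x \<in> X" and l: "lyapunov I g (g x) \<le> 0"
  shows "lyapunov I g x \<le> 0"
  unfolding lyapunov_le_0_iff
proof (intro allI impI)
  fix c :: real assume c: "0 < c"
  obtain b where b: "1 \<le> b" "\<And>x. x \<in> X \<Longrightarrow> abs_deriv I g x \<le> b" by (rule abs_deriv_bounded[OF g]) (rule that)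
  have "\<forall>\<^sub>F n in sequentially. jac g n (g x) \<le> exp (c / 2 * real n)"
    using l c unfolding lyapunov_le_0_iff by (meson half_gt_zero)
  moreover have "\<forall>\<^sub>F n in sequentially. 2 * ln b / c \<le> real n"
    using filterlim_real_sequentially unfolding filterlim_at_top by blast
  ultimately have "\<forall>\<^sub>F n in sequentially. jac g (Suc n) x \<le> exp (c * real (Suc n))"
  proof eventually_elim
    case (elim n)
    have "ln b \<le> c / 2 * real n" using elim(2) c by (simp add: field_simps)
    then have "b \<le> exp (c / 2 * real n)" using b(1)
      by (metis exp_ln exp_le_cancel_iff less_le_trans zero_less_one)
    then have "jac g (Suc n) x \<le> exp (c / 2 * real n) * exp (c / 2 * real n)"
      unfolding jac_Suc using elim(1) b(2)[OF x] jac_nonneg by (intro mult_mono) auto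
    also have "\<dots> = exp (c * real n)" by (simp add: exp_add[symmetric])
    also have "\<dots> \<le> exp (c * real (Suc n))" using c by simp
    finally show ?case .
  qed
  then show "\<forall>\<^sub>F n in sequentially. jac g n x \<le> exp (c * real n)"
    by (rule eventually_sequentially_Suc[of "\<lambda>n. jac g n x \<le> exp (c * real n)", THEN iffD1])
qed

lemma lyapunov_measurable:
  assumes g: "smooth_map I g" and s: "sets \<mu> = sets (borel_on I)"
  shows "{x \<in> X. lyapunov I g x \<le> 0} \<in> sets \<mu>"
proof -
  have j: "jac g n \<in> borel_measurable \<mu>" for n by (rule measurable_X[OF s jac_continuous[OF g]])
  have [measurable]: "ext_ln \<in> borel_measurable borel" unfolding ext_ln_def[abs_def] by measurable
  have "lyapunov I g \<in> borel_measurable \<mu>"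
    unfolding lyapunov_jac[abs_def] using j by measurable
  then have "{x \<in> space \<mu>. lyapunov I g x \<le> 0} \<in> sets \<mu>" by measurable
  then show ?thesis by (simp add: space_X[OF s])
qed

section \<open>Weak-* accumulation and convergence of iterates\<close>

lemma continuous_integrable:
  fixes \<phi> :: "'a \<Rightarrow> real"
  assumes "\<nu> \<in> borel_probs I" "continuous_on X \<phi>"
  shows "integrable \<nu> \<phi>"
proof -
  have \<nu>: "prob_space \<nu>" "sets \<nu> = sets (borel_on I)" using assms(1) by (auto simp: borel_probs_def)
  interpret prob_space \<nu> by fact
  have "bounded (\<phi> ` X)" by (intro compact_imp_bounded compact_continuous_image assms compact_X)
  then obtain b where "\<forall>y\<in>\<phi> ` X. norm y \<le> b" unfolding bounded_iff by blast
  then show ?thesis using measurable_X[OF \<nu>(2) assms(2)] space_X[OF \<nu>(2)]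
    by (intro integrable_const_bound[where B = b]) auto
qed

text \<open>Two test functions at the same indices, because invariance of the limit compares the
  integrals of \<phi> and of \<phi> \<circ> f.\<close>

lemma accumulation_frequently:
  assumes acc: "accumulation_point (weak_star I) \<mu>s \<mu>" and \<eta>: "0 < \<eta>"
    and \<phi>: "continuous_on X (\<phi> :: 'a \<Rightarrow> real)" and \<psi>: "continuous_on X (\<psi> :: 'a \<Rightarrow> real)"
  shows "\<mu> \<in> borel_probs I" "\<exists>\<^sub>F k in sequentially. \<bar>(\<integral>x. \<phi> x \<partial>\<mu>s k) - (\<integral>x. \<phi> x \<partial>\<mu>)\<bar> < \<eta> \<and>
    \<bar>(\<integral>x. \<psi> x \<partial>\<mu>s k) - (\<integral>x. \<psi> x \<partial>\<mu>)\<bar> < \<eta>"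
proof -
  let ?S = "{{\<nu> \<in> borel_probs I. (\<integral>x. \<phi> x \<partial>\<nu>) \<in> U} | (\<phi> :: 'a \<Rightarrow> real) U. continuous_on X \<phi> \<and> open U}"
  have "\<mu> \<in> topspace (weak_star I)" using acc by (simp add: accumulation_point_def)
  then have "\<mu> \<in> \<Union>?S" unfolding weak_star_def topology_generated_by_topspace .
  then show \<mu>: "\<mu> \<in> borel_probs I" by blast
  have o: "openin (weak_star I) {\<nu> \<in> borel_probs I. (\<integral>x. \<phi> x \<partial>\<nu>) \<in> ball (\<integral>x. \<phi> x \<partial>\<mu>) \<eta>}"
    if "continuous_on X \<phi>" for \<phi> :: "'a \<Rightarrow> real"
    unfolding weak_star_def by (rule topology_generated_by_Basis) (use that in blast)
  have "openin (weak_star I) ({\<nu> \<in> borel_probs I. (\<integral>x. \<phi> x \<partial>\<nu>) \<in> ball (\<integral>x. \<phi> x \<partial>\<mu>) \<eta>} \<inter>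
      {\<nu> \<in> borel_probs I. (\<integral>x. \<psi> x \<partial>\<nu>) \<in> ball (\<integral>x. \<psi> x \<partial>\<mu>) \<eta>})" (is "openin _ ?U")
    by (intro openin_Int o \<phi> \<psi>)
  moreover have "\<mu> \<in> ?U" using \<mu> \<eta> by simp
  ultimately have "\<exists>\<^sub>F k in sequentially. \<mu>s k \<in> ?U" using acc unfolding accumulation_point_def by blast
  then show "\<exists>\<^sub>F k in sequentially. \<bar>(\<integral>x. \<phi> x \<partial>\<mu>s k) - (\<integral>x. \<phi> x \<partial>\<mu>)\<bar> < \<eta> \<and> \<bar>(\<integral>x. \<psi> x \<partial>\<mu>s k) - (\<integral>x. \<psi> x \<partial>\<mu>)\<bar> < \<eta>"
    by (rule frequently_elim1) (auto simp: dist_real_def abs_minus_commute)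
qed

text \<open>The indicator of a closed set is the limit of continuous functions that decrease with
  the distance to the set, and closed subsets form a generator stable under intersection.\<close>

lemma measure_eq_of_integrals:
  assumes \<mu>: "\<mu> \<in> borel_probs I" and \<nu>: "\<nu> \<in> borel_probs I"
    and eq: "\<And>\<phi> :: 'a \<Rightarrow> real. continuous_on X \<phi> \<Longrightarrow> (\<integral>x. \<phi> x \<partial>\<mu>) = (\<integral>x. \<phi> x \<partial>\<nu>)"
  shows "\<mu> = \<nu>"
proof -
  have closed_lim: "(\<lambda>n. \<integral>x. max 0 (1 - real n * infdist x C) \<partial>\<rho>) \<longlonglongrightarrow> measure \<rho> C"
    if \<rho>: "\<rho> \<in> borel_probs I" and C: "closed C" "C \<subseteq> X" "C \<noteq> {}" for \<rho> C
  proof -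
    have \<rho>': "prob_space \<rho>" "sets \<rho> = sets (borel_on I)" using \<rho> by (auto simp: borel_probs_def)
    interpret prob_space \<rho> by fact
    have Cs: "C \<in> events" using C by (subst sets_X[OF \<rho>'(2)]) auto
    have "(\<lambda>n. \<integral>x. max 0 (1 - real n * infdist x C) \<partial>\<rho>) \<longlonglongrightarrow> (\<integral>x. indicator C x \<partial>\<rho>)"
    proof (rule integral_dominated_convergence[where w = "\<lambda>_. 1"])
      show "indicator C \<in> borel_measurable \<rho>" using Cs by simp
      show "(\<lambda>x. max 0 (1 - real n * infdist x C)) \<in> borel_measurable \<rho>" for n
        by (intro measurable_X[OF \<rho>'(2)] continuous_intros)
      show "AE x in \<rho>. norm (max 0 (1 - real n * infdist x C)) \<le> 1" for n
        by (intro AE_I2) (simp add: infdist_nonneg)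
      show "AE x in \<rho>. (\<lambda>n. max 0 (1 - real n * infdist x C)) \<longlonglongrightarrow> indicator C x"
      proof (rule AE_I2)
        fix x
        show "(\<lambda>n. max 0 (1 - real n * infdist x C)) \<longlonglongrightarrow> indicator C x"
        proof (cases "x \<in> C")
          case True
          then show ?thesis by simp
        next
          case False
          then have d: "0 < infdist x C" using C by (simp add: infdist_pos_not_in_closed)
          obtain N :: nat where N: "1 / infdist x C < real N" using reals_Archimedean2 by blast
          have "max 0 (1 - real n * infdist x C) = indicator C x" if "N \<le> n" for n
          proof -
            have "1 / infdist x C < real n" using N that by linarith
            then have "1 < real n * infdist x C" using d by (simp add: pos_divide_less_eq)
            then show ?thesis using False by simp
          qed
          then show ?thesis by (intro tendsto_eventually) (auto simp: eventually_sequentially)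
        qed
      qed
    qed simp
    then show ?thesis using Cs by (simp add: Int_absorb2[OF sets.sets_into_space])
  qed
  have pr: "prob_space \<mu>" "prob_space \<nu>" and st: "sets \<mu> = sets (borel_on I)" "sets \<nu> = sets (borel_on I)"
    using \<mu> \<nu> by (auto simp: borel_probs_def)
  interpret m: prob_space \<mu> by fact
  interpret n: prob_space \<nu> by fact
  have cl: "measure \<mu> C = measure \<nu> C" if C: "closed C" "C \<subseteq> X" for C
  proof (cases "C = {}")
    case False
    have "(\<integral>x. max 0 (1 - real n * infdist x C) \<partial>\<mu>) = (\<integral>x. max 0 (1 - real n * infdist x C) \<partial>\<nu>)" for n
      by (intro eq continuous_intros)
    then show ?thesis using closed_lim[OF \<mu> C False] closed_lim[OF \<nu> C False] LIMSEQ_unique by simp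
  qed simp
  let ?E = "{C. closed C \<and> C \<subseteq> X}"
  have gen: "sets (borel_on I) = sigma_sets X ?E"
  proof -
    have "sets (borel_on I) = sigma_sets X ((\<inter>) X ` Collect closed)"
      unfolding borel_on_def sets_restrict_space borel_eq_closed
      using sigma_sets_Int[of X UNIV "Collect closed"] compact_X(2) by (simp add: sigma_sets.Basic)
    also have "(\<inter>) X ` Collect closed = ?E" using compact_X(2) by auto
    finally show ?thesis .
  qed
  show ?thesis
  proof (rule measure_eqI_generator_eq[where E = ?E and \<Omega> = X and A = "\<lambda>_. X"])
    show "Int_stable ?E" by (auto simp: Int_stable_def)
    show "emeasure \<mu> C = emeasure \<nu> C" if "C \<in> ?E" for C
      using cl that by (simp add: m.emeasure_eq_measure n.emeasure_eq_measure)
  qed (use st gen compact_X(2) in \<open>auto simp: m.emeasure_eq_measure\<close>)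
qed

lemma smooth_convergence_uniform:
  assumes "smooth_convergence I fs f" "0 < \<eta>"
  shows "\<forall>\<^sub>F k in sequentially. \<forall>x\<in>X. dist (fs k x) (f x) < \<eta>"
    "\<forall>\<^sub>F k in sequentially. \<forall>x\<in>X. \<bar>abs_deriv I (fs k) x - abs_deriv I f x\<bar> < \<eta>"
proof -
  have u: "\<forall>\<^sub>F k in sequentially. \<forall>t\<in>J. dist (nth_deriv J n (fs k \<circ> p) t) (nth_deriv J n (f \<circ> p) t) < \<eta>" for n
    using assms unfolding smooth_convergence_def uniform_limit_iff by blast
  show "\<forall>\<^sub>F k in sequentially. \<forall>x\<in>X. dist (fs k x) (f x) < \<eta>"
    using u[of 0]
  proof eventually_elim
    case (elim k)
    show ?case
    proof
      fix x assume x: "x \<in> X"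
      show "dist (fs k x) (f x) < \<eta>" using elim[rule_format, OF prm_mem(2)[OF x]] prm(2)[OF x] by simp
    qed
  qed
  show "\<forall>\<^sub>F k in sequentially. \<forall>x\<in>X. \<bar>abs_deriv I (fs k) x - abs_deriv I f x\<bar> < \<eta>"
    using u[of 1]
  proof eventually_elim
    case (elim k)
    show ?case
    proof
      fix x assume x: "x \<in> X"
      have "dist (nth_deriv J 1 (fs k \<circ> p) (prm x)) (nth_deriv J 1 (f \<circ> p) (prm x)) < \<eta>"
        using elim prm_mem(2)[OF x] by blast
      then have "norm (vector_derivative (fs k \<circ> p) (at (prm x) within J) - vector_derivative (f \<circ> p) (at
        (prm x) within J)) < \<eta>"
        by (simp add: dist_norm)
      then show "\<bar>abs_deriv I (fs k) x - abs_deriv I f x\<bar> < \<eta>"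
        unfolding abs_deriv_def prm_def[symmetric] using norm_triangle_ineq3 le_less_trans by blast
    qed
  qed
qed

lemma uniform_compose:
  fixes \<phi> :: "'a \<Rightarrow> 'b::metric_space"
  assumes \<phi>: "continuous_on X \<phi>" and \<eta>: "0 < \<eta>"
    and u: "\<And>\<eta>. 0 < \<eta> \<Longrightarrow> \<forall>\<^sub>F k in sequentially. \<forall>x\<in>X. dist (gs k x) (g x) < \<eta>"
    and X: "\<And>k x. x \<in> X \<Longrightarrow> gs k x \<in> X" "\<And>x. x \<in> X \<Longrightarrow> g x \<in> X"
  shows "\<forall>\<^sub>F k in sequentially. \<forall>x\<in>X. dist (\<phi> (gs k x)) (\<phi> (g x)) < \<eta>"
proof -
  obtain d where d: "0 < d" "\<forall>x\<in>X. \<forall>y\<in>X. dist y x < d \<longrightarrow> dist (\<phi> y) (\<phi> x) < \<eta>"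
    using compact_uniformly_continuous[OF \<phi> compact_X(1), unfolded uniformly_continuous_on_def, rule_format,
      OF \<eta>] by metis
  show ?thesis using u[OF d(1)] by eventually_elim (use d(2) X in blast)
qed

lemma smooth_convergence_funpow:
  assumes f: "smooth_map I f" "\<And>k. smooth_map I (fs k)" "smooth_convergence I fs f" and \<eta>: "0 < \<eta>"
  shows "\<forall>\<^sub>F k in sequentially. \<forall>x\<in>X. dist ((fs k ^^ m) x) ((f ^^ m) x) < \<eta>"
  using \<eta>
proof (induction m arbitrary: \<eta>)
  case (Suc m)
  have "\<forall>\<^sub>F k in sequentially. \<forall>x\<in>X. dist (f ((fs k ^^ m) x)) (f ((f ^^ m) x)) < \<eta> / 2"
    by (rule uniform_compose[OF smooth_continuous[OF f(1)]]) (use Suc funpow_X f in auto)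
  moreover have "\<forall>\<^sub>F k in sequentially. \<forall>x\<in>X. dist (fs k x) (f x) < \<eta> / 2"
    by (rule smooth_convergence_uniform(1)[OF f(3)]) (use Suc in simp)
  ultimately show ?case
  proof eventually_elim
    case (elim k)
    show ?case
    proof
      fix x assume x: "x \<in> X"
      have "dist (fs k ((fs k ^^ m) x)) (f ((fs k ^^ m) x)) < \<eta> / 2" using elim(2) funpow_X[OF f(2) x] by blast
      moreover have "dist (f ((fs k ^^ m) x)) (f ((f ^^ m) x)) < \<eta> / 2" using elim(1) x by blast
      ultimately show "dist ((fs k ^^ Suc m) x) ((f ^^ Suc m) x) < \<eta>"
        using dist_triangle[of "fs k ((fs k ^^ m) x)" "f ((f ^^ m) x)" "f ((fs k ^^ m) x)"] by simp
    qed
  qed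
qed auto

lemma smooth_convergence_jac:
  assumes f: "smooth_map I f" "\<And>k. smooth_map I (fs k)" "smooth_convergence I fs f" and \<eta>: "0 < \<eta>"
  shows "\<forall>\<^sub>F k in sequentially. \<forall>x\<in>X. \<bar>jac (fs k) m x - jac f m x\<bar> < \<eta>"
proof -
  have step: "\<forall>\<^sub>F k in sequentially. \<forall>x\<in>X. \<bar>abs_deriv I (fs k) ((fs k ^^ i) x) - abs_deriv I f ((f ^^ i) x)\<bar>
    < \<eta>"
    if "0 < \<eta>" for i \<eta>
  proof -
    have "\<forall>\<^sub>F k in sequentially. \<forall>x\<in>X. dist (abs_deriv I f ((fs k ^^ i) x)) (abs_deriv I f ((f ^^ i) x)) <
      \<eta> / 2"
      by (rule uniform_compose[OF abs_deriv_continuous[OF f(1)]])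
        (use that smooth_convergence_funpow[OF f] funpow_X f in auto)
    moreover have "\<forall>\<^sub>F k in sequentially. \<forall>x\<in>X. \<bar>abs_deriv I (fs k) x - abs_deriv I f x\<bar> < \<eta> / 2"
      by (rule smooth_convergence_uniform(2)[OF f(3)]) (use that in simp)
    ultimately show ?thesis
    proof eventually_elim
      case (elim k)
      show ?case
      proof
        fix x assume x: "x \<in> X"
        have "\<bar>abs_deriv I (fs k) ((fs k ^^ i) x) - abs_deriv I f ((fs k ^^ i) x)\<bar> < \<eta> / 2"
          using elim(2) funpow_X[OF f(2) x] by blast
        moreover have "\<bar>abs_deriv I f ((fs k ^^ i) x) - abs_deriv I f ((f ^^ i) x)\<bar> < \<eta> / 2"
          using elim(1) x by (simp add: dist_real_def)
        ultimately show "\<bar>abs_deriv I (fs k) ((fs k ^^ i) x) - abs_deriv I f ((f ^^ i) x)\<bar> < \<eta>" by linarith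
      qed
    qed
  qed
  obtain b where b: "1 \<le> b" "\<And>x. x \<in> X \<Longrightarrow> abs_deriv I f x \<le> b" by (rule abs_deriv_bounded[OF f(1)]) (rule that)
  have jf: "jac f m x \<le> b ^ m" if "x \<in> X" for x m
  proof -
    have "jac f m x \<le> (\<Prod>i<m. b)" unfolding jac_def using funpow_X[OF f(1) that] b(2)
      by (intro prod_mono) (auto simp: abs_deriv_def)
    then show ?thesis by simp
  qed
  show ?thesis using \<eta>
  proof (induction m arbitrary: \<eta>)
    case (Suc m)
    \<comment> \<open>Twice the error e * (b + b ^ m + 1) of the product rule stays below \<eta>; e
      \<le> 1 controls the product of the two differences.\<close>
    define e where "e = min 1 (\<eta> / (2 * (b + b ^ m + 1)))"
    have bm: "0 < b + b ^ m + 1" using b(1) by (simp add: add_pos_nonneg)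
    have e: "0 < e" "e \<le> 1" using Suc.prems bm by (auto simp: e_def)
    have "e \<le> \<eta> / (2 * (b + b ^ m + 1))" by (simp add: e_def)
    then have "e * (2 * (b + b ^ m + 1)) \<le> \<eta>" using bm by (subst (asm) pos_le_divide_eq) auto
    then have "2 * (e * (b + b ^ m + 1)) \<le> \<eta>" by (simp only: mult.left_commute)
    then have e2: "e * (b + b ^ m + 1) < \<eta>" using Suc.prems by linarith
    from Suc.IH[OF e(1)] step[OF e(1), of m] show ?case
    proof eventually_elim
      case (elim k)
      show ?case
      proof
        fix x assume x: "x \<in> X"
        define u where "u = jac (fs k) m x" define u' where "u' = jac f m x"
        define v where "v = abs_deriv I (fs k) ((fs k ^^ m) x)" define v'
          where "v' = abs_deriv I f ((f ^^ m) x)"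
        have d: "\<bar>u - u'\<bar> \<le> e" "\<bar>v - v'\<bar> \<le> e" using elim x by (auto simp: u_def u'_def v_def v'_def less_imp_le)
        have n: "0 \<le> u'" "u' \<le> b ^ m" "0 \<le> v'" "v' \<le> b"
          using jac_nonneg jf[OF x] b(2)[OF funpow_X[OF f(1) x]] by (auto simp: u'_def v'_def abs_deriv_def)
        have "u * v - u' * v' = (u - u') * v' + u' * (v - v') + (u - u') * (v - v')"
          by (simp add: algebra_simps)
        then have "\<bar>u * v - u' * v'\<bar> \<le> \<bar>u - u'\<bar> * \<bar>v'\<bar> + \<bar>u'\<bar> * \<bar>v - v'\<bar> + \<bar>u - u'\<bar> * \<bar>v - v'\<bar>"
          by (simp add: abs_mult[symmetric])
        also have "\<dots> \<le> e * b + b ^ m * e + e * 1"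
          using d n e by (intro add_mono mult_mono) auto
        also have "\<dots> = e * (b + b ^ m + 1)" by (simp add: algebra_simps)
        also note e2
        finally show "\<bar>jac (fs k) (Suc m) x - jac f (Suc m) x\<bar> < \<eta>"
          by (simp add: jac_def u_def u'_def v_def v'_def)
      qed
    qed
  qed (simp add: jac_def)
qed

text \<open>The integrals of \<phi> and \<phi> \<circ> f are compared along one approximating
  measure, which is invariant under its own map; the three errors are the two weak-* approximations
  and the uniform distance of \<phi> \<circ> f from \<phi> composed with that map.\<close>

lemma limit_invariant:
  assumes f: "smooth_map I f" "\<And>k. smooth_map I (fs k)" "smooth_convergence I fs f"
    and inv: "\<And>k. invariant_prob I (fs k) (\<mu>s k)" and acc: "accumulation_point (weak_star I) \<mu>s \<mu>"
  shows "invariant_prob I f \<mu>"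
proof -
  have \<mu>: "\<mu> \<in> borel_probs I"
    by (rule accumulation_frequently(1)[OF acc zero_less_one continuous_on_const continuous_on_const])
  then have \<mu>': "prob_space \<mu>" "sets \<mu> = sets (borel_on I)" by (auto simp: borel_probs_def)
  have fm: "f \<in> measurable \<mu> \<mu>"
  proof -
    have "f \<in> measurable \<mu> (restrict_space borel X)"
      using measurable_X[OF \<mu>'(2) smooth_continuous[OF f(1)]] smooth_X[OF f(1)] space_X[OF \<mu>'(2)]
      by (intro measurable_restrict_space2) auto
    then show ?thesis using measurable_cong_sets[OF refl \<mu>'(2), of \<mu>] by (simp add: borel_on_def)
  qed
  have d: "distr \<mu> \<mu> f \<in> borel_probs I"
    using \<mu>' prob_space.prob_space_distr[OF \<mu>'(1) fm] by (simp add: borel_probs_def)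
  have "distr \<mu> \<mu> f = \<mu>"
  proof (rule measure_eq_of_integrals[OF d \<mu>])
    fix \<phi> :: "'a \<Rightarrow> real" assume \<phi>: "continuous_on X \<phi>"
    have \<phi>f: "continuous_on X (\<lambda>x. \<phi> (f x))"
      by (rule continuous_on_compose2[OF \<phi> smooth_continuous[OF f(1)]]) (use smooth_X[OF f(1)] in auto)
    have "\<bar>(\<integral>x. \<phi> (f x) \<partial>\<mu>) - (\<integral>x. \<phi> x \<partial>\<mu>)\<bar> \<le> 3 * \<eta>" if \<eta>: "0 < \<eta>" for \<eta>
    proof -
      have "\<forall>\<^sub>F k in sequentially. \<forall>x\<in>X. dist (\<phi> (fs k x)) (\<phi> (f x)) < \<eta>"
        by (rule uniform_compose[OF \<phi> \<eta> smooth_convergence_uniform(1)[OF f(3)]]) (use smooth_X f in auto)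
      then obtain k where k: "\<forall>x\<in>X. dist (\<phi> (fs k x)) (\<phi> (f x)) < \<eta>"
        "\<bar>(\<integral>x. \<phi> x \<partial>\<mu>s k) - (\<integral>x. \<phi> x \<partial>\<mu>)\<bar> < \<eta>" "\<bar>(\<integral>x. \<phi> (f x) \<partial>\<mu>s k) - (\<integral>x. \<phi> (f x) \<partial>\<mu>)\<bar> < \<eta>"
        using frequently_ex[OF frequently_eventually_conj[OF accumulation_frequently(2)[OF acc \<eta> \<phi> \<phi>f]]]
          by blast
      have i: "\<mu>s k \<in> borel_probs I" "fs k \<in> measurable (\<mu>s k) (\<mu>s k)" "distr (\<mu>s k) (\<mu>s k) (fs k) = \<mu>s k"
        using inv[of k] by (auto simp: invariant_prob_def)
      then have i': "prob_space (\<mu>s k)" "sets (\<mu>s k) = sets (borel_on I)" by (auto simp: borel_probs_def)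
      interpret prob_space "\<mu>s k" by fact
      have \<phi>fk: "continuous_on X (\<lambda>x. \<phi> (fs k x))"
        by (rule continuous_on_compose2[OF \<phi> smooth_continuous[OF f(2)]]) (use smooth_X[OF f(2)] in auto)
      have "(\<integral>x. \<phi> x \<partial>\<mu>s k) = (\<integral>x. \<phi> x \<partial>distr (\<mu>s k) (\<mu>s k) (fs k))" by (simp add: i(3))
      also have "\<dots> = (\<integral>x. \<phi> (fs k x) \<partial>\<mu>s k)" by (rule integral_distr[OF i(2) measurable_X[OF i'(2) \<phi>]])
      finally have e: "(\<integral>x. \<phi> x \<partial>\<mu>s k) = (\<integral>x. \<phi> (fs k x) \<partial>\<mu>s k)" .
      have "\<bar>(\<integral>x. \<phi> (fs k x) \<partial>\<mu>s k) - (\<integral>x. \<phi> (f x) \<partial>\<mu>s k)\<bar> = \<bar>\<integral>x. \<phi> (fs k x) - \<phi> (f x) \<partial>\<mu>s k\<bar>"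
        using continuous_integrable[OF i(1) \<phi>fk] continuous_integrable[OF i(1) \<phi>f] by simp
      also have "\<dots> \<le> (\<integral>x. \<bar>\<phi> (fs k x) - \<phi> (f x)\<bar> \<partial>\<mu>s k)" by (rule integral_abs_bound)
      also have "\<dots> \<le> (\<integral>x. \<eta> \<partial>\<mu>s k)"
        using continuous_integrable[OF i(1) \<phi>fk] continuous_integrable[OF i(1) \<phi>f] k(1) space_X[OF i'(2)]
        by (intro integral_mono) (auto simp: dist_real_def less_imp_le)
      also have "\<dots> = \<eta>" by (simp add: prob_space)
      finally show ?thesis using k e by linarith
    qed
    then have "\<bar>(\<integral>x. \<phi> (f x) \<partial>\<mu>) - (\<integral>x. \<phi> x \<partial>\<mu>)\<bar> \<le> 0 + e" if "0 < e" for e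
      using that
        by (metis add_0 divide_pos_pos mult.commute nonzero_eq_divide_eq zero_less_numeral zero_neq_numeral)
    then have "\<bar>(\<integral>x. \<phi> (f x) \<partial>\<mu>) - (\<integral>x. \<phi> x \<partial>\<mu>)\<bar> \<le> 0" by (rule field_le_epsilon)
    then show "(\<integral>x. \<phi> x \<partial>distr \<mu> \<mu> f) = (\<integral>x. \<phi> x \<partial>\<mu>)"
      using integral_distr[OF fm measurable_X[OF \<mu>'(2) \<phi>]] by simp
  qed
  then show ?thesis using \<mu> fm by (simp add: invariant_prob_def)
qed

end

text \<open>Compactness selects finitely many components of a thin open neighbourhood. Components
  are disjoint, so their lengths add up to at most its measure.\<close>

lemma null_interval_cover:
  fixes K :: "real set"
  assumes K: "compact K" "K \<in> null_sets lborel" and e: "0 < e"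
  obtains r :: nat and u v where "\<forall>j<r. u j \<le> v j" "K \<subseteq> (\<Union>j<r. {u j<..<v j})" "(\<Sum>j<r. v j - u j) \<le> e"
proof -
  have Kb: "K \<in> sets borel" using K by auto
  obtain U0 where U0: "open U0" "K \<subseteq> U0" "emeasure lborel (U0 - K) \<le> e"
    by (rule outer_regular_lborel_le[OF Kb e])
  obtain R where R: "K \<subseteq> ball 0 R" using compact_imp_bounded[OF K(1)] bounded_subset_ballD by metis
  define U where "U = U0 \<inter> ball 0 R"
  have U: "open U" "bounded U" "K \<subseteq> U" using U0 R by (auto simp: U_def)
  have "emeasure lborel U \<le> emeasure lborel ((U0 - K) \<union> K)" using U0 Kb
    by (intro emeasure_mono) (auto simp: U_def)
  also have "\<dots> = emeasure lborel (U0 - K)" using U0 K by (intro emeasure_Un_null_set) auto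
  finally have Ue: "emeasure lborel U \<le> ennreal e" using U0(3) by simp
  have "K \<subseteq> \<Union>(components U)" using U by simp
  then obtain D where D: "D \<subseteq> components U" "finite D" "K \<subseteq> \<Union>D"
    using compactE[OF K(1), of "components U"] open_components[OF U(1)] by metis
  have "Inf C < Sup C \<and> C = {Inf C<..<Sup C}" if "C \<in> D" for C
  proof -
    have C: "C \<in> components U" using that D by blast
    have "C = {Inf C<..<Sup C}"
      by (rule open_interval_of_connected[OF open_components[OF U(1) C] in_components_connected[OF C]
          bounded_subset[OF U(2) in_components_subset[OF C]] in_components_nonempty[OF C]])
    then show ?thesis using in_components_nonempty[OF C] by (metis greaterThanLessThan_empty_iff not_le)
  qed
  then obtain l r where lr: "\<forall>C\<in>D. l C < r C \<and> C = {l C<..<r C}" by blast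
  obtain f where f: "bij_betw f {..<card D} D"
    using ex_bij_betw_nat_finite[OF D(2)] by (auto simp: atLeast0LessThan)
  have fD: "f j \<in> D" if "j < card D" for j using f that by (auto simp: bij_betw_def)
  show ?thesis
  proof (rule that)
    show "\<forall>j<card D. l (f j) \<le> r (f j)" using lr fD by (auto intro: less_imp_le)
    show "K \<subseteq> (\<Union>j<card D. {l (f j)<..<r (f j)})"
    proof
      fix x assume "x \<in> K"
      then obtain C where C: "C \<in> D" "x \<in> C" using D by blast
      then have "C \<in> f ` {..<card D}" using f by (simp add: bij_betw_def)
      then obtain j where j: "j < card D" "f j = C" by blast
      have "x \<in> {l C<..<r C}" using C lr by blast
      then show "x \<in> (\<Union>j<card D. {l (f j)<..<r (f j)})" using j by blast
    qed
    have dj: "disjoint_family_on (\<lambda>C. C) D"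
      using pairwise_disjoint_components[of U] D(1) unfolding disjoint_family_on_def pairwise_def by blast
    have "ennreal (\<Sum>j<card D. r (f j) - l (f j)) = ennreal (\<Sum>C\<in>D. r C - l C)"
      by (simp add: sum.reindex_bij_betw[OF f, of "\<lambda>C. r C - l C"])
    also have "\<dots> = (\<Sum>C\<in>D. ennreal (r C - l C))" using lr
      by (intro sum_ennreal[symmetric]) (auto intro: less_imp_le)
    also have "\<dots> = (\<Sum>C\<in>D. emeasure lborel C)"
    proof (rule sum.cong[OF refl])
      fix C assume "C \<in> D"
      then have "l C \<le> r C" "emeasure lborel C = emeasure lborel {l C<..<r C}" using lr
        by (auto intro: less_imp_le)
      then show "ennreal (r C - l C) = emeasure lborel C" by simp
    qed
    also have "\<dots> = emeasure lborel (\<Union>C\<in>D. C)"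
      using D open_components[OF U(1)] by (intro sum_emeasure dj) auto
    also have "\<dots> \<le> emeasure lborel U"
    proof (rule emeasure_mono)
      show "(\<Union>C\<in>D. C) \<subseteq> U" using D(1) in_components_subset by blast
    qed (use U(1) in simp)
    also note Ue
    finally show "(\<Sum>j<card D. r (f j) - l (f j)) \<le> e" using e by simp
  qed
qed

section \<open>Null sets, slow points and the limit measure\<close>

context curve_system begin

text \<open>\<open>fund_dom I\<close> may or may not contain L, which is immaterial for one point.
  Negligible sets are convenient because their preimages under a lift need no measurability
  argument.\<close>

lemma null_curve_iff:
  assumes S: "S \<in> sets (borel_on I)"
  shows "S \<in> null_sets (lebesgue_on_curve I) \<longleftrightarrow> negligible {t \<in> {0..L}. p t \<in> S}"
proof -
  let ?A = "{t \<in> fund_dom I. p t \<in> S}"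
  have "S \<in> null_sets (lebesgue_on_curve I) \<longleftrightarrow> ?A \<in> null_sets lborel"
    using S emeasure_lebesgue_on_curve[OF S] by (auto simp: null_sets_def lebesgue_on_curve_def)
  also have "\<dots> \<longleftrightarrow> negligible ?A"
    using emeasure_lebesgue_on_curve(1)[OF S] by (simp add: negligible_iff_null_sets null_sets_completion_iff)
  also have "\<dots> \<longleftrightarrow> negligible {t \<in> {0..L}. p t \<in> S}"
  proof
    assume "negligible ?A"
    then have "negligible (insert L ?A)" by simp
    then show "negligible {t \<in> {0..L}. p t \<in> S}"
      by (rule negligible_subset) (use fund(3) in \<open>auto simp: subset_eq\<close>)
  next
    assume "negligible {t \<in> {0..L}. p t \<in> S}"
    then show "negligible ?A" by (rule negligible_subset) (use fund(1) in auto)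
  qed
  finally show ?thesis .
qed

lemma lyapunov_funpow_preimage:
  assumes g: "smooth_map I g" and x: "x \<in> X" and l: "lyapunov I g ((g ^^ i) x) \<le> 0"
  shows "lyapunov I g x \<le> 0"
  using l
proof (induction i)
  case (Suc i)
  then show ?case using lyapunov_preimage[OF g funpow_X[OF g x]] by simp
qed simp

text \<open>At each point of nonpositive exponent the growth bound holds from some time on.
  Dominated convergence turns this into a statement at one common time, off a set of small
  measure.\<close>

lemma eventually_slow:
  assumes \<mu>: "\<mu> \<in> borel_probs I" and g: "smooth_map I g" and c: "0 < c" and \<eta>: "0 < \<eta>"
  shows "\<forall>\<^sub>F n in sequentially. measure \<mu> {x \<in> X. lyapunov I g x \<le> 0 \<and> exp (c * real n) < jac g n x} < \<eta>"
proof -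
  have \<mu>': "prob_space \<mu>" "sets \<mu> = sets (borel_on I)" using \<mu> by (auto simp: borel_probs_def)
  interpret prob_space \<mu> by fact
  let ?S = "\<lambda>n. {x \<in> X. lyapunov I g x \<le> 0 \<and> exp (c * real n) < jac g n x}"
  have S: "?S n \<in> events" for n
  proof -
    have "?S n = {x \<in> X. lyapunov I g x \<le> 0} \<inter> {x \<in> space \<mu>. exp (c * real n) < jac g n x}"
      using space_X[OF \<mu>'(2)] by auto
    moreover have "{x \<in> space \<mu>. exp (c * real n) < jac g n x} \<in> events"
      using measurable_X[OF \<mu>'(2) jac_continuous[OF g]] by measurable
    ultimately show ?thesis using lyapunov_measurable[OF g \<mu>'(2)] by simp
  qed
  have "(\<lambda>n. \<integral>x. indicator (?S n) x \<partial>\<mu>) \<longlonglongrightarrow> (\<integral>x. (0::real) \<partial>\<mu>)"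
  proof (rule integral_dominated_convergence[where w = "\<lambda>_. 1"])
    show "AE x in \<mu>. (\<lambda>n. indicator (?S n) x :: real) \<longlonglongrightarrow> 0"
    proof (intro AE_I2 tendsto_eventually)
      fix x assume "x \<in> space \<mu>"
      show "\<forall>\<^sub>F n in sequentially. indicator (?S n) x = (0::real)"
      proof (cases "lyapunov I g x \<le> 0")
        case True
        then have "\<forall>\<^sub>F n in sequentially. jac g n x \<le> exp (c * real n)"
          using c unfolding lyapunov_le_0_iff by blast
        then show ?thesis by (rule eventually_mono) (simp add: not_less)
      qed simp
    qed
    show "(\<lambda>x. indicator (?S n) x :: real) \<in> borel_measurable \<mu>" for n using S by simp
    show "AE x in \<mu>. norm (indicator (?S n) x :: real) \<le> 1" for n by (intro AE_I2) simp
  qed auto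
  moreover have "(\<integral>x. indicator (?S n) x \<partial>\<mu>) = prob (?S n)" for n
    using S[of n] by (simp add: Int_absorb2[OF sets.sets_into_space])
  ultimately have "(\<lambda>n. prob (?S n)) \<longlonglongrightarrow> 0" by simp
  then show ?thesis using \<eta> by (rule order_tendstoD)
qed

text \<open>The complement of Z is replaced by a compact set C disjoint from Z, so that the two can
  be separated by a continuous function, while the points outside C have parameters in short
  intervals as \<open>core_inequality\<close> requires.\<close>

lemma null_cover:
  assumes Z: "Z \<in> null_sets (lebesgue_on_curve I)" "compact Z" and e: "0 < e"
  obtains r :: nat and u v and C where "\<forall>j<r. u j \<le> v j \<and> v j - u j \<le> e" "(\<Sum>j<r. v j - u j) \<le> e"
    "compact C" "C \<subseteq> X" "C \<inter> Z = {}" "X - C \<subseteq> p ` ((\<Union>j<r. {u j<..<v j}) \<inter> J)"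
proof -
  have Zs: "Z \<in> sets (borel_on I)" using Z(1) by (auto simp: lebesgue_on_curve_def)
  let ?K = "{t \<in> {0..L}. p t \<in> Z}"
  have "closed (p -` Z \<inter> {0..L})"
    using cont_L compact_imp_closed[OF Z(2)] continuous_on_closed_vimage[of "{0..L}" p] by auto
  also have "p -` Z \<inter> {0..L} = ?K" by auto
  finally have K: "compact ?K"
    by (auto simp: compact_eq_bounded_closed intro: bounded_subset[OF bounded_closed_interval])
  have "?K \<in> null_sets lborel"
    using Z(1) borel_compact[OF K] unfolding null_curve_iff[OF Zs] negligible_iff_null_sets
    by (simp add: null_sets_completion_iff)
  then obtain r :: nat and u v where uv: "\<forall>j<r. u j \<le> v j" "?K \<subseteq> (\<Union>j<r. {u j<..<v j})" "(\<Sum>j<r. v j - u j) \<le> e"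
    by (rule null_interval_cover[OF K _ e])
  let ?W = "\<Union>j<r. {u j<..<v j}"
  have le: "v j - u j \<le> e" if "j < r" for j
    using member_le_sum[of j "{..<r}" "\<lambda>j. v j - u j"] uv that by fastforce
  have "compact ({0..L} - ?W)" by (intro compact_diff compact_Icc open_UN) auto
  then have "compact (p ` ({0..L} - ?W))"
    by (intro compact_continuous_image continuous_on_subset[OF cont_L]) auto
  moreover have "p ` ({0..L} - ?W) \<subseteq> X" using surj(1) by auto
  moreover have "p ` ({0..L} - ?W) \<inter> Z = {}" using uv(2) by blast
  moreover have "X - p ` ({0..L} - ?W) \<subseteq> p ` (?W \<inter> J)"
  proof
    fix x assume x: "x \<in> X - p ` ({0..L} - ?W)"
    then have "prm x \<in> {0..L}" "prm x \<in> J" "p (prm x) = x" using prm_mem prm(2) by auto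
    moreover from this have "prm x \<in> ?W" using x by (metis (no_types, lifting) DiffD2 DiffI imageI)
    ultimately show "x \<in> p ` (?W \<inter> J)" by (metis IntI imageI)
  qed
  ultimately show ?thesis using uv(1,3) le by (intro that[of r u v "p ` ({0..L} - ?W)"]) auto
qed

lemma eventually_uniform_bounds:
  assumes f: "smooth_map I f" "smooth_convergence I fs f"
  obtains B a where "1 \<le> a" "\<forall>\<^sub>F k in sequentially. (\<forall>i\<le>n. \<forall>t\<in>J. norm (nth_deriv J i (fs k \<circ> p) t) \<le> B) \<and>
    (\<forall>x\<in>X. abs_deriv I (fs k) x \<le> exp a)"
proof -
  obtain B where B: "\<forall>i\<le>n. \<forall>t\<in>J. norm (nth_deriv J i (f \<circ> p) t) \<le> B" using bounded_derivs[OF f(1)] by blast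
  have "\<forall>\<^sub>F k in sequentially. \<forall>i\<in>{..n}. \<forall>t\<in>J. norm (nth_deriv J i (fs k \<circ> p) t) \<le> B + 1"
  proof (rule eventually_ball_finite[OF finite_atMost ballI])
    fix i assume i: "i \<in> {..n}"
    have "\<forall>\<^sub>F k in sequentially. \<forall>t\<in>J. dist (nth_deriv J i (fs k \<circ> p) t) (nth_deriv J i (f \<circ> p) t) < 1"
      using f(2) zero_less_one unfolding smooth_convergence_def uniform_limit_iff by blast
    then show "\<forall>\<^sub>F k in sequentially. \<forall>t\<in>J. norm (nth_deriv J i (fs k \<circ> p) t) \<le> B + 1"
    proof eventually_elim
      case (elim k)
      show ?case
      proof
        fix t assume t: "t \<in> J"
        have "norm (nth_deriv J i (f \<circ> p) t) \<le> B" using B i t by simp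
        moreover have "dist (nth_deriv J i (fs k \<circ> p) t) (nth_deriv J i (f \<circ> p) t) < 1" using elim t by blast
        ultimately show "norm (nth_deriv J i (fs k \<circ> p) t) \<le> B + 1"
          using norm_triangle_sub[of "nth_deriv J i (fs k \<circ> p) t" "nth_deriv J i (f \<circ> p) t"]
            by (simp add: dist_norm)
      qed
    qed
  qed
  moreover obtain b where b: "1 \<le> b" "\<And>x. x \<in> X \<Longrightarrow> abs_deriv I f x \<le> b"
    by (rule abs_deriv_bounded[OF f(1)]) (rule that)
  define a where "a = max 1 (ln (b + 1))"
  have a: "b + 1 \<le> exp a"
  proof -
    have "ln (b + 1) \<le> a" by (simp add: a_def)
    then show ?thesis using b(1) by (metis exp_le_cancel_iff exp_ln add_pos_pos less_le_trans zero_less_one)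
  qed
  have "\<forall>\<^sub>F k in sequentially. \<forall>x\<in>X. abs_deriv I (fs k) x \<le> exp a"
    using smooth_convergence_uniform(2)[OF f(2) zero_less_one]
  proof eventually_elim
    case (elim k)
    show ?case using elim b(2) a by (auto simp: abs_le_iff) fastforce
  qed
  ultimately have "\<forall>\<^sub>F k in sequentially. (\<forall>i\<le>n. \<forall>t\<in>J. norm (nth_deriv J i (fs k \<circ> p) t) \<le> B + 1) \<and>
    (\<forall>x\<in>X. abs_deriv I (fs k) x \<le> exp a)" by eventually_elim auto
  then show ?thesis by (rule that[rotated]) (simp add: a_def)
qed

text \<open>By contradiction. The core inequality is applied to a map of the sequence, with an
  iterate N so high that f^N expands too slowly at most points of nonpositive exponent, and with a
  thin neighbourhood of most of Z in the role of U. The event in the inequality has a discontinuous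
  indicator that depends on the index; it is dominated by a continuous function that converges
  uniformly, so that weak-* convergence is needed for \<open>\<phi> f\<close> only.\<close>

theorem limit_not_concentrated:
  assumes f: "smooth_map I f" "\<And>k. smooth_map I (fs k)" "smooth_convergence I fs f"
    and inv: "\<And>k. invariant_prob I (fs k) (\<mu>s k)"
      and ac: "\<And>k. absolutely_continuous (lebesgue_on_curve I) (\<mu>s k)"
    and h: "0 < h" "\<And>k. ereal h \<le> metric_entropy (fs k) (\<mu>s k)"
    and acc: "accumulation_point (weak_star I) \<mu>s \<mu>" and Z: "Z \<in> null_sets (lebesgue_on_curve I)"
  shows "measure \<mu> ({x \<in> X. lyapunov I f x \<le> 0} \<union> Z) \<noteq> 1"
proof
  let ?X1 = "{x \<in> X. lyapunov I f x \<le> 0}"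
  assume full: "measure \<mu> (?X1 \<union> Z) = 1"
  have \<mu>i: "invariant_prob I f \<mu>" by (rule limit_invariant[OF f inv acc])
  then have \<mu>: "\<mu> \<in> borel_probs I" by (simp add: invariant_prob_def)
  then have bp: "prob_space \<mu>" "sets \<mu> = sets (borel_on I)" by (auto simp: borel_probs_def)
  interpret prob_space \<mu> by fact
  have sp: "space \<mu> = X" by (rule space_X[OF bp(2)])
  have Zs: "Z \<in> sets (borel_on I)" using Z by (auto simp: lebesgue_on_curve_def)
  have ev: "?X1 \<in> events" "Z \<in> events" using lyapunov_measurable[OF f(1) bp(2)] Zs bp(2) by auto
  define h1 where "h1 = h / 2"
  have h1: "0 < h1" using h by (simp add: h1_def)
  have hk: "ereal h1 < metric_entropy (fs k) (\<mu>s k)" for k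
    using h by (intro less_le_trans[OF _ h(2)]) (simp add: h1_def)
  define c where "c = h1 / 16"
  have c: "0 < c" using h1 by (simp add: c_def)
  \<comment> \<open>The bound a on the first derivative must precede the choice of n, and the bound
    B on Suc n derivatives can only follow it; hence two separate calls.\<close>
  obtain a B0 where a: "1 \<le> a" "\<forall>\<^sub>F k in sequentially. (\<forall>i\<le>0. \<forall>t\<in>J. norm (nth_deriv J i (fs k \<circ> p) t) \<le> B0) \<and>
      (\<forall>x\<in>X. abs_deriv I (fs k) x \<le> exp a)"
    by (rule eventually_uniform_bounds[OF f(1,3), of 0]) (rule that)
  let ?Q = "\<lambda>n \<beta> k B K. \<forall>g \<mu> (r::nat) u v U.
    smooth_map I g \<longrightarrow> (\<forall>i\<le>Suc n. \<forall>t\<in>J. norm (nth_deriv J i (g \<circ> p) t) \<le> B) \<longrightarrow>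
    (\<forall>x\<in>X. abs_deriv I g x \<le> exp a) \<longrightarrow> invariant_prob I g \<mu> \<longrightarrow> absolutely_continuous (lebesgue_on_curve I) \<mu> \<longrightarrow>
    ereal h1 < metric_entropy g \<mu> \<longrightarrow> U \<in> sets \<mu> \<longrightarrow> (\<forall>j<r. u j \<le> v j \<and> v j - u j \<le> L / 2) \<longrightarrow>
    U \<subseteq> p ` ((\<Union>j<r. {u j<..<v j}) \<inter> J) \<longrightarrow>
    \<beta> \<le> K * (\<Sum>j<r. v j - u j) + measure \<mu> {x \<in> X. exp (h1 / 16 * real k) \<le> jac g k x \<and> (g ^^ k) x \<notin> U}"
  obtain n \<beta> k0 where \<beta>: "0 < \<beta>" and core: "\<forall>k\<ge>k0. \<forall>B. \<exists>K\<ge>0. ?Q n \<beta> k B K"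
    using core_inequality[OF h1 a(1)] by (elim exE conjE)
  obtain B a' where B: "\<forall>\<^sub>F k in sequentially. (\<forall>i\<le>Suc n. \<forall>t\<in>J. norm (nth_deriv J i (fs k \<circ> p) t) \<le> B) \<and>
      (\<forall>x\<in>X. abs_deriv I (fs k) x \<le> exp a')"
    by (rule eventually_uniform_bounds[OF f(1,3), of "Suc n"]) (rule that)
  obtain N where N: "k0 \<le> N" "2 / c \<le> real N" "prob {x \<in> X. lyapunov I f x \<le> 0 \<and>
    exp (c / 2 * real N) < jac f N x} < \<beta> / 8"
  proof -
    have "\<forall>\<^sub>F n in sequentially. 2 / c \<le> real n" using filterlim_real_sequentially
      unfolding filterlim_at_top by blast
    moreover have "\<forall>\<^sub>F n in sequentially. prob {x \<in> X. lyapunov I f x \<le> 0 \<and>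
      exp (c / 2 * real n) < jac f n x} < \<beta> / 8"
      by (rule eventually_slow[OF \<mu> f(1)]) (use c \<beta> in auto)
    ultimately have "\<forall>\<^sub>F n in sequentially. k0 \<le> n \<and> 2 / c \<le> real n \<and>
      prob {x \<in> X. lyapunov I f x \<le> 0 \<and> exp (c / 2 * real n) < jac f n x} < \<beta> / 8"
      using eventually_ge_at_top[of k0] by eventually_elim auto
    then show ?thesis using that eventually_happens' sequentially_bot by blast
  qed
  define E where "E = exp (c * real N)"
  \<comment> \<open>The slow rate c / 2 and the required rate c leave a gap of at least 1, the width
    of the ramp of \<theta>.\<close>
  have E: "exp (c / 2 * real N) \<le> E - 1"
  proof -
    define y where "y = exp (c / 2 * real N)"
    have "1 \<le> c / 2 * real N" using N(2) c by (simp add: field_simps)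
    then have "2 \<le> y" using exp_ge_add_one_self[of "c / 2 * real N"] unfolding y_def by linarith
    then have "y * 2 \<le> y * y" by (intro mult_left_mono) auto
    moreover have "E = y * y" by (simp add: E_def y_def exp_add[symmetric])
    ultimately show ?thesis using \<open>2 \<le> y\<close> unfolding y_def[symmetric] by linarith
  qed
  obtain K where K: "0 \<le> K" "?Q n \<beta> N B K" using spec[OF mp[OF spec[OF core] N(1)], of B] by (elim exE conjE)
  obtain Z' where Z': "compact Z'" "Z' \<subseteq> Z" "prob (Z - Z') \<le> \<beta> / 8"
    by (rule compact_inner_approx[OF bp(1) bp(2)[unfolded borel_on_def] compact_X(2) ev(2), of
      "\<beta> / 8"]) (use \<beta> in auto)
  have Z's: "Z' \<in> events" using sets_X[OF bp(2)] Z' sets.sets_into_space[OF ev(2)]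
    by (auto simp: borel_compact sp)
  have Z'0: "Z' \<in> null_sets (lebesgue_on_curve I)"
    by (rule null_sets_subset[OF Z _ Z'(2)]) (use Z's bp(2) in \<open>auto simp: lebesgue_on_curve_def\<close>)
  define e where "e = min (L / 2) (\<beta> / (8 * (K + 1)))"
  have e: "0 < e" "e \<le> L / 2" "K * e \<le> \<beta> / 8"
  proof -
    show "0 < e" using L \<beta> K(1) by (auto simp: e_def)
    show "e \<le> L / 2" unfolding e_def by (rule min.cobounded1)
    have "e \<le> \<beta> / (8 * (K + 1))" by (simp add: e_def)
    then have "e * (8 * (K + 1)) \<le> \<beta>" using K(1) by (subst (asm) pos_le_divide_eq) auto
    then have "8 * (K * e) + 8 * e \<le> \<beta>" by (simp add: algebra_simps)
    then show "K * e \<le> \<beta> / 8" using \<open>0 < e\<close> by linarith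
  qed
  obtain r :: nat and u v C where uv: "\<forall>j<r. u j \<le> v j \<and> v j - u j \<le> e" "(\<Sum>j<r. v j - u j) \<le> e"
    and C: "compact C" "C \<subseteq> X" "C \<inter> Z' = {}" "X - C \<subseteq> p ` ((\<Union>j<r. {u j<..<v j}) \<inter> J)"
    by (rule null_cover[OF Z'0 Z'(1) e(1)]) (rule that)
  \<comment> \<open>A continuous function that is 1 on the complement C of the neighbourhood and 0
    on Z'.\<close>
  obtain \<psi> :: "'a \<Rightarrow> real" where \<psi>: "continuous_on UNIV \<psi>" "\<And>x. \<psi> x \<in> closed_segment 0 1"
    "\<And>x. x \<in> Z' \<Longrightarrow> \<psi> x = 0" "\<And>x. x \<in> C \<Longrightarrow> \<psi> x = 1"
    by (rule Urysohn[of Z' C 0 "1::real"]) (use Z' C compact_imp_closed in auto)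
  have \<psi>01: "0 \<le> \<psi> x" "\<psi> x \<le> 1" for x using \<psi>(2)[of x] by (auto simp: closed_segment_eq_real_ivl)
  have \<psi>X: "continuous_on X \<psi>" by (rule continuous_on_subset[OF \<psi>(1)]) simp
  \<comment> \<open>A continuous ramp from 0 at E - 1 to 1 at E; its Lipschitz constant 1 passes the
    convergence of \<open>jac\<close> on to \<phi>.\<close>
  define \<theta> where "\<theta> s = min 1 (max 0 (s - E + 1))" for s :: real
  have \<theta>: "0 \<le> \<theta> s" "\<theta> s \<le> 1" "\<bar>\<theta> s - \<theta> s'\<bar> \<le> \<bar>s - s'\<bar>" "E \<le> s \<Longrightarrow> \<theta> s = 1" "s \<le> E - 1 \<Longrightarrow> \<theta> s = 0" for s s'
    by (auto simp: \<theta>_def)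
  define \<phi> where "\<phi> g x = \<theta> (jac g N x) * \<psi> ((g ^^ N) x)" for g x
  have \<phi>c: "continuous_on X (\<phi> g)" if "smooth_map I g" for g
  proof -
    have "continuous_on X (\<lambda>x. \<psi> ((g ^^ N) x))"
      by (rule continuous_on_compose2[OF \<psi>X funpow_continuous[OF that]]) (use funpow_X[OF that] in auto)
    then show ?thesis unfolding \<phi>_def \<theta>_def by (intro continuous_intros jac_continuous that)
  qed
  have \<phi>01: "0 \<le> \<phi> g x" "\<phi> g x \<le> 1" for g x
    using \<theta>(1,2) \<psi>01 by (auto simp: \<phi>_def intro!: mult_nonneg_nonneg mult_le_one)
  have b8: "0 < \<beta> / 8" using \<beta> by simp
  have close: "\<forall>\<^sub>F k in sequentially. \<forall>x\<in>X. \<bar>\<phi> (fs k) x - \<phi> f x\<bar> \<le> \<beta> / 4"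
  proof -
    have "\<forall>\<^sub>F k in sequentially. \<forall>x\<in>X. dist (\<psi> ((fs k ^^ N) x)) (\<psi> ((f ^^ N) x)) < \<beta> / 8"
      by (rule uniform_compose[OF \<psi>X b8]) (use smooth_convergence_funpow[OF f] funpow_X f in auto)
    with smooth_convergence_jac[OF f b8, of N] show ?thesis
    proof eventually_elim
      case (elim k)
      show ?case
      proof
        fix x assume x: "x \<in> X"
        define s where "s = \<theta> (jac (fs k) N x)" define s' where "s' = \<theta> (jac f N x)"
        define t where "t = \<psi> ((fs k ^^ N) x)" define t' where "t' = \<psi> ((f ^^ N) x)"
        have "\<bar>jac (fs k) N x - jac f N x\<bar> < \<beta> / 8" using elim(1) x by blast
        then have ds: "\<bar>s - s'\<bar> \<le> \<beta> / 8" unfolding s_def s'_def using \<theta>(3) by (meson less_imp_le order_trans)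
        have "dist t t' < \<beta> / 8" using elim(2) x unfolding t_def t'_def by blast
        then have dt: "\<bar>t - t'\<bar> \<le> \<beta> / 8" by (simp add: dist_real_def)
        have "s * t - s' * t' = (s - s') * t + s' * (t - t')" by (simp add: algebra_simps)
        then have "\<bar>s * t - s' * t'\<bar> \<le> \<bar>s - s'\<bar> * t + s' * \<bar>t - t'\<bar>"
          using abs_triangle_ineq[of "(s - s') * t" "s' * (t - t')"] \<psi>01 \<theta>(1)
            by (simp add: abs_mult s'_def t_def)
        also have "\<dots> \<le> \<beta> / 8 * 1 + 1 * (\<beta> / 8)"
          using ds dt \<psi>01 \<theta>(1,2) \<beta> by (intro add_mono mult_mono) (auto simp: t_def s'_def)
        finally show "\<bar>\<phi> (fs k) x - \<phi> f x\<bar> \<le> \<beta> / 4" by (simp add: \<phi>_def s_def s'_def t_def t'_def)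
      qed
    qed
  qed
  \<comment> \<open>Accumulation yields its estimate for infinitely many indices only, but the other
    conditions hold eventually, so some index satisfies all of them.\<close>
  obtain k where k: "\<forall>i\<le>Suc n. \<forall>t\<in>J. norm (nth_deriv J i (fs k \<circ> p) t) \<le> B" "\<forall>x\<in>X. abs_deriv I (fs k) x \<le> exp a"
    "\<forall>x\<in>X. \<bar>\<phi> (fs k) x - \<phi> f x\<bar> \<le> \<beta> / 4" "\<bar>(\<integral>x. \<phi> f x \<partial>\<mu>s k) - (\<integral>x. \<phi> f x \<partial>\<mu>)\<bar> < \<beta> / 8"
    using frequently_ex[OF frequently_eventually_conj[OF accumulation_frequently(2)[OF acc b8 \<phi>c[OF f(1)]
      \<phi>c[OF f(1)]]
      eventually_conj[OF a(2) eventually_conj[OF B close]]]] by blast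
  have \<nu>: "\<mu>s k \<in> borel_probs I" using inv[of k] by (simp add: invariant_prob_def)
  then have bk: "prob_space (\<mu>s k)" "sets (\<mu>s k) = sets (borel_on I)" by (auto simp: borel_probs_def)
  interpret m: prob_space "\<mu>s k" by fact
  have Cs: "X - C \<in> sets (\<mu>s k)" using C compact_X(2) by (subst sets_X[OF bk(2)]) (auto simp: borel_compact)
  let ?H = "{x \<in> X. E \<le> jac (fs k) N x \<and> (fs k ^^ N) x \<notin> X - C}"
  have "\<beta> \<le> K * (\<Sum>j<r. v j - u j) + measure (\<mu>s k) ?H"
    unfolding E_def c_def
  proof (rule K(2)[rule_format, OF f(2) _ _ inv ac hk Cs])
    show "u j \<le> v j \<and> v j - u j \<le> L / 2" if "j < r" for j using uv(1) e(2) that by force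
  qed (use k(1,2) C(4) in simp_all)
  also have "K * (\<Sum>j<r. v j - u j) \<le> K * e" using uv(2) K(1) by (rule mult_left_mono)
  also note e(3)
  also have "measure (\<mu>s k) ?H \<le> (\<integral>x. \<phi> f x \<partial>\<mu>s k) + \<beta> / 4"
  proof -
    have Hs: "?H \<in> m.events"
    proof -
      have "?H = {x \<in> X. E \<le> jac (fs k) N x} \<inter> ((fs k ^^ N) -` C \<inter> X)" using funpow_X[OF f(2)] by auto
      moreover have "closed ((fs k ^^ N) -` C \<inter> X)"
        using funpow_continuous[OF f(2)] compact_imp_closed[OF C(1)] continuous_on_closed_vimage[OF
          compact_X(2)] by blast
      ultimately show ?thesis using jac_set[OF f(2) bk(2), of E] sets_X[OF bk(2)] by auto
    qed
    have "measure (\<mu>s k) ?H = (\<integral>x. indicator ?H x \<partial>\<mu>s k)" using Hs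
      by (simp add: Int_absorb2[OF sets.sets_into_space])
    also have "\<dots> \<le> (\<integral>x. \<phi> f x + \<beta> / 4 \<partial>\<mu>s k)"
    proof (rule integral_mono)
      show "integrable (\<mu>s k) (indicator ?H :: 'a \<Rightarrow> real)" using Hs by (simp add: m.emeasure_eq_measure)
      show "integrable (\<mu>s k) (\<lambda>x. \<phi> f x + \<beta> / 4)" using continuous_integrable[OF \<nu> \<phi>c[OF f(1)]] by simp
      fix x assume "x \<in> space (\<mu>s k)"
      then have x: "x \<in> X" using space_X[OF bk(2)] by simp
      have "indicator ?H x \<le> \<phi> (fs k) x"
        using \<phi>01 \<theta>(4) \<psi>(4) funpow_X[OF f(2) x] by (auto simp: \<phi>_def split: split_indicator)
      moreover have "\<bar>\<phi> (fs k) x - \<phi> f x\<bar> \<le> \<beta> / 4" using k(3) x by blast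
      ultimately show "indicator ?H x \<le> \<phi> f x + \<beta> / 4" by linarith
    qed
    also have "\<dots> = (\<integral>x. \<phi> f x \<partial>\<mu>s k) + \<beta> / 4"
      using continuous_integrable[OF \<nu> \<phi>c[OF f(1)]] by (simp add: m.prob_space)
    finally show ?thesis .
  qed
  also have "(\<integral>x. \<phi> f x \<partial>\<mu>s k) \<le> (\<integral>x. \<phi> f x \<partial>\<mu>) + \<beta> / 8" using k(4) by linarith
  also have "(\<integral>x. \<phi> f x \<partial>\<mu>) \<le> \<beta> / 4"
  proof -
    let ?S = "{x \<in> X. lyapunov I f x \<le> 0 \<and> exp (c / 2 * real N) < jac f N x}"
    let ?P = "\<lambda>A. {x \<in> X. (f ^^ N) x \<in> A}"
    let ?D = "Z - Z'" and ?F = "X - (?X1 \<union> Z)"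
    have Fs: "?F \<in> events" "?D \<in> events" using ev Z's sp sets.top[of \<mu>] by (auto intro!: sets.Diff)
    have Ps: "?P A \<in> events" if "A \<in> events" for A
    proof -
      have "f \<in> measurable \<mu> \<mu>" using \<mu>i by (simp add: invariant_prob_def)
      then have "f ^^ N \<in> measurable \<mu> \<mu>" by (rule measurable_compose_n)
      then have "(f ^^ N) -` A \<inter> space \<mu> \<in> events" using that by (rule measurable_sets)
      also have "(f ^^ N) -` A \<inter> space \<mu> = ?P A" using sp by auto
      finally show ?thesis .
    qed
    have Ss: "?S \<in> events"
    proof -
      have "{x \<in> space \<mu>. exp (c / 2 * real N) < jac f N x} \<in> events"
        using measurable_X[OF bp(2) jac_continuous[OF f(1)]] by measurable
      then have "?X1 \<inter> {x \<in> space \<mu>. exp (c / 2 * real N) < jac f N x} \<in> events" using ev(1) by blast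
      also have "?X1 \<inter> {x \<in> space \<mu>. exp (c / 2 * real N) < jac f N x} = ?S" using sp by auto
      finally show ?thesis .
    qed
    have "(\<integral>x. \<phi> f x \<partial>\<mu>) \<le> (\<integral>x. indicator (?S \<union> (?P ?D \<union> ?P ?F)) x \<partial>\<mu>)"
    proof (rule integral_mono[OF continuous_integrable[OF \<mu> \<phi>c[OF f(1)]]])
      show "integrable \<mu> (indicator (?S \<union> (?P ?D \<union> ?P ?F)) :: 'a \<Rightarrow> real)"
        using Ss Ps[OF Fs(1)] Ps[OF Fs(2)] by (simp add: emeasure_eq_measure)
      fix x assume "x \<in> space \<mu>"
      then have x: "x \<in> X" using sp by simp
      show "\<phi> f x \<le> indicator (?S \<union> (?P ?D \<union> ?P ?F)) x"
      proof (cases "x \<in> ?S \<union> (?P ?D \<union> ?P ?F)")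
        case False
        \<comment> \<open>The distinction is made on the image under f^N. If it has nonpositive
          exponent, so has x by \<open>lyapunov_funpow_preimage\<close>; then f^N is slow at x and
          \<theta> vanishes. Otherwise it lies in Z', where \<psi> vanishes.\<close>
        have "jac f N x \<le> E - 1 \<or> (f ^^ N) x \<in> Z'"
        proof (rule ccontr)
          assume n: "\<not> (jac f N x \<le> E - 1 \<or> (f ^^ N) x \<in> Z')"
          have "(f ^^ N) x \<in> ?X1" using False n x funpow_X[OF f(1) x, of N] by blast
          then have "lyapunov I f x \<le> 0" using lyapunov_funpow_preimage[OF f(1) x] by blast
          then show False using False n x E by auto
        qed
        then have "\<phi> f x = 0" using \<theta>(5) \<psi>(3) by (auto simp: \<phi>_def)
        then show ?thesis by simp
      qed (use \<phi>01 in simp)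
    qed
    also have "\<dots> = prob (?S \<union> (?P ?D \<union> ?P ?F))"
      using Ss Ps[OF Fs(1)] Ps[OF Fs(2)]
        by (subst Bochner_Integration.integral_indicator) (simp add: Int_absorb2[OF sets.sets_into_space])
    also have "\<dots> \<le> prob ?S + prob (?P ?D \<union> ?P ?F)"
      by (rule measure_Un_le[OF Ss sets.Un[OF Ps[OF Fs(2)] Ps[OF Fs(1)]]])
    also have "prob (?P ?D \<union> ?P ?F) \<le> prob (?P ?D) + prob (?P ?F)"
      by (rule measure_Un_le[OF Ps[OF Fs(2)] Ps[OF Fs(1)]])
    also have "prob (?P ?D) = prob ?D" by (rule funpow_preserves[OF \<mu>i Fs(2)])
    also have "prob (?P ?F) = prob ?F" by (rule funpow_preserves[OF \<mu>i Fs(1)])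
    also have "prob ?F = 0" using prob_compl[of "?X1 \<union> Z"] ev full sp by simp
    finally show ?thesis using N(3) Z'(3) by simp
  qed
  \<comment> \<open>The four errors \<beta> / 8, \<beta> / 4, \<beta> / 8 and \<beta> / 4 amount to
    3/4 of \<beta>.\<close>
  finally show False using \<beta> by simp
qed

text \<open>A map is nonsingular away from its critical points. In the parameter, all preimages of Z
  form countably many translates of one negligible set, and the lift pulls it back to a negligible
  set where its derivative is nonzero.\<close>

lemma null_vimage:
  assumes g: "smooth_map I g" and Z: "Z \<in> null_sets (lebesgue_on_curve I)"
  shows "{x \<in> X. abs_deriv I g x \<noteq> 0 \<and> g x \<in> Z} \<in> null_sets (lebesgue_on_curve I)"
proof -
  let ?Y = "{x \<in> X. abs_deriv I g x \<noteq> 0 \<and> g x \<in> Z}"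
  have Zs: "Z \<in> sets (borel_on I)" using Z by (auto simp: lebesgue_on_curve_def)
  then have Zb: "Z \<in> sets borel" using sets_X[OF refl] by blast
  have Ys: "?Y \<in> sets (borel_on I)"
  proof -
    have "g -` Z \<inter> space (borel_on I) \<in> sets (borel_on I)"
      using measurable_X[OF refl smooth_continuous[OF g]] Zb by (rule measurable_sets)
    moreover have "abs_deriv I g -` (- {0}) \<inter> space (borel_on I) \<in> sets (borel_on I)"
      using measurable_X[OF refl abs_deriv_continuous[OF g]] by (rule measurable_sets) simp
    ultimately have "(g -` Z \<inter> space (borel_on I)) \<inter> (abs_deriv I g -` (- {0}) \<inter> space (borel_on I)) \<in> sets
      (borel_on I)"
      by (rule sets.Int)
    also have "(g -` Z \<inter> space (borel_on I)) \<inter> (abs_deriv I g -` (- {0}) \<inter> space (borel_on I)) = ?Y"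
      using space_X[OF refl] by auto
    finally show ?thesis .
  qed
  obtain G G' C where G: "\<forall>t\<in>J. G t \<in> J" "\<forall>t\<in>J. p (G t) = g (p t)"
    "\<forall>t\<in>J. (G has_real_derivative G' t) (at t within J)"
    "\<forall>t\<in>J. \<bar>G' t\<bar> = abs_deriv I g (p t)" "bnd 0 C J G'"
    by (rule smooth_lift[OF g])
  define T0 where "T0 = {t \<in> {0..L}. p t \<in> Z}"
  have T0: "negligible T0" using Z null_curve_iff[OF Zs] by (simp add: T0_def)
  have "negligible (\<Union>k::int. (+) (real_of_int k * L) ` T0)"
    by (rule negligible_countable_Union) (auto intro: negligible_translation[OF T0])
  moreover have "{t \<in> J. p t \<in> Z} \<subseteq> (\<Union>k::int. (+) (real_of_int k * L) ` T0)"
  proof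
    fix t assume t: "t \<in> {t \<in> J. p t \<in> Z}"
    then have x: "p t \<in> X" using p_X by blast
    obtain k :: int where "t = prm (p t) + k * L"
      using period[of t "prm (p t)"] prm(2)[OF x] prm_mem(2)[OF x] t by auto
    moreover have "prm (p t) \<in> T0" unfolding T0_def using prm(2)[OF x] prm_mem(1)[OF x] t by simp
    ultimately show "t \<in> (\<Union>k::int. (+) (real_of_int k * L) ` T0)"
      by (auto intro!: exI[of _ k] image_eqI[of _ _ "prm (p t)"])
  qed
  ultimately have T: "negligible {t \<in> J. p t \<in> Z}" by (rule negligible_subset)
  have "negligible {t \<in> {t \<in> {0..L}. G' t \<noteq> 0}. G t \<in> {t \<in> J. p t \<in> Z}}"
  proof (rule negligible_differentiable_vimage[OF T])
    fix t assume t: "t \<in> {t \<in> {0..L}. G' t \<noteq> 0}"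
    then have tJ: "t \<in> J" using dom(1) by blast
    show "inj ((*) (G' t))" using t by (auto simp: inj_on_def)
    show "(G has_derivative (*) (G' t)) (at t within {t \<in> {0..L}. G' t \<noteq> 0})"
      unfolding has_field_derivative_def[symmetric]
      by (rule has_field_derivative_subset[OF bspec[OF G(3) tJ]]) (use dom(1) in auto)
  qed
  moreover have "{t \<in> {0..L}. p t \<in> ?Y} \<subseteq> {t \<in> {t \<in> {0..L}. G' t \<noteq> 0}. G t \<in> {t \<in> J. p t \<in> Z}}"
  proof
    fix t assume t: "t \<in> {t \<in> {0..L}. p t \<in> ?Y}"
    then have tJ: "t \<in> J" using dom(1) by blast
    have "G' t \<noteq> 0" using G(4) tJ t by auto
    then show "t \<in> {t \<in> {t \<in> {0..L}. G' t \<noteq> 0}. G t \<in> {t \<in> J. p t \<in> Z}}" using G(1,2) tJ t by simp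
  qed
  ultimately show ?thesis unfolding null_curve_iff[OF Ys] by (rule negligible_subset)
qed

section \<open>The absolutely continuous part of positive exponent\<close>

lemma critical_lyapunov: "abs_deriv I g x = 0 \<Longrightarrow> lyapunov I g x \<le> 0"
  unfolding lyapunov_le_0_iff
proof (intro allI impI)
  fix c :: real assume a: "abs_deriv I g x = 0"
  have "\<forall>\<^sub>F n in sequentially. (0::nat) < n" by (rule eventually_gt_at_top)
  then show "\<forall>\<^sub>F n in sequentially. jac g n x \<le> exp (c * real n)"
  proof eventually_elim
    case (elim n)
    then obtain m where "n = Suc m" by (cases n) auto
    then show ?case using a by (simp add: jac_Suc)
  qed
qed

text \<open>D is contained in its preimage up to a null set, and both have the same finite
  measure.\<close>

lemma invariant_AE_eq:
  assumes \<mu>: "invariant_prob I g \<mu>" and D: "D \<in> sets \<mu>" and sub: "AE x in \<mu>. x \<in> D \<longrightarrow> g x \<in> D"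
  shows "AE x in \<mu>. g x \<in> D \<longleftrightarrow> x \<in> D"
proof -
  have bp: "prob_space \<mu>" "sets \<mu> = sets (borel_on I)" and T: "g \<in> measurable \<mu> \<mu>"
    using \<mu> by (auto simp: invariant_prob_def borel_probs_def)
  interpret prob_space \<mu> by fact
  let ?P = "g -` D \<inter> space \<mu>"
  have P: "?P \<in> events" using T D by (rule measurable_sets)
  have "prob ?P = prob D"
    using funpow_preserves[OF \<mu> D, of 1] space_X[OF bp(2)] by (simp add: vimage_def Int_def conj_commute)
  also have "prob D = prob (?P \<inter> D)"
    using sub AE_space P D by (intro finite_measure_eq_AE) auto
  finally have "prob (?P - D) = 0" using finite_measure_Diff'[OF P D] by simp
  then have "AE x in \<mu>. x \<notin> ?P - D" using P D by (intro prob_eq_0[THEN iffD1]) auto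
  with sub AE_space show ?thesis by eventually_elim auto
qed

lemma uniform_measure_invariant:
  assumes \<mu>: "invariant_prob I g \<mu>" and D: "D \<in> sets \<mu>" "measure \<mu> D \<noteq> 0" and sub: "AE x in \<mu>. x \<in> D \<longrightarrow> g x \<in> D"
  shows "invariant_prob I g (uniform_measure \<mu> D)"
proof -
  have bp: "prob_space \<mu>" "sets \<mu> = sets (borel_on I)" and T: "g \<in> measurable \<mu> \<mu>" "distr \<mu> \<mu> g = \<mu>"
    using \<mu> by (auto simp: invariant_prob_def borel_probs_def)
  interpret prob_space \<mu> by fact
  let ?\<nu> = "uniform_measure \<mu> D"
  have D0: "emeasure \<mu> D \<noteq> 0" "emeasure \<mu> D \<noteq> \<infinity>" using D(2) by (auto simp: emeasure_eq_measure)
  have T': "g \<in> measurable ?\<nu> ?\<nu>" using T(1) by simp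
  have "distr ?\<nu> ?\<nu> g = ?\<nu>"
  proof (rule measure_eqI)
    fix A assume "A \<in> sets (distr ?\<nu> ?\<nu> g)"
    then have A: "A \<in> events" by simp
    have P: "g -` S \<inter> space \<mu> \<in> events" if "S \<in> events" for S using T(1) that by (rule measurable_sets)
    have "emeasure (distr ?\<nu> ?\<nu> g) A = emeasure \<mu> (D \<inter> (g -` A \<inter> space \<mu>)) / emeasure \<mu> D"
      using A D P[OF A] T' by (simp add: emeasure_distr)
    also have "emeasure \<mu> (D \<inter> (g -` A \<inter> space \<mu>)) = emeasure \<mu> (g -` (D \<inter> A) \<inter> space \<mu>)"
      using invariant_AE_eq[OF \<mu> D(1) sub] P[OF A] P[of "D \<inter> A"] A D(1) by (intro emeasure_eq_AE) auto
    also have "\<dots> = emeasure (distr \<mu> \<mu> g) (D \<inter> A)" using A D T(1) by (intro emeasure_distr[symmetric]) auto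
    also have "\<dots> / emeasure \<mu> D = emeasure ?\<nu> A" using A D by (simp add: T(2))
    finally show "emeasure (distr ?\<nu> ?\<nu> g) A = emeasure ?\<nu> A" .
  qed simp
  then show ?thesis using T' prob_space_uniform_measure[OF D0] bp(2)
    by (simp add: invariant_prob_def borel_probs_def)
qed

text \<open>Z realises the largest mass that a Lebesgue null set can carry inside C, so further null
  sets meet D = C - Z in mass zero, and \<mu> restricted to D is the absolutely continuous part of
  \<mu> on C. Having a set instead of a density lets forward invariance be read off pointwise: a
  point of D is not critical, its image has positive exponent, and the image avoids Z almost surely
  by \<open>null_vimage\<close>.\<close>

theorem SRB_component_of_not_concentrated:
  assumes g: "smooth_map I g" and \<mu>: "invariant_prob I g \<mu>"
    and nc: "\<And>Z. Z \<in> null_sets (lebesgue_on_curve I) \<Longrightarrow> measure \<mu> ({x \<in> X. lyapunov I g x \<le> 0} \<union> Z) \<noteq> 1"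
  shows "has_SRB_component I g \<mu>"
proof -
  have bp: "prob_space \<mu>" "sets \<mu> = sets (borel_on I)" using \<mu>
    by (auto simp: invariant_prob_def borel_probs_def)
  interpret prob_space \<mu> by fact
  have sp: "space \<mu> = X" by (rule space_X[OF bp(2)])
  let ?X1 = "{x \<in> X. lyapunov I g x \<le> 0}" and ?N = "null_sets (lebesgue_on_curve I)"
  have X1: "?X1 \<in> events" by (rule lyapunov_measurable[OF g bp(2)])
  define C where "C = X - ?X1"
  have C: "C \<in> events" using X1 sets.compl_sets[OF X1] sp by (simp add: C_def)
  have Ns: "Z \<in> events" if "Z \<in> ?N" for Z using null_setsD2[OF that] bp(2) by (simp add: lebesgue_on_curve_def)
  define s where "s = (SUP Z\<in>?N. prob (C \<inter> Z))"
  have bdd: "bdd_above ((\<lambda>Z. prob (C \<inter> Z)) ` ?N)" by (intro bdd_aboveI[of _ 1]) auto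
  have ne: "?N \<noteq> {}" by (metis empty_iff null_sets.empty_sets)
  have "\<exists>Z\<in>?N. s - 1 / real (Suc n) < prob (C \<inter> Z)" for n
    using less_cSUP_iff[OF ne bdd, of "s - 1 / real (Suc n)"] by (simp add: s_def)
  then obtain Zn where Zn: "\<And>n. Zn n \<in> ?N" "\<And>n. s - 1 / real (Suc n) < prob (C \<inter> Zn n)" by metis
  define Z where "Z = (\<Union>n. Zn n)"
  have Z: "Z \<in> ?N" unfolding Z_def using Zn(1) by (rule null_sets_UN)
  have sZ: "s \<le> prob (C \<inter> Z)"
  proof (rule field_le_epsilon)
    fix e :: real assume "0 < e"
    then obtain n where n: "1 / real (Suc n) < e" by (rule nat_approx_posE)
    have "prob (C \<inter> Zn n) \<le> prob (C \<inter> Z)" using sets.Int[OF C Ns[OF Z]]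
      by (rule finite_measure_mono[rotated]) (unfold Z_def, blast)
    then show "s \<le> prob (C \<inter> Z) + e" using n Zn(2)[of n] by linarith
  qed
  define D where "D = C - Z"
  have D: "D \<in> events" using C Ns[OF Z] by (simp add: D_def)
  have D0: "prob (D \<inter> Y) = 0" if Y: "Y \<in> ?N" for Y
  proof -
    have "prob (C \<inter> (Z \<union> Y)) \<le> s" unfolding s_def using Z Y by (intro cSUP_upper bdd) auto
    moreover have "prob (C \<inter> (Z \<union> Y)) = prob (C \<inter> Z) + prob (D \<inter> Y)"
    proof -
      have "C \<inter> (Z \<union> Y) = C \<inter> Z \<union> D \<inter> Y" by (auto simp: D_def)
      moreover have "prob (C \<inter> Z \<union> D \<inter> Y) = prob (C \<inter> Z) + prob (D \<inter> Y)"
        using C D Ns[OF Z] Ns[OF Y] by (intro finite_measure_Union) (auto simp: D_def)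
      ultimately show ?thesis by simp
    qed
    ultimately show ?thesis using sZ measure_nonneg[of \<mu> "D \<inter> Y"] by linarith
  qed
  have Dpos: "prob D \<noteq> 0"
  proof
    assume "prob D = 0"
    then have "prob (space \<mu> - D) = 1" using prob_compl[OF D] by simp
    moreover have "prob (space \<mu> - D) \<le> prob (?X1 \<union> Z)" using X1 Ns[OF Z] sp
      by (intro finite_measure_mono) (auto simp: D_def C_def)
    ultimately show False using nc[OF Z] prob_le_1[of "?X1 \<union> Z"] by linarith
  qed
  have sub: "AE x in \<mu>. x \<in> D \<longrightarrow> g x \<in> D"
  proof -
    let ?Y = "{x \<in> X. abs_deriv I g x \<noteq> 0 \<and> g x \<in> Z}"
    have Y: "?Y \<in> ?N" by (rule null_vimage[OF g Z])
    \<comment> \<open>Maximality of Z, applied to the noncritical part of the preimage of Z.\<close>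
    have "AE x in \<mu>. x \<notin> D \<inter> ?Y" using D0[OF Y] sets.Int[OF D Ns[OF Y]] by (simp only: prob_eq_0)
    then show ?thesis
    proof eventually_elim
      case (elim x)
      show ?case
      proof
        assume x: "x \<in> D"
        then have xX: "x \<in> X" "\<not> lyapunov I g x \<le> 0" by (auto simp: D_def C_def)
        have "\<not> lyapunov I g (g x) \<le> 0" using lyapunov_preimage[OF g xX(1)] xX(2) by blast
        moreover have "g x \<notin> Z" using elim x xX critical_lyapunov by blast
        ultimately show "g x \<in> D" using smooth_X[OF g xX(1)] by (simp add: D_def C_def)
      qed
    qed
  qed
  define \<mu>1 where "\<mu>1 = uniform_measure \<mu> D"
  have \<mu>1i: "invariant_prob I g \<mu>1" unfolding \<mu>1_def by (rule uniform_measure_invariant[OF \<mu> D Dpos sub])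
  have hyp: "hyperbolic I g \<mu>1"
    unfolding hyperbolic_def \<mu>1_def by (rule AE_uniform_measureI[OF D]) (auto simp: D_def C_def not_le)
  have ac: "absolutely_continuous (lebesgue_on_curve I) \<mu>1"
    unfolding absolutely_continuous_def
  proof
    fix Y assume Y: "Y \<in> ?N"
    show "Y \<in> null_sets \<mu>1" using D0[OF Y] D Ns[OF Y] by (auto simp: \<mu>1_def null_sets_def emeasure_eq_measure)
  qed
  have SRB1: "SRB I g \<mu>1" using \<mu>1i hyp ac by (simp add: SRB_def)
  have m1: "prob D * measure \<mu>1 A = prob (D \<inter> A)" if "A \<in> events" for A
    using Dpos D that by (simp add: \<mu>1_def emeasure_eq_measure)
  have split: "prob A = prob (D \<inter> A) + prob ((space \<mu> - D) \<inter> A)" if A: "A \<in> events" for A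
  proof -
    have "A = D \<inter> A \<union> (space \<mu> - D) \<inter> A" using sets.sets_into_space[OF A] by auto
    then have "prob A = prob (D \<inter> A \<union> (space \<mu> - D) \<inter> A)" by simp
    also have "\<dots> = prob (D \<inter> A) + prob ((space \<mu> - D) \<inter> A)" using A D by (intro finite_measure_Union) auto
    finally show ?thesis .
  qed
  have Dc: "space \<mu> - D \<in> events" "prob (space \<mu> - D) = 1 - prob D" using D prob_compl[OF D] by auto
  have "\<exists>\<mu>0. invariant_prob I g \<mu>0 \<and> (\<forall>A\<in>events. (1 - prob D) * measure \<mu>0 A = prob ((space \<mu> - D) \<inter> A))"
  proof (cases "prob D = 1")
    \<comment> \<open>The second measure then has coefficient 0, but some invariant measure must
      still be named.\<close>
    case True
    then have "prob ((space \<mu> - D) \<inter> A) = 0" if "A \<in> events" for A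
      using finite_measure_mono[of "(space \<mu> - D) \<inter> A" "space \<mu> - D"] Dc that by (simp add: measure_le_0_iff)
    then show ?thesis using \<mu>1i True by auto
  next
    case False
    have Dc0: "prob (space \<mu> - D) \<noteq> 0" using Dc False by simp
    have "AE x in \<mu>. x \<in> space \<mu> - D \<longrightarrow> g x \<in> space \<mu> - D"
      using invariant_AE_eq[OF \<mu> D sub] by eventually_elim (use smooth_X[OF g] sp in auto)
    then have "invariant_prob I g (uniform_measure \<mu> (space \<mu> - D))"
      by (rule uniform_measure_invariant[OF \<mu> Dc(1) Dc0])
    moreover have "(1 - prob D) * measure (uniform_measure \<mu> (space \<mu> - D)) A = prob ((space \<mu> - D) \<inter> A)"
      if "A \<in> events" for A
      using Dc Dc0 that by (subst measure_uniform_measure) (auto simp: emeasure_eq_measure)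
    ultimately show ?thesis by blast
  qed
  then obtain \<mu>0 where \<mu>0: "invariant_prob I g \<mu>0" "\<forall>A\<in>events. (1 - prob D) * measure \<mu>0 A =
    prob ((space \<mu> - D) \<inter> A)" by blast
  have "0 < prob D" "prob D \<le> 1" using Dpos by (auto simp: zero_less_measure_iff)
  moreover have "\<forall>A\<in>events. prob A = prob D * measure \<mu>1 A + (1 - prob D) * measure \<mu>0 A"
    using m1 \<mu>0(2) split by simp
  ultimately show ?thesis unfolding has_SRB_component_def using \<mu> SRB1 \<mu>0(1) by blast
qed

theorem limit_has_SRB_component:
  assumes f: "smooth_map I f" "\<And>k. smooth_map I (fs k)" "smooth_convergence I fs f"
    and SRB: "\<And>k. SRB I (fs k) (\<mu>s k)" and h: "0 < h" "\<And>k. ereal h \<le> metric_entropy (fs k) (\<mu>s k)"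
    and acc: "accumulation_point (weak_star I) \<mu>s \<mu>"
  shows "has_SRB_component I f \<mu>"
proof -
  have S: "invariant_prob I (fs k) (\<mu>s k)" "absolutely_continuous (lebesgue_on_curve I) (\<mu>s k)" for k
    using SRB[of k] by (auto simp: SRB_def)
  show ?thesis
    by (rule SRB_component_of_not_concentrated[OF f(1) limit_invariant[OF f S(1) acc]
        limit_not_concentrated[OF f S h acc]])
qed

end

section \<open>The interval and the circle\<close>

lemma smooth_nth_deriv:
  assumes "smooth_map I g" "t \<in> par_dom I"
  shows "(nth_deriv (par_dom I) i (g \<circ> par I) has_vector_derivative nth_deriv (par_dom I) (Suc i) (g \<circ> par I) t)
    (at t within par_dom I)"
  using assms by (simp add: smooth_map_def differentiable_on_def vector_derivative_works[symmetric])

lemma smooth_nth_deriv_continuous: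
  "smooth_map I g \<Longrightarrow> continuous_on (par_dom I) (nth_deriv (par_dom I) i (g \<circ> par I))"
  by (simp add: smooth_map_def differentiable_imp_continuous_on)

lemma smooth_bnd:
  assumes g: "smooth_map I g" and l: "bounded_linear l" "\<And>x. \<bar>l x\<bar> \<le> norm x"
    and B: "\<forall>i\<le>m + n. \<forall>t\<in>par_dom I. norm (nth_deriv (par_dom I) i (g \<circ> par I) t) \<le> B"
  shows "bnd n B (par_dom I) (\<lambda>t. l (nth_deriv (par_dom I) m (g \<circ> par I) t))"
proof -
  let ?d = "\<lambda>i t. l (nth_deriv (par_dom I) (m + i) (g \<circ> par I) t)"
  have "bnd n B (par_dom I) (?d 0)"
  proof (rule chain_bnd)
    show "\<forall>i<n. \<forall>x\<in>par_dom I. (?d i has_real_derivative ?d (Suc i) x) (at x within par_dom I)"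
      using bounded_linear.has_vector_derivative[OF l(1) smooth_nth_deriv[OF g]]
      by (simp add: has_real_derivative_iff_has_vector_derivative del: nth_deriv.simps)
    show "\<forall>i\<le>n. \<forall>x\<in>par_dom I. \<bar>?d i x\<bar> \<le> B" using B l(2) by (meson add_le_cancel_left order_trans)
  qed
  then show ?thesis by simp
qed

interpretation interval: curve_system unit_interval 1
proof
  let ?I = unit_interval
  have I: "par ?I = (\<lambda>t. t)" "par_dom ?I = {0..1}" "fund_dom ?I = {0..1}" "points ?I = {0..1}"
    by (simp_all add: unit_interval_def points_def)
  have inv: "inv_into {0..1} (\<lambda>t. t) x = x" if "x \<in> {0..1}" for x :: real
    using inv_into_f_f[of "\<lambda>t. t" "{0..1}" x] that by simp
  show "(0::real) < 1" "{0..1} \<subseteq> par_dom ?I" "convex (par_dom ?I)" "fund_dom ?I \<subseteq> {0..1}"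
    "fund_dom ?I \<in> sets borel"
    "{0..<1} \<subseteq> fund_dom ?I" "par ?I ` {0..1} = points ?I" "bij_betw (par ?I) (fund_dom ?I) (points ?I)"
    "continuous_on (par_dom ?I) (par ?I)"
    by (auto simp: I bij_betw_def continuous_on_id)
  have "(\<lambda>x. x) \<in> borel_measurable (borel_on ?I)"
    unfolding borel_on_def by (intro measurable_restrict_space1) simp
  then show "inv_into (fund_dom ?I) (par ?I) \<in> borel_measurable (borel_on ?I)"
    by (rule measurable_cong[THEN iffD1, rotated]) (simp add: I borel_on_def space_restrict_space inv)
  show "\<exists>k::int. s = t + k * 1" if "par ?I s = par ?I t" for s t
    using that by (intro exI[of _ 0]) (simp add: I)
  show "\<exists>B. \<forall>t\<in>par_dom ?I. norm (nth_deriv (par_dom ?I) n (g \<circ> par ?I) t) \<le> B" if g: "smooth_map ?I g" for g n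
  proof -
    have "bounded (nth_deriv (par_dom ?I) n (g \<circ> par ?I) ` par_dom ?I)"
      by (intro compact_imp_bounded compact_continuous_image smooth_nth_deriv_continuous g) (simp add: I)
    then show ?thesis unfolding bounded_iff by blast
  qed
  fix n B
  show "\<exists>C\<ge>0. \<forall>g. smooth_map ?I g \<longrightarrow>
      (\<forall>i\<le>Suc n. \<forall>t\<in>par_dom ?I. norm (nth_deriv (par_dom ?I) i (g \<circ> par ?I) t) \<le> B) \<longrightarrow>
      (\<exists>G G'. (\<forall>t\<in>par_dom ?I. G t \<in> par_dom ?I \<and> par ?I (G t) = g (par ?I t) \<and>
          (G has_real_derivative G' t) (at t within par_dom ?I) \<and> \<bar>G' t\<bar> = abs_deriv ?I g (par ?I t)) \<and>
        bnd n C (par_dom ?I) G')"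
  proof (rule exI[of _ "\<bar>B\<bar>"], intro conjI allI impI)
    fix g assume g: "smooth_map ?I g"
      and B: "\<forall>i\<le>Suc n. \<forall>t\<in>par_dom ?I. norm (nth_deriv (par_dom ?I) i (g \<circ> par ?I) t) \<le> B"
    let ?G' = "nth_deriv (par_dom ?I) 1 (g \<circ> par ?I)"
    have gp: "g \<circ> par ?I = g" by (simp add: I fun_eq_iff)
    show "\<exists>G G'. (\<forall>t\<in>par_dom ?I. G t \<in> par_dom ?I \<and> par ?I (G t) = g (par ?I t) \<and>
          (G has_real_derivative G' t) (at t within par_dom ?I) \<and> \<bar>G' t\<bar> = abs_deriv ?I g (par ?I t)) \<and>
        bnd n \<bar>B\<bar> (par_dom ?I) G'"
    proof (rule exI[of _ g], rule exI[of _ ?G'], intro conjI ballI)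
      fix t assume t: "t \<in> par_dom ?I"
      show "g t \<in> par_dom ?I" using g t by (auto simp: smooth_map_def I)
      show "par ?I (g t) = g (par ?I t)" by (simp add: I)
      show "(g has_real_derivative ?G' t) (at t within par_dom ?I)"
        using smooth_nth_deriv[OF g t, of 0] by (simp add: gp has_real_derivative_iff_has_vector_derivative)
      show "\<bar>?G' t\<bar> = abs_deriv ?I g (par ?I t)" using t by (simp add: abs_deriv_def I inv)
    next
      have "bnd n B (par_dom ?I) ?G'"
        using smooth_bnd[OF g bounded_linear_ident, of 1 n B] B by simp
      then show "bnd n \<bar>B\<bar> (par_dom ?I) ?G'" by (rule bnd_mono) simp
    qed
  qed simp
qed

lemma cis_eq_iff: "cis s = cis t \<longleftrightarrow> (\<exists>k::int. s = t + k * (2 * pi))"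
  using sin_cos_eq_iff[of s t] by (auto simp: complex_eq_iff mult_ac)

lemma cis_reduce:
  obtains s where "s \<in> {0..<2 * pi}" "cis s = cis t"
proof
  let ?k = "\<lfloor>t / (2 * pi)\<rfloor>" and ?s = "t - \<lfloor>t / (2 * pi)\<rfloor> * (2 * pi)"
  have "of_int ?k \<le> t / (2 * pi)" "t / (2 * pi) < of_int ?k + 1" by linarith+
  then have "of_int ?k * (2 * pi) \<le> t" "t < (of_int ?k + 1) * (2 * pi)"
    using pi_gt_zero by (simp_all only: pos_le_divide_eq pos_divide_less_eq mult_pos_pos zero_less_numeral)
  then show "?s \<in> {0..<2 * pi}" by (simp add: algebra_simps)
  have "?s = t + real_of_int (- ?k) * (2 * pi)" by simp
  then show "cis ?s = cis t" unfolding cis_eq_iff by blast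
qed

lemma circle_nth_deriv_periodic:
  assumes g: "smooth_map circle g" and st: "cis s = cis t"
  shows "nth_deriv UNIV n (g \<circ> cis) s = nth_deriv UNIV n (g \<circ> cis) t"
proof -
  let ?D = "\<lambda>n. nth_deriv UNIV n (g \<circ> cis)"
  have d: "(?D n has_vector_derivative ?D (Suc n) t) (at t)" for n t
    using smooth_nth_deriv[OF g, of t n] by (simp add: circle_def)
  have "?D n (t + 2 * pi) = ?D n t" for t
  proof (induction n arbitrary: t)
    case 0
    have "cis (t + 2 * pi) = cis t" unfolding cis_eq_iff by (rule exI[of _ 1]) simp
    then show ?case by simp
  next
    case (Suc n)
    have "((\<lambda>x. x + 2 * pi) has_vector_derivative 1) (at t)" by (auto intro!: derivative_eq_intros)
    from vector_diff_chain_at[OF this d[of n "t + 2 * pi"]]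
    have "((\<lambda>x. ?D n (x + 2 * pi)) has_vector_derivative ?D (Suc n) (t + 2 * pi)) (at t)" by (simp add: o_def)
    then have "(?D n has_vector_derivative ?D (Suc n) (t + 2 * pi)) (at t)" by (simp only: Suc.IH)
    then show ?case using vector_derivative_unique_at d by blast
  qed
  then interpret periodic_fun_simple "?D n" "2 * pi" by unfold_locales
  obtain k :: int where "s = t + k * (2 * pi)" using st unfolding cis_eq_iff by blast
  then show ?thesis using plus_of_int[of t k] by simp
qed

text \<open>The angle is found by integration instead of covering theory. Differentiating |u|^2 = 1
  shows that cnj u * u' is purely imaginary, say \<i> * G'; an antiderivative G makes cis (- G) * u
  constant, and the initial value makes the constant 1. The explicit formula for G' also yields the
  bounds on its derivatives by the product rule.\<close>

lemma circle_lift: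
  assumes g: "smooth_map circle g"
  obtains G where "\<And>t. cis (G t) = g (cis t)"
    "\<And>t. (G has_real_derivative Re (g (cis t)) * Im (nth_deriv UNIV 1 (g \<circ> cis) t) - Im (g (cis t)) * Re
      (nth_deriv UNIV 1 (g \<circ> cis) t)) (at t)"
    "\<And>t. \<bar>Re (g (cis t)) * Im (nth_deriv UNIV 1 (g \<circ> cis) t) - Im (g (cis t)) * Re (nth_deriv UNIV 1 (g \<circ>
      cis) t)\<bar> =
      norm (nth_deriv UNIV 1 (g \<circ> cis) t)"
proof -
  define u where "u t = g (cis t)" for t
  define u1 where "u1 = nth_deriv UNIV 1 (g \<circ> cis)"
  define G' where "G' t = Re (u t) * Im (u1 t) - Im (u t) * Re (u1 t)" for t
  have du: "(u has_vector_derivative u1 t) (at t)" for t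
    using smooth_nth_deriv[OF g, of t 0] by (simp add: circle_def u_def[abs_def] u1_def o_def)
  have u1: "norm (u t) = 1" for t
    using g by (auto simp: u_def smooth_map_def points_circle Pi_iff)
  then have ru: "(Re (u t))\<^sup>2 + (Im (u t))\<^sup>2 = 1" for t by (metis cmod_power2 one_power2)
  have dR: "((\<lambda>t. Re (u t)) has_real_derivative Re (u1 t)) (at t)"
    "((\<lambda>t. Im (u t)) has_real_derivative Im (u1 t)) (at t)" for t
    using bounded_linear.has_vector_derivative[OF bounded_linear_Re du]
      bounded_linear.has_vector_derivative[OF bounded_linear_Im du]
    by (simp_all add: has_real_derivative_iff_has_vector_derivative)
  have orth: "Re (u t) * Re (u1 t) + Im (u t) * Im (u1 t) = 0" for t
  proof -
    have "((\<lambda>t. (Re (u t))\<^sup>2 + (Im (u t))\<^sup>2) has_real_derivative 2 * Re (u t) * Re (u1 t) +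
      2 * Im (u t) * Im (u1 t)) (at t)"
      using DERIV_add[OF DERIV_power[OF dR(1)[of t], of 2] DERIV_power[OF dR(2)[of t], of 2]]
        by (simp add: mult_ac)
    then have "((\<lambda>t. 1 :: real) has_real_derivative 2 * Re (u t) * Re (u1 t) +
      2 * Im (u t) * Im (u1 t)) (at t)" by (simp only: ru)
    then have "2 * Re (u t) * Re (u1 t) + 2 * Im (u t) * Im (u1 t) = 0" using DERIV_const DERIV_unique by blast
    then show ?thesis by simp
  qed
  have cnj: "cnj (u t) * u1 t = \<i> * of_real (G' t)" for t
    using orth[of t] by (simp add: complex_eq_iff G'_def algebra_simps)
  have u1G: "u1 t = u t * (\<i> * of_real (G' t))" for t
  proof -
    have "u t * (cnj (u t) * u1 t) = u1 t" using u1[of t]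
      by (simp add: mult.assoc[symmetric] complex_norm_square[symmetric])
    then show ?thesis unfolding cnj by simp
  qed
  have nG: "\<bar>G' t\<bar> = norm (u1 t)" for t unfolding u1G by (simp add: norm_mult u1)
  have "continuous_on UNIV u1" using smooth_nth_deriv_continuous[OF g, of 1] by (simp add: circle_def u1_def)
  moreover have "continuous_on UNIV u"
    using du by (intro continuous_at_imp_continuous_on ballI has_vector_derivative_continuous) blast
  ultimately have "continuous_on UNIV G'" unfolding G'_def by (intro continuous_intros)
  then obtain F where F: "\<And>t. (F has_vector_derivative G' t) (at t)"
    using einterval_antiderivative[of "- \<infinity>" \<infinity> G'] by (auto simp: continuous_on_eq_continuous_at)
  define G where "G t = Arg (u 0) + (F t - F 0)" for t
  have dG: "(G has_real_derivative G' t) (at t)" for t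
    unfolding G_def using F[of t] unfolding has_real_derivative_iff_has_vector_derivative[symmetric]
    by (auto intro!: derivative_eq_intros)
  have "((\<lambda>t. cis (- G t) * u t) has_vector_derivative 0) (at t within UNIV)" for t
  proof -
    have "((\<lambda>t. - G t) has_vector_derivative - G' t) (at t)"
      using DERIV_minus[OF dG[of t]] by (simp add: has_real_derivative_iff_has_vector_derivative)
    then have "((\<lambda>t. cis (- G t)) has_vector_derivative (- G' t) *\<^sub>R (\<i> * cis (- G t))) (at t)"
      unfolding has_vector_derivative_def by (auto dest!: has_derivative_cis simp: o_def)
    from has_vector_derivative_mult[OF this du[of t]]
    show ?thesis by (rule has_vector_derivative_eq_rhs) (simp add: u1G scaleR_conv_of_real algebra_simps)
  qed
  then obtain w where w: "\<And>t. cis (- G t) * u t = w"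
    by (rule has_vector_derivative_zero_constant[OF convex_UNIV]) auto
  have "u 0 = cis (Arg (u 0))" using u1[of 0] cis_Arg[of "u 0"]
    by (metis divide_self_if norm_zero sgn_div_norm inverse_1 scaleR_one zero_neq_one)
  then have "w = 1" using w[of 0] by (simp add: G_def) (metis add.left_inverse cis_mult cis_zero)
  then have "cis (G t) = u t" for t using w[of t]
    by (metis add.right_inverse cis_mult cis_zero mult.assoc mult.right_neutral mult_1)
  then show ?thesis using dG nG by (intro that[of G]) (auto simp: u_def u1_def G'_def)
qed

interpretation circle: curve_system circle "2 * pi"
proof
  let ?I = circle
  have I: "par ?I = cis" "par_dom ?I = UNIV" "fund_dom ?I = {0..<2 * pi}" "points ?I = range cis"
    by (simp_all add: circle_def points_def)
  have rng: "cis ` {0..<2 * pi} = range cis"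
  proof -
    have "cis t \<in> cis ` {0..<2 * pi}" for t
      by (rule cis_reduce[of t]) (metis imageI)
    then show ?thesis by blast
  qed
  have inj: "inj_on cis {0..<2 * pi}"
  proof (rule inj_onI)
    fix s t assume st: "s \<in> {0..<2 * pi}" "t \<in> {0..<2 * pi}" "cis s = cis t"
    then obtain k :: int where k: "s = t + k * (2 * pi)" unfolding cis_eq_iff by blast
    have "0 \<le> s" "s < 2 * pi" "0 \<le> t" "t < 2 * pi" using st by auto
    then have "real_of_int k * (2 * pi) < 1 * (2 * pi)" "(- 1) * (2 * pi) < real_of_int k * (2 * pi)"
      using k by linarith+
    then have "real_of_int k < 1" "- 1 < real_of_int k" unfolding mult_less_cancel_right using pi_gt_zero
      by auto
    then have "k = 0" by linarith
    then show "s = t" using k by simp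
  qed
  have bij: "bij_betw cis {0..<2 * pi} (range cis)" using inj rng by (simp add: bij_betw_def)
  have full: "cis ` {0..2 * pi} = range cis"
  proof -
    have "cis ` {0..<2 * pi} \<subseteq> cis ` {0..2 * pi}" by (intro image_mono) auto
    then show ?thesis using rng by blast
  qed
  have cr: "closed (range cis)" unfolding full[symmetric]
    by (intro compact_imp_closed compact_continuous_image continuous_on_cis continuous_on_id) auto
  show "0 < 2 * pi" "{0..2 * pi} \<subseteq> par_dom ?I" "convex (par_dom ?I)" "fund_dom ?I \<subseteq> {0..2 * pi}"
    "fund_dom ?I \<in> sets borel"
    "{0..<2 * pi} \<subseteq> fund_dom ?I" "par ?I ` {0..2 * pi} = points ?I"
      "bij_betw (par ?I) (fund_dom ?I) (points ?I)"
    "continuous_on (par_dom ?I) (par ?I)"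
    using full bij by (auto simp: I intro!: continuous_on_cis continuous_on_id)
  show "inv_into (fund_dom ?I) (par ?I) \<in> borel_measurable (borel_on ?I)"
  proof (rule borel_measurableI_le)
    fix a
    let ?S = "{x \<in> space (borel_on ?I). inv_into (fund_dom ?I) (par ?I) x \<le> a}"
    \<comment> \<open>Sublevel sets of the angle are closed arcs starting at 1, empty for negative
      a; so measurability holds although the angle jumps at 1.\<close>
    have "?S = (if a < 2 * pi then cis ` {0..a} else range cis)"
    proof -
      have "?S = {x \<in> cis ` {0..<2 * pi}. inv_into {0..<2 * pi} cis x \<le> a}" unfolding rng
        by (simp add: borel_on_def space_restrict_space I)
      also have "\<dots> = cis ` {t \<in> {0..<2 * pi}. t \<le> a}" by (auto simp: inv_into_f_f[OF inj])
      also have "{t \<in> {0..<2 * pi}. t \<le> a} = (if a < 2 * pi then {0..a} else {0..<2 * pi})" by auto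
      finally show ?thesis by (simp add: rng)
    qed
    also have "\<dots> \<in> sets (borel_on ?I)"
    proof -
      have "closed (cis ` {0..a})"
        by (intro compact_imp_closed compact_continuous_image continuous_on_cis continuous_on_id) auto
      then show ?thesis using cr unfolding borel_on_def
        by (subst sets_restrict_space_iff) (auto simp: I intro: borel_closed)
    qed
    finally show "?S \<in> sets (borel_on ?I)" .
  qed
  show "\<exists>k::int. s = t + k * (2 * pi)" if "par ?I s = par ?I t" for s t
    using that by (simp add: I cis_eq_iff)
  show "\<exists>B. \<forall>t\<in>par_dom ?I. norm (nth_deriv (par_dom ?I) n (g \<circ> par ?I) t) \<le> B" if g: "smooth_map ?I g" for g n
  proof -
    have "bounded (nth_deriv UNIV n (g \<circ> cis) ` {0..2 * pi})"
      using smooth_nth_deriv_continuous[OF g, of n] unfolding I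
      by (intro compact_imp_bounded compact_continuous_image) (auto elim: continuous_on_subset)
    then obtain B where B: "\<And>t. t \<in> {0..2 * pi} \<Longrightarrow> norm (nth_deriv UNIV n (g \<circ> cis) t) \<le> B"
      unfolding bounded_iff by blast
    have "norm (nth_deriv UNIV n (g \<circ> cis) t) \<le> B" for t
    proof -
      obtain s where s: "s \<in> {0..<2 * pi}" "cis s = cis t" by (rule cis_reduce)
      then show ?thesis using B[of s] circle_nth_deriv_periodic[OF g s(2), of n] by auto
    qed
    then show ?thesis unfolding I by blast
  qed
  fix n and B :: real
  \<comment> \<open>The product rule for the two products in G'; the factor |- 1| is the one
    produced by \<open>bnd_cmult\<close> for the minus sign.\<close>
  define C where "C = 2 ^ n * (\<bar>B\<bar> * \<bar>B\<bar>) + \<bar>- 1\<bar> * (2 ^ n * (\<bar>B\<bar> * \<bar>B\<bar>))"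
  show "\<exists>C\<ge>0. \<forall>g. smooth_map ?I g \<longrightarrow>
      (\<forall>i\<le>Suc n. \<forall>t\<in>par_dom ?I. norm (nth_deriv (par_dom ?I) i (g \<circ> par ?I) t) \<le> B) \<longrightarrow>
      (\<exists>G G'. (\<forall>t\<in>par_dom ?I. G t \<in> par_dom ?I \<and> par ?I (G t) = g (par ?I t) \<and>
          (G has_real_derivative G' t) (at t within par_dom ?I) \<and> \<bar>G' t\<bar> = abs_deriv ?I g (par ?I t)) \<and>
        bnd n C (par_dom ?I) G')"
  proof (rule exI[of _ C], intro conjI allI impI)
    fix g assume g: "smooth_map ?I g"
      and B: "\<forall>i\<le>Suc n. \<forall>t\<in>par_dom ?I. norm (nth_deriv (par_dom ?I) i (g \<circ> par ?I) t) \<le> B"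
    let ?D = "nth_deriv UNIV 1 (g \<circ> cis)"
    let ?G' = "\<lambda>t. Re (g (cis t)) * Im (?D t) - Im (g (cis t)) * Re (?D t)"
    obtain G where G: "\<And>t. cis (G t) = g (cis t)" "\<And>t. (G has_real_derivative ?G' t) (at t)"
      "\<And>t. \<bar>?G' t\<bar> = norm (?D t)"
      by (rule circle_lift[OF g]) (rule that)
    show "\<exists>G G'. (\<forall>t\<in>par_dom ?I. G t \<in> par_dom ?I \<and> par ?I (G t) = g (par ?I t) \<and>
          (G has_real_derivative G' t) (at t within par_dom ?I) \<and> \<bar>G' t\<bar> = abs_deriv ?I g (par ?I t)) \<and>
        bnd n C (par_dom ?I) G'"
    proof (rule exI[of _ G], rule exI[of _ ?G'], intro conjI ballI)
      fix t assume "t \<in> par_dom ?I"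
      show "G t \<in> par_dom ?I" "par ?I (G t) = g (par ?I t)"
        "(G has_real_derivative ?G' t) (at t within par_dom ?I)"
        using G(1,2) by (simp_all add: I)
      \<comment> \<open>\<open>abs_deriv\<close> uses the parameter in the fundamental domain, and
        periodicity of the derivative allows any other.\<close>
      have "cis (inv_into {0..<2 * pi} cis (cis t)) = cis t" by (rule f_inv_into_f) (simp add: rng)
      from circle_nth_deriv_periodic[OF g this, of 1]
      show "\<bar>?G' t\<bar> = abs_deriv ?I g (par ?I t)" unfolding G(3) by (simp add: abs_deriv_def I)
    next
      have l: "bounded_linear Re" "\<And>x. \<bar>Re x\<bar> \<le> norm x" "bounded_linear Im" "\<And>x. \<bar>Im x\<bar> \<le> norm x"
        by (auto intro: bounded_linear_Re bounded_linear_Im abs_Re_le_cmod abs_Im_le_cmod)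
      have B': "\<forall>i\<le>m + n. \<forall>t\<in>par_dom ?I. norm (nth_deriv (par_dom ?I) i (g \<circ> par ?I) t) \<le> \<bar>B\<bar>" if "m \<le> 1" for m
        using B that by (auto intro: order_trans[OF _ abs_ge_self])
      have "bnd n \<bar>B\<bar> UNIV (\<lambda>t. Re (g (cis t)))" "bnd n \<bar>B\<bar> UNIV (\<lambda>t. Im (g (cis t)))"
        using smooth_bnd[OF g l(1,2) B'[of 0]] smooth_bnd[OF g l(3,4) B'[of 0]] by (simp_all add: I)
      moreover have "bnd n \<bar>B\<bar> UNIV (\<lambda>t. Re (?D t))" "bnd n \<bar>B\<bar> UNIV (\<lambda>t. Im (?D t))"
        using smooth_bnd[OF g l(1,2) B'[of 1]] smooth_bnd[OF g l(3,4) B'[of 1]] by (simp_all only: I order_refl)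
      ultimately have "bnd n C UNIV (\<lambda>t. Re (g (cis t)) * Im (?D t) + (- 1) * (Im (g (cis t)) * Re (?D t)))"
        unfolding C_def by (intro bnd_add bnd_cmult bnd_mult) auto
      then show "bnd n C (par_dom ?I) ?G'" by (simp add: I)
    qed
  qed (unfold C_def, intro add_nonneg_nonneg mult_nonneg_nonneg abs_ge_zero zero_le_power, simp_all)
qed

theorem corollary1p11:
  shows
    "(\<forall>(f :: real \<Rightarrow> real) (fs :: nat \<Rightarrow> real \<Rightarrow> real) (\<mu>s :: nat \<Rightarrow> real measure) (h :: real) \<mu>.
        smooth_map unit_interval f \<and> (\<forall>k. smooth_map unit_interval (fs k)) \<and>
        smooth_convergence unit_interval fs f \<and>
        (\<forall>k. SRB unit_interval (fs k) (\<mu>s k) \<and> ergodic (fs k) (\<mu>s k)) \<and>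
        h > 0 \<and> (\<forall>k. metric_entropy (fs k) (\<mu>s k) \<ge> ereal h) \<and>
        accumulation_point (weak_star unit_interval) \<mu>s \<mu>
        \<longrightarrow> has_SRB_component unit_interval f \<mu>)
     \<and>
     (\<forall>(f :: complex \<Rightarrow> complex) (fs :: nat \<Rightarrow> complex \<Rightarrow> complex) (\<mu>s :: nat \<Rightarrow> complex measure)
        (h :: real) \<mu>.
        smooth_map circle f \<and> (\<forall>k. smooth_map circle (fs k)) \<and>
        smooth_convergence circle fs f \<and>
        (\<forall>k. SRB circle (fs k) (\<mu>s k) \<and> ergodic (fs k) (\<mu>s k)) \<and>
        h > 0 \<and> (\<forall>k. metric_entropy (fs k) (\<mu>s k) \<ge> ereal h) \<and>
        accumulation_point (weak_star circle) \<mu>s \<mu>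
        \<longrightarrow> has_SRB_component circle f \<mu>)"
  using interval.limit_has_SRB_component circle.limit_has_SRB_component by blast

end
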